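(* Fix a link $L$ and an integer $n\ge1$. Identify the set of monic polynomials of degree $n$ over $\mathbb{C}$ with $\mathbb{C}^n$ (via the coefficients) and endow it with the Zariski topology. Then there are only finitely many KR-equivalence classes over $L$ of polynomials of degree $n$. One of these classes is generic in the sense that all other classes are finite unions of intersections of a Zariski-open set with a Zariski-closed set that is not $\mathbb{C}^n$.
   Context: KR-equivalence over $L$: two potentials (monic polynomials) $\partial w,\partial w'$ of degree $n$ are KR-equivalent over a link $L$ if the filtered cochain complexes $C_{\partial w}(D)$ and $C_{\partial w'}(D)$ ($D$ a diagram of $L$) are homotopy equivalent as filtered cochain complexes over $\mathbb{C}$ (maps and homotopies preserving the filtration). Khovanov–Rozansky complex. A potential of degree $n$ is a monic $\partial w\in\mathbb{C}[x]$ of degree $n$; let $w$ be a polynomial with $w'=(n+1)\partial w$. All variables have (quantum) degree 2, and $[k]$ means raising all quantum/filtration degrees by $k$. Let $D$ be an oriented link diagram. Replacing each crossing either by its oriented smoothing $\Gamma_0$ or by a thick edge $\Gamma_1$ (with two incoming and two outgoing thin edges) yields MOY graphs $\Gamma$. Put marks with variables on the thin edges. To a thin arc oriented from mark $x_j$ to mark $x_i$ assign the matrix factorization $R\xrightarrow{\pi}R[1-n]\xrightarrow{x_i-x_j}R$ with $\pi=\frac{w(x_i)-w(x_j)}{x_i-x_j}$. To a thick edge with outgoing $x_1,x_2$ and incoming $x_3,x_4$ assign the tensor product of $R\xrightarrow{u_1}R[1-n]\xrightarrow{x_1+x_2-x_3-x_4}R$ and $R\xrightarrow{u_2}R[3-n]\xrightarrow{x_1x_2-x_3x_4}R$,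 shifted by $[-1]$, where $w(x)+w(y)=g(x+y,xy)$, $u_1=\frac{g(x_1+x_2,x_1x_2)-g(x_3+x_4,x_1x_2)}{x_1+x_2-x_3-x_4}$, $u_2=\frac{g(x_3+x_4,x_1x_2)-g(x_3+x_4,x_3x_4)}{x_1x_2-x_3x_4}$. Tensoring over all pieces of $\Gamma$ gives a 2-periodic complex; its cohomology $h_{\partial w}(\Gamma)$ is a finite-dimensional filtered vector space; a circle gives $(\mathbb{C}[x]/\partial w)[1-n]$. The Khovanov–Rozansky maps $\chi_0:\Gamma_0\to\Gamma_1$, $\chi_1:\Gamma_1\to\Gamma_0$ are filtered of degree 1, with both composites multiplication by $x_1-x_3$ (where $\Gamma_0$ joins $x_4$ to $x_1$ and $x_3$ to $x_2$). A positive crossing is assigned $\Gamma_0[1-n]\xrightarrow{\chi_0}\Gamma_1[-n]$ in cohomological degrees $0,1$, a negative crossing $\Gamma_1[n]\xrightarrow{\chi_1}\Gamma_0[n-1]$ in degrees $-1,0$; the resulting cube of resolutions is a filtered cochain complex $C_{\partial w}(D)$ of finite-dimensional vector spaces, where $\mathcal F^j$ is the part of quantum degree $\le j$. Its filtered homotopy type is a link invariant. Equivariant version (known, Krasner): with $R_n=\mathbb{C}[a_0,\dots,a_{n-1}]$, $\deg a_i=2(n-i)$, and $p=x^n+a_{n-1}x^{n-1}+\dots+a_0$, there is a graded cochain complex $C_{U(n)}(D)$ of free finite rank $R_n[x]/p$-modules such that evaluating $a_i\mapsto v_i\in\mathbb{C}$ yields $C_{\partial w}(D)$ with $\partial w=x^n+v_{n-1}x^{n-1}+\dots+v_0$,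 up to filtered homotopy equivalence. *)

theory Defs
  imports
    Complex_Main
    "HOL-Computational_Algebra.Polynomial"
    "HOL-Library.Poly_Mapping"
    "HOL-Library.Function_Algebras"
    "HOL-Library.Set_Algebras"
begin

section \<open>Polynomials\<close>

subsection \<open>Divided differences\<close>

text \<open>The polynomial \<open>(q(a) - q(b)) / (a - b)\<close>. The library's synthetic division makes it
  meaningful in every commutative ring, in particular when \<open>a = b\<close>.\<close>

definition divided_diff :: "'a::comm_ring_1 poly \<Rightarrow> 'a \<Rightarrow> 'a \<Rightarrow> 'a" where
  "divided_diff q a b = poly (synthetic_div q b) a"

lemma divided_diff: "(a - b) * divided_diff q a b = poly q a - poly q b"
proof -
  have "poly q a = poly ([:-b, 1:] * synthetic_div q b + [:poly q b:]) a"
    by (simp only: synthetic_div_correct')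
  then show ?thesis
    by (simp add: divided_diff_def algebra_simps)
qed

lemma divided_diff_0 [simp]: "divided_diff 0 a b = 0"
  by (simp add: divided_diff_def)

lemma divided_diff_pCons [simp]:
  "divided_diff (pCons c q) a b = poly q b + a * divided_diff q a b"
  by (simp add: divided_diff_def)

lemma divided_diff_add: "divided_diff (p + q) a b = divided_diff p a b + divided_diff q a b"
proof (induction p arbitrary: q)
  case (pCons c p)
  then show ?case by (cases q) (simp add: algebra_simps)
qed simp

lemma divided_diff_smult: "divided_diff (smult c p) a b = c * divided_diff p a b"
  by (induction p) (simp_all add: algebra_simps)

lemma divided_diff_sum: "divided_diff (sum f A) a b = (\<Sum>i\<in>A. divided_diff (f i) a b)"
  by (induction A rule: infinite_finite_induct) (simp_all add: divided_diff_add)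

lemma divided_diff_commute: "divided_diff q a b = divided_diff q b a"
proof (induction q)
  case (pCons c q)
  have "poly q b + a * divided_diff q a b = poly q a + b * divided_diff q b a"
    using divided_diff[of a b q] pCons.IH by (simp add: algebra_simps)
  then show ?case by simp
qed simp

text \<open>The second divided difference
  \<open>(q[a,b] - q[a,c]) / (b - c)\<close>, where \<open>q[a,b]\<close> is the first one.\<close>

definition divided_diff2 :: "'a::comm_ring_1 poly \<Rightarrow> 'a \<Rightarrow> 'a \<Rightarrow> 'a \<Rightarrow> 'a" where
  "divided_diff2 q a b c = divided_diff (synthetic_div q a) b c"

lemma divided_diff2:
  "(b - c) * divided_diff2 q a b c = divided_diff q a b - divided_diff q a c"
  unfolding divided_diff2_def divided_diff
  by (simp add: divided_diff_commute[of q a]) (simp add: divided_diff_def)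


lemma divided_diff_const [simp]: "divided_diff [:c:] a b = 0"
  by simp

lemma divided_diff_1 [simp]: "divided_diff 1 a b = 0"
  by (simp add: one_pCons)

lemma divided_diff_minus: "divided_diff (p - q) a b = divided_diff p a b - divided_diff q a b"
  using divided_diff_add[of "p - q" q a b] by simp


subsection \<open>Power sums\<close>

text \<open>\<open>power_sum k (x + y) (x * y) = x ^ k + y ^ k\<close>, by Newton's recursion.\<close>

fun power_sum :: "nat \<Rightarrow> 'a::comm_ring_1 \<Rightarrow> 'a \<Rightarrow> 'a" where
  "power_sum 0 s t = 2"
| "power_sum (Suc 0) s t = s"
| "power_sum (Suc (Suc k)) s t = s * power_sum (Suc k) s t - t * power_sum k s t"

lemma power_sum: "power_sum k (x + y) (x * y) = x ^ k + y ^ k"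
  by (induction k "x + y" "x * y" rule: power_sum.induct) (simp_all add: algebra_simps)

text \<open>The polynomial \<open>g\<close> with \<open>w(x) + w(y) = g(x + y, x * y)\<close>: \<open>sum_poly1 w t\<close> is
  \<open>g(s, t)\<close> as a polynomial in \<open>s\<close>, and \<open>sum_poly2 w s\<close> is \<open>g(s, t)\<close> as a polynomial in \<open>t\<close>.\<close>

definition sum_poly1 :: "'a::comm_ring_1 poly \<Rightarrow> 'a \<Rightarrow> 'a poly" where
  "sum_poly1 w t = (\<Sum>k\<le>degree w. smult (coeff w k) (power_sum k [:0, 1:] [:t:]))"

definition sum_poly2 :: "'a::comm_ring_1 poly \<Rightarrow> 'a \<Rightarrow> 'a poly" where
  "sum_poly2 w s = (\<Sum>k\<le>degree w. smult (coeff w k) (power_sum k [:s:] [:0, 1:]))"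

lemma poly_power_sum: "poly (power_sum k p q) a = power_sum k (poly p a) (poly q a)"
  by (induction k p q rule: power_sum.induct) simp_all

lemma poly_sum_poly1: "poly (sum_poly1 w t) s = (\<Sum>k\<le>degree w. coeff w k * power_sum k s t)"
  by (simp add: sum_poly1_def poly_sum poly_power_sum)

lemma poly_sum_poly2: "poly (sum_poly2 w s) t = (\<Sum>k\<le>degree w. coeff w k * power_sum k s t)"
  by (simp add: sum_poly2_def poly_sum poly_power_sum)

lemma sum_poly: "poly (sum_poly1 w (x * y)) (x + y) = poly w x + poly w y"
  by (simp add: poly_sum_poly1 power_sum poly_altdef[of w] algebra_simps sum.distrib)


subsection \<open>Potentials\<close>

definition potentials :: "nat \<Rightarrow> complex poly set" where
  "potentials n = {p. degree p = n \<and> lead_coeff p = 1}"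

text \<open>The polynomial \<open>w\<close> with \<open>w' = (n + 1) p\<close> and constant term \<open>0\<close>.\<close>

definition antiderivative :: "complex poly \<Rightarrow> complex poly" where
  "antiderivative p =
    (\<Sum>k\<le>degree p. monom (of_nat (degree p + 1) * coeff p k / of_nat (k + 1)) (k + 1))"

lemma pderiv_sum: "pderiv (sum f A) = (\<Sum>i\<in>A. pderiv (f i))"
  by (induction A rule: infinite_finite_induct) (simp_all add: pderiv_add)

lemma pderiv_antiderivative: "pderiv (antiderivative p) = smult (of_nat (degree p + 1)) p"
proof -
  have "pderiv (antiderivative p) =
      (\<Sum>k\<le>degree p. pderiv (monom (of_nat (degree p + 1) * coeff p k / of_nat (k + 1)) (k + 1)))"
    unfolding antiderivative_def by (rule pderiv_sum)
  also have "\<dots> = (\<Sum>k\<le>degree p. smult (of_nat (degree p + 1)) (monom (coeff p k) k))"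
    by (intro sum.cong refl) (simp add: pderiv_monom smult_monom del: of_nat_Suc)
  also have "\<dots> = smult (of_nat (degree p + 1)) p"
    using poly_as_sum_of_monoms'[of "smult (of_nat (degree p + 1)) p" "degree p"]
    by (simp add: smult_monom del: of_nat_Suc of_nat_add)
  finally show ?thesis .
qed


subsection \<open>Polynomials in several variables\<close>

type_synonym mpoly = "(nat \<Rightarrow>\<^sub>0 nat) \<Rightarrow>\<^sub>0 complex"

definition Var :: "nat \<Rightarrow> mpoly" where
  "Var i = Poly_Mapping.single (Poly_Mapping.single i 1) 1"

definition Const :: "complex \<Rightarrow> mpoly" where
  "Const c = Poly_Mapping.single 0 c"

definition mpolys :: "nat set \<Rightarrow> mpoly set" where
  "mpolys V = {f. \<forall>m \<in> Poly_Mapping.keys f. Poly_Mapping.keys m \<subseteq> V}"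

definition monom_degree :: "(nat \<Rightarrow>\<^sub>0 nat) \<Rightarrow> nat" where
  "monom_degree m = (\<Sum>i\<in>Poly_Mapping.keys m. Poly_Mapping.lookup m i)"

definition mpoly_eval :: "mpoly \<Rightarrow> (nat \<Rightarrow> complex) \<Rightarrow> complex" where
  "mpoly_eval f v = (\<Sum>m\<in>Poly_Mapping.keys f.
     Poly_Mapping.lookup f m * (\<Prod>i\<in>Poly_Mapping.keys m. v i ^ Poly_Mapping.lookup m i))"


subsection \<open>The Zariski topology on monic polynomials\<close>

text \<open>A monic polynomial \<open>p\<close> of degree \<open>n\<close> is the point
  \<open>(coeff p 0, \<dots>, coeff p (n - 1))\<close> of affine \<open>n\<close>-space.\<close>

definition zariski_closed :: "nat \<Rightarrow> complex poly set \<Rightarrow> bool" where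
  "zariski_closed n Z \<longleftrightarrow>
    (\<exists>F \<subseteq> mpolys {..<n}. Z = {p \<in> potentials n. \<forall>f\<in>F. mpoly_eval f (coeff p) = 0})"

definition zariski_open :: "nat \<Rightarrow> complex poly set \<Rightarrow> bool" where
  "zariski_open n U \<longleftrightarrow> U \<subseteq> potentials n \<and> zariski_closed n (potentials n - U)"


section \<open>Filtered cochain complexes over the complex numbers\<close>

text \<open>\<open>chain C i\<close> is the space in cohomological degree \<open>i\<close>, with addition \<open>add C i\<close> and
  scalar multiplication \<open>scale C i\<close>; \<open>filt C i j\<close> is the \<open>j\<close>-th step of its increasing filtration.\<close>

record 'a filtered_complex =
  chain :: "int \<Rightarrow> 'a set"
  add :: "int \<Rightarrow> 'a \<Rightarrow> 'a \<Rightarrow> 'a"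
  scale :: "int \<Rightarrow> complex \<Rightarrow> 'a \<Rightarrow> 'a"
  filt :: "int \<Rightarrow> int \<Rightarrow> 'a set"
  diff :: "int \<Rightarrow> 'a \<Rightarrow> 'a"

definition filtered_linear ::
  "'a filtered_complex \<Rightarrow> int \<Rightarrow> 'b filtered_complex \<Rightarrow> int \<Rightarrow> ('a \<Rightarrow> 'b) \<Rightarrow> bool" where
  "filtered_linear C i C' i' f \<longleftrightarrow>
    f ` chain C i \<subseteq> chain C' i' \<and>
    (\<forall>x\<in>chain C i. \<forall>y\<in>chain C i. f (add C i x y) = add C' i' (f x) (f y)) \<and>
    (\<forall>c. \<forall>x\<in>chain C i. f (scale C i c x) = scale C' i' c (f x)) \<and>
    (\<forall>j. f ` filt C i j \<subseteq> filt C' i' j)"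

definition filtered_cochain_map ::
  "'a filtered_complex \<Rightarrow> 'b filtered_complex \<Rightarrow> (int \<Rightarrow> 'a \<Rightarrow> 'b) \<Rightarrow> bool" where
  "filtered_cochain_map C C' f \<longleftrightarrow>
    (\<forall>i. filtered_linear C i C' i (f i) \<and>
         (\<forall>x\<in>chain C i. diff C' i (f i x) = f (i + 1) (diff C i x)))"

definition filtered_homotopic ::
  "'a filtered_complex \<Rightarrow> 'b filtered_complex \<Rightarrow> (int \<Rightarrow> 'a \<Rightarrow> 'b) \<Rightarrow> (int \<Rightarrow> 'a \<Rightarrow> 'b) \<Rightarrow> bool" where
  "filtered_homotopic C C' f g \<longleftrightarrow>
    (\<exists>h. \<forall>i. filtered_linear C i C' (i - 1) (h i) \<and>
         (\<forall>x\<in>chain C i. f i x =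
            add C' i (g i x) (add C' i (diff C' (i - 1) (h i x)) (h (i + 1) (diff C i x)))))"

definition filtered_homotopy_equivalent :: "'a filtered_complex \<Rightarrow> 'b filtered_complex \<Rightarrow> bool" where
  "filtered_homotopy_equivalent C C' \<longleftrightarrow>
    (\<exists>f g. filtered_cochain_map C C' f \<and> filtered_cochain_map C' C g \<and>
           filtered_homotopic C C (\<lambda>i. g i \<circ> f i) (\<lambda>i. id) \<and>
           filtered_homotopic C' C' (\<lambda>i. f i \<circ> g i) (\<lambda>i. id))"


section \<open>Oriented link diagrams\<close>

text \<open>
  A link diagram is cut at marks on its thin edges into crossings and crossingless arcs; marks are
  natural numbers. Drawn with both strands pointing upwards, the ends of a crossing are the
  outgoing \<open>out1\<close> (top left), \<open>out2\<close> (top right) and the incoming \<open>in3\<close> (bottom right),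
  \<open>in4\<close> (bottom left). An arc \<open>(j, i)\<close> is oriented from mark \<open>j\<close> to mark \<open>i\<close>; a
  crossingless circle with one mark is the arc \<open>(i, i)\<close>.
\<close>

datatype crossing = Crossing (positive: bool) (out1: nat) (out2: nat) (in3: nat) (in4: nat)

record diagram =
  crossings :: "crossing list"
  arcs :: "(nat \<times> nat) list"

definition out_marks :: "diagram \<Rightarrow> nat list" where
  "out_marks D = concat (map (\<lambda>c. [out1 c, out2 c]) (crossings D)) @ map snd (arcs D)"

definition in_marks :: "diagram \<Rightarrow> nat list" where
  "in_marks D = concat (map (\<lambda>c. [in3 c, in4 c]) (crossings D)) @ map fst (arcs D)"

definition marks :: "diagram \<Rightarrow> nat set" where
  "marks D = set (out_marks D)"

text \<open>
  Planarity: the diagram is a 4-valent (2-valent at arcs) graph with the cyclic order of half-edges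
  at each vertex given as above, whose edges are the marks. The half-edge \<open>(m, True)\<close> is the
  end of the edge \<open>m\<close> at the piece for which \<open>m\<close> is outgoing, \<open>(m, False)\<close> the other
  one. The faces are the orbits of the rotation composed with the flip of edges. Such a graph
  can be drawn in the sphere iff \<open>V - E + F = 2 K\<close>, with \<open>K\<close> the number of connected
  components.
\<close>

definition rotation :: "diagram \<Rightarrow> ((nat \<times> bool) \<times> (nat \<times> bool)) set" where
  "rotation D =
    (\<Union>c\<in>set (crossings D).
      {((out1 c, True), (in4 c, False)), ((in4 c, False), (in3 c, False)),
       ((in3 c, False), (out2 c, True)), ((out2 c, True), (out1 c, True))}) \<union>
    (\<Union>(j, i)\<in>set (arcs D). {((i, True), (j, False)), ((j, False), (i, True))})"

definition edge_flip :: "((nat \<times> bool) \<times> (nat \<times> bool)) set" where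
  "edge_flip = {((m, b), (m, \<not> b)) | m b. True}"

definition planar :: "diagram \<Rightarrow> bool" where
  "planar D \<longleftrightarrow>
    length (crossings D) + length (arcs D) + card ((marks D \<times> UNIV) // (rotation D O edge_flip)\<^sup>*) =
    card (marks D) + 2 * card ((marks D \<times> UNIV) // (rotation D \<union> edge_flip)\<^sup>*)"

definition link_diagram :: "diagram \<Rightarrow> bool" where
  "link_diagram D \<longleftrightarrow>
    distinct (out_marks D) \<and> distinct (in_marks D) \<and> set (out_marks D) = set (in_marks D) \<and> planar D"


section \<open>The Khovanov--Rozansky complex\<close>

subsection \<open>Matrix factorizations of arcs and thick edges\<close>

definition thick_u1 :: "'a::comm_ring_1 poly \<Rightarrow> 'a \<Rightarrow> 'a \<Rightarrow> 'a \<Rightarrow> 'a \<Rightarrow> 'a" where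
  "thick_u1 w x1 x2 x3 x4 = divided_diff (sum_poly1 w (x1 * x2)) (x1 + x2) (x3 + x4)"

definition thick_u2 :: "'a::comm_ring_1 poly \<Rightarrow> 'a \<Rightarrow> 'a \<Rightarrow> 'a \<Rightarrow> 'a \<Rightarrow> 'a" where
  "thick_u2 w x1 x2 x3 x4 = divided_diff (sum_poly2 w (x3 + x4)) (x1 * x2) (x3 * x4)"

text \<open>A factor \<open>(a, b, k)\<close> stands for \<open>R \<rightarrow> R[k] \<rightarrow> R\<close> with maps \<open>a\<close> and \<open>b\<close>.
  The parameter \<open>n\<close> is the degree of the potential.\<close>

type_synonym factor = "mpoly \<times> mpoly \<times> int"

definition arc_factor :: "int \<Rightarrow> mpoly poly \<Rightarrow> nat \<Rightarrow> nat \<Rightarrow> factor" where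
  "arc_factor n w j i = (divided_diff w (Var i) (Var j), Var i - Var j, 1 - n)"

text \<open>The oriented smoothing joins \<open>in4\<close> to \<open>out1\<close> and \<open>in3\<close> to \<open>out2\<close>. The shift
  \<open>[-1]\<close> of a thick edge is accounted for in \<open>vertex_shift\<close> below.\<close>

definition smoothing_factors :: "int \<Rightarrow> mpoly poly \<Rightarrow> crossing \<Rightarrow> factor list" where
  "smoothing_factors n w c = [arc_factor n w (in4 c) (out1 c), arc_factor n w (in3 c) (out2 c)]"

definition thick_factors :: "int \<Rightarrow> mpoly poly \<Rightarrow> crossing \<Rightarrow> factor list" where
  "thick_factors n w c =
    (let x1 = Var (out1 c); x2 = Var (out2 c); x3 = Var (in3 c); x4 = Var (in4 c) in
      [(thick_u1 w x1 x2 x3 x4, x1 + x2 - x3 - x4, 1 - n),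
       (thick_u2 w x1 x2 x3 x4, x1 * x2 - x3 * x4, 3 - n)])"


subsection \<open>The cube of resolutions\<close>

text \<open>A vertex of the cube is the set \<open>v\<close> of the (indices of) crossings at which the target
  of \<open>\<chi>\<^sub>0\<close> resp. \<open>\<chi>\<^sub>1\<close> is chosen.\<close>

definition thick :: "diagram \<Rightarrow> nat set \<Rightarrow> nat \<Rightarrow> bool" where
  "thick D v c \<longleftrightarrow> (positive (crossings D ! c) \<longleftrightarrow> c \<in> v)"

text \<open>The crossing with index \<open>c\<close> contributes the factors with indices \<open>2 * c\<close> and
  \<open>2 * c + 1\<close>.\<close>

definition factors :: "diagram \<Rightarrow> int \<Rightarrow> mpoly poly \<Rightarrow> nat set \<Rightarrow> factor list" where
  "factors D n w v =
    concat (map (\<lambda>c. if thick D v c then thick_factors n w (crossings D ! c)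
                      else smoothing_factors n w (crossings D ! c)) [0..<length (crossings D)]) @
    map (\<lambda>(j, i). arc_factor n w j i) (arcs D)"

definition num_factors :: "diagram \<Rightarrow> nat" where
  "num_factors D = 2 * length (crossings D) + length (arcs D)"

text \<open>Positive crossings are \<open>\<Gamma>\<^sub>0[1-n] \<rightarrow> \<Gamma>\<^sub>1[-n]\<close> in degrees \<open>0, 1\<close>, negative ones
  \<open>\<Gamma>\<^sub>1[n] \<rightarrow> \<Gamma>\<^sub>0[n-1]\<close> in degrees \<open>-1, 0\<close>.\<close>

definition vertex_shift :: "diagram \<Rightarrow> int \<Rightarrow> nat set \<Rightarrow> int" where
  "vertex_shift D n v = (\<Sum>c<length (crossings D).
     if positive (crossings D ! c)
     then (if thick D v c then - n + (-1) else 1 - n)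
     else (if thick D v c then n + (-1) else n - 1))"

definition cohom_degree :: "diagram \<Rightarrow> nat set \<Rightarrow> int" where
  "cohom_degree D v =
    int (card v) - int (card {c. c < length (crossings D) \<and> \<not> positive (crossings D ! c)})"

text \<open>
  The tensor product of the factors at a vertex \<open>v\<close> is free over \<open>R\<close>, the ring of polynomials in
  the marks, with one basis element for each set \<open>S\<close> of factors (those at which the middle
  term \<open>R[k]\<close> is chosen). An element \<open>z\<close> of the direct sum over all vertices has the
  coordinates \<open>z (v, S)\<close>.
\<close>

type_synonym cube_elem = "nat set \<times> nat set \<Rightarrow> mpoly"

definition mf_space :: "diagram \<Rightarrow> int \<Rightarrow> cube_elem set" where
  "mf_space D i = {z. \<forall>v S. z (v, S) \<in> mpolys (marks D) \<and>
     (z (v, S) \<noteq> 0 \<longrightarrow>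
        v \<subseteq> {..<length (crossings D)} \<and> S \<subseteq> {..<num_factors D} \<and> cohom_degree D v = i)}"

text \<open>The tensor product differential, with Koszul signs; it has square zero on closed diagrams.\<close>

definition mf_diff :: "diagram \<Rightarrow> int \<Rightarrow> mpoly poly \<Rightarrow> cube_elem \<Rightarrow> cube_elem" where
  "mf_diff D n w z = (\<lambda>(v, S). \<Sum>k<num_factors D.
     case factors D n w v ! k of (a, b, _) \<Rightarrow>
       (- 1) ^ card {l \<in> S. k < l} *
       (if k \<in> S then a * z (v, S - {k}) else b * z (v, insert k S)))"

text \<open>The filtration by quantum degree: all variables have degree \<open>2\<close>.\<close>

definition basis_degree :: "diagram \<Rightarrow> int \<Rightarrow> mpoly poly \<Rightarrow> nat set \<Rightarrow> nat set \<Rightarrow> int" where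
  "basis_degree D n w v S = vertex_shift D n v + (\<Sum>k\<in>S. snd (snd (factors D n w v ! k)))"

definition mf_filt :: "diagram \<Rightarrow> int \<Rightarrow> mpoly poly \<Rightarrow> int \<Rightarrow> cube_elem set" where
  "mf_filt D n w j = {z. \<forall>v S. \<forall>m \<in> Poly_Mapping.keys (z (v, S)).
     2 * int (monom_degree m) + basis_degree D n w v S \<le> j}"


subsection \<open>The Khovanov--Rozansky maps\<close>

text \<open>
  On the four basis elements belonging to one crossing, written \<open>(False, False)\<close>,
  \<open>(True, False)\<close>, \<open>(False, True)\<close>, \<open>(True, True)\<close> according to membership of its two
  factors, \<open>\<chi>\<^sub>0\<close> and \<open>\<chi>\<^sub>1\<close> are Khovanov and Rozansky's matrices (for their
  parameters \<open>\<mu> = 1\<close>, \<open>\<lambda> = 0\<close>; other choices are homotopic). The arguments \<open>t\<close> are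
  coordinate functions. Their entry
  \<open>a = (u\<^sub>1 + x\<^sub>1 u\<^sub>2 - \<pi>\<^sub>2\<^sub>3) / (x\<^sub>1 - x\<^sub>4)\<close>
  is given by a division-free formula, justified by lemma \<open>chi_entry\<close>.
\<close>

definition chi_entry :: "'a::comm_ring_1 poly \<Rightarrow> 'a \<Rightarrow> 'a \<Rightarrow> 'a \<Rightarrow> 'a \<Rightarrow> 'a" where
  "chi_entry w x1 x2 x3 x4 =
    x1 * (x1 - x3) *
      divided_diff2 (sum_poly2 w (x3 + x4)) (x1 * x2) (x3 * x4) (x1 * (x3 + x4 - x1)) -
    divided_diff2 w x2 x3 (x3 + x4 - x1)"

lemma divided_diff_power_sum:
  "divided_diff (power_sum k [:0, 1:] [:x * y:]) (x + y) (x + y') +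
     x * divided_diff (power_sum k [:x + y':] [:0, 1:]) (x * y) (x * y') =
   divided_diff (monom 1 k) y y'"
proof (induction k rule: induct_nat_012)
  case 0
  have "(2 :: 'a poly) = [:2:]"
    by (simp add: numeral_poly)
  then show ?case
    by (metis add_0 divided_diff_const monom_0 mult_zero_right power_sum.simps(1))
next
  case 1
  then show ?case by (simp add: monom_Suc)
next
  case (ge2 k)
  define P where "P k = power_sum k [:0, 1:] [:x * y:]" for k
  define Q where "Q k = power_sum k [:x + y':] [:0, 1:]" for k
  define A where "A k = divided_diff (P k) (x + y) (x + y')" for k
  define B where "B k = divided_diff (Q k) (x * y) (x * y')" for k
  define h where "h k = divided_diff (monom 1 k) y y'" for k
  have P: "poly (P k) (x + y) = x ^ k + y ^ k" for k
    by (simp add: P_def poly_power_sum power_sum)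
  have P': "poly (P k) (x + y') = power_sum k (x + y') (x * y)" for k
    by (simp add: P_def poly_power_sum)
  have Q: "poly (Q k) (x * y) = power_sum k (x + y') (x * y)" for k
    by (simp add: Q_def poly_power_sum)
  have A: "A (Suc (Suc k)) = (x ^ Suc k + y ^ Suc k) + (x + y') * A (Suc k) - x * y * A k"
  proof -
    have "A (Suc (Suc k)) =
        divided_diff (pCons 0 (P (Suc k)) - smult (x * y) (P k)) (x + y) (x + y')"
      by (simp add: A_def P_def)
    also have "\<dots> = poly (P (Suc k)) (x + y') + (x + y) * A (Suc k) - x * y * A k"
      by (simp add: divided_diff_minus divided_diff_smult A_def)
    also have "\<dots> = poly (P (Suc k)) (x + y) + (x + y') * A (Suc k) - x * y * A k"
      using divided_diff[of "x + y" "x + y'" "P (Suc k)"] by (simp add: A_def algebra_simps)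
    finally show ?thesis by (simp add: P)
  qed
  have B: "B (Suc (Suc k)) =
      (x + y') * B (Suc k) - power_sum k (x + y') (x * y) - x * y' * B k"
  proof -
    have "B (Suc (Suc k)) =
        divided_diff (smult (x + y') (Q (Suc k)) - pCons 0 (Q k)) (x * y) (x * y')"
      by (simp add: B_def Q_def)
    also have "\<dots> = (x + y') * B (Suc k) - poly (Q k) (x * y') - x * y * B k"
      by (simp add: divided_diff_minus divided_diff_smult B_def)
    also have "\<dots> = (x + y') * B (Suc k) - poly (Q k) (x * y) - x * y' * B k"
      using divided_diff[of "x * y" "x * y'" "Q k"] by (simp add: B_def algebra_simps)
    finally show ?thesis by (simp add: Q)
  qed
  have A': "(y - y') * A k = x ^ k + y ^ k - power_sum k (x + y') (x * y)"
    using divided_diff[of "x + y" "x + y'" "P k"] by (simp add: A_def P P')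
  have h: "h (Suc j) = y ^ j + y' * h j" for j
    using divided_diff[of y y' "monom 1 j"]
    by (simp add: h_def monom_Suc poly_monom algebra_simps)
  have IH: "A k = h k - x * B k" "A (Suc k) = h (Suc k) - x * B (Suc k)"
    using ge2.IH by (simp_all add: A_def B_def P_def Q_def h_def algebra_simps)
  have "A (Suc (Suc k)) + x * B (Suc (Suc k)) =
      y ^ Suc k + (x + y') * (A (Suc k) + x * B (Suc k)) - x * y' * (A k + x * B k) - x * y ^ k +
      x * (x ^ k + y ^ k - power_sum k (x + y') (x * y) - (y - y') * A k)"
    unfolding A B by (simp add: algebra_simps)
  also have "\<dots> = y ^ Suc k + (x + y') * h (Suc k) - x * y' * h k - x * y ^ k"
    unfolding A' by (simp add: IH)
  also have "\<dots> = h (Suc (Suc k))"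
    unfolding h by (simp add: algebra_simps)
  finally show ?case
    by (simp only: A_def B_def P_def Q_def h_def)
qed

lemma chi_entry:
  "(x1 - x4) * chi_entry w x1 x2 x3 x4 =
    thick_u1 w x1 x2 x3 x4 + x1 * thick_u2 w x1 x2 x3 x4 - divided_diff w x2 x3"
proof -
  define y where "y = x3 + x4 - x1"
  define Q where "Q = sum_poly2 w (x3 + x4)"
  have w: "w = (\<Sum>k\<le>degree w. smult (coeff w k) (monom 1 k))"
    by (simp add: smult_monom poly_as_sum_of_monoms)
  have dw: "divided_diff w x2 y = (\<Sum>k\<le>degree w. coeff w k * divided_diff (monom 1 k) x2 y)"
    by (subst w) (simp add: divided_diff_sum divided_diff_smult)
  have "thick_u1 w x1 x2 x3 x4 + x1 * divided_diff Q (x1 * x2) (x1 * y) =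
      (\<Sum>k\<le>degree w. coeff w k *
        (divided_diff (power_sum k [:0, 1:] [:x1 * x2:]) (x1 + x2) (x1 + y) +
         x1 * divided_diff (power_sum k [:x1 + y:] [:0, 1:]) (x1 * x2) (x1 * y)))"
    by (simp add: thick_u1_def Q_def sum_poly1_def sum_poly2_def divided_diff_sum y_def
        divided_diff_smult sum_distrib_left sum.distrib algebra_simps)
  then have E: "thick_u1 w x1 x2 x3 x4 + x1 * divided_diff Q (x1 * x2) (x1 * y) =
      divided_diff w x2 y"
    by (simp only: divided_diff_power_sum dw)
  have "(x3 * x4 - x1 * y) * divided_diff2 Q (x1 * x2) (x3 * x4) (x1 * y) =
      divided_diff Q (x1 * x2) (x3 * x4) - divided_diff Q (x1 * x2) (x1 * y)"
    by (rule divided_diff2)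
  moreover have "x3 * x4 - x1 * y = (x1 - x4) * (x1 - x3)"
    by (simp add: y_def algebra_simps)
  moreover have "(x1 - x4) * divided_diff2 w x2 x3 y = divided_diff w x2 x3 - divided_diff w x2 y"
    using divided_diff2[of x3 y w x2] by (simp add: y_def)
  ultimately have
    "(x1 - x4) * (x1 - x3) * divided_diff2 Q (x1 * x2) (x3 * x4) (x1 * y) =
      divided_diff Q (x1 * x2) (x3 * x4) - divided_diff Q (x1 * x2) (x1 * y)"
    "(x1 - x4) * divided_diff2 w x2 x3 y = divided_diff w x2 x3 - divided_diff w x2 y"
    by simp_all
  moreover have "(x1 - x4) * (x1 * (x1 - x3) * d - e) =
      x1 * ((x1 - x4) * (x1 - x3) * d) - (x1 - x4) * e" for d e
    by (simp add: algebra_simps)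
  ultimately have "(x1 - x4) * chi_entry w x1 x2 x3 x4 =
      x1 * (divided_diff Q (x1 * x2) (x3 * x4) - divided_diff Q (x1 * x2) (x1 * y)) -
      (divided_diff w x2 x3 - divided_diff w x2 y)"
    by (simp only: chi_entry_def Q_def y_def)
  then show ?thesis
    by (simp add: E[symmetric] thick_u2_def Q_def algebra_simps)
qed

lemma thick_potential:
  "(x1 + x2 - x3 - x4) * thick_u1 w x1 x2 x3 x4 + (x1 * x2 - x3 * x4) * thick_u2 w x1 x2 x3 x4 =
    poly w x1 + poly w x2 - poly w x3 - poly w x4"
proof -
  have "(x1 + x2 - x3 - x4) * thick_u1 w x1 x2 x3 x4 =
      poly (sum_poly1 w (x1 * x2)) (x1 + x2) - poly (sum_poly1 w (x1 * x2)) (x3 + x4)"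
    using divided_diff[of "x1 + x2" "x3 + x4"] by (simp add: thick_u1_def algebra_simps)
  moreover have "(x1 * x2 - x3 * x4) * thick_u2 w x1 x2 x3 x4 =
      poly (sum_poly1 w (x1 * x2)) (x3 + x4) - poly (sum_poly1 w (x3 * x4)) (x3 + x4)"
    by (simp add: thick_u2_def divided_diff poly_sum_poly1 poly_sum_poly2)
  ultimately show ?thesis
    by (simp add: sum_poly)
qed

fun chi0 :: "'a::comm_ring_1 poly \<Rightarrow> 'a \<Rightarrow> 'a \<Rightarrow> 'a \<Rightarrow> 'a \<Rightarrow>
    (bool \<Rightarrow> bool \<Rightarrow> 'a) \<Rightarrow> bool \<Rightarrow> bool \<Rightarrow> 'a" where
  "chi0 w x1 x2 x3 x4 t False False = (x1 - x3) * t False False"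
| "chi0 w x1 x2 x3 x4 t True True = chi_entry w x1 x2 x3 x4 * t False False + t True True"
| "chi0 w x1 x2 x3 x4 t True False = x1 * t True False - x3 * t False True"
| "chi0 w x1 x2 x3 x4 t False True = - t True False + t False True"

fun chi1 :: "'a::comm_ring_1 poly \<Rightarrow> 'a \<Rightarrow> 'a \<Rightarrow> 'a \<Rightarrow> 'a \<Rightarrow>
    (bool \<Rightarrow> bool \<Rightarrow> 'a) \<Rightarrow> bool \<Rightarrow> bool \<Rightarrow> 'a" where
  "chi1 w x1 x2 x3 x4 t False False = t False False"
| "chi1 w x1 x2 x3 x4 t True True =
     - chi_entry w x1 x2 x3 x4 * t False False + (x1 - x3) * t True True"
| "chi1 w x1 x2 x3 x4 t True False = t True False + x3 * t False True"
| "chi1 w x1 x2 x3 x4 t False True = t True False + x1 * t False True"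

lemma chi0_chi1: "chi0 w x1 x2 x3 x4 (chi1 w x1 x2 x3 x4 t) b b' = (x1 - x3) * t b b'"
  by (cases b; cases b') (simp_all add: algebra_simps)

lemma chi1_chi0: "chi1 w x1 x2 x3 x4 (chi0 w x1 x2 x3 x4 t) b b' = (x1 - x3) * t b b'"
  by (cases b; cases b') (simp_all add: algebra_simps)

definition set_bits :: "nat \<Rightarrow> nat set \<Rightarrow> bool \<Rightarrow> bool \<Rightarrow> nat set" where
  "set_bits c S b b' =
    (S - {2 * c, 2 * c + 1}) \<union> (if b then {2 * c} else {}) \<union> (if b' then {2 * c + 1} else {})"

definition cube_diff :: "diagram \<Rightarrow> mpoly poly \<Rightarrow> cube_elem \<Rightarrow> cube_elem" where
  "cube_diff D w z = (\<lambda>(v, S). \<Sum>c | c \<in> v \<and> c < length (crossings D).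
     (- 1) ^ card {c' \<in> v. c' < c} *
     (let X = crossings D ! c in
       (if positive X then chi0 else chi1) w (Var (out1 X)) (Var (out2 X)) (Var (in3 X)) (Var (in4 X))
         (\<lambda>b b'. z (v - {c}, set_bits c S b b')) (2 * c \<in> S) (2 * c + 1 \<in> S)))"


subsection \<open>The complex of a link diagram\<close>

text \<open>The cohomology of the matrix factorizations (that is, \<open>Z / B\<close> with the cosets as elements) with
  the induced filtration and the differential induced by \<open>\<chi>\<^sub>0\<close> and \<open>\<chi>\<^sub>1\<close>.\<close>

definition KR_complex :: "diagram \<Rightarrow> complex poly \<Rightarrow> cube_elem set filtered_complex" where
  "KR_complex D p =
    (let n = int (degree p);
         w = map_poly Const (antiderivative p);
         Z = (\<lambda>i. {z \<in> mf_space D i. mf_diff D n w z = 0});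
         B = (\<lambda>i. mf_diff D n w ` mf_space D i)
     in \<lparr>chain = (\<lambda>i. {z +o B i | z. z \<in> Z i}),
         add = (\<lambda>i X Y. X + Y),
         scale = (\<lambda>i c X. (\<lambda>z s. Const c * z s) ` X + B i),
         filt = (\<lambda>i j. {z +o B i | z. z \<in> Z i \<inter> mf_filt D n w j}),
         diff = (\<lambda>i X. cube_diff D w ` X + B (i + 1))\<rparr>)"

definition KR_equivalence :: "diagram \<Rightarrow> nat \<Rightarrow> (complex poly \<times> complex poly) set" where
  "KR_equivalence D n = {(p, q). p \<in> potentials n \<and> q \<in> potentials n \<and>
     filtered_homotopy_equivalent (KR_complex D p) (KR_complex D q)}"

end

(* Over a field, a bounded filtered complex decomposes into one-dimensional pieces with zero
   differential and two-dimensional ones with an isomorphism as differential. Hence its filtered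
   homotopy type is determined by finitely many dimensions, namely those of the spaces of cocycles of
   the matrix factorization in F^j whose image under the cube differential is cohomologous to an
   element of F^k. These are nullities of linear systems whose
   coefficients are polynomials in the coefficients of the potential p. The size of the systems is
   bounded independently of p: every w'(x), hence p(x) with leading term x^n, acts null-homotopically
   on a matrix factorization, so that cocycles and coboundaries can be reduced to elements of bounded
   degree. Gaussian elimination with parameters stratifies the space of potentials into finitely many
   locally closed sets on which all nullities are constant. By irreducibility of affine space, the
   nonempty open strata meet pairwise, so they lie in the same class, which is the generic one. *)

theory Submission
  imports Defs "HOL-Library.FuncSet" "HOL-Library.Product_Plus"
begin

section \<open>Stratifications of the space of potentials\<close>

subsection \<open>Evaluation of polynomials\<close>

text \<open>Matrix factorizations are infinite-dimensional, and the bound on their cohomology must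
  be the same for all potentials of degree n. It comes from leading terms: p(x_q) has leading term
  x_q^n, and the powers x_q^n of the different variables form a regular sequence. So in high
  filtration degree the leading part of a cocycle can be moved into the image of the differential,
  one variable at a time. The filtration on cohomology is an induced one: a class lies in a
  filtration step if one of its representatives does, which hides an existential quantifier over
  coboundaries. The linear systems therefore carry a witness for the coboundary as additional
  unknowns, and the dimensions that matter are differences of nullities. The decomposition into
  small pieces is Barannikov's normal form, obtained by Gaussian elimination with base changes that
  respect the filtration. What survives is the number of pairs with given levels of source and
  target. Two complexes for which these numbers agree are isomorphic as filtered complexes, so that
  all homotopies can be taken to be zero.\<close>

definition monom_eval :: "(nat \<Rightarrow>\<^sub>0 nat) \<Rightarrow> (nat \<Rightarrow> complex) \<Rightarrow> complex" where
  "monom_eval m v = (\<Prod>i\<in>Poly_Mapping.keys m. v i ^ Poly_Mapping.lookup m i)"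

lemma mpoly_eval_alt:
  "mpoly_eval f v = (\<Sum>m\<in>Poly_Mapping.keys f. Poly_Mapping.lookup f m * monom_eval m v)"
  by (simp add: mpoly_eval_def monom_eval_def)

lemma keys_add_nat: "Poly_Mapping.keys (m + m' :: 'a \<Rightarrow>\<^sub>0 nat) = Poly_Mapping.keys m \<union> Poly_Mapping.keys m'"
  by (auto simp: in_keys_iff lookup_add)

lemma monom_eval_superset:
  assumes "finite A" "Poly_Mapping.keys m \<subseteq> A"
  shows "monom_eval m v = (\<Prod>i\<in>A. v i ^ Poly_Mapping.lookup m i)"
  unfolding monom_eval_def using assms
  by (intro prod.mono_neutral_left) (auto simp: in_keys_iff)

lemma monom_eval_add: "monom_eval (m + m') v = monom_eval m v * monom_eval m' v"
proof -
  let ?A = "Poly_Mapping.keys m \<union> Poly_Mapping.keys m'"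
  have "monom_eval (m + m') v = (\<Prod>i\<in>?A. v i ^ Poly_Mapping.lookup (m + m') i)"
    by (rule monom_eval_superset) (auto simp: keys_add_nat)
  also have "\<dots> = (\<Prod>i\<in>?A. v i ^ Poly_Mapping.lookup m i) * (\<Prod>i\<in>?A. v i ^ Poly_Mapping.lookup m' i)"
    by (simp add: lookup_add power_add prod.distrib)
  also have "\<dots> = monom_eval m v * monom_eval m' v"
    by (simp add: monom_eval_superset[of ?A])
  finally show ?thesis .
qed

lemma mpoly_eval_0 [simp]: "mpoly_eval 0 v = 0"
  by (simp add: mpoly_eval_def)

lemma mpoly_eval_single: "mpoly_eval (Poly_Mapping.single m c) v = c * monom_eval m v"
  by (simp add: mpoly_eval_alt)

lemma mpoly_eval_add: "mpoly_eval (f + g) v = mpoly_eval f v + mpoly_eval g v"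
  unfolding mpoly_eval_alt by (rule setsum_keys_plus_distrib) (simp_all add: algebra_simps)

lemma mpoly_eval_sum: "mpoly_eval (sum f A) v = (\<Sum>x\<in>A. mpoly_eval (f x) v)"
  by (induction A rule: infinite_finite_induct) (simp_all add: mpoly_eval_add)

lemma poly_mapping_as_sum:
  "f = (\<Sum>m\<in>Poly_Mapping.keys f. Poly_Mapping.single m (Poly_Mapping.lookup f m))"
proof (rule poly_mapping_eqI)
  fix k
  show "Poly_Mapping.lookup f k =
      Poly_Mapping.lookup (\<Sum>m\<in>Poly_Mapping.keys f. Poly_Mapping.single m (Poly_Mapping.lookup f m)) k"
    by (auto simp: lookup_sum lookup_single when_def sum.delta in_keys_iff)
qed

lemma mpoly_eval_mult: "mpoly_eval (f * g) v = mpoly_eval f v * mpoly_eval g v"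
proof -
  let ?F = "\<lambda>m. Poly_Mapping.single m (Poly_Mapping.lookup f m)"
  let ?G = "\<lambda>m. Poly_Mapping.single m (Poly_Mapping.lookup g m)"
  have "f * g = (\<Sum>m\<in>Poly_Mapping.keys f. \<Sum>m'\<in>Poly_Mapping.keys g. ?F m * ?G m')"
    by (subst poly_mapping_as_sum[of f], subst poly_mapping_as_sum[of g]) (simp add: sum_product)
  then have "mpoly_eval (f * g) v = (\<Sum>m\<in>Poly_Mapping.keys f. \<Sum>m'\<in>Poly_Mapping.keys g.
      mpoly_eval (?F m) v * mpoly_eval (?G m') v)"
    by (simp add: mpoly_eval_sum mpoly_eval_single mult_single monom_eval_add mult_ac)
  also have "\<dots> = mpoly_eval f v * mpoly_eval g v"
    by (simp add: mpoly_eval_alt[of f] mpoly_eval_alt[of g] mpoly_eval_single sum_product)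
  finally show ?thesis .
qed

lemma mpoly_eval_Const [simp]: "mpoly_eval (Const c) v = c"
  by (simp add: Const_def mpoly_eval_single monom_eval_def)

lemma mpoly_eval_Var [simp]: "mpoly_eval (Var i) v = v i"
  by (simp add: Var_def mpoly_eval_single monom_eval_def)

lemma mpolys_0 [simp]: "0 \<in> mpolys V"
  by (simp add: mpolys_def)

lemma mpolys_add: "f \<in> mpolys V \<Longrightarrow> g \<in> mpolys V \<Longrightarrow> f + g \<in> mpolys V"
  using keys_add[of f g] by (fastforce simp: mpolys_def)

lemma mpolys_mult: "f \<in> mpolys V \<Longrightarrow> g \<in> mpolys V \<Longrightarrow> f * g \<in> mpolys V"
  using keys_mult[of f g] by (fastforce simp: mpolys_def keys_add_nat)

lemma mpolys_Const [simp]: "Const c \<in> mpolys V"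
  by (simp add: mpolys_def Const_def)

lemma mpolys_Var [simp]: "i \<in> V \<Longrightarrow> Var i \<in> mpolys V"
  by (simp add: mpolys_def Var_def)

subsection \<open>Polynomial functions of the coefficients\<close>

definition polyfun :: "nat \<Rightarrow> (complex poly \<Rightarrow> complex) \<Rightarrow> bool" where
  "polyfun n f \<longleftrightarrow> (\<exists>g\<in>mpolys {..<n}. \<forall>p\<in>potentials n. f p = mpoly_eval g (coeff p))"

lemma polyfun_const [intro, simp]: "polyfun n (\<lambda>p. c)"
  unfolding polyfun_def by (rule bexI[of _ "Const c"]) simp_all

text \<open>The coordinates of affine space are the coefficients below the leading one; the leading
  coefficient enters as the constant \<open>1\<close>, because potentials are monic.\<close>

lemma polyfun_coeff [intro]: "i \<le> n \<Longrightarrow> polyfun n (\<lambda>p. coeff p i)"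
proof (cases "i = n")
  case True
  show ?thesis unfolding polyfun_def
    by (rule bexI[of _ "Const 1"]) (auto simp: True potentials_def)
next
  case False
  assume "i \<le> n"
  then show ?thesis unfolding polyfun_def
    by (intro bexI[of _ "Var i"]) (use False in auto)
qed

lemma polyfun_add [intro]: "polyfun n f \<Longrightarrow> polyfun n g \<Longrightarrow> polyfun n (\<lambda>p. f p + g p)"
  unfolding polyfun_def by (metis mpoly_eval_add mpolys_add)

lemma polyfun_mult [intro]: "polyfun n f \<Longrightarrow> polyfun n g \<Longrightarrow> polyfun n (\<lambda>p. f p * g p)"
  unfolding polyfun_def by (metis mpoly_eval_mult mpolys_mult)

lemma polyfun_minus: "polyfun n f \<Longrightarrow> polyfun n (\<lambda>p. - f p)"
  using polyfun_mult[of n "\<lambda>_. -1" f] by simp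

lemma polyfun_diff [intro]: "polyfun n f \<Longrightarrow> polyfun n g \<Longrightarrow> polyfun n (\<lambda>p. f p - g p)"
  using polyfun_add[of n f "\<lambda>p. - g p"] polyfun_minus[of n g] by simp

subsection \<open>Closed and open sets\<close>

lemma zariski_closed_Int:
  assumes "zariski_closed n Z" "zariski_closed n Z'"
  shows "zariski_closed n (Z \<inter> Z')"
proof -
  from assms obtain F F' where
    "F \<subseteq> mpolys {..<n}" "Z = {p \<in> potentials n. \<forall>f\<in>F. mpoly_eval f (coeff p) = 0}"
    "F' \<subseteq> mpolys {..<n}" "Z' = {p \<in> potentials n. \<forall>f\<in>F'. mpoly_eval f (coeff p) = 0}"
    unfolding zariski_closed_def by blast
  then show ?thesis unfolding zariski_closed_def
    by (intro exI[of _ "F \<union> F'"]) blast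
qed

lemma zariski_closed_Un:
  assumes "zariski_closed n Z" "zariski_closed n Z'"
  shows "zariski_closed n (Z \<union> Z')"
proof -
  from assms obtain F F' where
    F: "F \<subseteq> mpolys {..<n}" "Z = {p \<in> potentials n. \<forall>f\<in>F. mpoly_eval f (coeff p) = 0}"
    "F' \<subseteq> mpolys {..<n}" "Z' = {p \<in> potentials n. \<forall>f\<in>F'. mpoly_eval f (coeff p) = 0}"
    unfolding zariski_closed_def by blast
  show ?thesis unfolding zariski_closed_def
  proof (intro exI[of _ "(\<lambda>(f, g). f * g) ` (F \<times> F')"] conjI)
    show "(\<lambda>(f, g). f * g) ` (F \<times> F') \<subseteq> mpolys {..<n}"
      using F by (auto intro: mpolys_mult)
    show "Z \<union> Z' = {p \<in> potentials n. \<forall>f\<in>(\<lambda>(f, g). f * g) ` (F \<times> F'). mpoly_eval f (coeff p) = 0}"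
      unfolding F(2,4) by (auto simp: mpoly_eval_mult)
  qed
qed

lemma zariski_closed_potentials: "zariski_closed n (potentials n)"
  unfolding zariski_closed_def by (rule exI[of _ "{}"]) simp

lemma zariski_open_potentials: "zariski_open n (potentials n)"
  unfolding zariski_open_def zariski_closed_def by (intro conjI exI[of _ "{Const 1}"]) auto

lemma zariski_closed_vanishing: "polyfun n f \<Longrightarrow> zariski_closed n {p \<in> potentials n. f p = 0}"
  unfolding polyfun_def zariski_closed_def
  by (elim bexE, rename_tac g, rule_tac x = "{g}" in exI) auto

lemma zariski_open_nonvanishing: "polyfun n f \<Longrightarrow> zariski_open n {p \<in> potentials n. f p \<noteq> 0}"
proof -
  assume "polyfun n f"
  moreover have "potentials n - {p \<in> potentials n. f p \<noteq> 0} = {p \<in> potentials n. f p = 0}"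
    by auto
  ultimately show ?thesis
    using zariski_closed_vanishing[of n f] by (auto simp: zariski_open_def)
qed

lemma zariski_open_Int:
  assumes "zariski_open n U" "zariski_open n U'"
  shows "zariski_open n (U \<inter> U')"
proof -
  have "potentials n - U \<inter> U' = (potentials n - U) \<union> (potentials n - U')"
    by auto
  then show ?thesis
    using assms zariski_closed_Un[of n "potentials n - U" "potentials n - U'"]
    by (auto simp: zariski_open_def)
qed

lemma mpoly_eval_on_line: "\<exists>P. \<forall>t. mpoly_eval f (\<lambda>i. a i + t * b i) = poly P t"
  by (rule exI[of _ "\<Sum>m\<in>Poly_Mapping.keys f. smult (Poly_Mapping.lookup f m)
        (\<Prod>i\<in>Poly_Mapping.keys m. [:a i, b i:] ^ Poly_Mapping.lookup m i)"])
    (simp add: mpoly_eval_def poly_sum poly_prod)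

lemma zariski_open_witness:
  assumes "zariski_open n U" "p \<in> U"
  obtains f where "mpoly_eval f (coeff p) \<noteq> 0"
    "\<And>q. q \<in> potentials n \<Longrightarrow> mpoly_eval f (coeff q) \<noteq> 0 \<Longrightarrow> q \<in> U"
proof -
  from assms obtain F where F: "potentials n - U = {p \<in> potentials n. \<forall>f\<in>F. mpoly_eval f (coeff p) = 0}"
    and p: "p \<in> potentials n" unfolding zariski_open_def zariski_closed_def by auto
  from p assms(2) F obtain f where f: "f \<in> F" "mpoly_eval f (coeff p) \<noteq> 0" by blast
  show thesis by (rule that[of f]) (use f F in blast)+
qed

lemma line_in_potentials:
  assumes "p \<in> potentials n" "q \<in> potentials n"
  shows "p + smult t (q - p) \<in> potentials n"
proof -
  have c: "coeff p n = 1" "coeff q n = 1" "degree p \<le> n" "degree q \<le> n"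
    using assms by (auto simp: potentials_def)
  then have "coeff (p + smult t (q - p)) n = 1" by simp
  moreover have "degree (p + smult t (q - p)) \<le> n"
    by (intro degree_add_le order.trans[OF degree_smult_le] degree_diff_le c)
  ultimately have "degree (p + smult t (q - p)) = n"
    by (metis le_antisym le_degree zero_neq_one)
  with \<open>coeff (p + smult t (q - p)) n = 1\<close> show ?thesis
    by (simp add: potentials_def)
qed

text \<open>Restricting to the line through a point of either set reduces irreducibility of affine
  space to that of the affine line.\<close>

lemma zariski_open_meet:
  assumes U: "zariski_open n U" "U \<noteq> {}" and U': "zariski_open n U'" "U' \<noteq> {}"
  shows "U \<inter> U' \<noteq> {}"
proof -
  from U obtain p where p: "p \<in> U" by blast
  from U' obtain q where q: "q \<in> U'" by blast
  have pq: "p \<in> potentials n" "q \<in> potentials n"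
    using p q U U' by (auto simp: zariski_open_def)
  obtain f where f: "mpoly_eval f (coeff p) \<noteq> 0"
    "\<And>q. q \<in> potentials n \<Longrightarrow> mpoly_eval f (coeff q) \<noteq> 0 \<Longrightarrow> q \<in> U"
    using zariski_open_witness[OF U(1) p] by metis
  obtain g where g: "mpoly_eval g (coeff q) \<noteq> 0"
    "\<And>q. q \<in> potentials n \<Longrightarrow> mpoly_eval g (coeff q) \<noteq> 0 \<Longrightarrow> q \<in> U'"
    using zariski_open_witness[OF U'(1) q] by metis
  have line: "coeff (p + smult t (q - p)) = (\<lambda>i. coeff p i + t * coeff (q - p) i)" for t
    by auto
  obtain P where P: "\<And>t. mpoly_eval f (coeff (p + smult t (q - p))) = poly P t"
    unfolding line using mpoly_eval_on_line[of f "coeff p" "coeff (q - p)"] by blast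
  obtain Q where Q: "\<And>t. mpoly_eval g (coeff (p + smult t (q - p))) = poly Q t"
    unfolding line using mpoly_eval_on_line[of g "coeff p" "coeff (q - p)"] by blast
  have "poly P 0 \<noteq> 0" using P[of 0] f(1) by simp
  moreover have "poly Q 1 \<noteq> 0" using Q[of 1] g(1) by simp
  ultimately have "P * Q \<noteq> 0" by auto
  then have "finite {t. poly (P * Q) t = 0}" by (rule poly_roots_finite)
  then obtain t where "poly (P * Q) t \<noteq> 0"
    using infinite_UNIV_char_0[where 'a = complex] by (metis (mono_tags) UNIV_eq_I mem_Collect_eq)
  then have "p + smult t (q - p) \<in> U \<inter> U'"
    using f(2) g(2) P Q line_in_potentials[OF pq, of t] by auto
  then show ?thesis by blast
qed

subsection \<open>Constructible functions\<close>

definition zariski_locally_closed :: "nat \<Rightarrow> complex poly set \<Rightarrow> bool" where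
  "zariski_locally_closed n A \<longleftrightarrow>
    (\<exists>U Z. zariski_open n U \<and> zariski_closed n Z \<and> A = U \<inter> Z)"

lemma zariski_locally_closed_Int:
  assumes "zariski_locally_closed n A" "zariski_locally_closed n B"
  shows "zariski_locally_closed n (A \<inter> B)"
proof -
  obtain U Z where A: "zariski_open n U" "zariski_closed n Z" "A = U \<inter> Z"
    using assms(1) unfolding zariski_locally_closed_def by (elim exE conjE)
  obtain U' Z' where B: "zariski_open n U'" "zariski_closed n Z'" "B = U' \<inter> Z'"
    using assms(2) unfolding zariski_locally_closed_def by (elim exE conjE)
  have "A \<inter> B = (U \<inter> U') \<inter> (Z \<inter> Z')" unfolding A(3) B(3) by (simp only: Int_ac)
  then show ?thesis
    unfolding zariski_locally_closed_def
    using zariski_open_Int[OF A(1) B(1)] zariski_closed_Int[OF A(2) B(2)]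
    by (intro exI[of _ "U \<inter> U'"] exI[of _ "Z \<inter> Z'"] conjI)
qed

lemma zariski_locally_closed_open: "zariski_open n U \<Longrightarrow> zariski_locally_closed n U"
  unfolding zariski_locally_closed_def
  by (rule exI[of _ U], rule exI[of _ "potentials n"])
    (auto simp: zariski_closed_potentials zariski_open_def)

lemma zariski_locally_closed_closed: "zariski_closed n Z \<Longrightarrow> zariski_locally_closed n Z"
  unfolding zariski_locally_closed_def
  by (rule exI[of _ "potentials n"], rule exI[of _ Z])
    (auto simp: zariski_open_potentials zariski_closed_def)

text \<open>A cover rather than a partition: common refinements are then plain intersections, and
  finiteness of the cover still leaves finitely many values. The values lie in an arbitrary type, so
  that whole tuples of invariants can be handled as one function.\<close>

definition constructible :: "nat \<Rightarrow> (complex poly \<Rightarrow> 'b) \<Rightarrow> bool" where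
  "constructible n f \<longleftrightarrow> (\<exists>\<P>. finite \<P> \<and> (\<forall>A\<in>\<P>. zariski_locally_closed n A) \<and>
     potentials n = \<Union>\<P> \<and> (\<forall>A\<in>\<P>. \<forall>p\<in>A. \<forall>q\<in>A. f p = f q))"

lemma constructible_const [intro]: "constructible n (\<lambda>p. c)"
  unfolding constructible_def
  by (rule exI[of _ "{potentials n}"])
    (simp add: zariski_locally_closed_open zariski_open_potentials)

lemma constructibleE:
  assumes "constructible n f"
  obtains \<P> where "finite \<P>" "\<And>A. A \<in> \<P> \<Longrightarrow> zariski_locally_closed n A" "potentials n = \<Union>\<P>"
    "\<And>A p q. A \<in> \<P> \<Longrightarrow> p \<in> A \<Longrightarrow> q \<in> A \<Longrightarrow> f p = f q"
proof -
  from assms obtain \<P> where P: "finite \<P> \<and> (\<forall>A\<in>\<P>. zariski_locally_closed n A) \<and>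
     potentials n = \<Union>\<P> \<and> (\<forall>A\<in>\<P>. \<forall>p\<in>A. \<forall>q\<in>A. f p = f q)"
    unfolding constructible_def by (elim exE)
  show thesis
  proof (rule that[of \<P>])
    fix A p q assume "A \<in> \<P>" "p \<in> A" "q \<in> A"
    then show "f p = f q"
      by (rule P[THEN conjunct2, THEN conjunct2, THEN conjunct2, rule_format])
  next
    show "zariski_locally_closed n A" if "A \<in> \<P>" for A
      using P that by blast
  qed (use P in blast)+
qed

lemma constructibleI:
  assumes "finite \<P>" "\<And>A. A \<in> \<P> \<Longrightarrow> zariski_locally_closed n A" "potentials n = \<Union>\<P>"
    "\<And>A p q. A \<in> \<P> \<Longrightarrow> p \<in> A \<Longrightarrow> q \<in> A \<Longrightarrow> f p = f q"
  shows "constructible n f"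
  unfolding constructible_def
  by (intro exI[of _ \<P>] conjI ballI) (rule assms; assumption)+

lemma constructible_compose:
  assumes "constructible n f"
  shows "constructible n (\<lambda>p. g (f p))"
proof (rule constructibleE[OF assms])
  fix \<P> assume P: "finite \<P>" "\<And>A. A \<in> \<P> \<Longrightarrow> zariski_locally_closed n A" "potentials n = \<Union>\<P>"
    and f: "\<And>A p q. A \<in> \<P> \<Longrightarrow> p \<in> A \<Longrightarrow> q \<in> A \<Longrightarrow> f p = f q"
  show ?thesis
  proof (rule constructibleI[OF P])
    fix A p q assume "A \<in> \<P>" "p \<in> A" "q \<in> A"
    from f[OF this] show "g (f p) = g (f q)" by (rule arg_cong)
  qed
qed

lemma constructible_Pair:
  assumes "constructible n f" "constructible n g"
  shows "constructible n (\<lambda>p. (f p, g p))"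
proof (rule constructibleE[OF assms(1)], rule constructibleE[OF assms(2)])
  fix \<P> \<Q>
  assume P: "finite \<P>" "\<And>A. A \<in> \<P> \<Longrightarrow> zariski_locally_closed n A" "potentials n = \<Union>\<P>"
    and f: "\<And>A p q. A \<in> \<P> \<Longrightarrow> p \<in> A \<Longrightarrow> q \<in> A \<Longrightarrow> f p = f q"
    and Q: "finite \<Q>" "\<And>A. A \<in> \<Q> \<Longrightarrow> zariski_locally_closed n A" "potentials n = \<Union>\<Q>"
    and g: "\<And>A p q. A \<in> \<Q> \<Longrightarrow> p \<in> A \<Longrightarrow> q \<in> A \<Longrightarrow> g p = g q"
  let ?R = "(\<lambda>(A, B). A \<inter> B) ` (\<P> \<times> \<Q>)"
  show ?thesis
  proof (rule constructibleI[of ?R])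
    show "finite ?R" using P(1) Q(1) by simp
    show "zariski_locally_closed n C" if "C \<in> ?R" for C
      using that zariski_locally_closed_Int[OF P(2) Q(2)] by auto
    have "\<Union>?R = \<Union>\<P> \<inter> \<Union>\<Q>" by auto
    then show "potentials n = \<Union>?R"
      unfolding P(3)[symmetric] Q(3)[symmetric] by simp
    fix C p q assume "C \<in> ?R" and pq: "p \<in> C" "q \<in> C"
    then obtain A B where "A \<in> \<P>" "B \<in> \<Q>" "C = A \<inter> B" by blast
    with pq f[of A p q] g[of B p q] show "(f p, g p) = (f q, g q)" by simp
  qed
qed

lemma constructible_combine:
  assumes "constructible n f" "constructible n g"
  shows "constructible n (\<lambda>p. h (f p) (g p))"
  using constructible_compose[OF constructible_Pair[OF assms], of "\<lambda>(x, y). h x y"] by simp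

text \<open>Outside the finite set \<open>A\<close> the restricted function is constantly
  \<open>undefined\<close>, so the finitely many components determine it. This serves to carry zero
  patterns and families of nullities as single values.\<close>

lemma constructible_restrict:
  assumes "finite A" "\<And>a. a \<in> A \<Longrightarrow> constructible n (f a)"
  shows "constructible n (\<lambda>p. restrict (\<lambda>a. f a p) A)"
  using assms
proof (induction A rule: finite_induct)
  case empty
  then show ?case by (simp add: restrict_def constructible_const)
next
  case (insert a A)
  have "constructible n (\<lambda>p. (restrict (\<lambda>a. f a p) A)(a := f a p))"
  proof (rule constructible_combine[where h = "\<lambda>r x. r(a := x)"])
    show "constructible n (\<lambda>p. restrict (\<lambda>a. f a p) A)"
      by (rule insert.IH) (rule insert.prems, simp)
    show "constructible n (f a)"
      by (rule insert.prems) simp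
  qed
  moreover have "(restrict (\<lambda>a. f a p) A)(a := f a p) = restrict (\<lambda>a. f a p) (insert a A)" for p
    by (auto simp: restrict_def)
  ultimately show ?case by (simp only:)
qed

lemma constructible_polyfun_eq_0:
  assumes "polyfun n f"
  shows "constructible n (\<lambda>p. f p = 0)"
  unfolding constructible_def
  by (rule exI[of _ "{{p \<in> potentials n. f p \<noteq> 0}, {p \<in> potentials n. f p = 0}}"])
    (auto intro: zariski_locally_closed_open zariski_locally_closed_closed
      zariski_closed_vanishing zariski_open_nonvanishing assms)

section \<open>Linear algebra\<close>

subsection \<open>Dimensions of images and kernels\<close>

context vector_space_pair
begin

lemma dim_image_inj:
  assumes f: "Vector_Spaces.linear s1 s2 f" and S: "vs1.subspace S" and inj: "inj_on f S"
  shows "vs2.dim (f ` S) = vs1.dim S"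
proof -
  interpret f: Vector_Spaces.linear s1 s2 f by fact
  obtain B where B: "B \<subseteq> S" "vs1.independent B" "S \<subseteq> vs1.span B" "card B = vs1.dim S"
    by (rule vs1.basis_exists)
  have span: "vs1.span B = S"
    using vs1.span_subspace[OF B(1,3) S] .
  have "card (f ` B) = vs2.dim (f ` S)"
  proof (rule vs2.basis_card_eq_dim)
    show "f ` B \<subseteq> f ` S" using B(1) by blast
    show "f ` S \<subseteq> vs2.span (f ` B)" using span f.span_image[of B] by simp
    show "vs2.independent (f ` B)"
      by (rule f.independent_injective_image[OF B(2)]) (simp add: span inj)
  qed
  moreover have "card (f ` B) = card B"
    by (rule card_image) (rule inj_on_subset[OF inj B(1)])
  ultimately show ?thesis using B(4) by simp
qed

text \<open>Rank-nullity for a subspace of a finite span; the surrounding spaces of polynomials are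
  infinite-dimensional. A basis \<open>B\<close> of the kernel is extended to a basis of
  \<open>S\<close>, and the added vectors \<open>C\<close> map to a basis of the image.\<close>

lemma dim_image_plus_dim_kernel:
  assumes f: "Vector_Spaces.linear s1 s2 f" and S: "vs1.subspace S" and fin: "S \<subseteq> vs1.span A" "finite A"
  shows "vs1.dim S = vs2.dim (f ` S) + vs1.dim {x \<in> S. f x = 0}"
proof -
  interpret f: Vector_Spaces.linear s1 s2 f by fact
  let ?K = "{x \<in> S. f x = 0}"
  have "?K = S \<inter> {x. f x = 0}" by auto
  then have K: "vs1.subspace ?K"
    using S f.subspace_kernel by (simp add: vs1.subspace_inter)
  obtain B where B: "B \<subseteq> ?K" "vs1.independent B" "?K \<subseteq> vs1.span B" "card B = vs1.dim ?K"
    by (rule vs1.basis_exists)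
  obtain B' where B': "B \<subseteq> B'" "B' \<subseteq> S" "vs1.independent B'" "S \<subseteq> vs1.span B'"
    using vs1.maximal_independent_subset_extend[of B S] B by blast
  have "B' \<subseteq> vs1.span A" using B'(2) fin(1) by blast
  then have finB': "finite B'"
    using vs1.independent_span_bound[OF fin(2) B'(3)] by blast
  define C where "C = B' - B"
  have C: "C \<subseteq> S" "vs1.independent C" "C \<subseteq> B'"
    using B' vs1.independent_mono[OF B'(3)] unfolding C_def by auto
  have spanB': "vs1.span B' = S" by (rule vs1.span_subspace[OF B'(2,4) S])
  \<comment> \<open>Such an \<open>x\<close> lies in the spans of both \<open>B\<close> and
    \<open>C\<close>, so its coordinates are supported on two disjoint sets and vanish.\<close>
  have zero: "x = 0" if x: "x \<in> vs1.span C" "f x = 0" for x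
  proof -
    have "x \<in> S" using x(1) vs1.span_mono[OF C(3)] spanB' by blast
    then have xB: "x \<in> vs1.span B" using x(2) B(3) by blast
    have "vs1.representation B' x = vs1.representation B x"
      by (rule vs1.representation_extend[OF B'(3) xB B'(1)])
    moreover have "vs1.representation B' x = vs1.representation C x"
      by (rule vs1.representation_extend[OF B'(3) x(1) C(3)])
    ultimately have "vs1.representation B' x b = 0" for b
      using vs1.representation_ne_zero[of B x b] vs1.representation_ne_zero[of C x b]
      by (auto simp: C_def)
    moreover have "x = (\<Sum>b\<in>B'. s1 (vs1.representation B' x b) b)"
      by (rule vs1.sum_representation_eq[symmetric]) (use \<open>x \<in> S\<close> B' finB' in auto)
    ultimately show ?thesis by simp
  qed
  have inj: "inj_on f (vs1.span C)"
    by (subst f.inj_on_iff_eq_0) (use zero in auto)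
  have "card (f ` C) = vs2.dim (f ` S)"
  proof (rule vs2.basis_card_eq_dim)
    show "f ` C \<subseteq> f ` S" using C(1) by blast
    show "vs2.independent (f ` C)"
      by (rule f.independent_injective_image[OF C(2) inj])
    have "f ` S = vs2.span (f ` B')" using f.span_image[of B'] spanB' by simp
    also have "\<dots> \<subseteq> vs2.span (f ` C)"
    proof (rule vs2.span_minimal)
      show "f ` B' \<subseteq> vs2.span (f ` C)"
      proof (rule image_subsetI)
        fix b assume b: "b \<in> B'"
        show "f b \<in> vs2.span (f ` C)"
        proof (cases "b \<in> B")
          case True
          then have "f b = 0" using B(1) by blast
          then show ?thesis by (simp add: vs2.span_zero)
        next
          case False
          with b show ?thesis by (simp add: C_def vs2.span_base)
        qed
      qed
    qed simp
    finally show "f ` S \<subseteq> vs2.span (f ` C)" .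
  qed
  moreover have "card (f ` C) = card C"
    by (rule card_image) (rule inj_on_subset[OF inj vs1.span_superset])
  moreover have "card B' = card B + card C"
    unfolding C_def using B'(1) finB' by (simp add: card_Diff_subset finite_subset card_mono)
  moreover have "card B' = vs1.dim S"
    by (rule vs1.basis_card_eq_dim[OF B'(2,4,3)])
  ultimately show ?thesis using B(4) by simp
qed

end

subsection \<open>Linear systems\<close>

definition fun_scale :: "complex \<Rightarrow> ('l \<Rightarrow> complex) \<Rightarrow> 'l \<Rightarrow> complex" where
  "fun_scale c x = (\<lambda>i. c * x i)"

global_interpretation fun_vs: vector_space fun_scale
  by unfold_locales (auto simp: fun_scale_def fun_eq_iff algebra_simps)

text \<open>Vectors vanish outside \<open>I\<close> instead of having \<open>I\<close> as index
  type, so that systems with fewer unknowns live in the same vector space.\<close>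

definition solutions :: "'l set \<Rightarrow> ('l \<Rightarrow> complex) list \<Rightarrow> ('l \<Rightarrow> complex) set" where
  "solutions I es = {x. (\<forall>i. i \<notin> I \<longrightarrow> x i = 0) \<and> (\<forall>e\<in>set es. (\<Sum>i\<in>I. e i * x i) = 0)}"

definition nullity :: "'l set \<Rightarrow> ('l \<Rightarrow> complex) list \<Rightarrow> nat" where
  "nullity I es = fun_vs.dim (solutions I es)"

lemma subspace_solutions: "fun_vs.subspace (solutions I es)"
  by (rule fun_vs.subspaceI)
    (auto simp: solutions_def fun_scale_def algebra_simps sum.distrib simp flip: sum_distrib_left)

text \<open>Cross-multiplication instead of division: coefficients that are polynomial in parameters
  stay polynomial.\<close>

definition eliminate :: "('l \<Rightarrow> complex) \<Rightarrow> 'l \<Rightarrow> ('l \<Rightarrow> complex) \<Rightarrow> 'l \<Rightarrow> complex" where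
  "eliminate e k e' = (\<lambda>i. e k * e' i - e' k * e i)"

lemma nullity_zero_equation:
  assumes "\<And>i. i \<in> I \<Longrightarrow> e i = 0"
  shows "nullity I (e # es) = nullity I es"
  using assms by (simp add: nullity_def solutions_def)

text \<open>The pivot equation determines \<open>x k\<close> from the other coordinates, so
  forgetting \<open>x k\<close> is a bijection onto the solutions of the eliminated system.\<close>

lemma nullity_eliminate:
  fixes e :: "'l \<Rightarrow> complex"
  assumes fin: "finite I" and k: "k \<in> I" "e k \<noteq> 0"
  shows "nullity I (e # es) = nullity (I - {k}) (map (eliminate e k) es)"
proof -
  interpret vector_space_pair fun_scale fun_scale ..
  let ?f = "\<lambda>x. x(k := 0)"
  let ?S = "solutions I (e # es)" and ?T = "solutions (I - {k}) (map (eliminate e k) es)"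
  have lin: "Vector_Spaces.linear fun_scale fun_scale ?f"
    by unfold_locales (auto simp: fun_scale_def fun_eq_iff)
  have split: "(\<Sum>i\<in>I. g i * x i) = g k * x k + (\<Sum>i\<in>I - {k}. g i * x i)" for g x :: "'l \<Rightarrow> complex"
    by (rule sum.remove[OF fin k(1)])
  have elim: "(\<Sum>i\<in>I - {k}. eliminate e k e' i * x i) =
      e k * (\<Sum>i\<in>I - {k}. e' i * x i) - e' k * (\<Sum>i\<in>I - {k}. e i * x i)"
    for e' x
    by (simp add: eliminate_def algebra_simps sum_subtractf sum_distrib_left)
  have upd: "(\<Sum>i\<in>I - {k}. g i * (x(k := y)) i) = (\<Sum>i\<in>I - {k}. g i * x i)" for g x :: "'l \<Rightarrow> complex" and y
    by (rule sum.cong) auto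
  have inj: "inj_on ?f ?S"
  proof (rule inj_onI)
    fix x y assume xy: "x \<in> ?S" "y \<in> ?S" "x(k := 0) = y(k := 0)"
    then have eq: "x i = y i" if "i \<noteq> k" for i
      using that by (metis fun_upd_other)
    have "e k * x k = - (\<Sum>i\<in>I - {k}. e i * x i)" "e k * y k = - (\<Sum>i\<in>I - {k}. e i * y i)"
      using xy(1,2) split[of e] by (simp_all add: solutions_def eq_neg_iff_add_eq_0)
    moreover have "(\<Sum>i\<in>I - {k}. e i * x i) = (\<Sum>i\<in>I - {k}. e i * y i)"
      by (rule sum.cong) (auto simp: eq)
    ultimately have "e k * x k = e k * y k" by simp
    then have "x k = y k" using k(2) by simp
    with eq show "x = y" by (metis ext)
  qed
  have "?f ` ?S = ?T"
  proof (intro set_eqI iffI)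
    fix y assume "y \<in> ?f ` ?S"
    then obtain x where x: "x \<in> ?S" "y = x(k := 0)" by blast
    have "(\<Sum>i\<in>I - {k}. eliminate e k e' i * y i) = 0" if "e' \<in> set es" for e'
    proof -
      have "e k * x k + (\<Sum>i\<in>I - {k}. e i * x i) = 0" "e' k * x k + (\<Sum>i\<in>I - {k}. e' i * x i) = 0"
        using x(1) that by (simp_all add: solutions_def split)
      then have "(\<Sum>i\<in>I - {k}. e i * x i) = - (e k * x k)" "(\<Sum>i\<in>I - {k}. e' i * x i) = - (e' k * x k)"
        by (simp_all add: eq_neg_iff_add_eq_0 add.commute)
      then show ?thesis unfolding elim x(2) upd by (simp add: algebra_simps)
    qed
    then show "y \<in> ?T" using x by (auto simp: solutions_def)
  next
    fix y assume y: "y \<in> ?T"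
    define x where "x = y(k := - (\<Sum>i\<in>I - {k}. e i * y i) / e k)"
    have "y k = 0" using y by (simp add: solutions_def)
    then have "x(k := 0) = y" by (auto simp: x_def)
    moreover have "x \<in> ?S"
    proof -
      have ek: "e k * x k = - (\<Sum>i\<in>I - {k}. e i * y i)" using k(2) by (simp add: x_def)
      then have "(\<Sum>i\<in>I. e i * x i) = 0" unfolding split x_def upd by (simp add: x_def)
      moreover have "(\<Sum>i\<in>I. e' i * x i) = 0" if "e' \<in> set es" for e'
      proof -
        have "(\<Sum>i\<in>I - {k}. eliminate e k e' i * y i) = 0"
          using y that by (simp add: solutions_def)
        then have "e k * (\<Sum>i\<in>I - {k}. e' i * y i) = e' k * (\<Sum>i\<in>I - {k}. e i * y i)"
          unfolding elim by simp
        then have "e k * (e' k * x k + (\<Sum>i\<in>I - {k}. e' i * y i)) = 0"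
          using ek by (simp add: distrib_left mult.left_commute[of "e k"])
        then have "e' k * x k + (\<Sum>i\<in>I - {k}. e' i * y i) = 0" using k(2) by simp
        then show ?thesis unfolding split by (simp add: x_def upd)
      qed
      moreover have "\<forall>i. i \<notin> I \<longrightarrow> x i = 0"
        using y k(1) by (auto simp: solutions_def x_def)
      ultimately show ?thesis by (simp add: solutions_def)
    qed
    ultimately show "y \<in> ?f ` ?S" by force
  qed
  then show ?thesis
    using dim_image_inj[OF lin subspace_solutions inj] by (simp add: nullity_def)
qed

text \<open>Gaussian elimination with parameters: the case distinctions are on the vanishing of
  polynomial functions of the parameters.\<close>

lemma constructible_nullity:
  assumes "finite I" "\<And>e i. e \<in> set es \<Longrightarrow> i \<in> I \<Longrightarrow> polyfun n (\<lambda>p. e p i)"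
  shows "constructible n (\<lambda>p. nullity I (map (\<lambda>e. e p) es))"
  using assms
proof (induction "length es" arbitrary: es I)
  case 0
  then show ?case by (simp add: constructible_const)
next
  case (Suc m)
  then obtain e es' where es: "es = e # es'" "m = length es'" by (cases es) auto
  have poly_e: "polyfun n (\<lambda>p. e p i)" if "i \<in> I" for i
    using Suc.prems(2) that by (simp add: es)
  have poly_es': "polyfun n (\<lambda>p. e' p i)" if "e' \<in> set es'" "i \<in> I" for e' i
    using Suc.prems(2) that by (simp add: es)
  have zeros: "constructible n (\<lambda>p. restrict (\<lambda>i. e p i = 0) I)"
    by (intro constructible_restrict constructible_polyfun_eq_0 poly_e Suc.prems(1))
  have rest: "constructible n (\<lambda>p. nullity I (map (\<lambda>e. e p) es'))"
    by (rule Suc.hyps(1)[OF es(2) Suc.prems(1)]) (rule poly_es')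
  define N where "N k p = nullity (I - {k}) (map (\<lambda>e'. e' p) (map (\<lambda>e' p. eliminate (e p) k (e' p)) es'))" for k p
  \<comment> \<open>Which pivot is available depends on \<open>p\<close>, so the eliminated systems
    for all \<open>k\<close> are treated in parallel.\<close>
  have step: "constructible n (\<lambda>p. restrict (\<lambda>k. N k p) I)"
  proof (rule constructible_restrict[OF Suc.prems(1)])
    fix k assume k: "k \<in> I"
    show "constructible n (N k)"
      unfolding N_def
    proof (rule Suc.hyps(1))
      fix e'' i assume "e'' \<in> set (map (\<lambda>e' p. eliminate (e p) k (e' p)) es')" "i \<in> I - {k}"
      then obtain e' where e': "e' \<in> set es'" "e'' = (\<lambda>p. eliminate (e p) k (e' p))" and i: "i \<in> I"
        by auto
      show "polyfun n (\<lambda>p. e'' p i)"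
        unfolding e'(2) eliminate_def
        by (intro polyfun_diff polyfun_mult poly_e poly_es' e'(1) i k)
    qed (use es Suc.prems in auto)
  qed
  \<comment> \<open>The pivot is chosen from the zero pattern \<open>Z\<close> alone; hence the
    nullity is a function of data already known to be constructible.\<close>
  define h where "h Z r s = (if \<forall>i\<in>I. Z i then r else s (SOME i. i \<in> I \<and> \<not> Z i))"
    for Z and r :: nat and s :: "'a \<Rightarrow> nat"
  have "constructible n (\<lambda>p. (\<lambda>(Z, r). h Z r) (restrict (\<lambda>i. e p i = 0) I, nullity I (map (\<lambda>e. e p) es'))
      (restrict (\<lambda>k. N k p) I))"
    by (rule constructible_combine[OF constructible_compose[OF constructible_Pair[OF zeros rest]] step])
  moreover have "(\<lambda>(Z, r). h Z r) (restrict (\<lambda>i. e p i = 0) I, nullity I (map (\<lambda>e. e p) es'))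
      (restrict (\<lambda>k. N k p) I) = nullity I (map (\<lambda>e. e p) es)" for p
  proof (cases "\<forall>i\<in>I. e p i = 0")
    case True
    then show ?thesis
      using nullity_zero_equation[of I "e p" "map (\<lambda>e. e p) es'"] by (simp add: h_def es)
  next
    case False
    define k where "k = (SOME i. i \<in> I \<and> \<not> restrict (\<lambda>i. e p i = 0) I i)"
    have "\<exists>i. i \<in> I \<and> \<not> restrict (\<lambda>i. e p i = 0) I i" using False by auto
    then have "k \<in> I \<and> \<not> restrict (\<lambda>i. e p i = 0) I k" unfolding k_def by (rule someI_ex)
    then have k: "k \<in> I" "e p k \<noteq> 0" by auto
    have "(\<lambda>(Z, r). h Z r) (restrict (\<lambda>i. e p i = 0) I, nullity I (map (\<lambda>e. e p) es'))
      (restrict (\<lambda>k. N k p) I) = restrict (\<lambda>k. N k p) I k"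
      using False by (simp add: h_def k_def del: restrict_apply) auto
    also have "\<dots> = N k p" using k by simp
    also have "\<dots> = nullity I (map (\<lambda>e. e p) es)"
      using nullity_eliminate[of I k "e p" "map (\<lambda>e. e p) es'", OF Suc.prems(1) k]
      by (simp add: N_def es comp_def)
    finally show ?thesis .
  qed
  ultimately show ?case by (simp only:)
qed

section \<open>Filtered homotopy equivalence\<close>

subsection \<open>Transitivity\<close>

text \<open>The laws that composition of homotopies requires; the record itself carries none. Chains
  will be cosets added as sets, for which there is no subtraction, so the laws speak of sums
  only.\<close>

definition additive_complex :: "'a::ab_semigroup_add filtered_complex \<Rightarrow> bool" where
  "additive_complex C \<longleftrightarrow>
    (\<forall>i. add C i = (+)) \<and>
    (\<forall>i. \<forall>x\<in>chain C i. \<forall>y\<in>chain C i. x + y \<in> chain C i) \<and>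
    (\<forall>i. \<forall>x\<in>chain C i. diff C i x \<in> chain C (i + 1)) \<and>
    (\<forall>i. \<forall>x\<in>chain C i. \<forall>y\<in>chain C i. diff C i (x + y) = diff C i x + diff C i y) \<and>
    (\<forall>i c. \<forall>x\<in>chain C i. \<forall>y\<in>chain C i. scale C i c (x + y) = scale C i c x + scale C i c y) \<and>
    (\<forall>i j. \<forall>x\<in>filt C i j. \<forall>y\<in>filt C i j. x + y \<in> filt C i j)"

lemma additive_complexD:
  assumes "additive_complex C"
  shows "add C i = (+)"
    "x \<in> chain C i \<Longrightarrow> y \<in> chain C i \<Longrightarrow> x + y \<in> chain C i"
    "x \<in> chain C i \<Longrightarrow> diff C i x \<in> chain C (i + 1)"
    "x \<in> chain C i \<Longrightarrow> y \<in> chain C i \<Longrightarrow> diff C i (x + y) = diff C i x + diff C i y"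
    "x \<in> chain C i \<Longrightarrow> y \<in> chain C i \<Longrightarrow> scale C i c (x + y) = scale C i c x + scale C i c y"
    "x \<in> filt C i j \<Longrightarrow> y \<in> filt C i j \<Longrightarrow> x + y \<in> filt C i j"
  using assms unfolding additive_complex_def by simp_all

lemma filtered_linearD:
  assumes "filtered_linear C i C' i' f"
  shows "x \<in> chain C i \<Longrightarrow> f x \<in> chain C' i'"
    "x \<in> chain C i \<Longrightarrow> y \<in> chain C i \<Longrightarrow> f (add C i x y) = add C' i' (f x) (f y)"
    "x \<in> chain C i \<Longrightarrow> f (scale C i c x) = scale C' i' c (f x)"
    "x \<in> filt C i j \<Longrightarrow> f x \<in> filt C' i' j"
  using assms unfolding filtered_linear_def image_subset_iff by blast+

lemma filtered_linearI:
  assumes "\<And>x. x \<in> chain C i \<Longrightarrow> f x \<in> chain C' i'"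
    "\<And>x y. x \<in> chain C i \<Longrightarrow> y \<in> chain C i \<Longrightarrow> f (add C i x y) = add C' i' (f x) (f y)"
    "\<And>c x. x \<in> chain C i \<Longrightarrow> f (scale C i c x) = scale C' i' c (f x)"
    "\<And>j x. x \<in> filt C i j \<Longrightarrow> f x \<in> filt C' i' j"
  shows "filtered_linear C i C' i' f"
  unfolding filtered_linear_def using assms by auto

lemma filtered_linear_comp:
  assumes "filtered_linear C i C' i' f" "filtered_linear C' i' C'' i'' g"
  shows "filtered_linear C i C'' i'' (g \<circ> f)"
  by (rule filtered_linearI)
    (simp_all add: filtered_linearD[OF assms(1)] filtered_linearD[OF assms(2)])

lemma filtered_linear_plus:
  assumes C: "additive_complex C" "additive_complex C'"
    and f: "filtered_linear C i C' i' f" and g: "filtered_linear C i C' i' g"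
  shows "filtered_linear C i C' i' (\<lambda>x. f x + g x)"
proof (rule filtered_linearI)
  fix x y assume xy: "x \<in> chain C i" "y \<in> chain C i"
  show "f (add C i x y) + g (add C i x y) = add C' i' (f x + g x) (f y + g y)"
    using filtered_linearD(2)[OF f xy] filtered_linearD(2)[OF g xy]
    by (simp add: additive_complexD(1)[OF C(2)] add_ac)
qed (simp_all add: additive_complexD[OF C(2)] filtered_linearD[OF f] filtered_linearD[OF g])

lemma filtered_cochain_map_comp:
  assumes "filtered_cochain_map C C' f" "filtered_cochain_map C' C'' g"
  shows "filtered_cochain_map C C'' (\<lambda>i. g i \<circ> f i)"
  unfolding filtered_cochain_map_def
proof (intro allI conjI ballI)
  fix i
  have f: "filtered_linear C i C' i (f i)" and g: "filtered_linear C' i C'' i (g i)"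
    using assms by (simp_all add: filtered_cochain_map_def)
  show "filtered_linear C i C'' i (g i \<circ> f i)" by (rule filtered_linear_comp[OF f g])
  fix x assume x: "x \<in> chain C i"
  have "diff C'' i (g i (f i x)) = g (i + 1) (diff C' i (f i x))"
    using assms(2) filtered_linearD(1)[OF f x] by (simp add: filtered_cochain_map_def)
  also have "\<dots> = g (i + 1) (f (i + 1) (diff C i x))"
    using assms(1) x by (simp add: filtered_cochain_map_def)
  finally show "diff C'' i ((g i \<circ> f i) x) = (g (i + 1) \<circ> f (i + 1)) (diff C i x)" by simp
qed

text \<open>If \<open>s\<close> is a homotopy for \<open>k\<close> and \<open>t\<close> one for
  \<open>g \<circ> f\<close>, then \<open>t + g \<circ> s \<circ> f\<close> is one for
  \<open>g \<circ> k \<circ> f\<close>. With \<open>k\<close> a composite through a third complex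
  this gives each half of transitivity.\<close>

lemma filtered_homotopic_comp:
  assumes C: "additive_complex C" "additive_complex C'"
    and f: "filtered_cochain_map C C' f" and g: "filtered_cochain_map C' C g"
    and h: "filtered_homotopic C' C' k (\<lambda>i. id)"
    and gf: "filtered_homotopic C C (\<lambda>i. g i \<circ> f i) (\<lambda>i. id)"
    and k: "\<And>i x. x \<in> chain C' i \<Longrightarrow> k i x \<in> chain C' i"
  shows "filtered_homotopic C C (\<lambda>i. g i \<circ> k i \<circ> f i) (\<lambda>i. id)"
proof -
  note C1 = additive_complexD[OF C(1)] and C2 = additive_complexD[OF C(2)]
  obtain s where s: "\<And>i. filtered_linear C' i C' (i - 1) (s i)"
    and ks: "\<And>i x. x \<in> chain C' i \<Longrightarrow> k i x = x + (diff C' (i - 1) (s i x) + s (i + 1) (diff C' i x))"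
    using h unfolding filtered_homotopic_def C2(1) by auto
  obtain t where t: "\<And>i. filtered_linear C i C (i - 1) (t i)"
    and gft: "\<And>i x. x \<in> chain C i \<Longrightarrow> g i (f i x) = x + (diff C (i - 1) (t i x) + t (i + 1) (diff C i x))"
    using gf unfolding filtered_homotopic_def C1(1) by auto
  have fl: "\<And>i. filtered_linear C i C' i (f i)"
    and fd: "\<And>i x. x \<in> chain C i \<Longrightarrow> diff C' i (f i x) = f (i + 1) (diff C i x)"
    using f by (simp_all add: filtered_cochain_map_def)
  have gl: "\<And>i. filtered_linear C' i C i (g i)"
    and gd: "\<And>i x. x \<in> chain C' i \<Longrightarrow> diff C i (g i x) = g (i + 1) (diff C' i x)"
    using g by (simp_all add: filtered_cochain_map_def)
  note f1 = filtered_linearD[OF fl] and g1 = filtered_linearD[OF gl]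
    and s1 = filtered_linearD[OF s] and t1 = filtered_linearD[OF t]
  let ?H = "\<lambda>i x. t i x + (g (i - 1) \<circ> s i \<circ> f i) x"
  show ?thesis unfolding filtered_homotopic_def
  proof (intro exI[of _ ?H] allI conjI ballI)
    fix i
    show "filtered_linear C i C (i - 1) (?H i)"
      by (rule filtered_linear_plus[OF C(1) C(1) t filtered_linear_comp[OF fl filtered_linear_comp[OF s gl]]])
    fix x assume x: "x \<in> chain C i"
    define y where "y = f i x"
    have y: "y \<in> chain C' i" using f1(1) x by (simp add: y_def)
    have sy: "s i y \<in> chain C' (i - 1)" using s1(1) y .
    have dsy: "diff C' (i - 1) (s i y) \<in> chain C' i" using C2(3)[OF sy] by simp
    have sdy: "s (i + 1) (diff C' i y) \<in> chain C' i" using s1(1)[OF C2(3)[OF y]] by simp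
    have "g i (k i y) = g i y + (g i (diff C' (i - 1) (s i y)) + g i (s (i + 1) (diff C' i y)))"
      unfolding ks[OF y] using g1(2)[of _ i] C1(1) C2(1) C2(2) y dsy sdy by simp
    also have "g i (diff C' (i - 1) (s i y)) = diff C (i - 1) (g (i - 1) (s i y))"
      using gd[OF sy] by simp
    also have "s (i + 1) (diff C' i y) = s (i + 1) (f (i + 1) (diff C i x))"
      using fd[OF x] by (simp add: y_def)
    also have "g i y = x + (diff C (i - 1) (t i x) + t (i + 1) (diff C i x))"
      using gft[OF x] by (simp add: y_def)
    finally have *: "g i (k i y) = x + (diff C (i - 1) (t i x) + t (i + 1) (diff C i x)) +
      (diff C (i - 1) (g (i - 1) (s i y)) + g i (s (i + 1) (f (i + 1) (diff C i x))))" .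
    have **: "diff C (i - 1) (t i x + g (i - 1) (s i y)) = diff C (i - 1) (t i x) + diff C (i - 1) (g (i - 1) (s i y))"
      by (rule C1(4)) (use t1(1)[OF x] g1(1)[OF sy] in simp_all)
    show "(g i \<circ> k i \<circ> f i) x = add C i (id x) (add C i (diff C (i - 1) (?H i x)) (?H (i + 1) (diff C i x)))"
      using * ** by (simp add: C1(1) add_ac flip: y_def)
  qed
qed

lemma filtered_homotopy_equivalent_trans:
  assumes C: "additive_complex C" "additive_complex C'" "additive_complex C''"
    and "filtered_homotopy_equivalent C C'" "filtered_homotopy_equivalent C' C''"
  shows "filtered_homotopy_equivalent C C''"
proof -
  obtain f g where fg: "filtered_cochain_map C C' f" "filtered_cochain_map C' C g"
    "filtered_homotopic C C (\<lambda>i. g i \<circ> f i) (\<lambda>i. id)" "filtered_homotopic C' C' (\<lambda>i. f i \<circ> g i) (\<lambda>i. id)"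
    using assms(4) unfolding filtered_homotopy_equivalent_def by (elim exE conjE)
  obtain f' g' where fg': "filtered_cochain_map C' C'' f'" "filtered_cochain_map C'' C' g'"
    "filtered_homotopic C' C' (\<lambda>i. g' i \<circ> f' i) (\<lambda>i. id)" "filtered_homotopic C'' C'' (\<lambda>i. f' i \<circ> g' i) (\<lambda>i. id)"
    using assms(5) unfolding filtered_homotopy_equivalent_def by (elim exE conjE)
  have lin: "filtered_linear C i C' i (f i)" "filtered_linear C' i C i (g i)"
    "filtered_linear C' i C'' i (f' i)" "filtered_linear C'' i C' i (g' i)" for i
    using fg(1,2) fg'(1,2) by (simp_all add: filtered_cochain_map_def)
  have chains: "(g' i \<circ> f' i) x \<in> chain C' i" "(f i \<circ> g i) x \<in> chain C' i" if "x \<in> chain C' i" for i x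
    by (rule filtered_linearD(1)[OF filtered_linear_comp[OF lin(3,4)] that])
      (rule filtered_linearD(1)[OF filtered_linear_comp[OF lin(2,1)] that])
  have "filtered_homotopic C C (\<lambda>i. g i \<circ> (g' i \<circ> f' i) \<circ> f i) (\<lambda>i. id)"
    by (rule filtered_homotopic_comp[OF C(1,2) fg(1,2) fg'(3) fg(3) chains(1)])
  moreover have "filtered_homotopic C'' C'' (\<lambda>i. f' i \<circ> (f i \<circ> g i) \<circ> g' i) (\<lambda>i. id)"
    by (rule filtered_homotopic_comp[OF C(3,2) fg'(2,1) fg(4) fg'(4) chains(2)])
  ultimately show ?thesis
    unfolding filtered_homotopy_equivalent_def
    by (intro exI[of _ "\<lambda>i. f' i \<circ> f i"] exI[of _ "\<lambda>i. g i \<circ> g' i"] conjI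
        filtered_cochain_map_comp[OF fg(1) fg'(1)] filtered_cochain_map_comp[OF fg'(2) fg(2)])
      (simp_all add: comp_assoc)
qed

lemma filtered_homotopy_equivalent_sym:
  "filtered_homotopy_equivalent C C' \<Longrightarrow> filtered_homotopy_equivalent C' C"
  unfolding filtered_homotopy_equivalent_def by (elim exE conjE, intro exI conjI)

subsection \<open>Complexes of cosets\<close>

text \<open>The shape of \<open>KR_complex\<close> without diagrams: cohomology is taken with
  respect to \<open>D\<close>, the differential of the matrix factorizations, and \<open>X\<close>,
  the differential of the cube, acts on it.\<close>

definition coset_complex ::
  "(complex \<Rightarrow> 'v \<Rightarrow> 'v::ab_group_add) \<Rightarrow> (int \<Rightarrow> 'v set) \<Rightarrow> (int \<Rightarrow> 'v set) \<Rightarrow> ('v \<Rightarrow> 'v) \<Rightarrow> ('v \<Rightarrow> 'v) \<Rightarrow>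
    'v set filtered_complex" where
  "coset_complex scl C F D X =
     \<lparr>chain = (\<lambda>i. {z +o D ` C i | z. z \<in> C i \<and> D z = 0}),
      add = (\<lambda>i X Y. X + Y),
      scale = (\<lambda>i c Y. scl c ` Y + D ` C i),
      filt = (\<lambda>i j. {z +o D ` C i | z. z \<in> C i \<and> D z = 0 \<and> z \<in> F j}),
      diff = (\<lambda>i Y. X ` Y + D ` C (i + 1))\<rparr>"

locale double_complex = vector_space scl
  for scl :: "complex \<Rightarrow> 'v::ab_group_add \<Rightarrow> 'v" +
  fixes C F :: "int \<Rightarrow> 'v set" and D X :: "'v \<Rightarrow> 'v"
  assumes subspace_C: "subspace (C i)"
    and subspace_F: "subspace (F j)"
    and linear_D: "Vector_Spaces.linear scl scl D"
    and linear_X: "Vector_Spaces.linear scl scl X"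
    and D_C: "x \<in> C i \<Longrightarrow> D x \<in> C i"
    and D_D: "x \<in> C i \<Longrightarrow> D (D x) = 0"
    and X_C: "x \<in> C i \<Longrightarrow> X x \<in> C (i + 1)"
    and D_X: "x \<in> C i \<Longrightarrow> D (X x) = X (D x)"
    and X_X: "x \<in> C i \<Longrightarrow> X (X x) = 0"
begin

sublocale D: Vector_Spaces.linear scl scl D by (rule linear_D)
sublocale X: Vector_Spaces.linear scl scl X by (rule linear_X)

definition "Z i = {x \<in> C i. D x = 0}"
definition "B i = D ` C i"

abbreviation "H \<equiv> coset_complex scl C F D X"

lemma subspace_Z: "subspace (Z i)"
proof -
  have "Z i = C i \<inter> {x. D x = 0}" by (auto simp: Z_def)
  then show ?thesis using subspace_inter[OF subspace_C D.subspace_kernel] by simp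
qed

lemma subspace_B: "subspace (B i)"
  unfolding B_def by (rule D.subspace_image[OF subspace_C])

lemma B_le_Z: "B i \<subseteq> Z i"
  unfolding B_def Z_def using D_C D_D by auto

lemma X_Z: "x \<in> Z i \<Longrightarrow> X x \<in> Z (i + 1)"
  unfolding Z_def using X_C[of x i] D_X[of x i] X.zero by simp

lemma X_B: "x \<in> B i \<Longrightarrow> X x \<in> B (i + 1)"
  unfolding B_def using X_C D_X by (auto simp flip: D_X)

lemma coset_eq_iff: "x +o B i = y +o B i \<longleftrightarrow> x - y \<in> B i"
proof
  assume "x +o B i = y +o B i"
  moreover have "x \<in> x +o B i" using subspace_0[OF subspace_B] by (auto simp: elt_set_plus_def)
  ultimately have "x \<in> y +o B i" by simp
  then show "x - y \<in> B i" by (auto simp: elt_set_plus_def)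
next
  assume xy: "x - y \<in> B i"
  have "u +o B i \<subseteq> v +o B i" if "u - v \<in> B i" for u v
  proof
    fix z assume "z \<in> u +o B i"
    then obtain b where "b \<in> B i" "z = u + b" by (auto simp: elt_set_plus_def)
    then have "z = v + ((u - v) + b)" "(u - v) + b \<in> B i"
      using that subspace_add[OF subspace_B] by auto
    then show "z \<in> v +o B i" unfolding elt_set_plus_def by blast
  qed
  from this[OF xy] this[of y x] show "x +o B i = y +o B i"
    using xy subspace_neg[OF subspace_B xy] by auto
qed

lemma coset_plus: "(x +o B i) + (y +o B i) = (x + y) +o B i"
proof (intro set_eqI iffI)
  fix z assume "z \<in> (x +o B i) + (y +o B i)"
  then obtain b c where "b \<in> B i" "c \<in> B i" "z = (x + b) + (y + c)"
    by (auto simp: elt_set_plus_def set_plus_def)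
  then have "z = (x + y) + (b + c)" "b + c \<in> B i" using subspace_add[OF subspace_B] by auto
  then show "z \<in> (x + y) +o B i" unfolding elt_set_plus_def by blast
next
  fix z assume "z \<in> (x + y) +o B i"
  then obtain b where "b \<in> B i" "z = (x + 0) + (y + b)" by (auto simp: elt_set_plus_def add_ac)
  then show "z \<in> (x +o B i) + (y +o B i)"
    unfolding elt_set_plus_def set_plus_def using subspace_0[OF subspace_B] by blast
qed

text \<open>Adding \<open>B'\<close> completes the image of a coset to a full coset, even if
  \<open>f\<close> is defined on representatives and is compatible with coboundaries only modulo
  \<open>B'\<close>. Scaling, \<open>X\<close> and maps between complexes are all instances.\<close>

lemma coset_image:
  assumes B': "subspace B'" and f: "\<And>b. b \<in> B i \<Longrightarrow> f (x + b) - f x \<in> B'"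
  shows "f ` (x +o B i) + B' = f x +o B'"
proof (intro set_eqI iffI)
  fix z assume "z \<in> f ` (x +o B i) + B'"
  then obtain b c where "b \<in> B i" "c \<in> B'" "z = f (x + b) + c"
    by (auto simp: elt_set_plus_def set_plus_def)
  then have "z = f x + ((f (x + b) - f x) + c)" "(f (x + b) - f x) + c \<in> B'"
    using f subspace_add[OF B'] by auto
  then show "z \<in> f x +o B'" unfolding elt_set_plus_def by blast
next
  fix z assume "z \<in> f x +o B'"
  then obtain b where b: "b \<in> B'" "z = f x + b" by (auto simp: elt_set_plus_def)
  have "x \<in> x +o B i" using subspace_0[OF subspace_B] by (auto simp: elt_set_plus_def)
  with b show "z \<in> f ` (x +o B i) + B'" unfolding set_plus_def by blast
qed

lemma chain_H: "chain H i = {z +o B i | z. z \<in> Z i}"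
  by (simp add: coset_complex_def B_def Z_def)

lemma filt_H: "filt H i j = {z +o B i | z. z \<in> Z i \<inter> F j}"
  by (simp add: coset_complex_def B_def Z_def conj_assoc)

lemma chain_HI: "z \<in> Z i \<Longrightarrow> z +o B i \<in> chain H i"
  unfolding chain_H by blast

lemma chain_HE: assumes "Y \<in> chain H i" obtains z where "z \<in> Z i" "Y = z +o B i"
  using assms unfolding chain_H by blast

lemma filt_HI: "z \<in> Z i \<Longrightarrow> z \<in> F j \<Longrightarrow> z +o B i \<in> filt H i j"
  unfolding filt_H by blast

lemma filt_HE: assumes "Y \<in> filt H i j" obtains z where "z \<in> Z i" "z \<in> F j" "Y = z +o B i"
  using assms unfolding filt_H by blast

lemma add_H [simp]: "add H i = (+)"
  by (simp add: coset_complex_def)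

lemma diff_H: "diff H i (z +o B i) = X z +o B (i + 1)"
proof -
  have "diff H i (z +o B i) = X ` (z +o B i) + B (i + 1)"
    by (simp add: coset_complex_def B_def)
  also have "\<dots> = X z +o B (i + 1)"
    by (rule coset_image[OF subspace_B]) (simp add: X.add X_B)
  finally show ?thesis .
qed

lemma scale_H: "scale H i c (z +o B i) = scl c z +o B i"
proof -
  have "scale H i c (z +o B i) = scl c ` (z +o B i) + B i"
    by (simp add: coset_complex_def B_def)
  also have "\<dots> = scl c z +o B i"
    by (rule coset_image[OF subspace_B]) (simp add: scale_right_distrib subspace_scale[OF subspace_B])
  finally show ?thesis .
qed

lemma additive_complex_H: "additive_complex H"
  unfolding additive_complex_def
  by (auto elim!: chain_HE filt_HE simp: coset_plus diff_H scale_H X.add scale_right_distrib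
      intro!: chain_HI filt_HI subspace_add[OF subspace_Z] subspace_add[OF subspace_F] X_Z)

end

text \<open>Representatives of a filtered isomorphism of cosets.\<close>

locale double_complex_iso =
  a: double_complex scl C F D X + b: double_complex scl C' F' D' X'
  for scl :: "complex \<Rightarrow> 'v::ab_group_add \<Rightarrow> 'v" and C F D X C' F' D' X' +
  fixes f g :: "int \<Rightarrow> 'v \<Rightarrow> 'v"
  assumes f_add: "x \<in> a.Z i \<Longrightarrow> y \<in> a.Z i \<Longrightarrow> f i (x + y) = f i x + f i y"
    and f_scale: "x \<in> a.Z i \<Longrightarrow> f i (scl c x) = scl c (f i x)"
    and f_Z: "x \<in> a.Z i \<Longrightarrow> f i x \<in> b.Z i"
    and f_B: "x \<in> a.B i \<Longrightarrow> f i x \<in> b.B i"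
    and f_F: "x \<in> a.Z i \<Longrightarrow> x \<in> F j \<Longrightarrow> f i x \<in> F' j"
    and f_X: "x \<in> a.Z i \<Longrightarrow> X' (f i x) - f (i + 1) (X x) \<in> b.B (i + 1)"
    and g_f: "x \<in> a.Z i \<Longrightarrow> g i (f i x) - x \<in> a.B i"
begin

definition "coset_map i Y = f i ` Y + b.B i"

lemma coset_map: "x \<in> a.Z i \<Longrightarrow> coset_map i (x +o a.B i) = f i x +o b.B i"
  unfolding coset_map_def
proof (rule a.coset_image[OF b.subspace_B])
  fix b assume x: "x \<in> a.Z i" and b: "b \<in> a.B i"
  then have "f i (x + b) = f i x + f i b" using f_add a.B_le_Z by blast
  then show "f i (x + b) - f i x \<in> b.B i" using f_B[OF b] by simp
qed

lemma filtered_cochain_map_coset_map: "filtered_cochain_map a.H b.H coset_map"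
  unfolding filtered_cochain_map_def
proof (intro allI conjI ballI)
  fix i
  show "filtered_linear a.H i b.H i (coset_map i)"
  proof (rule filtered_linearI)
    fix U V assume "U \<in> chain a.H i" "V \<in> chain a.H i"
    then obtain x y where "x \<in> a.Z i" "y \<in> a.Z i" and [simp]: "U = x +o a.B i" "V = y +o a.B i"
      unfolding a.chain_H by blast
    moreover from this have "x + y \<in> a.Z i" using a.subspace_add[OF a.subspace_Z] by blast
    ultimately show "coset_map i (add a.H i U V) = add b.H i (coset_map i U) (coset_map i V)"
      by (simp add: coset_map a.coset_plus b.coset_plus f_add)
  next
    fix U assume "U \<in> chain a.H i"
    then obtain x where x: "x \<in> a.Z i" and [simp]: "U = x +o a.B i" unfolding a.chain_H by blast
    show "coset_map i U \<in> chain b.H i"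
      using x f_Z[OF x] unfolding b.chain_H by (auto simp: coset_map)
    have "scl c x \<in> a.Z i" for c using a.subspace_scale[OF a.subspace_Z x] .
    then show "coset_map i (scale a.H i c U) = scale b.H i c (coset_map i U)" for c
      using x by (simp add: coset_map a.scale_H b.scale_H f_scale)
  next
    fix j U assume "U \<in> filt a.H i j"
    then obtain x where x: "x \<in> a.Z i" "x \<in> F j" and [simp]: "U = x +o a.B i" unfolding a.filt_H by blast
    show "coset_map i U \<in> filt b.H i j"
      using x f_Z[OF x(1)] f_F[OF x] unfolding b.filt_H by (auto simp: coset_map)
  qed
  fix U assume "U \<in> chain a.H i"
  then obtain x where x: "x \<in> a.Z i" and [simp]: "U = x +o a.B i" unfolding a.chain_H by blast
  show "diff b.H i (coset_map i U) = coset_map (i + 1) (diff a.H i U)"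
    using x by (simp add: coset_map a.diff_H b.diff_H a.X_Z b.coset_eq_iff f_X)
qed

lemma filtered_homotopic_coset_map:
  assumes "\<And>i x. x \<in> a.Z i \<Longrightarrow> k i (f i x +o b.B i) = g i (f i x) +o a.B i"
  shows "filtered_homotopic a.H a.H (\<lambda>i. k i \<circ> coset_map i) (\<lambda>i. id)"
  unfolding filtered_homotopic_def
\<comment> \<open>The maps are inverse to each other on cosets, so the zero homotopy works; its
  value is the zero coset, which is the set of coboundaries.\<close>
proof (intro exI[of _ "\<lambda>i U. 0 +o a.B (i - 1)"] allI conjI ballI)
  fix i
  have 0: "0 \<in> a.Z (i - 1)" "0 \<in> F j" for i j
    using a.subspace_0[OF a.subspace_Z] a.subspace_0[OF a.subspace_F] by auto
  show "filtered_linear a.H i a.H (i - 1) (\<lambda>U. 0 +o a.B (i - 1))"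
  proof (rule filtered_linearI)
    show "0 +o a.B (i - 1) \<in> chain a.H (i - 1)" by (rule a.chain_HI[OF 0(1)])
    show "0 +o a.B (i - 1) \<in> filt a.H (i - 1) j" for j by (rule a.filt_HI[OF 0])
    show "0 +o a.B (i - 1) = add a.H (i - 1) (0 +o a.B (i - 1)) (0 +o a.B (i - 1))"
      using a.coset_plus[of 0 "i - 1" 0] by simp
    show "0 +o a.B (i - 1) = scale a.H (i - 1) c (0 +o a.B (i - 1))" for c
      using a.scale_H[of "i - 1" c 0] by simp
  qed
  fix U assume "U \<in> chain a.H i"
  then obtain x where x: "x \<in> a.Z i" and [simp]: "U = x +o a.B i" unfolding a.chain_H by blast
  have "(k i \<circ> coset_map i) U = x +o a.B i"
    using x assms[OF x] by (simp add: coset_map a.coset_eq_iff g_f)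
  then show "(k i \<circ> coset_map i) U = add a.H i (id U) (add a.H i (diff a.H (i - 1) (0 +o a.B (i - 1))) (0 +o a.B (i + 1 - 1)))"
    using a.diff_H[of "i - 1" 0] a.coset_plus[of 0 i 0] a.coset_plus[of x i 0]
    by (simp add: a.X.zero)
qed

end

lemma filtered_homotopy_equivalent_cosets:
  assumes f: "double_complex_iso scl C F D X C' F' D' X' f g"
    and g: "double_complex_iso scl C' F' D' X' C F D X g f"
  shows "filtered_homotopy_equivalent (coset_complex scl C F D X) (coset_complex scl C' F' D' X')"
proof -
  interpret f: double_complex_iso scl C F D X C' F' D' X' f g by fact
  interpret g: double_complex_iso scl C' F' D' X' C F D X g f by fact
  show ?thesis
    unfolding filtered_homotopy_equivalent_def
    by (intro exI[of _ f.coset_map] exI[of _ g.coset_map] conjI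
        f.filtered_cochain_map_coset_map g.filtered_cochain_map_coset_map
        f.filtered_homotopic_coset_map g.filtered_homotopic_coset_map g.coset_map f.coset_map f.f_Z g.f_Z)
qed

section \<open>Normal forms of filtered complexes\<close>

text \<open>The levels confine all questions about classes to finite-dimensional spaces:
  representatives can be taken in \<open>F J\<close>, their images under \<open>X\<close> then lie
  in \<open>F L\<close>, and coboundaries in \<open>F L\<close> come from \<open>F K\<close>. No
  nonzero cochain lies in \<open>F J0\<close>, so \<open>J0\<close> can serve as the level of the
  zero vector.\<close>

locale filtered_double_complex = double_complex scl C F D X
  for scl :: "complex \<Rightarrow> 'v::ab_group_add \<Rightarrow> 'v" and C F :: "int \<Rightarrow> 'v set" and D X +
  fixes J0 J L K lo hi :: int
  assumes F_mono: "j \<le> j' \<Longrightarrow> F j \<subseteq> F j'"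
    and F_J0: "x \<in> C i \<Longrightarrow> x \<in> F J0 \<Longrightarrow> x = 0"
    and J0_le_J: "J0 \<le> J" and J_le_L: "J \<le> L"
    and reduce_Z: "x \<in> Z i \<Longrightarrow> \<exists>u\<in>C i. x - D u \<in> F J"
    and X_F: "x \<in> C i \<Longrightarrow> x \<in> F J \<Longrightarrow> X x \<in> F L"
    and reduce_B: "y \<in> C i \<Longrightarrow> D y \<in> F L \<Longrightarrow> \<exists>y'\<in>C i \<inter> F K. D y' = D y"
    and finite_dim: "\<exists>A. finite A \<and> C i \<inter> F j \<subseteq> span A"
    and C_hi: "hi \<le> i \<Longrightarrow> C i = {0}"
    and C_lo: "i < lo \<Longrightarrow> C i = {0}"
begin

definition comb :: "nat set \<Rightarrow> (nat \<Rightarrow> 'v) \<Rightarrow> (nat \<Rightarrow> complex) \<Rightarrow> 'v" where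
  "comb I e c = (\<Sum>s\<in>I. scl (c s) (e s))"

lemma comb_add: "comb I e (\<lambda>s. c s + d s) = comb I e c + comb I e d"
  by (simp add: comb_def scale_left_distrib sum.distrib)

lemma comb_diff: "comb I e (\<lambda>s. c s - d s) = comb I e c - comb I e d"
  by (simp add: comb_def scale_left_diff_distrib sum_subtractf)

lemma comb_scale: "comb I e (\<lambda>s. a * c s) = scl a (comb I e c)"
  by (simp add: comb_def scale_sum_right)

lemma comb_0: "comb I e (\<lambda>s. 0) = 0"
  by (simp add: comb_def)

lemma comb_cong: "(\<And>s. s \<in> I \<Longrightarrow> c s = d s) \<Longrightarrow> (\<And>s. s \<in> I \<Longrightarrow> e s = f s) \<Longrightarrow> comb I e c = comb I f d"
  by (simp add: comb_def)

lemma comb_mono: "finite I \<Longrightarrow> S \<subseteq> I \<Longrightarrow> (\<And>s. s \<in> I - S \<Longrightarrow> c s = 0) \<Longrightarrow> comb S e c = comb I e c"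
  unfolding comb_def by (rule sum.mono_neutral_left) auto

lemma comb_in:
  assumes "subspace V" "\<And>s. s \<in> I \<Longrightarrow> c s \<noteq> 0 \<Longrightarrow> e s \<in> V"
  shows "comb I e c \<in> V"
  unfolding comb_def
proof (rule subspace_sum[OF assms(1)])
  fix s assume "s \<in> I"
  then show "scl (c s) (e s) \<in> V"
    using assms(2)[of s] subspace_scale[OF assms(1)] subspace_0[OF assms(1)] by (cases "c s = 0") auto
qed

lemma comb_diff_in:
  assumes "subspace V" "\<And>s. s \<in> I \<Longrightarrow> c s \<noteq> 0 \<Longrightarrow> e s - f s \<in> V"
  shows "comb I e c - comb I f c \<in> V"
proof -
  have "comb I e c - comb I f c = comb I (\<lambda>s. e s - f s) c"
    by (simp add: comb_def scale_right_diff_distrib sum_subtractf)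
  then show ?thesis using comb_in[OF assms(1), of I c "\<lambda>s. e s - f s"] assms(2) by simp
qed

lemma X_comb: "X (comb I e c) = comb I (\<lambda>s. X (e s)) c"
  by (simp add: comb_def X.sum X.scale)

lemma comb_reindex: "inj_on \<sigma> S \<Longrightarrow> comb (\<sigma> ` S) e c = comb S (\<lambda>s. e (\<sigma> s)) (\<lambda>s. c (\<sigma> s))"
  by (simp add: comb_def sum.reindex)

lemma comb_insert: "finite I \<Longrightarrow> k \<notin> I \<Longrightarrow> comb (insert k I) e c = scl (c k) (e k) + comb I e c"
  by (simp add: comb_def)

lemmas B_add = subspace_add[OF subspace_B] and B_diff = subspace_diff[OF subspace_B]
  and B_scale = subspace_scale[OF subspace_B] and B_0 = subspace_0[OF subspace_B]
  and B_neg = subspace_neg[OF subspace_B]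

lemma B_diff_commute: "x - y \<in> B i \<Longrightarrow> y - x \<in> B i"
  using B_neg[of "x - y" i] by simp

lemma B_diff_trans: "x - y \<in> B i \<Longrightarrow> y - z \<in> B i \<Longrightarrow> x - z \<in> B i"
  using B_add[of "x - y" i "y - z"] by simp

definition independent_mod :: "int \<Rightarrow> nat set \<Rightarrow> (nat \<Rightarrow> 'v) \<Rightarrow> bool" where
  "independent_mod i I e \<longleftrightarrow> (\<forall>c. comb I e c \<in> B i \<longrightarrow> (\<forall>s\<in>I. c s = 0))"

lemma independent_modD: "independent_mod i I e \<Longrightarrow> comb I e c \<in> B i \<Longrightarrow> s \<in> I \<Longrightarrow> c s = 0"
  by (simp add: independent_mod_def)

lemma independent_mod_unique:
  assumes "independent_mod i I e" "z - comb I e c \<in> B i" "z - comb I e d \<in> B i" "s \<in> I"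
  shows "c s = d s"
proof -
  have "comb I e (\<lambda>s. c s - d s) \<in> B i"
    unfolding comb_diff by (rule B_diff_trans[OF B_diff_commute[OF assms(2)] assms(3)])
  from independent_modD[OF assms(1) this assms(4)] show ?thesis by simp
qed

definition spanned_mod :: "int \<Rightarrow> nat set \<Rightarrow> (nat \<Rightarrow> int) \<Rightarrow> (nat \<Rightarrow> 'v) \<Rightarrow> int \<Rightarrow> 'v set" where
  "spanned_mod i I lev e j =
    {z. \<exists>c. (\<forall>s\<in>I. c s \<noteq> 0 \<longrightarrow> lev s \<le> j) \<and> z - comb I e c \<in> B i}"

lemma spanned_modI:
  "z - comb I e c \<in> B i \<Longrightarrow> (\<And>s. s \<in> I \<Longrightarrow> c s \<noteq> 0 \<Longrightarrow> lev s \<le> j) \<Longrightarrow> z \<in> spanned_mod i I lev e j"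
  unfolding spanned_mod_def by blast

lemma subspace_spanned_mod: "subspace (spanned_mod i I lev e j)"
proof (rule subspaceI)
  show "0 \<in> spanned_mod i I lev e j"
    by (rule spanned_modI[where c = "\<lambda>_. 0"]) (simp_all add: comb_0 B_0)
next
  fix x y assume "x \<in> spanned_mod i I lev e j" "y \<in> spanned_mod i I lev e j"
  then obtain c d where c: "\<forall>s\<in>I. c s \<noteq> 0 \<longrightarrow> lev s \<le> j" "x - comb I e c \<in> B i"
    and d: "\<forall>s\<in>I. d s \<noteq> 0 \<longrightarrow> lev s \<le> j" "y - comb I e d \<in> B i"
    unfolding spanned_mod_def by blast
  have "x + y - comb I e (\<lambda>s. c s + d s) = (x - comb I e c) + (y - comb I e d)"
    by (simp add: comb_add)
  then have "x + y - comb I e (\<lambda>s. c s + d s) \<in> B i" using B_add[OF c(2) d(2)] by (simp only:)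
  then show "x + y \<in> spanned_mod i I lev e j"
    by (rule spanned_modI) (use c(1) d(1) in force)
next
  fix a x assume "x \<in> spanned_mod i I lev e j"
  then obtain c where c: "\<forall>s\<in>I. c s \<noteq> 0 \<longrightarrow> lev s \<le> j" "x - comb I e c \<in> B i"
    unfolding spanned_mod_def by blast
  have "scl a x - comb I e (\<lambda>s. a * c s) = scl a (x - comb I e c)"
    by (simp add: comb_scale scale_right_diff_distrib)
  then have "scl a x - comb I e (\<lambda>s. a * c s) \<in> B i" using B_scale[OF c(2)] by (simp only:)
  then show "scl a x \<in> spanned_mod i I lev e j"
    by (rule spanned_modI) (use c(1) in force)
qed

subsection \<open>Adapted bases\<close>

text \<open>Representatives of a basis of the cohomology in degree \<open>i\<close> adapted to the
  induced filtration: the vectors of level at most \<open>j\<close> give a basis of the classes that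
  meet \<open>F j\<close>.\<close>

definition adapted :: "int \<Rightarrow> nat set \<Rightarrow> (nat \<Rightarrow> int) \<Rightarrow> (nat \<Rightarrow> 'v) \<Rightarrow> bool" where
  "adapted i I lev e \<longleftrightarrow> finite I \<and>
    (\<forall>s\<in>I. e s \<in> Z i \<and> e s \<in> F (lev s) \<and> J0 < lev s \<and> lev s \<le> J) \<and>
    independent_mod i I e \<and> (\<forall>j. Z i \<inter> F j \<subseteq> spanned_mod i I lev e j)"

lemma adaptedD:
  assumes "adapted i I lev e"
  shows "finite I" "s \<in> I \<Longrightarrow> e s \<in> Z i" "s \<in> I \<Longrightarrow> e s \<in> F (lev s)" "s \<in> I \<Longrightarrow> J0 < lev s"
    "s \<in> I \<Longrightarrow> lev s \<le> J" "independent_mod i I e"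
  using assms by (simp_all add: adapted_def)

lemma adapted_spanned:
  assumes "adapted i I lev e" "z \<in> Z i" "z \<in> F j"
  obtains c where "\<And>s. s \<in> I \<Longrightarrow> c s \<noteq> 0 \<Longrightarrow> lev s \<le> j" "z - comb I e c \<in> B i"
proof -
  have "z \<in> spanned_mod i I lev e j" using assms by (auto simp: adapted_def)
  then show thesis using that unfolding spanned_mod_def by blast
qed

lemma adapted_spanned_Z:
  assumes "adapted i I lev e" "z \<in> Z i"
  obtains c where "z - comb I e c \<in> B i"
proof -
  from reduce_Z[OF assms(2)] obtain u where u: "u \<in> C i" "z - D u \<in> F J" by blast
  have Du: "D u \<in> B i" using u(1) by (simp add: B_def)
  then have "z - D u \<in> Z i" using subspace_diff[OF subspace_Z assms(2)] B_le_Z by blast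
  from adapted_spanned[OF assms(1) this u(2)] obtain c where "z - D u - comb I e c \<in> B i" by blast
  then have "z - D u - comb I e c + D u \<in> B i" using Du by (rule B_add)
  then show thesis using that[of c] by (simp add: algebra_simps)
qed

lemma independent_mod_insert:
  assumes fin: "finite I" and k: "k \<notin> I" and ind: "independent_mod i I e"
    and a: "a \<notin> spanned_mod i I lev e j" and lev: "\<And>s. s \<in> I \<Longrightarrow> lev s \<le> j"
  shows "independent_mod i (insert k I) (e(k := a))"
  unfolding independent_mod_def
proof (intro allI impI)
  fix c assume c: "comb (insert k I) (e(k := a)) c \<in> B i"
  have "comb (insert k I) (e(k := a)) c = scl (c k) a + comb I (e(k := a)) c"
    using comb_insert[OF fin k] by simp
  also have "comb I (e(k := a)) c = comb I e c"
    using k by (intro comb_cong) auto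
  finally have c': "scl (c k) a + comb I e c \<in> B i" using c by (simp only:)
  have "c k = 0"
  proof (rule ccontr)
    assume ck: "c k \<noteq> 0"
    have "scl (inverse (c k)) (scl (c k) a + comb I e c) = a - comb I e (\<lambda>s. (- inverse (c k)) * c s)"
      unfolding comb_scale using ck by (simp add: scale_right_distrib scale_minus_left)
    then have "a - comb I e (\<lambda>s. (- inverse (c k)) * c s) \<in> B i" using B_scale[OF c'] by metis
    then have "a \<in> spanned_mod i I lev e j" by (rule spanned_modI) (rule lev)
    with a show False by contradiction
  qed
  with c' have "comb I e c \<in> B i" by simp
  with independent_modD[OF ind] \<open>c k = 0\<close> show "\<forall>s\<in>insert k I. c s = 0" by blast
qed

lemma spanned_mod_mono:
  assumes "finite I'" "I \<subseteq> I'" "\<And>s. s \<in> I \<Longrightarrow> e' s = e s" "\<And>s. s \<in> I \<Longrightarrow> lev' s = lev s" "j \<le> j'"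
  shows "spanned_mod i I lev e j \<subseteq> spanned_mod i I' lev' e' j'"
proof
  fix z assume "z \<in> spanned_mod i I lev e j"
  then obtain c where c: "\<forall>s\<in>I. c s \<noteq> 0 \<longrightarrow> lev s \<le> j" "z - comb I e c \<in> B i"
    unfolding spanned_mod_def by blast
  let ?c = "\<lambda>s. if s \<in> I then c s else 0"
  have "comb I e c = comb I e' ?c" by (rule comb_cong) (simp_all add: assms(3))
  also have "\<dots> = comb I' e' ?c" by (rule comb_mono) (use assms in auto)
  finally have "z - comb I' e' ?c \<in> B i" using c(2) by simp
  moreover have "\<forall>s\<in>I'. ?c s \<noteq> 0 \<longrightarrow> lev' s \<le> j'" using c(1) assms(4,5) by auto
  ultimately show "z \<in> spanned_mod i I' lev' e' j'" by (intro spanned_modI) blast+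
qed

definition adapted_upto :: "int \<Rightarrow> int \<Rightarrow> nat set \<Rightarrow> (nat \<Rightarrow> int) \<Rightarrow> (nat \<Rightarrow> 'v) \<Rightarrow> bool" where
  "adapted_upto m i I lev e \<longleftrightarrow> finite I \<and>
    (\<forall>s\<in>I. e s \<in> Z i \<and> e s \<in> F (lev s) \<and> J0 < lev s \<and> lev s \<le> m) \<and>
    independent_mod i I e \<and> (\<forall>j\<le>m. Z i \<inter> F j \<subseteq> spanned_mod i I lev e j)"

text \<open>Induction on the level, starting where the filtration vanishes. The cocycles in the next
  step have a finite basis; each of its vectors that is not yet spanned modulo coboundaries joins
  the family with the new level.\<close>

lemma ex_adapted_upto:
  assumes "J0 \<le> m"
  shows "\<exists>I lev e. adapted_upto m i I lev e"
  using assms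
proof (induction m rule: int_ge_induct)
  case base
  have "Z i \<inter> F j \<subseteq> spanned_mod i {} lev e j" if "j \<le> J0" for j lev e
  proof
    fix z assume "z \<in> Z i \<inter> F j"
    then have "z = 0" using F_J0[of z i] F_mono[OF that] by (auto simp: Z_def)
    then show "z \<in> spanned_mod i {} lev e j" by (simp add: subspace_0[OF subspace_spanned_mod])
  qed
  then have "adapted_upto J0 i {} lev e" for lev e
    by (auto simp: adapted_upto_def independent_mod_def)
  then show ?case by blast
next
  case (step m)
  then obtain I lev e where ad: "adapted_upto m i I lev e" by blast
  have "subspace (Z i \<inter> F (m + 1))" by (rule subspace_inter[OF subspace_Z subspace_F])
  obtain G where G: "finite G" "C i \<inter> F (m + 1) \<subseteq> span G" using finite_dim by blast
  obtain A where A: "A \<subseteq> Z i \<inter> F (m + 1)" "independent A" "Z i \<inter> F (m + 1) \<subseteq> span A"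
    by (rule basis_exists)
  have "A \<subseteq> span G" using A(1) G(2) by (auto simp: Z_def)
  then have finA: "finite A" using independent_span_bound[OF G(1) A(2)] by blast
  have "\<exists>I lev e. finite I \<and> (\<forall>s\<in>I. e s \<in> Z i \<and> e s \<in> F (lev s) \<and> J0 < lev s \<and> lev s \<le> m + 1) \<and>
      independent_mod i I e \<and> (\<forall>j\<le>m. Z i \<inter> F j \<subseteq> spanned_mod i I lev e j) \<and>
      A \<subseteq> spanned_mod i I lev e (m + 1)"
    using finA A(1)
  proof (induction A rule: finite_induct)
    case empty
    from ad show ?case unfolding adapted_upto_def by (intro exI[of _ I] exI[of _ lev] exI[of _ e]) auto
  next
    case (insert a A)
    then obtain I lev e where I: "finite I" "\<forall>s\<in>I. e s \<in> Z i \<and> e s \<in> F (lev s) \<and> J0 < lev s \<and> lev s \<le> m + 1"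
      "independent_mod i I e" "\<forall>j\<le>m. Z i \<inter> F j \<subseteq> spanned_mod i I lev e j"
      "A \<subseteq> spanned_mod i I lev e (m + 1)" by auto
    show ?case
    proof (cases "a \<in> spanned_mod i I lev e (m + 1)")
      case True
      with I show ?thesis by (intro exI[of _ I] exI[of _ lev] exI[of _ e]) auto
    next
      case False
      obtain k where k: "k \<notin> I" using ex_new_if_finite[OF _ I(1)] by auto
      let ?I = "insert k I" and ?lev = "lev(k := m + 1)" and ?e = "e(k := a)"
      have mono: "spanned_mod i I lev e j \<subseteq> spanned_mod i ?I ?lev ?e j" for j
        by (rule spanned_mod_mono) (use k I(1) in auto)
      have "a \<in> spanned_mod i ?I ?lev ?e (m + 1)"
      proof -
        let ?c = "\<lambda>s. if s = k then 1 else 0"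
        have "comb ?I ?e ?c = a + comb I ?e ?c"
          using comb_insert[OF I(1) k, of ?e ?c] by simp
        also have "comb I ?e ?c = comb I ?e (\<lambda>_. 0)" by (rule comb_cong) (use k in auto)
        also have "\<dots> = 0" by (rule comb_0)
        finally have "a - comb ?I ?e ?c \<in> B i" by (simp add: B_0 fun_upd_def)
        then show ?thesis by (rule spanned_modI) (simp split: if_splits)
      qed
      moreover have "independent_mod i ?I ?e"
        by (rule independent_mod_insert[OF I(1) k I(3) False]) (use I(2) in auto)
      moreover have "\<forall>s\<in>?I. ?e s \<in> Z i \<and> ?e s \<in> F (?lev s) \<and> J0 < ?lev s \<and> ?lev s \<le> m + 1"
        using I(2) insert.prems step.hyps by auto
      moreover have "A \<subseteq> spanned_mod i ?I ?lev ?e (m + 1)" using I(5) mono by blast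
      moreover have "\<forall>j\<le>m. Z i \<inter> F j \<subseteq> spanned_mod i ?I ?lev ?e j"
        using I(4) mono by blast
      ultimately show ?thesis using I(1)
        by (intro exI[of _ ?I] exI[of _ ?lev] exI[of _ ?e]) (simp del: fun_upd_apply)
    qed
  qed
  then obtain I lev e where I: "finite I" "\<forall>s\<in>I. e s \<in> Z i \<and> e s \<in> F (lev s) \<and> J0 < lev s \<and> lev s \<le> m + 1"
      "independent_mod i I e" "\<forall>j\<le>m. Z i \<inter> F j \<subseteq> spanned_mod i I lev e j"
      "A \<subseteq> spanned_mod i I lev e (m + 1)" by auto
  have "Z i \<inter> F (m + 1) \<subseteq> spanned_mod i I lev e (m + 1)"
    using A(3) span_minimal[OF I(5) subspace_spanned_mod] by blast
  then have "\<forall>j\<le>m + 1. Z i \<inter> F j \<subseteq> spanned_mod i I lev e j"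
    using I(4) by (metis zle_add1_eq_le order_le_less)
  with I have "adapted_upto (m + 1) i I lev e" by (simp add: adapted_upto_def)
  then show ?case by blast
qed

text \<open>The construction may stop at \<open>J\<close>: beyond it no new classes appear, since
  every cocycle is cohomologous to one in \<open>F J\<close>.\<close>

lemma ex_adapted: "\<exists>I lev e. adapted i I lev e"
proof -
  obtain I lev e where I: "adapted_upto J i I lev e" using ex_adapted_upto[OF J0_le_J] by blast
  have "z \<in> spanned_mod i I lev e j" if z: "z \<in> Z i" "z \<in> F j" for z j
  proof (cases "j \<le> J")
    case True
    then show ?thesis using I z by (auto simp: adapted_upto_def)
  next
    case False
    from reduce_Z[OF z(1)] obtain u where u: "u \<in> C i" "z - D u \<in> F J" by blast
    have Du: "D u \<in> B i" using u(1) by (simp add: B_def)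
    then have "z - D u \<in> Z i" using subspace_diff[OF subspace_Z z(1)] B_le_Z by blast
    with u(2) I have "z - D u \<in> spanned_mod i I lev e J" by (auto simp: adapted_upto_def)
    also have "\<dots> \<subseteq> spanned_mod i I lev e j"
      by (rule spanned_mod_mono) (use False I in \<open>auto simp: adapted_upto_def\<close>)
    finally have *: "z - D u \<in> spanned_mod i I lev e j" .
    have "D u \<in> spanned_mod i I lev e j"
      by (rule spanned_modI[where c = "\<lambda>_. 0"]) (simp_all add: comb_0 Du)
    from subspace_add[OF subspace_spanned_mod * this] show ?thesis by simp
  qed
  with I have "adapted i I lev e" unfolding adapted_def adapted_upto_def by blast
  then show ?thesis by blast
qed

text \<open>An elementary filtered base change. The new vector involves no level above
  \<open>lev s0\<close>, so it stays in the same filtration step, and its coefficient at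
  \<open>s0\<close> is nonzero, so the change can be undone within every step.\<close>

lemma adapted_replace:
  assumes ad: "adapted i I lev e" and s0: "s0 \<in> I" "a s0 \<noteq> 0"
    and lev: "\<And>s. s \<in> I \<Longrightarrow> a s \<noteq> 0 \<Longrightarrow> lev s \<le> lev s0"
  shows "adapted i I lev (e(s0 := comb I e a))"
proof -
  let ?y = "comb I e a"
  let ?e = "e(s0 := ?y)"
  let ?T = "\<lambda>c s. c s0 * a s + (if s = s0 then 0 else c s)"
  note fin = adaptedD(1)[OF ad]
  have comb: "comb I ?e c = comb I e (?T c)" for c
  proof -
    have "comb I ?e c = scl (c s0) ?y + comb (I - {s0}) ?e c"
      using comb_insert[of "I - {s0}" s0 ?e c] fin s0(1) by (simp add: insert_absorb)
    also have "comb (I - {s0}) ?e c = comb (I - {s0}) e (\<lambda>s. if s = s0 then 0 else c s)"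
      by (rule comb_cong) auto
    also have "\<dots> = comb I e (\<lambda>s. if s = s0 then 0 else c s)"
      by (rule comb_mono) (use fin in auto)
    also have "scl (c s0) ?y = comb I e (\<lambda>s. c s0 * a s)" by (simp add: comb_scale)
    finally show ?thesis by (simp only: comb_add)
  qed
  have "?y \<in> Z i" by (rule comb_in[OF subspace_Z adaptedD(2)[OF ad]])
  moreover have "?y \<in> F (lev s0)"
    by (rule comb_in[OF subspace_F]) (use adaptedD(3)[OF ad] F_mono lev in blast)
  ultimately have 1: "\<forall>s\<in>I. ?e s \<in> Z i \<and> ?e s \<in> F (lev s) \<and> J0 < lev s \<and> lev s \<le> J"
    using adaptedD[OF ad] by auto
  have 2: "independent_mod i I ?e"
    unfolding independent_mod_def
  proof (intro allI impI)
    fix c assume "comb I ?e c \<in> B i"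
    then have T: "?T c s = 0" if "s \<in> I" for s
      unfolding comb using independent_modD[OF adaptedD(6)[OF ad]] that by blast
    from T[OF s0(1)] s0(2) have "c s0 = 0" by simp
    show "\<forall>s\<in>I. c s = 0"
    proof
      fix s assume "s \<in> I"
      from T[OF this] \<open>c s0 = 0\<close> show "c s = 0" by (cases "s = s0") simp_all
    qed
  qed
  have 3: "Z i \<inter> F j \<subseteq> spanned_mod i I lev ?e j" for j
  proof
    fix z assume "z \<in> Z i \<inter> F j"
    then obtain d where d: "\<And>s. s \<in> I \<Longrightarrow> d s \<noteq> 0 \<Longrightarrow> lev s \<le> j" "z - comb I e d \<in> B i"
      using adapted_spanned[OF ad, of z j] by blast
    define c where "c s = (if s = s0 then d s0 / a s0 else d s - (d s0 / a s0) * a s)" for s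
    have "?T c = d" using s0(2) by (simp add: c_def fun_eq_iff)
    then have "z - comb I ?e c \<in> B i" using d(2) by (simp only: comb)
    moreover have "lev s \<le> j" if s: "s \<in> I" "c s \<noteq> 0" for s
    proof -
      have "d s \<noteq> 0 \<or> (d s0 \<noteq> 0 \<and> a s \<noteq> 0)"
        using s(2) s0(2) by (auto simp: c_def split: if_splits)
      then show ?thesis using d(1)[OF s(1)] d(1)[OF s0(1)] lev[OF s(1)] by auto
    qed
    ultimately show "z \<in> spanned_mod i I lev ?e j" by (intro spanned_modI) blast+
  qed
  from 1 2 3 fin show ?thesis unfolding adapted_def by blast
qed

subsection \<open>Pairing\<close>

text \<open>Reduction of the differential between two consecutive degrees to a partial matching. The
  indices in \<open>R'\<close> are those already paired with indices in the next degree; \<open>P\<close> is the set of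
  indices processed so far, which are those of smallest level.\<close>

lemma ex_matching:
  assumes e: "adapted i I lev e" and e': "adapted (i + 1) I' lev' e'" and R': "R' \<subseteq> I'"
    and X_e': "\<And>t. t \<in> I' - R' \<Longrightarrow> X (e' t) \<in> B (i + 1 + 1)"
    and ind: "independent_mod (i + 1 + 1) R' (\<lambda>t. X (e' t))"
    and "P \<subseteq> I" "\<forall>s\<in>P. \<forall>t\<in>I - P. lev s \<le> lev t"
  shows "\<exists>f f' S \<sigma>. adapted i I lev f \<and> adapted (i + 1) I' lev' f' \<and> S \<subseteq> P \<and> inj_on \<sigma> S \<and>
    \<sigma> ` S \<subseteq> I' - R' \<and> (\<forall>t\<in>R'. f' t = e' t) \<and> (\<forall>t\<in>I' - R'. X (f' t) \<in> B (i + 1 + 1)) \<and>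
    (\<forall>s\<in>S. X (f s) - f' (\<sigma> s) \<in> B (i + 1)) \<and> (\<forall>s\<in>P - S. X (f s) \<in> B (i + 1))"
proof -
  have "finite P" using \<open>P \<subseteq> I\<close> adaptedD(1)[OF e] by (rule finite_subset)
  then show ?thesis using assms(6,7)
  proof (induction "card P" arbitrary: P)
    case 0
    then have "P = {}" by simp
    then show ?case using e e' X_e'
      by (intro exI[of _ e] exI[of _ e'] exI[of _ "{}"] exI[of _ id]) auto
  next
    case (Suc n)
    then have "P \<noteq> {}" by auto
    then have "Max (lev ` P) \<in> lev ` P" using Suc.prems by (intro Max_in) auto
    then obtain m where m: "m \<in> P" "lev m = Max (lev ` P)" by (elim imageE) simp
    have max: "lev s \<le> lev m" if "s \<in> P" for s
      using m(2) Suc.prems(1) that by (simp add: Max_ge)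
    \<comment> \<open>The index \<open>m\<close> of largest level comes last: multiples of all
      vectors treated before can then be added to \<open>f m\<close> without leaving its filtration
      step.\<close>
    define P0 where "P0 = P - {m}"
    have card: "n = card P0"
      unfolding P0_def card_Diff_singleton[OF m(1)] Suc.hyps(2)[symmetric] by simp
    have fin: "finite P0" using Suc.prems(1) by (simp add: P0_def)
    have P0I: "P0 \<subseteq> I" using Suc.prems(2) by (auto simp: P0_def)
    have "m \<notin> P0" "P = insert m P0" using m(1) by (auto simp: P0_def)
    note P0 = card fin P0I this
    have levP0: "\<forall>s\<in>P0. \<forall>t\<in>I - P0. lev s \<le> lev t"
    proof (intro ballI)
      fix s t assume "s \<in> P0" "t \<in> I - P0"
      then show "lev s \<le> lev t"
        using max[of s] Suc.prems(3) by (cases "t = m") (auto simp: P0(5))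
    qed
    from Suc.hyps(1)[OF P0(1,2,3) levP0] obtain f f' S \<sigma> where
      f: "adapted i I lev f" and f': "adapted (i + 1) I' lev' f'" and S: "S \<subseteq> P0" "inj_on \<sigma> S"
        "\<sigma> ` S \<subseteq> I' - R'" and R: "\<forall>t\<in>R'. f' t = e' t" and X_f': "\<forall>t\<in>I' - R'. X (f' t) \<in> B (i + 1 + 1)"
      and X_S: "\<forall>s\<in>S. X (f s) - f' (\<sigma> s) \<in> B (i + 1)" and X_P0: "\<forall>s\<in>P0 - S. X (f s) \<in> B (i + 1)"
      by (elim exE conjE)
    have mI: "m \<in> I" and mS: "m \<notin> S" using m(1) Suc.prems(2) P0(4) S(1) by auto
    have SI: "S \<subseteq> I" using S(1) P0(3) by blast
    have finS: "finite S" using SI adaptedD(1)[OF f] by (rule finite_subset)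
    have finI': "finite I'" using adaptedD(1)[OF f'] .
    have fm: "f m \<in> Z i" using adaptedD(2)[OF f mI] .
    obtain c where c: "X (f m) - comb I' f' c \<in> B (i + 1)"
      using adapted_spanned_Z[OF f' X_Z[OF fm]] by blast
    \<comment> \<open>Since \<open>X (X (f m)) = 0\<close> and the images of the sources
      \<open>R'\<close> are independent modulo coboundaries, \<open>X (f m)\<close> has no
      components at \<open>R'\<close>. The pairing between the next two degrees is therefore never
      disturbed.\<close>
    have cR: "c t = 0" if "t \<in> R'" for t
    proof -
      have "X (X (f m)) = 0" using fm X_X[of "f m" i] by (simp add: Z_def)
      then have 1: "X (comb I' f' c) \<in> B (i + 1 + 1)"
        using X_B[OF c] B_neg[of "- X (comb I' f' c)"] by (simp add: X.diff)
      have "comb I' (\<lambda>t. X (f' t)) c - comb I' (\<lambda>t. X (f' t)) (\<lambda>t. if t \<in> R' then c t else 0) =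
          comb I' (\<lambda>t. X (f' t)) (\<lambda>t. c t - (if t \<in> R' then c t else 0))"
        by (simp add: comb_diff)
      also have "\<dots> \<in> B (i + 1 + 1)"
        by (rule comb_in[OF subspace_B]) (use X_f' in \<open>auto split: if_splits\<close>)
      finally have 2: "comb I' (\<lambda>t. X (f' t)) c - comb I' (\<lambda>t. X (f' t)) (\<lambda>t. if t \<in> R' then c t else 0) \<in> B (i + 1 + 1)" .
      have "comb I' (\<lambda>t. X (f' t)) (\<lambda>t. if t \<in> R' then c t else 0) =
          comb R' (\<lambda>t. X (f' t)) (\<lambda>t. if t \<in> R' then c t else 0)"
        by (rule comb_mono[symmetric]) (use finI' R' in auto)
      also have "\<dots> = comb R' (\<lambda>t. X (e' t)) c"
        by (rule comb_cong) (use R in auto)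
      finally have "comb R' (\<lambda>t. X (e' t)) c \<in> B (i + 1 + 1)"
        using B_diff[OF 1 2] by (simp add: X_comb)
      then show ?thesis using independent_modD[OF ind] that by blast
    qed
    \<comment> \<open>Subtracting the sources in \<open>S\<close> with these coefficients clears the
      components of \<open>X (f m)\<close> at targets that are already taken.\<close>
    define a where "a s = (if s = m then 1 else if s \<in> S then - c (\<sigma> s) else 0)" for s
    define g where "g = f(m := comb I f a)"
    have g: "adapted i I lev g"
      unfolding g_def
    proof (rule adapted_replace[OF f mI])
      show "a m \<noteq> 0" by (simp add: a_def)
      fix s assume "a s \<noteq> 0"
      then have "s = m \<or> s \<in> S" by (auto simp: a_def split: if_splits)
      then show "lev s \<le> lev m" using max S(1) P0(5) by auto
    qed
    define b where "b t = (if t \<in> \<sigma> ` S then 0 else c t)" for t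
    have gm: "X (g m) - comb I' f' b \<in> B (i + 1)"
    proof -
      have "comb I f a = comb (insert m S) f a"
        by (rule comb_mono[symmetric]) (use adaptedD(1)[OF f] mI SI in \<open>auto simp: a_def\<close>)
      also have "\<dots> = f m + comb S f a" using comb_insert[OF finS mS] by (simp add: a_def)
      also have "comb S f a = comb S f (\<lambda>s. (-1) * c (\<sigma> s))"
        by (rule comb_cong) (use mS in \<open>auto simp: a_def\<close>)
      also have "\<dots> = - comb S f (\<lambda>s. c (\<sigma> s))" unfolding comb_scale by (simp add: scale_minus_left)
      finally have gm: "X (g m) = X (f m) - comb S (\<lambda>s. X (f s)) (\<lambda>s. c (\<sigma> s))"
        by (simp add: g_def X.diff X_comb)
      have "comb S (\<lambda>s. X (f s)) (\<lambda>s. c (\<sigma> s)) - comb S (\<lambda>s. f' (\<sigma> s)) (\<lambda>s. c (\<sigma> s)) \<in> B (i + 1)"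
        by (rule comb_diff_in[OF subspace_B]) (use X_S in blast)
      moreover have "comb S (\<lambda>s. f' (\<sigma> s)) (\<lambda>s. c (\<sigma> s)) = comb I' f' (\<lambda>t. if t \<in> \<sigma> ` S then c t else 0)"
      proof -
        have "comb S (\<lambda>s. f' (\<sigma> s)) (\<lambda>s. c (\<sigma> s)) = comb (\<sigma> ` S) f' c"
          by (rule comb_reindex[OF S(2), symmetric])
        also have "\<dots> = comb (\<sigma> ` S) f' (\<lambda>t. if t \<in> \<sigma> ` S then c t else 0)"
          by (rule comb_cong) auto
        also have "\<dots> = comb I' f' (\<lambda>t. if t \<in> \<sigma> ` S then c t else 0)"
          by (rule comb_mono) (use finI' S(3) in auto)
        finally show ?thesis .
      qed
      ultimately have "comb S (\<lambda>s. X (f s)) (\<lambda>s. c (\<sigma> s)) - comb I' f' (\<lambda>t. if t \<in> \<sigma> ` S then c t else 0) \<in> B (i + 1)"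
        by simp
      from B_diff[OF c this]
      have "X (g m) - (comb I' f' c - comb I' f' (\<lambda>t. if t \<in> \<sigma> ` S then c t else 0)) \<in> B (i + 1)"
        by (simp add: gm algebra_simps)
      moreover have "comb I' f' c - comb I' f' (\<lambda>t. if t \<in> \<sigma> ` S then c t else 0) = comb I' f' b"
        unfolding comb_diff[symmetric] by (rule comb_cong) (auto simp: b_def)
      ultimately show ?thesis by simp
    qed
    have g_other: "g s = f s" if "s \<noteq> m" for s using that by (simp add: g_def)
    let ?N = "{t \<in> I'. b t \<noteq> 0}"
    have N: "t \<in> I' - R' - \<sigma> ` S" if "t \<in> ?N" for t
      using that cR by (auto simp: b_def split: if_splits)
    show ?case
    proof (cases "?N = {}")
      case True
      then have "comb I' f' b = comb I' f' (\<lambda>_. 0)" by (intro comb_cong) auto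
      then have "X (g m) \<in> B (i + 1)" using gm by (simp add: comb_0)
      moreover have "\<forall>s\<in>S. X (g s) - f' (\<sigma> s) \<in> B (i + 1)"
        using X_S mS by (auto simp: g_def)
      moreover have "\<forall>s\<in>P0 - S. X (g s) \<in> B (i + 1)"
        using X_P0 P0(4) by (auto simp: g_def)
      ultimately show ?thesis using g f' S R X_f' P0(5)
        by (intro exI[of _ g] exI[of _ f'] exI[of _ S] exI[of _ \<sigma>]) auto
    next
      case False
      have finN: "finite ?N" using finI' by simp
      have "Max (lev' ` ?N) \<in> lev' ` ?N" using False finN by (intro Max_in) auto
      then obtain t0 where t0: "t0 \<in> ?N" "lev' t0 = Max (lev' ` ?N)" by (elim imageE) simp
      \<comment> \<open>\<open>t0\<close> has the largest level among the remaining components,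
        which is what permits the whole image to replace the basis vector at
        \<open>t0\<close>.\<close>
      define g' where "g' = f'(t0 := comb I' f' b)"
      have g': "adapted (i + 1) I' lev' g'"
        unfolding g'_def
      proof (rule adapted_replace[OF f'])
        fix t assume "t \<in> I'" "b t \<noteq> 0"
        then show "lev' t \<le> lev' t0" unfolding t0(2) using finN by (intro Max_ge) auto
      qed (use t0 in auto)
      have t0': "t0 \<in> I'" "t0 \<notin> R'" "t0 \<notin> \<sigma> ` S" using N[OF t0(1)] by auto
      have g'_other: "g' t = f' t" if "t \<noteq> t0" for t using that by (simp add: g'_def)
      have g't0: "g' t0 = comb I' f' b" by (simp add: g'_def)
      let ?S = "insert m S" and ?\<sigma> = "\<sigma>(m := t0)"
      have \<sigma>S: "?\<sigma> s = \<sigma> s" if "s \<in> S" for s using that mS by auto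
      have n1: "X (g' t) \<in> B (i + 1 + 1)" if t: "t \<in> I' - R'" for t
      proof (cases "t = t0")
        case True
        have "comb I' (\<lambda>t. X (f' t)) b \<in> B (i + 1 + 1)"
          by (rule comb_in[OF subspace_B]) (use N X_f' in blast)
        then show ?thesis by (simp add: True g't0 X_comb)
      next
        case False
        then show ?thesis using g'_other X_f' t by simp
      qed
      have n2: "\<forall>t\<in>R'. g' t = e' t"
        using R t0'(2) by (auto simp: g'_def)
      have n3: "X (g s) - g' (?\<sigma> s) \<in> B (i + 1)" if s: "s \<in> ?S" for s
      proof (cases "s = m")
        case True
        then show ?thesis using gm by (simp add: g't0)
      next
        case False
        then have "s \<in> S" using s by simp
        moreover from this have "\<sigma> s \<noteq> t0" using t0'(3) by blast
        ultimately show ?thesis using X_S g_other[OF False] g'_other[of "\<sigma> s"] \<sigma>S by simp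
      qed
      have n4: "\<forall>s\<in>P - ?S. X (g s) \<in> B (i + 1)"
        using X_P0 g_other by (auto simp: P0(5))
      have n5: "inj_on ?\<sigma> ?S"
        using S(2) t0'(3) mS by (auto simp: inj_on_def)
      have n6: "?\<sigma> ` ?S \<subseteq> I' - R'" using S(3) t0' mS by auto
      have n7: "?S \<subseteq> P" using S(1) P0(5) by auto
      from n1 have n1': "\<forall>t\<in>I' - R'. X (g' t) \<in> B (i + 1 + 1)" by (rule ballI)
      from n3 have n3': "\<forall>s\<in>?S. X (g s) - g' (?\<sigma> s) \<in> B (i + 1)" by (rule ballI)
      show ?thesis
        by (intro exI[of _ g] exI[of _ g'] exI[of _ ?S] exI[of _ ?\<sigma>] conjI)
          (fact g g' n1' n2 n3' n4 n5 n6 n7)+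
    qed
  qed
qed

text \<open>\<open>S i\<close> are the sources in degree \<open>i\<close> and
  \<open>\<sigma> i\<close> sends them to their targets. As targets are never sources, the complex
  splits into pairs and isolated vectors, up to coboundaries.\<close>

definition normal ::
  "(int \<Rightarrow> nat set) \<Rightarrow> (int \<Rightarrow> nat \<Rightarrow> int) \<Rightarrow> (int \<Rightarrow> nat \<Rightarrow> 'v) \<Rightarrow> (int \<Rightarrow> nat set) \<Rightarrow> (int \<Rightarrow> nat \<Rightarrow> nat) \<Rightarrow> int \<Rightarrow> bool"
  where
  "normal I lev e S \<sigma> i \<longleftrightarrow>
    S i \<subseteq> I i \<and> inj_on (\<sigma> i) (S i) \<and> \<sigma> i ` S i \<subseteq> I (i + 1) - S (i + 1) \<and>
    (\<forall>s\<in>S i. X (e i s) - e (i + 1) (\<sigma> i s) \<in> B (i + 1)) \<and>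
    (\<forall>s\<in>I i - S i. X (e i s) \<in> B (i + 1))"

lemma adapted_empty:
  assumes "adapted i I lev e" "C i = {0}"
  shows "I = {}"
proof (rule ccontr)
  assume "I \<noteq> {}"
  then obtain s where s: "s \<in> I" by blast
  have "e t = 0" if "t \<in> I" for t
    using adaptedD(2)[OF assms(1) that] assms(2) by (simp add: Z_def)
  then have "comb I e (\<lambda>_. 1) = 0" by (simp add: comb_def)
  then show False using independent_modD[OF adaptedD(6)[OF assms(1)] _ s, of "\<lambda>_. 1"] B_0 by simp
qed

text \<open>Supplies the independence hypothesis of \<open>ex_matching\<close> for the next lower
  degree: modulo coboundaries the images of the sources are distinct basis vectors.\<close>

lemma normal_independent:
  assumes e: "adapted (i + 1) (I (i + 1)) (lev (i + 1)) (e (i + 1))" and n: "normal I lev e S \<sigma> i"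
    and fin: "finite (I i)"
  shows "independent_mod (i + 1) (S i) (\<lambda>t. X (e i t))"
  unfolding independent_mod_def
proof (intro allI impI ballI)
  fix c s assume c: "comb (S i) (\<lambda>t. X (e i t)) c \<in> B (i + 1)" and s: "s \<in> S i"
  have S: "S i \<subseteq> I i" "inj_on (\<sigma> i) (S i)" "\<sigma> i ` S i \<subseteq> I (i + 1)"
    using n unfolding normal_def by blast+
  define d where "d t = (if t \<in> \<sigma> i ` S i then c (inv_into (S i) (\<sigma> i) t) else 0)" for t
  have d: "d (\<sigma> i s) = c s" if "s \<in> S i" for s
    using that S(2) by (simp add: d_def inv_into_f_f)
  have "comb (I (i + 1)) (e (i + 1)) d = comb (\<sigma> i ` S i) (e (i + 1)) d"
    by (rule comb_mono[symmetric]) (use adaptedD(1)[OF e] S(3) in \<open>auto simp: d_def\<close>)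
  also have "\<dots> = comb (S i) (\<lambda>s. e (i + 1) (\<sigma> i s)) (\<lambda>s. d (\<sigma> i s))"
    by (rule comb_reindex[OF S(2)])
  also have "\<dots> = comb (S i) (\<lambda>s. e (i + 1) (\<sigma> i s)) c"
    by (rule comb_cong) (simp_all add: d)
  finally have eq: "comb (I (i + 1)) (e (i + 1)) d = comb (S i) (\<lambda>s. e (i + 1) (\<sigma> i s)) c" .
  have "comb (S i) (\<lambda>t. X (e i t)) c - comb (S i) (\<lambda>s. e (i + 1) (\<sigma> i s)) c \<in> B (i + 1)"
    by (rule comb_diff_in[OF subspace_B]) (use n in \<open>simp add: normal_def\<close>)
  from B_diff[OF c this] have "comb (I (i + 1)) (e (i + 1)) d \<in> B (i + 1)" by (simp add: eq)
  from independent_modD[OF adaptedD(6)[OF e] this, of "\<sigma> i s"] show "c s = 0"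
    using s S(3) d by auto
qed

text \<open>Descending induction on the degree. Matching degree \<open>k\<close> with
  \<open>k + 1\<close> leaves the basis vectors at the sources \<open>S (k + 1)\<close> unchanged
  and keeps the images of the other ones coboundaries, so the normal form reached in degree
  \<open>k + 1\<close> survives.\<close>

lemma ex_normal_from:
  assumes I0: "\<And>i. adapted i (I i) (lev i) (e0 i)" and "m \<le> hi"
  shows "\<exists>e S \<sigma>. (\<forall>i. adapted i (I i) (lev i) (e i)) \<and> (\<forall>i\<ge>m. normal I lev e S \<sigma> i)"
  using \<open>m \<le> hi\<close>
proof (induction m rule: int_le_induct)
  case base
  have "I i = {}" if "hi \<le> i" for i using adapted_empty[OF I0 C_hi[OF that]] .
  then show ?case using I0
    by (intro exI[of _ e0] exI[of _ "\<lambda>_. {}"] exI[of _ "\<lambda>_. id"]) (auto simp: normal_def)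
next
  case (step m)
  then obtain e S \<sigma> where e: "\<And>i. adapted i (I i) (lev i) (e i)"
    and n: "\<And>i. i \<ge> m \<Longrightarrow> normal I lev e S \<sigma> i" by blast
  define k where "k = m - 1"
  have m: "m = k + 1" by (simp add: k_def)
  have nm: "normal I lev e S \<sigma> (k + 1)" using n m by simp
  have "\<exists>f f' S' \<sigma>'. adapted k (I k) (lev k) f \<and> adapted (k + 1) (I (k + 1)) (lev (k + 1)) f' \<and>
    S' \<subseteq> I k \<and> inj_on \<sigma>' S' \<and> \<sigma>' ` S' \<subseteq> I (k + 1) - S (k + 1) \<and> (\<forall>t\<in>S (k + 1). f' t = e (k + 1) t) \<and>
    (\<forall>t\<in>I (k + 1) - S (k + 1). X (f' t) \<in> B (k + 1 + 1)) \<and>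
    (\<forall>s\<in>S'. X (f s) - f' (\<sigma>' s) \<in> B (k + 1)) \<and> (\<forall>s\<in>I k - S'. X (f s) \<in> B (k + 1))"
    by (rule ex_matching[OF e e _ _ normal_independent[OF e nm adaptedD(1)[OF e]]])
      (use nm in \<open>auto simp: normal_def\<close>)
  then obtain f f' S' \<sigma>' where f: "adapted k (I k) (lev k) f" "adapted (k + 1) (I (k + 1)) (lev (k + 1)) f'"
    "S' \<subseteq> I k" "inj_on \<sigma>' S'" "\<sigma>' ` S' \<subseteq> I (k + 1) - S (k + 1)" "\<forall>t\<in>S (k + 1). f' t = e (k + 1) t"
    "\<forall>t\<in>I (k + 1) - S (k + 1). X (f' t) \<in> B (k + 1 + 1)"
    "\<forall>s\<in>S'. X (f s) - f' (\<sigma>' s) \<in> B (k + 1)" "\<forall>s\<in>I k - S'. X (f s) \<in> B (k + 1)"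
    by (elim exE conjE)
  define e2 where "e2 = e(k := f, k + 1 := f')"
  define S2 where "S2 = S(k := S')"
  define \<sigma>2 where "\<sigma>2 = \<sigma>(k := \<sigma>')"
  have "adapted i (I i) (lev i) (e2 i)" for i
    using e f(1,2) by (auto simp: e2_def)
  moreover have "normal I lev e2 S2 \<sigma>2 i" if "i \<ge> k" for i
  proof -
    consider "i = k" | "i = k + 1" | "i \<ge> k + 2" using \<open>i \<ge> k\<close> by linarith
    then show ?thesis
    proof cases
      case 1
      then show ?thesis using f by (simp add: normal_def e2_def S2_def \<sigma>2_def)
    next
      case 2
      have "\<forall>s\<in>S (k + 1). X (f' s) - e (k + 1 + 1) (\<sigma> (k + 1) s) \<in> B (k + 1 + 1)"
        using nm f(6) by (simp add: normal_def)
      then show ?thesis using nm f(7) 2 by (simp add: normal_def e2_def S2_def \<sigma>2_def)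
    next
      case 3
      then have "normal I lev e S \<sigma> i" using n m by simp
      then show ?thesis using 3 by (simp add: normal_def e2_def S2_def \<sigma>2_def)
    qed
  qed
  ultimately show ?case unfolding k_def[symmetric] by blast
qed

lemma ex_normal:
  "\<exists>I lev e S \<sigma>. (\<forall>i. adapted i (I i) (lev i) (e i)) \<and> (\<forall>i. normal I lev e S \<sigma> i)"
proof -
  have "\<exists>T. \<forall>i. adapted i (fst (T i)) (fst (snd (T i))) (snd (snd (T i)))"
    using ex_adapted by (intro choice allI) (metis fst_conv snd_conv)
  then obtain T where T: "\<And>i. adapted i (fst (T i)) (fst (snd (T i))) (snd (snd (T i)))" by blast
  define I lev e0 where "I i = fst (T i)" and "lev i = fst (snd (T i))" and "e0 i = snd (snd (T i))" for i
  have I: "adapted i (I i) (lev i) (e0 i)" for i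
    using T by (simp add: I_def lev_def e0_def)
  obtain e S \<sigma> where e: "\<And>i. adapted i (I i) (lev i) (e i)"
    and n: "\<And>i. i \<ge> min lo hi \<Longrightarrow> normal I lev e S \<sigma> i"
    using ex_normal_from[OF I, of "min lo hi"] by auto
  have empty: "I i = {}" if "i < lo" for i using adapted_empty[OF I C_lo[OF that]] .
  \<comment> \<open>Below the range of the induction the index sets are empty; there
    \<open>S\<close> has to be cleared, because nothing is known about it.\<close>
  define S2 where "S2 i = (if i < min lo hi then {} else S i)" for i
  have "normal I lev e S2 \<sigma> i" for i
  proof (cases "i < min lo hi")
    case True
    then show ?thesis using empty[of i] by (simp add: normal_def S2_def)
  next
    case False
    then have "S2 i = S i" "S2 (i + 1) = S (i + 1)" by (auto simp: S2_def)
    moreover have "normal I lev e S \<sigma> i" using False by (intro n) linarith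
    ultimately show ?thesis by (simp add: normal_def)
  qed
  with e show ?thesis by blast
qed

end

subsection \<open>Counting\<close>

context vector_space
begin

lemma span_image_finite:
  assumes "finite A" "x \<in> span (e ` A)"
  shows "\<exists>c. x = (\<Sum>s\<in>A. scale (c s) (e s))"
proof -
  have "subspace {x. \<exists>c. x = (\<Sum>s\<in>A. scale (c s) (e s))}"
  proof (rule subspaceI)
    show "0 \<in> {x. \<exists>c. x = (\<Sum>s\<in>A. scale (c s) (e s))}"
      by (auto intro!: exI[of _ "\<lambda>_. 0"])
  next
    fix x y assume "x \<in> {x. \<exists>c. x = (\<Sum>s\<in>A. scale (c s) (e s))}" "y \<in> {x. \<exists>c. x = (\<Sum>s\<in>A. scale (c s) (e s))}"
    then obtain c d where "x = (\<Sum>s\<in>A. scale (c s) (e s))" "y = (\<Sum>s\<in>A. scale (d s) (e s))" by blast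
    then have "x + y = (\<Sum>s\<in>A. scale (c s + d s) (e s))"
      by (simp add: scale_left_distrib sum.distrib)
    then show "x + y \<in> {x. \<exists>c. x = (\<Sum>s\<in>A. scale (c s) (e s))}"
      by (intro CollectI) (rule exI)
  next
    fix a x assume "x \<in> {x. \<exists>c. x = (\<Sum>s\<in>A. scale (c s) (e s))}"
    then obtain c where "x = (\<Sum>s\<in>A. scale (c s) (e s))" by blast
    then have "scale a x = (\<Sum>s\<in>A. scale (a * c s) (e s))" by (simp add: scale_sum_right)
    then show "scale a x \<in> {x. \<exists>c. x = (\<Sum>s\<in>A. scale (c s) (e s))}"
      by (intro CollectI) (rule exI)
  qed
  moreover have "e ` A \<subseteq> {x. \<exists>c. x = (\<Sum>s\<in>A. scale (c s) (e s))}"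
  proof (rule image_subsetI)
    fix t assume t: "t \<in> A"
    have "(\<Sum>s\<in>A. scale (if s = t then 1 else 0) (e s)) = (\<Sum>s\<in>A. if s = t then e s else 0)"
      by (rule sum.cong) auto
    then have "e t = (\<Sum>s\<in>A. scale (if s = t then 1 else 0) (e s))"
      using t assms(1) by simp
    then show "e t \<in> {x. \<exists>c. x = (\<Sum>s\<in>A. scale (c s) (e s))}"
      by (intro CollectI) (rule exI)
  qed
  ultimately show ?thesis using span_minimal assms(2) by blast
qed

text \<open>Converts a number of vectors that form a basis of \<open>W\<close> modulo
  \<open>V\<close> into a difference of dimensions. This is how indices of an adapted basis get
  counted by dimensions of spaces of cochains.\<close>

lemma dim_add_card:
  assumes V: "subspace V" and fin: "V \<subseteq> span G" "finite G" and A: "finite A"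
    and ind: "\<And>c. (\<Sum>s\<in>A. scale (c s) (e s)) \<in> V \<Longrightarrow> \<forall>s\<in>A. c s = 0"
    and W: "\<And>x. x \<in> W \<longleftrightarrow> (\<exists>c. x - (\<Sum>s\<in>A. scale (c s) (e s)) \<in> V)"
  shows "dim W = dim V + card A"
proof -
  obtain b where b: "b \<subseteq> V" "independent b" "V \<subseteq> span b" "card b = dim V"
    by (rule basis_exists)
  have finb: "finite b"
    using independent_span_bound[OF fin(2) b(2)] b(1) fin(1) by blast
  have spanb: "span b = V" by (rule span_subspace[OF b(1,3) V])
  have "independent (b \<union> e ` A') \<and> card (b \<union> e ` A') = card b + card A'" if "A' \<subseteq> A" for A'
  proof -
    have "finite A'" using that A by (rule finite_subset)
    then show ?thesis using that
    proof (induction A' rule: finite_induct)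
      case empty
      show ?case using b(2) by simp
    next
      case (insert a A')
      have notin: "e a \<notin> span (b \<union> e ` A')"
      proof
        assume "e a \<in> span (b \<union> e ` A')"
        then obtain x y where xy: "e a = x + y" "x \<in> V" "y \<in> span (e ` A')"
          unfolding span_Un spanb by blast
        obtain c where c: "y = (\<Sum>s\<in>A'. scale (c s) (e s))"
          using span_image_finite[OF insert.hyps(1) xy(3)] by blast
        let ?d = "\<lambda>s. if s = a then 1 else if s \<in> A' then - c s else 0"
        have "(\<Sum>s\<in>A. scale (?d s) (e s)) = (\<Sum>s\<in>insert a A'. scale (?d s) (e s))"
          by (rule sum.mono_neutral_right) (use A insert.prems in auto)
        also have "\<dots> = e a + (\<Sum>s\<in>A'. scale (?d s) (e s))"
          using insert.hyps by simp
        also have "(\<Sum>s\<in>A'. scale (?d s) (e s)) = (\<Sum>s\<in>A'. - scale (c s) (e s))"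
          by (rule sum.cong) (use insert.hyps in auto)
        also have "\<dots> = - y" by (simp add: c sum_negf)
        finally have "(\<Sum>s\<in>A. scale (?d s) (e s)) = x" by (simp add: xy(1))
        with xy(2) ind[of ?d] insert.prems have "?d a = 0" by blast
        then show False by simp
      qed
      have notin': "e a \<notin> b \<union> e ` A'" by (rule notI) (use notin span_base in metis)
      have IH: "independent (b \<union> e ` A')" "card (b \<union> e ` A') = card b + card A'"
        using insert.IH insert.prems by auto
      show ?case
        using independent_insertI[OF notin IH(1)] IH(2) notin' finb insert.hyps by simp
    qed
  qed
  then have ind': "independent (b \<union> e ` A)" and card: "card (b \<union> e ` A) = card b + card A"
    by blast+
  have "W = span (b \<union> e ` A)"
  proof (intro set_eqI iffI)
    fix x assume "x \<in> W"
    then obtain c where c: "x - (\<Sum>s\<in>A. scale (c s) (e s)) \<in> V" using W by blast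
    have "(\<Sum>s\<in>A. scale (c s) (e s)) \<in> span (e ` A)"
      by (intro span_sum span_scale span_base) simp
    with c show "x \<in> span (b \<union> e ` A)" unfolding span_Un spanb
      by (intro CollectI exI[of _ "x - (\<Sum>s\<in>A. scale (c s) (e s))"] exI[of _ "\<Sum>s\<in>A. scale (c s) (e s)"]) simp
  next
    fix x assume "x \<in> span (b \<union> e ` A)"
    then obtain y z where "x = y + z" "y \<in> V" "z \<in> span (e ` A)" unfolding span_Un spanb by blast
    moreover from this obtain c where "z = (\<Sum>s\<in>A. scale (c s) (e s))"
      using span_image_finite[OF A] by blast
    ultimately show "x \<in> W" unfolding W by (intro exI[of _ c]) simp
  qed
  then show ?thesis using dim_span_eq_card_independent[OF ind'] card b(4) by simp
qed

end

definition pair_scale :: "('a \<Rightarrow> 'b \<Rightarrow> 'b) \<Rightarrow> 'a \<Rightarrow> 'b \<times> 'b \<Rightarrow> 'b \<times> 'b" where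
  "pair_scale s c z = (s c (fst z), s c (snd z))"

lemma vector_space_pair_scale:
  fixes s :: "'a::field \<Rightarrow> 'b::ab_group_add \<Rightarrow> 'b"
  assumes "vector_space s"
  shows "vector_space (pair_scale s)"
proof -
  interpret vector_space s by fact
  show ?thesis
    by unfold_locales (simp_all add: pair_scale_def scale_right_distrib scale_left_distrib)
qed

context filtered_double_complex
begin

sublocale prod: vector_space "pair_scale scl"
  by (rule vector_space_pair_scale) unfold_locales

text \<open>The first projection of this space consists of the cocycles in \<open>F j\<close> whose image is
  cohomologous to an element of \<open>F k\<close>. By the choice of \<open>K\<close> it is a finite-dimensional space of
  solutions of linear equations.\<close>

definition Sys :: "int \<Rightarrow> int \<Rightarrow> int \<Rightarrow> ('v \<times> 'v) set" where
  "Sys i j k = {(x, y). x \<in> C i \<and> x \<in> F j \<and> y \<in> C (i + 1) \<and> y \<in> F K \<and> D x = 0 \<and> X x - D y \<in> F k}"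

definition "sdim i j k = prod.dim (Sys i j k)"

definition Q :: "int \<Rightarrow> int \<Rightarrow> int \<Rightarrow> 'v set" where
  "Q i j k = {x \<in> Z i. x \<in> F j \<and> (\<exists>y\<in>B (i + 1). X x - y \<in> F k)}"

lemma Sys_finite: "\<exists>A. finite A \<and> Sys i j k \<subseteq> prod.span A"
proof -
  obtain G where G: "finite G" "C i \<inter> F j \<subseteq> span G" using finite_dim by blast
  obtain G' where G': "finite G'" "C (i + 1) \<inter> F K \<subseteq> span G'" using finite_dim by blast
  let ?A = "(\<lambda>x. (x, 0)) ` G \<union> (\<lambda>y. (0, y)) ` G'"
  have l: "Vector_Spaces.linear scl (pair_scale scl) (\<lambda>x. (x, 0))"
    and r: "Vector_Spaces.linear scl (pair_scale scl) (\<lambda>y. (0, y))"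
    by unfold_locales (simp_all add: pair_scale_def)
  interpret l: Vector_Spaces.linear scl "pair_scale scl" "\<lambda>x. (x, 0)" by (rule l)
  interpret r: Vector_Spaces.linear scl "pair_scale scl" "\<lambda>y. (0, y)" by (rule r)
  have "(x, y) \<in> prod.span ?A" if "(x, y) \<in> Sys i j k" for x y
  proof -
    have "x \<in> span G" "y \<in> span G'" using that G G' by (auto simp: Sys_def)
    then have "(x, 0) \<in> prod.span ((\<lambda>x. (x, 0)) ` G)" "(0, y) \<in> prod.span ((\<lambda>y. (0, y)) ` G')"
      unfolding l.span_image r.span_image by blast+
    then have "(x, 0) \<in> prod.span ?A" "(0, y) \<in> prod.span ?A"
      by (meson Un_upper1 Un_upper2 prod.span_mono subsetD)+
    from prod.span_add[OF this] show ?thesis by simp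
  qed
  then show ?thesis using G(1) G'(1) by (intro exI[of _ ?A]) auto
qed

lemma subspace_Sys: "prod.subspace (Sys i j k)"
proof (rule prod.subspaceI)
  show "0 \<in> Sys i j k"
    using subspace_0[OF subspace_C] subspace_0[OF subspace_F] by (simp add: Sys_def zero_prod_def D.zero X.zero)
next
  fix z w assume "z \<in> Sys i j k" "w \<in> Sys i j k"
  then show "z + w \<in> Sys i j k"
    using subspace_add[OF subspace_F, of "X (fst z) - D (snd z)" k "X (fst w) - D (snd w)"]
    by (auto simp: Sys_def D.add X.add algebra_simps
        intro: subspace_add[OF subspace_C] subspace_add[OF subspace_F])
next
  fix c z assume "z \<in> Sys i j k"
  then show "pair_scale scl c z \<in> Sys i j k"
    using subspace_scale[OF subspace_F, of "X (fst z) - D (snd z)" k c]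
    by (auto simp: Sys_def pair_scale_def D.scale X.scale scale_right_diff_distrib
        intro: subspace_scale[OF subspace_C] subspace_scale[OF subspace_F])
qed

text \<open>At level \<open>J0\<close> the first component must be \<open>0\<close>, so
  \<open>Sys i J0 j\<close> consists of the bounded cochains with coboundary in \<open>F j\<close>.
  By \<open>reduce_B\<close> the bound costs no coboundaries.\<close>

lemma B_F_image: "j \<le> L \<Longrightarrow> (\<lambda>z. D (snd z)) ` Sys i J0 j = B (i + 1) \<inter> F j"
proof (intro set_eqI iffI)
  fix w assume "w \<in> (\<lambda>z. D (snd z)) ` Sys i J0 j"
  then obtain x y where xy: "(x, y) \<in> Sys i J0 j" "w = D y" by force
  moreover from this have "x = 0" using F_J0[of x i] by (simp add: Sys_def)
  ultimately have "- D y \<in> F j" by (simp add: Sys_def X.zero)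
  then have "D y \<in> F j" using subspace_neg[OF subspace_F, of "- D y" j] by simp
  with xy show "w \<in> B (i + 1) \<inter> F j" by (auto simp: Sys_def B_def)
next
  fix w assume "j \<le> L" "w \<in> B (i + 1) \<inter> F j"
  then obtain y where "y \<in> C (i + 1)" "w = D y" "D y \<in> F L" "D y \<in> F j"
    using F_mono[of j L] by (auto simp: B_def)
  moreover from this obtain y' where "y' \<in> C (i + 1)" "y' \<in> F K" "D y' = D y" using reduce_B by blast
  ultimately have "(0, y') \<in> Sys i J0 j" "w = D (snd (0, y'))"
    using subspace_0[OF subspace_C] subspace_0[OF subspace_F] subspace_neg[OF subspace_F]
    by (auto simp: Sys_def D.zero X.zero)
  then show "w \<in> (\<lambda>z. D (snd z)) ` Sys i J0 j" by (rule rev_image_eqI)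
qed

text \<open>Rank-nullity for \<open>D\<close> on the bounded witnesses. The kernel is again one of
  the systems, with both levels equal to \<open>J0\<close>, since a coboundary in
  \<open>F J0\<close> is zero.\<close>

lemma dim_B_F:
  assumes "J0 \<le> j" "j \<le> L"
  shows "sdim i J0 j = dim (B (i + 1) \<inter> F j) + sdim i J0 J0"
proof -
  interpret pr: vector_space_pair "pair_scale scl" scl ..
  obtain A where A: "finite A" "Sys i J0 j \<subseteq> prod.span A" using Sys_finite by blast
  have lin: "Vector_Spaces.linear (pair_scale scl) scl (\<lambda>z. D (snd z))"
    by unfold_locales (simp_all add: pair_scale_def D.add D.scale)
  have "{z \<in> Sys i J0 j. D (snd z) = 0} = Sys i J0 J0"
  proof (intro set_eqI iffI)
    fix z assume "z \<in> {z \<in> Sys i J0 j. D (snd z) = 0}"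
    moreover from this have "fst z = 0" using F_J0 by (auto simp: Sys_def)
    ultimately show "z \<in> Sys i J0 J0"
      using subspace_0[OF subspace_F] by (auto simp: Sys_def X.zero)
  next
    fix z assume z: "z \<in> Sys i J0 J0"
    then have "fst z = 0" using F_J0 by (auto simp: Sys_def)
    with z have "- D (snd z) \<in> F J0" "- D (snd z) \<in> C (i + 1)"
      using subspace_neg[OF subspace_C, OF D_C, of "snd z" "i + 1"] by (auto simp: Sys_def X.zero)
    then have "D (snd z) = 0" using F_J0 by fastforce
    moreover have "z \<in> Sys i J0 j" using z F_mono[OF assms(1)] by (auto simp: Sys_def)
    ultimately show "z \<in> {z \<in> Sys i J0 j. D (snd z) = 0}" by simp
  qed
  then show ?thesis
    using pr.dim_image_plus_dim_kernel[OF lin subspace_Sys A(2,1)] B_F_image[OF assms(2)]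
    by (simp add: sdim_def)
qed

text \<open>Projection of the system to the cocycle: it reaches all of \<open>Q\<close> because a
  witness can be replaced by one in \<open>F K\<close>, and its kernel consists of witnesses alone,
  which is the system at level \<open>J0\<close>.\<close>

lemma dim_Q:
  assumes "J0 \<le> k" "k \<le> J" "j \<le> J"
  shows "sdim i j k = dim (Q i j k) + sdim i J0 k"
proof -
  interpret pr: vector_space_pair "pair_scale scl" scl ..
  obtain A where A: "finite A" "Sys i j k \<subseteq> prod.span A" using Sys_finite by blast
  have lin: "Vector_Spaces.linear (pair_scale scl) scl fst"
    by unfold_locales (simp_all add: pair_scale_def)
  have "fst ` Sys i j k = Q i j k"
  proof (intro set_eqI iffI)
    fix x assume "x \<in> fst ` Sys i j k"
    then show "x \<in> Q i j k" by (auto simp: Sys_def Q_def Z_def B_def)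
  next
    fix x assume x: "x \<in> Q i j k"
    then obtain y where y: "y \<in> C (i + 1)" "X x - D y \<in> F k" by (auto simp: Q_def B_def)
    have "x \<in> C i" "x \<in> F J" using x F_mono[OF assms(3)] by (auto simp: Q_def Z_def)
    then have "X x \<in> F L" by (rule X_F)
    moreover have "X x - D y \<in> F L" using y(2) F_mono[of k L] assms(2) J_le_L by auto
    ultimately have "X x - (X x - D y) \<in> F L" by (rule subspace_diff[OF subspace_F])
    then have "D y \<in> F L" by simp
    with y(1) obtain y' where "y' \<in> C (i + 1)" "y' \<in> F K" "D y' = D y" using reduce_B by blast
    with x y have "(x, y') \<in> Sys i j k" by (auto simp: Sys_def Q_def Z_def)
    then show "x \<in> fst ` Sys i j k" by force
  qed
  moreover have "{z \<in> Sys i j k. fst z = 0} = Sys i J0 k"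
    using F_J0 subspace_0[OF subspace_F] by (auto simp: Sys_def X.zero)
  ultimately show ?thesis
    using pr.dim_image_plus_dim_kernel[OF lin subspace_Sys A(2,1)] by (simp add: sdim_def)
qed

text \<open>The levels of source and target of the piece that starts at \<open>s\<close>. An index
  that is no source gets \<open>J0\<close>, which lies below all levels, as if \<open>J0\<close>
  were the level of its image \<open>0\<close>.\<close>

definition key :: "(int \<Rightarrow> nat \<Rightarrow> int) \<Rightarrow> (int \<Rightarrow> nat set) \<Rightarrow> (int \<Rightarrow> nat \<Rightarrow> nat) \<Rightarrow> int \<Rightarrow> nat \<Rightarrow> int \<times> int" where
  "key lev S \<sigma> i s = (lev i s, if s \<in> S i then lev (i + 1) (\<sigma> i s) else J0)"

lemma normal_X_comb:
  assumes "adapted i (I i) (lev i) (e i)" "normal I lev e S \<sigma> i"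
  shows "X (comb (I i) (e i) c) - comb (S i) (\<lambda>s. e (i + 1) (\<sigma> i s)) c \<in> B (i + 1)"
proof -
  have fin: "finite (I i)" using adaptedD(1)[OF assms(1)] .
  have S: "S i \<subseteq> I i" using assms(2) by (simp add: normal_def)
  have "comb (I i) (\<lambda>s. X (e i s)) (\<lambda>s. if s \<in> S i then 0 else c s) \<in> B (i + 1)"
    by (rule comb_in[OF subspace_B]) (use assms(2) in \<open>auto simp: normal_def split: if_splits\<close>)
  moreover have "comb (S i) (\<lambda>s. X (e i s)) c - comb (S i) (\<lambda>s. e (i + 1) (\<sigma> i s)) c \<in> B (i + 1)"
    by (rule comb_diff_in[OF subspace_B]) (use assms(2) in \<open>auto simp: normal_def\<close>)
  ultimately have "comb (I i) (\<lambda>s. X (e i s)) (\<lambda>s. if s \<in> S i then 0 else c s) +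
      (comb (S i) (\<lambda>s. X (e i s)) c - comb (S i) (\<lambda>s. e (i + 1) (\<sigma> i s)) c) \<in> B (i + 1)"
    by (rule B_add)
  moreover have "comb (S i) (\<lambda>s. X (e i s)) c = comb (I i) (\<lambda>s. X (e i s)) (\<lambda>s. if s \<in> S i then c s else 0)"
  proof -
    have "comb (S i) (\<lambda>s. X (e i s)) c = comb (S i) (\<lambda>s. X (e i s)) (\<lambda>s. if s \<in> S i then c s else 0)"
      by (rule comb_cong) auto
    also have "\<dots> = comb (I i) (\<lambda>s. X (e i s)) (\<lambda>s. if s \<in> S i then c s else 0)"
      by (rule comb_mono) (use fin S in auto)
    finally show ?thesis .
  qed
  moreover have "comb (I i) (\<lambda>s. X (e i s)) (\<lambda>s. if s \<in> S i then 0 else c s) +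
      comb (I i) (\<lambda>s. X (e i s)) (\<lambda>s. if s \<in> S i then c s else 0) = X (comb (I i) (e i) c)"
    unfolding X_comb comb_add[symmetric] by (rule comb_cong) auto
  ultimately show ?thesis by (simp add: algebra_simps)
qed

lemma normal_comb_reindex:
  assumes "adapted (i + 1) (I (i + 1)) (lev (i + 1)) (e (i + 1))" "normal I lev e S \<sigma> i"
  obtains d where "comb (S i) (\<lambda>s. e (i + 1) (\<sigma> i s)) c = comb (I (i + 1)) (e (i + 1)) d"
    "\<And>s. s \<in> S i \<Longrightarrow> d (\<sigma> i s) = c s"
    "\<And>t. t \<notin> \<sigma> i ` S i \<Longrightarrow> d t = 0"
proof -
  have S: "inj_on (\<sigma> i) (S i)" "\<sigma> i ` S i \<subseteq> I (i + 1)"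
    using assms(2) unfolding normal_def by blast+
  define d where "d t = (if t \<in> \<sigma> i ` S i then c (inv_into (S i) (\<sigma> i) t) else 0)" for t
  have d: "d (\<sigma> i s) = c s" if "s \<in> S i" for s
    using that S(1) by (simp add: d_def inv_into_f_f)
  have "comb (I (i + 1)) (e (i + 1)) d = comb (\<sigma> i ` S i) (e (i + 1)) d"
    by (rule comb_mono[symmetric]) (use adaptedD(1)[OF assms(1)] S(2) in \<open>auto simp: d_def\<close>)
  also have "\<dots> = comb (S i) (\<lambda>s. e (i + 1) (\<sigma> i s)) (\<lambda>s. d (\<sigma> i s))"
    by (rule comb_reindex[OF S(1)])
  also have "\<dots> = comb (S i) (\<lambda>s. e (i + 1) (\<sigma> i s)) c"
    by (rule comb_cong) (simp_all add: d)
  finally have eq: "comb (S i) (\<lambda>s. e (i + 1) (\<sigma> i s)) c = comb (I (i + 1)) (e (i + 1)) d" by (rule sym)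
  show thesis by (rule that[OF eq d]) (simp_all add: d_def)
qed

text \<open>The basis vectors with key below \<open>(j, k)\<close> form a basis of
  \<open>Q i j k\<close> modulo the coboundaries in \<open>F j\<close>. The right-hand side is the
  difference of the two dimensions, each one written as a difference of dimensions of
  systems.\<close>

lemma card_key:
  assumes e: "\<And>i. adapted i (I i) (lev i) (e i)" and n: "normal I lev e S \<sigma> i"
    and jk: "J0 \<le> j" "j \<le> J" "J0 \<le> k" "k \<le> J"
  shows "int (card {s \<in> I i. fst (key lev S \<sigma> i s) \<le> j \<and> snd (key lev S \<sigma> i s) \<le> k}) =
    int (sdim i j k) - int (sdim i J0 k) - (int (sdim (i - 1) J0 j) - int (sdim (i - 1) J0 J0))"
proof -
  let ?A = "{s \<in> I i. fst (key lev S \<sigma> i s) \<le> j \<and> snd (key lev S \<sigma> i s) \<le> k}"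
  let ?V = "B i \<inter> F j"
  have V: "subspace ?V" by (rule subspace_inter[OF subspace_B subspace_F])
  have fin: "finite (I i)" using adaptedD(1)[OF e] .
  have A: "?A \<subseteq> I i" "finite ?A" using fin by auto
  obtain G where G: "finite G" "C i \<inter> F j \<subseteq> span G" using finite_dim by blast
  have S: "S i \<subseteq> I i" "inj_on (\<sigma> i) (S i)" "\<sigma> i ` S i \<subseteq> I (i + 1)"
    using n unfolding normal_def by blast+
  have VC: "?V \<subseteq> C i \<inter> F j" using B_le_Z[of i] unfolding Z_def by blast
  have AF: "e i s \<in> F j" if "s \<in> ?A" for s
    using that adaptedD(3)[OF e, of s i] F_mono[of "lev i s" j] by (auto simp: key_def)
  have "dim (Q i j k) = dim ?V + card ?A"
  proof (rule dim_add_card[OF V _ G(1) A(2)])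
    show "?V \<subseteq> span G" using VC G(2) by blast
    show "\<forall>s\<in>?A. c s = 0" if "(\<Sum>s\<in>?A. scl (c s) (e i s)) \<in> ?V" for c
    proof -
      let ?c = "\<lambda>s. if s \<in> ?A then c s else 0"
      have "comb (I i) (e i) ?c = comb ?A (e i) ?c"
        by (rule comb_mono[symmetric, OF fin A(1)]) auto
      also have "\<dots> = comb ?A (e i) c" by (rule comb_cong) auto
      finally have "comb (I i) (e i) ?c \<in> B i" using that by (simp add: comb_def)
      then have "?c s = 0" if "s \<in> I i" for s using independent_modD[OF adaptedD(6)[OF e]] that by blast
      then show ?thesis using A(1) by (metis (mono_tags, lifting) subsetD)
    qed
    show "x \<in> Q i j k \<longleftrightarrow> (\<exists>c. x - (\<Sum>s\<in>?A. scl (c s) (e i s)) \<in> ?V)" for x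
    proof
      assume x: "x \<in> Q i j k"
      then have xZ: "x \<in> Z i" and xF: "x \<in> F j" by (auto simp: Q_def)
      obtain y where y: "y \<in> B (i + 1)" "X x - y \<in> F k" using x by (auto simp: Q_def)
      obtain c where c: "\<And>s. s \<in> I i \<Longrightarrow> c s \<noteq> 0 \<Longrightarrow> lev i s \<le> j" "x - comb (I i) (e i) c \<in> B i"
        using adapted_spanned[OF e xZ xF] by blast
      obtain d where d: "comb (S i) (\<lambda>s. e (i + 1) (\<sigma> i s)) c = comb (I (i + 1)) (e (i + 1)) d"
        "\<And>s. s \<in> S i \<Longrightarrow> d (\<sigma> i s) = c s" "\<And>t. t \<notin> \<sigma> i ` S i \<Longrightarrow> d t = 0"
        using normal_comb_reindex[OF e n] by blast
      have "X x - X (comb (I i) (e i) c) \<in> B (i + 1)" using X_B[OF c(2)] by (simp add: X.diff)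
      from B_diff_trans[OF this normal_X_comb[OF e n]]
      have "X x - comb (I (i + 1)) (e (i + 1)) d \<in> B (i + 1)" by (simp add: d(1))
      from B_diff[OF this y(1)]
      have Xd: "(X x - y) - comb (I (i + 1)) (e (i + 1)) d \<in> B (i + 1)"
        by (simp only: diff_diff_eq add.commute)
      have "X x - y \<in> Z (i + 1)"
        using subspace_diff[OF subspace_Z X_Z[OF xZ]] B_le_Z y(1) by blast
      from adapted_spanned[OF e this y(2)] obtain d' where
        d': "\<And>s. s \<in> I (i + 1) \<Longrightarrow> d' s \<noteq> 0 \<Longrightarrow> lev (i + 1) s \<le> k"
          "(X x - y) - comb (I (i + 1)) (e (i + 1)) d' \<in> B (i + 1)" by blast
      \<comment> \<open>The image has unique coordinates modulo coboundaries: those read off from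
        the normal form agree with those of its representative in \<open>F k\<close>, so only
        targets of level at most \<open>k\<close> can occur.\<close>
      have dd': "d t = d' t" if "t \<in> I (i + 1)" for t
        by (rule independent_mod_unique[OF adaptedD(6)[OF e] Xd d'(2) that])
      have cA: "c s = 0" if s: "s \<in> I i" "s \<notin> ?A" for s
      proof (rule ccontr)
        assume cs: "c s \<noteq> 0"
        then have "lev i s \<le> j" using c(1) s(1) by blast
        with s jk(3) have "s \<in> S i" and l: "\<not> lev (i + 1) (\<sigma> i s) \<le> k"
          by (auto simp: key_def split: if_splits)
        then have "\<sigma> i s \<in> I (i + 1)" "d (\<sigma> i s) \<noteq> 0" using S(3) d(2) cs by auto
        with dd' d'(1) l show False by metis
      qed
      have "comb ?A (e i) c = comb (I i) (e i) c"
        by (rule comb_mono[OF fin A(1)]) (use cA in blast)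
      then have "x - comb ?A (e i) c \<in> B i" using c(2) by simp
      moreover have "x - comb ?A (e i) c \<in> F j"
        by (intro subspace_diff[OF subspace_F xF] comb_in[OF subspace_F]) (rule AF)
      ultimately show "\<exists>c. x - (\<Sum>s\<in>?A. scl (c s) (e i s)) \<in> ?V"
        by (intro exI[of _ c]) (simp add: comb_def)
    next
      assume "\<exists>c. x - (\<Sum>s\<in>?A. scl (c s) (e i s)) \<in> ?V"
      then obtain c where c: "x - comb ?A (e i) c \<in> ?V" by (auto simp: comb_def)
      have cZ: "comb ?A (e i) c \<in> Z i"
        by (rule comb_in[OF subspace_Z]) (use adaptedD(2)[OF e] in blast)
      have cF: "comb ?A (e i) c \<in> F j" by (rule comb_in[OF subspace_F AF])
      have "x - comb ?A (e i) c \<in> Z i" "x - comb ?A (e i) c \<in> F j" using c B_le_Z by blast+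
      from subspace_add[OF subspace_Z this(1) cZ] subspace_add[OF subspace_F this(2) cF]
      have xZF: "x \<in> Z i" "x \<in> F j" by simp_all
      let ?c = "\<lambda>s. if s \<in> ?A then c s else 0"
      have "comb ?A (e i) c = comb ?A (e i) ?c" by (rule comb_cong) auto
      also have "\<dots> = comb (I i) (e i) ?c" by (rule comb_mono[OF fin A(1)]) auto
      finally have eq: "comb ?A (e i) c = comb (I i) (e i) ?c" .
      have "X x - X (comb (I i) (e i) ?c) \<in> B (i + 1)"
        using X_B[of "x - comb (I i) (e i) ?c" i] c by (simp add: X.diff eq)
      from B_diff_trans[OF this normal_X_comb[OF e n]]
      have 1: "X x - comb (S i) (\<lambda>s. e (i + 1) (\<sigma> i s)) ?c \<in> B (i + 1)" .
      have 2: "comb (S i) (\<lambda>s. e (i + 1) (\<sigma> i s)) ?c \<in> F k"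
      proof (rule comb_in[OF subspace_F])
        fix s assume s: "s \<in> S i" "?c s \<noteq> 0"
        then have "s \<in> ?A" by (auto split: if_splits)
        then have "lev (i + 1) (\<sigma> i s) \<le> k" using s(1) by (simp add: key_def)
        then show "e (i + 1) (\<sigma> i s) \<in> F k"
          using adaptedD(3)[OF e, of "\<sigma> i s" "i + 1"] S(3) s(1) F_mono by blast
      qed
      show "x \<in> Q i j k"
        unfolding Q_def using xZF 1 2
        by (intro CollectI conjI bexI[of _ "X x - comb (S i) (\<lambda>s. e (i + 1) (\<sigma> i s)) ?c"]) simp_all
    qed
  qed
  moreover have "sdim i j k = dim (Q i j k) + sdim i J0 k" by (rule dim_Q[OF jk(3,4,2)])
  moreover have "sdim (i - 1) J0 j = dim ?V + sdim (i - 1) J0 J0"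
    using dim_B_F[of j "i - 1"] jk J_le_L by simp
  ultimately show ?thesis by simp
qed

end

subsection \<open>Matching of normal forms\<close>

lemma ex_bij_betw_of_card_fibres:
  assumes fin: "finite A" "finite A'"
    and card: "\<And>k. card {a \<in> A. f a = k} = card {a \<in> A'. f' a = k}"
  shows "\<exists>\<beta>. bij_betw \<beta> A A' \<and> (\<forall>a\<in>A. f' (\<beta> a) = f a)"
proof -
  have "\<exists>\<gamma>. bij_betw \<gamma> {a \<in> A. f a = k} {a \<in> A'. f' a = k}" for k
    by (rule finite_same_card_bij) (use fin card in auto)
  then obtain \<gamma> where \<gamma>: "\<And>k. bij_betw (\<gamma> k) {a \<in> A. f a = k} {a \<in> A'. f' a = k}" by metis
  define \<beta> where "\<beta> a = \<gamma> (f a) a" for a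
  have \<beta>: "\<beta> a \<in> A' \<and> f' (\<beta> a) = f a" if "a \<in> A" for a
    using bij_betwE[OF \<gamma>[of "f a"]] that by (auto simp: \<beta>_def)
  have "inj_on \<beta> A"
  proof (rule inj_onI)
    fix a b assume ab: "a \<in> A" "b \<in> A" "\<beta> a = \<beta> b"
    then have "f a = f b" using \<beta> by metis
    then show "a = b"
      using inj_onD[OF bij_betw_imp_inj_on[OF \<gamma>[of "f a"]], of a b] ab by (simp add: \<beta>_def)
  qed
  moreover have "\<beta> ` A = A'"
  proof
    show "\<beta> ` A \<subseteq> A'" using \<beta> by blast
    show "A' \<subseteq> \<beta> ` A"
    proof
      fix a' assume "a' \<in> A'"
      then have "a' \<in> \<gamma> (f' a') ` {a \<in> A. f a = f' a'}"
        using bij_betw_imp_surj_on[OF \<gamma>[of "f' a'"]] by auto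
      then obtain a where "a \<in> A" "f a = f' a'" "a' = \<gamma> (f' a') a" by blast
      then show "a' \<in> \<beta> ` A" by (intro image_eqI[of _ _ a]) (simp_all add: \<beta>_def)
    qed
  qed
  ultimately show ?thesis using \<beta> unfolding bij_betw_def by blast
qed

lemma card_of_card_fibres:
  assumes fin: "finite A" "finite A'"
    and card: "\<And>k. card {a \<in> A. f a = k} = card {a \<in> A'. f' a = k}"
  shows "card {a \<in> A. P (f a)} = card {a \<in> A'. P (f' a)}"
proof -
  obtain \<beta> where \<beta>: "bij_betw \<beta> A A'" "\<And>a. a \<in> A \<Longrightarrow> f' (\<beta> a) = f a"
    using ex_bij_betw_of_card_fibres[OF fin card] by blast
  have "\<beta> ` {a \<in> A. P (f a)} = {a \<in> A'. P (f' a)}"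
    using \<beta> bij_betw_imp_surj_on[OF \<beta>(1)] by force
  moreover have "inj_on \<beta> {a \<in> A. P (f a)}"
    using bij_betw_imp_inj_on[OF \<beta>(1)] by (rule inj_on_subset) auto
  ultimately show ?thesis by (metis card_image)
qed

text \<open>Inclusion-exclusion on quadrants: the cumulative counts at four neighbouring points give
  the count at one point.\<close>

lemma card_eq_of_card_le:
  fixes f :: "'a \<Rightarrow> int \<times> int" and f' :: "'b \<Rightarrow> int \<times> int"
  assumes fin: "finite A" "finite A'"
    and card: "\<And>j k. card {a \<in> A. fst (f a) \<le> j \<and> snd (f a) \<le> k} =
      card {a \<in> A'. fst (f' a) \<le> j \<and> snd (f' a) \<le> k}"
  shows "card {a \<in> A. f a = jk} = card {a \<in> A'. f' a = jk}"
proof -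
  obtain j k where jk: "jk = (j, k)" by fastforce
  have "card {a \<in> A. fst (f a) \<le> j \<and> snd (f a) \<le> k} + card {a \<in> A. fst (f a) \<le> j - 1 \<and> snd (f a) \<le> k - 1} =
      card {a \<in> A. fst (f a) \<le> j - 1 \<and> snd (f a) \<le> k} + card {a \<in> A. fst (f a) \<le> j \<and> snd (f a) \<le> k - 1} +
      card {a \<in> A. f a = (j, k)}" if "finite A" for A and f :: "'c \<Rightarrow> int \<times> int"
  proof -
    let ?S = "\<lambda>j k. {a \<in> A. fst (f a) \<le> j \<and> snd (f a) \<le> k}"
    have "?S j k = (?S (j - 1) k \<union> ?S j (k - 1)) \<union> {a \<in> A. f a = (j, k)}"
      "(?S (j - 1) k \<union> ?S j (k - 1)) \<inter> {a \<in> A. f a = (j, k)} = {}"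
      by (auto simp: prod_eq_iff)
    then have "card (?S j k) = card (?S (j - 1) k \<union> ?S j (k - 1)) + card {a \<in> A. f a = (j, k)}"
      using \<open>finite A\<close> by (metis (no_types, lifting) card_Un_disjoint finite_Un finite_subset mem_Collect_eq subsetI)
    moreover have "?S (j - 1) k \<inter> ?S j (k - 1) = ?S (j - 1) (k - 1)" by auto
    then have "card (?S (j - 1) k) + card (?S j (k - 1)) =
        card (?S (j - 1) k \<union> ?S j (k - 1)) + card (?S (j - 1) (k - 1))"
      using card_Un_Int[of "?S (j - 1) k" "?S j (k - 1)"] \<open>finite A\<close> by simp
    ultimately show ?thesis by simp
  qed
  from this[OF fin(1), of f] this[OF fin(2), of f'] show ?thesis
    unfolding jk card by linarith
qed

locale matching_data =
  fixes I :: "int \<Rightarrow> nat set" and lev :: "int \<Rightarrow> nat \<Rightarrow> int" and S :: "int \<Rightarrow> nat set"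
    and \<sigma> :: "int \<Rightarrow> nat \<Rightarrow> nat" and J0 :: int
  assumes finite_I: "finite (I i)" and lev_I: "s \<in> I i \<Longrightarrow> J0 < lev i s"
    and S_I: "S i \<subseteq> I i" and inj_\<sigma>: "inj_on (\<sigma> i) (S i)" and \<sigma>_S: "\<sigma> i ` S i \<subseteq> I (i + 1) - S (i + 1)"
begin

definition "mkey i s = (lev i s, if s \<in> S i then lev (i + 1) (\<sigma> i s) else J0)"

definition "T i = \<sigma> (i - 1) ` S (i - 1)"

lemma T_I: "T i \<subseteq> I i - S i"
  using \<sigma>_S[of "i - 1"] by (simp add: T_def)

text \<open>Levels of basis vectors exceed \<open>J0\<close>, so the default entry marks exactly the
  indices that are not sources.\<close>

lemma S_key: "s \<in> I i \<Longrightarrow> s \<in> S i \<longleftrightarrow> snd (mkey i s) \<noteq> J0"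
  using lev_I[of "\<sigma> i s" "i + 1"] \<sigma>_S[of i] by (auto simp: mkey_def)

lemma card_S_key: "card {s \<in> S i. P (mkey i s)} = card {s \<in> I i. P (mkey i s) \<and> snd (mkey i s) \<noteq> J0}"
  by (rule arg_cong[of _ _ card]) (use S_key S_I in blast)

lemma card_T: "card {t \<in> T i. lev i t = j} = card {s \<in> S (i - 1). snd (mkey (i - 1) s) = j}"
proof -
  have "{t \<in> T i. lev i t = j} = \<sigma> (i - 1) ` {s \<in> S (i - 1). snd (mkey (i - 1) s) = j}"
    by (auto simp: T_def mkey_def)
  moreover have "inj_on (\<sigma> (i - 1)) {s \<in> S (i - 1). snd (mkey (i - 1) s) = j}"
    using inj_\<sigma> by (rule inj_on_subset) auto
  ultimately show ?thesis by (simp add: card_image)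
qed

lemma card_U:
  "card {s \<in> I i - S i - T i. lev i s = j} =
    card {s \<in> I i. fst (mkey i s) = j} - card {s \<in> S i. fst (mkey i s) = j} - card {t \<in> T i. lev i t = j}"
proof -
  have "{s \<in> I i - S i - T i. lev i s = j} =
      ({s \<in> I i. fst (mkey i s) = j} - {s \<in> S i. fst (mkey i s) = j}) - {t \<in> T i. lev i t = j}"
    by (auto simp: mkey_def)
  moreover have "{s \<in> S i. fst (mkey i s) = j} \<subseteq> {s \<in> I i. fst (mkey i s) = j}"
    using S_I by auto
  moreover have "{t \<in> T i. lev i t = j} \<subseteq> {s \<in> I i. fst (mkey i s) = j} - {s \<in> S i. fst (mkey i s) = j}"
    using T_I by (auto simp: mkey_def)
  moreover have "finite {s \<in> S i. fst (mkey i s) = j}" "finite {t \<in> T i. lev i t = j}"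
    using finite_I[of i] S_I[of i] T_I[of i] by (auto intro: finite_subset)
  ultimately show ?thesis by (simp add: card_Diff_subset)
qed

end

text \<open>The keys fix the number of sources for each pair of levels, hence the number of targets
  of each level in the next degree, and by subtraction the number of isolated indices. The bijection
  is free on sources and isolated indices; on targets it is forced by compatibility with
  \<open>\<sigma>\<close>.\<close>

lemma ex_matching_of_card:
  assumes a: "matching_data I lev S \<sigma> J0" and b: "matching_data I' lev' S' \<sigma>' J0"
    and card: "\<And>i k. card {s \<in> I i. matching_data.mkey lev S \<sigma> J0 i s = k} =
      card {s \<in> I' i. matching_data.mkey lev' S' \<sigma>' J0 i s = k}"
  shows "\<exists>\<beta>. \<forall>i. bij_betw (\<beta> i) (I i) (I' i) \<and> (\<forall>s\<in>I i. lev' i (\<beta> i s) = lev i s) \<and>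
    (\<forall>s\<in>I i. \<beta> i s \<in> S' i \<longleftrightarrow> s \<in> S i) \<and> (\<forall>s\<in>S i. \<beta> (i + 1) (\<sigma> i s) = \<sigma>' i (\<beta> i s))"
proof -
  interpret a: matching_data I lev S \<sigma> J0 by (rule a)
  interpret b: matching_data I' lev' S' \<sigma>' J0 by (rule b)
  have P: "card {s \<in> I i. P (a.mkey i s)} = card {s \<in> I' i. P (b.mkey i s)}" for i P
    by (rule card_of_card_fibres[OF a.finite_I b.finite_I card])
  have PS: "card {s \<in> S i. P (a.mkey i s)} = card {s \<in> S' i. P (b.mkey i s)}" for i P
    unfolding a.card_S_key b.card_S_key by (rule P[of i "\<lambda>k. P k \<and> snd k \<noteq> J0"])
  have finS: "finite (S i)" "finite (S' i)" for i
    using finite_subset[OF a.S_I a.finite_I] finite_subset[OF b.S_I b.finite_I] by auto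
  have "\<exists>\<beta>. bij_betw \<beta> (S i) (S' i) \<and> (\<forall>s\<in>S i. b.mkey i (\<beta> s) = a.mkey i s)" for i
    by (rule ex_bij_betw_of_card_fibres[OF finS PS[of i "\<lambda>x. x = _"]])
  then obtain \<beta>S where \<beta>S: "\<And>i. bij_betw (\<beta>S i) (S i) (S' i)" "\<And>i s. s \<in> S i \<Longrightarrow> b.mkey i (\<beta>S i s) = a.mkey i s"
    by metis
  have \<beta>S_mem: "\<beta>S i s \<in> S' i" if "s \<in> S i" for i s using bij_betwE[OF \<beta>S(1)] that by blast
  have "card {s \<in> I i - S i - a.T i. lev i s = j} = card {s \<in> I' i - S' i - b.T i. lev' i s = j}" for i j
    unfolding a.card_U b.card_U a.card_T b.card_T
    using P[of i "\<lambda>k. fst k = j"] PS[of i "\<lambda>k. fst k = j"] PS[of "i - 1" "\<lambda>k. snd k = j"] by simp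
  then have "\<exists>\<beta>. bij_betw \<beta> (I i - S i - a.T i) (I' i - S' i - b.T i) \<and> (\<forall>s\<in>I i - S i - a.T i. lev' i (\<beta> s) = lev i s)" for i
    by (intro ex_bij_betw_of_card_fibres) (auto simp: a.finite_I b.finite_I)
  then obtain \<beta>U where \<beta>U: "\<And>i. bij_betw (\<beta>U i) (I i - S i - a.T i) (I' i - S' i - b.T i)"
    "\<And>i s. s \<in> I i - S i - a.T i \<Longrightarrow> lev' i (\<beta>U i s) = lev i s"
    by metis
  define \<beta>T where "\<beta>T i t = \<sigma>' (i - 1) (\<beta>S (i - 1) (inv_into (S (i - 1)) (\<sigma> (i - 1)) t))" for i t
  have \<beta>T_\<sigma>: "\<beta>T (i + 1) (\<sigma> i s) = \<sigma>' i (\<beta>S i s)" if "s \<in> S i" for i s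
    using that by (simp add: \<beta>T_def inv_into_f_f[OF a.inj_\<sigma>])
  have \<beta>T: "bij_betw (\<beta>T i) (a.T i) (b.T i)" for i
  proof -
    have "bij_betw (inv_into (S (i - 1)) (\<sigma> (i - 1))) (a.T i) (S (i - 1))"
      unfolding a.T_def by (rule bij_betw_inv_into[OF inj_on_imp_bij_betw[OF a.inj_\<sigma>]])
    from bij_betw_trans[OF bij_betw_trans[OF this \<beta>S(1)] inj_on_imp_bij_betw[OF b.inj_\<sigma>]]
    show ?thesis unfolding b.T_def \<beta>T_def comp_def .
  qed
  have \<beta>T_lev: "lev' i (\<beta>T i t) = lev i t" if "t \<in> a.T i" for i t
  proof -
    from that obtain s where s: "s \<in> S (i - 1)" "t = \<sigma> (i - 1) s" by (auto simp: a.T_def)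
    have "snd (b.mkey (i - 1) (\<beta>S (i - 1) s)) = snd (a.mkey (i - 1) s)" using \<beta>S(2)[OF s(1)] by simp
    then show ?thesis using \<beta>T_\<sigma>[OF s(1)] \<beta>S_mem[OF s(1)] s by (simp add: a.mkey_def b.mkey_def)
  qed
  define \<beta> where "\<beta> i s = (if s \<in> S i then \<beta>S i s else if s \<in> a.T i then \<beta>T i s else \<beta>U i s)" for i s
  have disj: "s \<notin> S i" if "s \<in> a.T i" for s i using that a.T_I by blast
  have disj': "s \<notin> S' i" if "s \<in> b.T i" for s i using that b.T_I by blast
  have bS: "bij_betw (\<beta> i) (S i) (S' i)" for i
    using \<beta>S(1)[of i] by (subst bij_betw_cong[of _ _ "\<beta>S i"]) (auto simp: \<beta>_def)
  have bT: "bij_betw (\<beta> i) (a.T i) (b.T i)" for i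
    using \<beta>T[of i] by (subst bij_betw_cong[of _ _ "\<beta>T i"]) (auto simp: \<beta>_def disj)
  have bU: "bij_betw (\<beta> i) (I i - S i - a.T i) (I' i - S' i - b.T i)" for i
    using \<beta>U(1)[of i] by (subst bij_betw_cong[of _ _ "\<beta>U i"]) (auto simp: \<beta>_def)
  have bij: "bij_betw (\<beta> i) (I i) (I' i)" for i
  proof -
    have "bij_betw (\<beta> i) (S i \<union> a.T i \<union> (I i - S i - a.T i)) (S' i \<union> b.T i \<union> (I' i - S' i - b.T i))"
      by (rule bij_betw_combine[OF bij_betw_combine[OF bS bT] bU]) (use disj' in auto)
    moreover have "S i \<union> a.T i \<union> (I i - S i - a.T i) = I i" using a.S_I a.T_I by blast
    moreover have "S' i \<union> b.T i \<union> (I' i - S' i - b.T i) = I' i" using b.S_I b.T_I by blast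
    ultimately show ?thesis by simp
  qed
  have "lev' i (\<beta> i s) = lev i s" if s: "s \<in> I i" for i s
  proof -
    have "lev' i (\<beta>S i s) = lev i s" if "s \<in> S i"
      using arg_cong[OF \<beta>S(2)[OF that], of fst] by (simp add: a.mkey_def b.mkey_def)
    then show ?thesis using \<beta>T_lev \<beta>U(2) s by (simp add: \<beta>_def)
  qed
  moreover have "\<beta> i s \<in> S' i \<longleftrightarrow> s \<in> S i" if s: "s \<in> I i" for i s
  proof
    assume "\<beta> i s \<in> S' i"
    then obtain s' where s': "s' \<in> S i" "\<beta> i s = \<beta> i s'"
      using bij_betw_imp_surj_on[OF bS[of i]] by (metis imageE)
    then have "s = s'" using inj_onD[OF bij_betw_imp_inj_on[OF bij]] s a.S_I by blast
    with s' show "s \<in> S i" by simp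
  next
    assume "s \<in> S i"
    then show "\<beta> i s \<in> S' i" using bij_betwE[OF bS] by blast
  qed
  moreover have "\<beta> (i + 1) (\<sigma> i s) = \<sigma>' i (\<beta> i s)" if s: "s \<in> S i" for i s
  proof -
    have "\<sigma> i s \<in> a.T (i + 1)" using s by (simp add: a.T_def)
    then show ?thesis using s disj \<beta>T_\<sigma> by (simp add: \<beta>_def)
  qed
  ultimately show ?thesis using bij by (intro exI[of _ \<beta>]) simp
qed

section \<open>Filtered isomorphisms between complexes with matching normal forms\<close>

context filtered_double_complex
begin

lemma matching_data_normal:
  assumes "\<And>i. adapted i (I i) (lev i) (e i)" "\<And>i. normal I lev e S \<sigma> i"
  shows "matching_data I lev S \<sigma> J0"
proof
  fix i s
  show "finite (I i)" by (rule adaptedD(1)[OF assms(1)])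
  show "J0 < lev i s" if "s \<in> I i" by (rule adaptedD(4)[OF assms(1) that])
  show "S i \<subseteq> I i" "inj_on (\<sigma> i) (S i)" "\<sigma> i ` S i \<subseteq> I (i + 1) - S (i + 1)"
    using assms(2)[of i] by (simp_all add: normal_def)
qed

text \<open>The value \<open>0\<close> outside \<open>I\<close> makes the coordinates unique as
  functions, from which their linearity follows.\<close>

definition coord :: "int \<Rightarrow> nat set \<Rightarrow> (nat \<Rightarrow> 'v) \<Rightarrow> 'v \<Rightarrow> nat \<Rightarrow> complex" where
  "coord i I e z = (SOME c. z - comb I e c \<in> B i \<and> (\<forall>s. s \<notin> I \<longrightarrow> c s = 0))"

lemma coord:
  assumes "adapted i I lev e" "z \<in> Z i"
  shows "z - comb I e (coord i I e z) \<in> B i" "s \<notin> I \<Longrightarrow> coord i I e z s = 0"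
proof -
  obtain c where c: "z - comb I e c \<in> B i" using adapted_spanned_Z[OF assms] by blast
  let ?c = "\<lambda>s. if s \<in> I then c s else 0"
  have "comb I e ?c = comb I e c" by (rule comb_cong) auto
  with c have "z - comb I e ?c \<in> B i \<and> (\<forall>s. s \<notin> I \<longrightarrow> ?c s = 0)" by simp
  from someI[of "\<lambda>c. z - comb I e c \<in> B i \<and> (\<forall>s. s \<notin> I \<longrightarrow> c s = 0)", OF this]
  show "z - comb I e (coord i I e z) \<in> B i" "s \<notin> I \<Longrightarrow> coord i I e z s = 0"
    unfolding coord_def by blast+
qed

lemma coord_eq:
  assumes "adapted i I lev e" "z \<in> Z i" "z - comb I e c \<in> B i" "\<And>s. s \<notin> I \<Longrightarrow> c s = 0"
  shows "coord i I e z = c"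
proof
  fix s
  show "coord i I e z s = c s"
    using independent_mod_unique[OF adaptedD(6)[OF assms(1)] coord(1)[OF assms(1,2)] assms(3), of s]
      coord(2)[OF assms(1,2)] assms(4) by (cases "s \<in> I") auto
qed

end

locale matched_normal_forms =
  a: filtered_double_complex scl C F D X J0 J L K lo hi +
  b: filtered_double_complex scl C F D' X' J0 J L K lo hi
  for scl :: "complex \<Rightarrow> 'v::ab_group_add \<Rightarrow> 'v" and C F D X D' X' J0 J L K lo hi +
  fixes I lev e S \<sigma> I' lev' e' S' \<sigma>' and \<beta> \<gamma> :: "int \<Rightarrow> nat \<Rightarrow> nat"
  assumes e: "a.adapted i (I i) (lev i) (e i)" and n: "a.normal I lev e S \<sigma> i"
    and e': "b.adapted i (I' i) (lev' i) (e' i)" and n': "b.normal I' lev' e' S' \<sigma>' i"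
    and \<beta>: "bij_betw (\<beta> i) (I i) (I' i)"
    and \<gamma>_\<beta>: "s \<in> I i \<Longrightarrow> \<gamma> i (\<beta> i s) = s"
    and \<beta>_lev: "s \<in> I i \<Longrightarrow> lev' i (\<beta> i s) = lev i s"
    and \<beta>_S: "s \<in> I i \<Longrightarrow> \<beta> i s \<in> S' i \<longleftrightarrow> s \<in> S i"
    and \<beta>_\<sigma>: "s \<in> S i \<Longrightarrow> \<beta> (i + 1) (\<sigma> i s) = \<sigma>' i (\<beta> i s)"
begin

definition "f i z = a.comb (I i) (\<lambda>s. e' i (\<beta> i s)) (a.coord i (I i) (e i) z)"
definition "g i z = a.comb (I' i) (\<lambda>s. e i (\<gamma> i s)) (b.coord i (I' i) (e' i) z)"

lemma \<beta>_mem: "s \<in> I i \<Longrightarrow> \<beta> i s \<in> I' i"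
  using bij_betwE[OF \<beta>] by blast

text \<open>The map \<open>f\<close> sends basis vectors to matching basis vectors. It respects the
  filtration because a cocycle in \<open>F j\<close> has coordinates of level at most
  \<open>j\<close> only, it commutes with the differentials up to coboundaries because pairs match
  pairs, and it kills coboundaries because their coordinates vanish.\<close>

lemma double_complex_iso: "double_complex_iso scl C F D X C F D' X' f g"
proof
  fix i x assume x: "x \<in> a.Z i"
  note cx = a.coord[OF e x]
  show fZ: "f i x \<in> b.Z i"
    unfolding f_def by (rule a.comb_in[OF b.subspace_Z]) (rule b.adaptedD(2)[OF e' \<beta>_mem])
  show "f i (scl c x) = scl c (f i x)" for c
  proof -
    have "a.coord i (I i) (e i) (scl c x) = (\<lambda>s. c * a.coord i (I i) (e i) x s)"
    proof (rule a.coord_eq[OF e a.subspace_scale[OF a.subspace_Z x]])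
      show "scl c x - a.comb (I i) (e i) (\<lambda>s. c * a.coord i (I i) (e i) x s) \<in> a.B i"
        unfolding a.comb_scale using a.B_scale[OF cx(1), of c] by (simp only: a.scale_right_diff_distrib)
    qed (simp add: cx(2))
    then show ?thesis unfolding f_def by (simp only: a.comb_scale)
  qed
  show "f i (x + y) = f i x + f i y" if y: "y \<in> a.Z i" for y
  proof -
    note cy = a.coord[OF e y]
    have "a.coord i (I i) (e i) (x + y) = (\<lambda>s. a.coord i (I i) (e i) x s + a.coord i (I i) (e i) y s)"
    proof (rule a.coord_eq[OF e a.subspace_add[OF a.subspace_Z x y]])
      show "x + y - a.comb (I i) (e i) (\<lambda>s. a.coord i (I i) (e i) x s + a.coord i (I i) (e i) y s) \<in> a.B i"
        unfolding a.comb_add using a.B_add[OF cx(1) cy(1)] by (simp only: add_diff_add)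
    qed (simp add: cx(2) cy(2))
    then show ?thesis unfolding f_def by (simp only: a.comb_add)
  qed
  show "f i x \<in> F j" if xF: "x \<in> F j" for j
    unfolding f_def
  proof (rule a.comb_in[OF a.subspace_F])
    obtain c where c: "\<And>s. s \<in> I i \<Longrightarrow> c s \<noteq> 0 \<Longrightarrow> lev i s \<le> j" "x - a.comb (I i) (e i) c \<in> a.B i"
      using a.adapted_spanned[OF e x xF] by blast
    fix s assume s: "s \<in> I i" "a.coord i (I i) (e i) x s \<noteq> 0"
    have "a.coord i (I i) (e i) x s = c s"
      by (rule a.independent_mod_unique[OF a.adaptedD(6)[OF e] cx(1) c(2) s(1)])
    then have "lev' i (\<beta> i s) \<le> j" using c(1) s \<beta>_lev by simp
    then show "e' i (\<beta> i s) \<in> F j"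
      using b.adaptedD(3)[OF e' \<beta>_mem[OF s(1)]] a.F_mono by blast
  qed
  show "X' (f i x) - f (i + 1) (X x) \<in> b.B (i + 1)"
  proof -
    let ?c = "a.coord i (I i) (e i) x"
    obtain d where d: "a.comb (S i) (\<lambda>s. e (i + 1) (\<sigma> i s)) ?c = a.comb (I (i + 1)) (e (i + 1)) d"
      "\<And>s. s \<in> S i \<Longrightarrow> d (\<sigma> i s) = ?c s" "\<And>t. t \<notin> \<sigma> i ` S i \<Longrightarrow> d t = 0"
      using a.normal_comb_reindex[OF e n] by blast
    have S: "S i \<subseteq> I i" "inj_on (\<sigma> i) (S i)" "\<sigma> i ` S i \<subseteq> I (i + 1)"
      using n[of i] unfolding a.normal_def by blast+
    have "X x - X (a.comb (I i) (e i) ?c) \<in> a.B (i + 1)" using a.X_B[OF cx(1)] by (simp add: a.X.diff)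
    from a.B_diff_trans[OF this a.normal_X_comb[OF e n]]
    have "X x - a.comb (I (i + 1)) (e (i + 1)) d \<in> a.B (i + 1)" by (simp only: d(1))
    then have "a.coord (i + 1) (I (i + 1)) (e (i + 1)) (X x) = d"
      by (rule a.coord_eq[OF e a.X_Z[OF x]]) (use d(3) S(3) in blast)
    then have "f (i + 1) (X x) = a.comb (I (i + 1)) (\<lambda>s. e' (i + 1) (\<beta> (i + 1) s)) d"
      by (simp add: f_def)
    also have "\<dots> = a.comb (\<sigma> i ` S i) (\<lambda>s. e' (i + 1) (\<beta> (i + 1) s)) d"
      by (rule a.comb_mono[symmetric]) (use a.adaptedD(1)[OF e] S(3) d(3) in auto)
    also have "\<dots> = a.comb (S i) (\<lambda>s. e' (i + 1) (\<beta> (i + 1) (\<sigma> i s))) (\<lambda>s. d (\<sigma> i s))"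
      by (rule a.comb_reindex[OF S(2)])
    also have "\<dots> = a.comb (S i) (\<lambda>s. e' (i + 1) (\<sigma>' i (\<beta> i s))) ?c"
      by (rule a.comb_cong) (simp_all add: d(2) \<beta>_\<sigma>)
    also have "\<dots> = a.comb (S i) (\<lambda>s. e' (i + 1) (\<sigma>' i (\<beta> i s))) (\<lambda>s. if s \<in> S i then ?c s else 0)"
      by (rule a.comb_cong) simp_all
    also have "\<dots> = a.comb (I i) (\<lambda>s. e' (i + 1) (\<sigma>' i (\<beta> i s))) (\<lambda>s. if s \<in> S i then ?c s else 0)"
      by (rule a.comb_mono[OF a.adaptedD(1)[OF e] S(1)]) simp
    finally have fX: "f (i + 1) (X x) = \<dots>" .
    have "a.comb (I i) (\<lambda>s. X' (e' i (\<beta> i s))) (\<lambda>s. if s \<in> S i then ?c s else 0) - f (i + 1) (X x) \<in> b.B (i + 1)"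
      unfolding fX
    proof (rule a.comb_diff_in[OF b.subspace_B])
      fix s assume "s \<in> I i" "(if s \<in> S i then ?c s else 0) \<noteq> 0"
      then have "\<beta> i s \<in> S' i" using \<beta>_S by (auto split: if_splits)
      then show "X' (e' i (\<beta> i s)) - e' (i + 1) (\<sigma>' i (\<beta> i s)) \<in> b.B (i + 1)"
        using n'[of i] by (simp add: b.normal_def)
    qed
    moreover have "a.comb (I i) (\<lambda>s. X' (e' i (\<beta> i s))) (\<lambda>s. if s \<in> S i then 0 else ?c s) \<in> b.B (i + 1)"
    proof (rule a.comb_in[OF b.subspace_B])
      fix s assume "s \<in> I i" "(if s \<in> S i then 0 else ?c s) \<noteq> 0"
      then have "\<beta> i s \<in> I' i - S' i" using \<beta>_S \<beta>_mem by (auto split: if_splits)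
      then show "X' (e' i (\<beta> i s)) \<in> b.B (i + 1)"
        using n'[of i] by (simp add: b.normal_def)
    qed
    ultimately have "a.comb (I i) (\<lambda>s. X' (e' i (\<beta> i s))) (\<lambda>s. if s \<in> S i then ?c s else 0) - f (i + 1) (X x) +
      a.comb (I i) (\<lambda>s. X' (e' i (\<beta> i s))) (\<lambda>s. if s \<in> S i then 0 else ?c s) \<in> b.B (i + 1)"
      by (rule b.B_add)
    moreover have "X' (f i x) = a.comb (I i) (\<lambda>s. X' (e' i (\<beta> i s))) (\<lambda>s. if s \<in> S i then ?c s else 0) +
      a.comb (I i) (\<lambda>s. X' (e' i (\<beta> i s))) (\<lambda>s. if s \<in> S i then 0 else ?c s)"
      unfolding f_def b.X_comb a.comb_add[symmetric] by (rule a.comb_cong) auto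
    ultimately show ?thesis by (simp add: algebra_simps)
  qed
  show "g i (f i x) - x \<in> a.B i"
  proof -
    let ?c = "a.coord i (I i) (e i) x"
    let ?d = "\<lambda>t. if t \<in> I' i then ?c (\<gamma> i t) else 0"
    have img: "\<beta> i ` I i = I' i" and inj: "inj_on (\<beta> i) (I i)"
      using \<beta>[of i] by (auto simp: bij_betw_def)
    have re: "a.comb (I' i) h ?d = a.comb (I i) (\<lambda>s. h (\<beta> i s)) ?c" for h
    proof -
      have "a.comb (I' i) h ?d = a.comb (I i) (\<lambda>s. h (\<beta> i s)) (\<lambda>s. ?d (\<beta> i s))"
        using a.comb_reindex[OF inj, of h ?d] by (simp only: img)
      also have "\<dots> = a.comb (I i) (\<lambda>s. h (\<beta> i s)) ?c"
        by (rule a.comb_cong) (simp_all add: \<gamma>_\<beta> \<beta>_mem)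
      finally show ?thesis .
    qed
    have "f i x - b.comb (I' i) (e' i) ?d \<in> b.B i"
      unfolding re f_def by (simp add: b.B_0)
    then have "b.coord i (I' i) (e' i) (f i x) = ?d"
      by (rule b.coord_eq[OF e' fZ]) simp
    then have "g i (f i x) = a.comb (I i) (\<lambda>s. e i (\<gamma> i (\<beta> i s))) ?c"
      by (simp only: g_def re)
    also have "\<dots> = a.comb (I i) (e i) ?c"
      by (rule a.comb_cong) (simp_all add: \<gamma>_\<beta>)
    finally show ?thesis using a.B_diff_commute[OF cx(1)] by simp
  qed
next
  fix i x assume x: "x \<in> a.B i"
  then have "a.coord i (I i) (e i) x = (\<lambda>_. 0)"
    by (intro a.coord_eq[OF e]) (use a.B_le_Z in \<open>auto simp: a.comb_0\<close>)
  then show "f i x \<in> b.B i" by (simp add: f_def a.comb_0 b.B_0)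
qed

end

text \<open>Equal dimensions give equal cumulative counts of keys, hence matching normal forms. The
  range starts at \<open>lo - 1\<close> because the coboundaries in degree \<open>lo\<close> are
  counted by a system of the degree below.\<close>

theorem filtered_homotopy_equivalent_of_sdim:
  assumes a: "filtered_double_complex scl C F D X J0 J L K lo hi"
    and b: "filtered_double_complex scl C F D' X' J0 J L K lo hi"
    and sdim: "\<And>i j k. i \<in> {lo - 1..hi} \<Longrightarrow> j \<in> {J0..J} \<Longrightarrow> k \<in> {J0..J} \<Longrightarrow>
      filtered_double_complex.sdim scl C F D X K i j k = filtered_double_complex.sdim scl C F D' X' K i j k"
  shows "filtered_homotopy_equivalent (coset_complex scl C F D X) (coset_complex scl C F D' X')"
proof -
  interpret a: filtered_double_complex scl C F D X J0 J L K lo hi by (rule a)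
  interpret b: filtered_double_complex scl C F D' X' J0 J L K lo hi by (rule b)
  obtain I lev e S \<sigma> where e: "\<And>i. a.adapted i (I i) (lev i) (e i)" and n: "\<And>i. a.normal I lev e S \<sigma> i"
    using a.ex_normal by blast
  obtain I' lev' e' S' \<sigma>' where e': "\<And>i. b.adapted i (I' i) (lev' i) (e' i)"
    and n': "\<And>i. b.normal I' lev' e' S' \<sigma>' i"
    using b.ex_normal by blast
  interpret ma: matching_data I lev S \<sigma> J0 by (rule a.matching_data_normal[OF e n])
  interpret mb: matching_data I' lev' S' \<sigma>' J0 by (rule b.matching_data_normal[OF e' n'])
  have keys: "a.key lev S \<sigma> = ma.mkey" "b.key lev' S' \<sigma>' = mb.mkey"
    by (simp_all add: fun_eq_iff a.key_def ma.mkey_def b.key_def mb.mkey_def)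
  have range: "J0 < fst (ma.mkey i s) \<and> fst (ma.mkey i s) \<le> J \<and> J0 \<le> snd (ma.mkey i s) \<and> snd (ma.mkey i s) \<le> J"
    if "s \<in> I i" for i s
    using a.adaptedD(4,5)[OF e that] a.adaptedD(4,5)[OF e, of "\<sigma> i s" "i + 1"] ma.\<sigma>_S[of i] a.J0_le_J
    by (auto simp: ma.mkey_def less_imp_le)
  have range': "J0 < fst (mb.mkey i s) \<and> fst (mb.mkey i s) \<le> J \<and> J0 \<le> snd (mb.mkey i s) \<and> snd (mb.mkey i s) \<le> J"
    if "s \<in> I' i" for i s
    using b.adaptedD(4,5)[OF e' that] b.adaptedD(4,5)[OF e', of "\<sigma>' i s" "i + 1"] mb.\<sigma>_S[of i] a.J0_le_J
    by (auto simp: mb.mkey_def less_imp_le)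
  have card: "card {s \<in> I i. fst (ma.mkey i s) \<le> j \<and> snd (ma.mkey i s) \<le> k} =
      card {s \<in> I' i. fst (mb.mkey i s) \<le> j \<and> snd (mb.mkey i s) \<le> k}" for i j k
  proof -
    consider "j < J0 \<or> k < J0" | "i < lo \<or> hi \<le> i" | "J0 \<le> j" "J0 \<le> k" "lo \<le> i" "i < hi" by linarith
    then show ?thesis
    proof cases
      case 1
      then have "{s \<in> I i. fst (ma.mkey i s) \<le> j \<and> snd (ma.mkey i s) \<le> k} = {}"
        "{s \<in> I' i. fst (mb.mkey i s) \<le> j \<and> snd (mb.mkey i s) \<le> k} = {}"
        using range[of _ i] range'[of _ i] by fastforce+
      then show ?thesis by (simp only: card.empty)
    next
      case 2
      then have "C i = {0}" using a.C_hi a.C_lo by blast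
      then have "I i = {}" "I' i = {}" using a.adapted_empty[OF e] b.adapted_empty[OF e'] by auto
      then show ?thesis by simp
    next
      case 3
      \<comment> \<open>The entries of all keys lie between \<open>J0\<close> and \<open>J\<close>,
        so larger bounds may be cut off at \<open>J\<close>.\<close>
      let ?j = "min j J" and ?k = "min k J"
      have eq: "{s \<in> I i. fst (ma.mkey i s) \<le> j \<and> snd (ma.mkey i s) \<le> k} =
          {s \<in> I i. fst (ma.mkey i s) \<le> ?j \<and> snd (ma.mkey i s) \<le> ?k}"
        using range[of _ i] by auto
      have eq': "{s \<in> I' i. fst (mb.mkey i s) \<le> j \<and> snd (mb.mkey i s) \<le> k} =
          {s \<in> I' i. fst (mb.mkey i s) \<le> ?j \<and> snd (mb.mkey i s) \<le> ?k}"
        using range'[of _ i] by auto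
      have jk: "J0 \<le> ?j" "?j \<le> J" "J0 \<le> ?k" "?k \<le> J" using 3 a.J0_le_J by auto
      have "a.sdim i' j' k' = b.sdim i' j' k'" if "i' \<in> {i - 1, i}" "j' \<in> {J0..J}" "k' \<in> {J0..J}" for i' j' k'
        by (rule sdim) (use that 3 in auto)
      then have "int (card {s \<in> I i. fst (ma.mkey i s) \<le> ?j \<and> snd (ma.mkey i s) \<le> ?k}) =
          int (card {s \<in> I' i. fst (mb.mkey i s) \<le> ?j \<and> snd (mb.mkey i s) \<le> ?k})"
        using a.card_key[of I lev e S \<sigma> i ?j ?k, OF e n jk] b.card_key[of I' lev' e' S' \<sigma>' i ?j ?k, OF e' n' jk]
          jk a.J0_le_J unfolding keys by simp
      then show ?thesis unfolding eq eq' by simp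
    qed
  qed
  have "\<exists>\<beta>. \<forall>i. bij_betw (\<beta> i) (I i) (I' i) \<and> (\<forall>s\<in>I i. lev' i (\<beta> i s) = lev i s) \<and>
    (\<forall>s\<in>I i. \<beta> i s \<in> S' i \<longleftrightarrow> s \<in> S i) \<and> (\<forall>s\<in>S i. \<beta> (i + 1) (\<sigma> i s) = \<sigma>' i (\<beta> i s))"
    by (rule ex_matching_of_card[OF ma.matching_data_axioms mb.matching_data_axioms])
      (rule card_eq_of_card_le[OF ma.finite_I mb.finite_I card])
  then obtain \<beta> where "\<forall>i. bij_betw (\<beta> i) (I i) (I' i) \<and> (\<forall>s\<in>I i. lev' i (\<beta> i s) = lev i s) \<and>
    (\<forall>s\<in>I i. \<beta> i s \<in> S' i \<longleftrightarrow> s \<in> S i) \<and> (\<forall>s\<in>S i. \<beta> (i + 1) (\<sigma> i s) = \<sigma>' i (\<beta> i s))"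
    by (elim exE)
  then have \<beta>: "\<And>i. bij_betw (\<beta> i) (I i) (I' i)"
    "\<And>i s. s \<in> I i \<Longrightarrow> lev' i (\<beta> i s) = lev i s" "\<And>i s. s \<in> I i \<Longrightarrow> \<beta> i s \<in> S' i \<longleftrightarrow> s \<in> S i"
    "\<And>i s. s \<in> S i \<Longrightarrow> \<beta> (i + 1) (\<sigma> i s) = \<sigma>' i (\<beta> i s)"
    by simp_all
  define \<gamma> where "\<gamma> i = inv_into (I i) (\<beta> i)" for i
  have \<gamma>_\<beta>: "\<gamma> i (\<beta> i s) = s" if "s \<in> I i" for i s
    unfolding \<gamma>_def by (rule bij_betw_inv_into_left[OF \<beta>(1) that])
  have \<beta>_\<gamma>: "\<beta> i (\<gamma> i s) = s" if "s \<in> I' i" for i s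
    unfolding \<gamma>_def by (rule bij_betw_inv_into_right[OF \<beta>(1) that])
  have \<gamma>: "bij_betw (\<gamma> i) (I' i) (I i)" for i
    unfolding \<gamma>_def by (rule bij_betw_inv_into[OF \<beta>(1)])
  have \<gamma>_mem: "\<gamma> i s \<in> I i" if "s \<in> I' i" for i s
    using bij_betwE[OF \<gamma>] that by blast
  interpret ab: matched_normal_forms scl C F D X D' X' J0 J L K lo hi I lev e S \<sigma> I' lev' e' S' \<sigma>' \<beta> \<gamma>
    by unfold_locales (rule e n e' n' \<beta> \<gamma>_\<beta>; assumption?)+
  interpret ba: matched_normal_forms scl C F D' X' D X J0 J L K lo hi I' lev' e' S' \<sigma>' I lev e S \<sigma> \<gamma> \<beta>
  proof unfold_locales
    fix i s
    show "lev i (\<gamma> i s) = lev' i s" if "s \<in> I' i"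
      using \<beta>(2)[OF \<gamma>_mem[OF that]] \<beta>_\<gamma>[OF that] by simp
    show "\<gamma> i s \<in> S i \<longleftrightarrow> s \<in> S' i" if "s \<in> I' i"
      using \<beta>(3)[OF \<gamma>_mem[OF that]] \<beta>_\<gamma>[OF that] by simp
    show "\<gamma> (i + 1) (\<sigma>' i s) = \<sigma> i (\<gamma> i s)" if s: "s \<in> S' i"
    proof -
      have s': "s \<in> I' i" using s mb.S_I by blast
      have gs: "\<gamma> i s \<in> S i" using \<beta>(3)[OF \<gamma>_mem[OF s']] \<beta>_\<gamma>[OF s'] s by simp
      then have "\<sigma> i (\<gamma> i s) \<in> I (i + 1)" using ma.\<sigma>_S by blast
      moreover have "\<beta> (i + 1) (\<sigma> i (\<gamma> i s)) = \<sigma>' i s" using \<beta>(4)[OF gs] \<beta>_\<gamma>[OF s'] by simp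
      ultimately show ?thesis using \<gamma>_\<beta> by metis
    qed
  qed (rule e n e' n' \<gamma> \<beta>_\<gamma>; assumption?)+
  have "ba.f = ab.g" "ba.g = ab.f"
    by (simp_all add: fun_eq_iff ab.f_def ab.g_def ba.f_def ba.g_def)
  then show ?thesis
    using filtered_homotopy_equivalent_cosets[OF ab.double_complex_iso] ba.double_complex_iso by simp
qed

section \<open>Identities for divided differences\<close>

lemma divided_diff2_pCons:
  "divided_diff2 (pCons c q) a b d = divided_diff q d a + b * divided_diff2 q a b d"
  by (simp add: divided_diff2_def) (simp add: divided_diff_def)

subsection \<open>Specialization\<close>

text \<open>Identities in generic arguments, in which one may cancel \<open>x1 - x4\<close>, specialize to arbitrary
  ones. Here \<open>x4\<close> is made generic by adjoining a variable.\<close>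

definition spec :: "'a::comm_ring_1 poly \<Rightarrow> 'a" where "spec q = poly q 0"

lemma spec_simps [simp]:
  "spec (p + q) = spec p + spec q" "spec (p * q) = spec p * spec q" "spec (p - q) = spec p - spec q"
  "spec (- p) = - spec p" "spec 0 = 0" "spec 1 = 1" "spec [:c:] = c" "spec (pCons c q) = c"
  by (simp_all add: spec_def)

lemma spec_sum: "spec (sum f A) = (\<Sum>x\<in>A. spec (f x))"
  by (simp add: spec_def poly_sum)

lemma spec_numeral [simp]: "spec (numeral k) = numeral k"
  by (simp add: spec_def)

lemma spec_poly: "spec (poly q a) = poly (map_poly spec q) (spec a)"
  by (induction q) (simp_all add: map_poly_pCons)

lemma spec_divided_diff: "spec (divided_diff q a b) = divided_diff (map_poly spec q) (spec a) (spec b)"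
  by (induction q) (simp_all add: map_poly_pCons spec_poly)

lemma spec_divided_diff2:
  "spec (divided_diff2 q a b c) = divided_diff2 (map_poly spec q) (spec a) (spec b) (spec c)"
proof (induction q)
  case 0
  then show ?case by (simp add: divided_diff2_def)
next
  case (pCons c q)
  then show ?case by (simp add: map_poly_pCons divided_diff2_pCons spec_divided_diff)
qed

lemma map_poly_spec_diff: "map_poly spec (p - q) = map_poly spec p - map_poly spec q"
  by (rule poly_eqI) (simp add: coeff_map_poly)

lemma map_poly_spec_mult: "map_poly spec (p * q) = map_poly spec p * map_poly spec q"
  by (rule poly_eqI) (simp add: coeff_map_poly coeff_mult spec_sum)

lemma map_poly_spec_smult: "map_poly spec (smult c q) = smult (spec c) (map_poly spec q)"
  by (rule poly_eqI) (simp add: coeff_map_poly)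

lemma map_poly_spec_sum: "map_poly spec (sum f A) = (\<Sum>x\<in>A. map_poly spec (f x))"
  by (rule poly_eqI) (simp add: coeff_map_poly coeff_sum spec_sum)

lemma map_poly_spec_power_sum:
  "map_poly spec (power_sum k s t) = power_sum k (map_poly spec s) (map_poly spec t)"
proof (induction k s t rule: power_sum.induct)
  case (1 s t)
  have "map_poly spec [:2:] = [:2 :: 'a:]" by (simp add: map_poly_pCons)
  then show ?case by (simp add: numeral_poly)
qed (simp_all add: map_poly_spec_diff map_poly_spec_mult)

definition lift_poly :: "'a::comm_ring_1 poly \<Rightarrow> 'a poly poly" where
  "lift_poly w = map_poly (\<lambda>c. [:c:]) w"

lemma degree_lift_poly: "degree (lift_poly w) = degree w"
  unfolding lift_poly_def by (rule degree_map_poly) simp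

lemma coeff_lift_poly: "coeff (lift_poly w) k = [:coeff w k:]"
  by (simp add: lift_poly_def coeff_map_poly)

lemma map_poly_spec_lift_poly: "map_poly spec (lift_poly w) = w"
  by (rule poly_eqI) (simp add: coeff_map_poly coeff_lift_poly)

lemma map_poly_spec_sum_poly1: "map_poly spec (sum_poly1 (lift_poly w) t) = sum_poly1 w (spec t)"
  by (simp add: sum_poly1_def map_poly_spec_sum map_poly_spec_smult degree_lift_poly coeff_lift_poly
      map_poly_spec_power_sum map_poly_pCons)

lemma map_poly_spec_sum_poly2: "map_poly spec (sum_poly2 (lift_poly w) t) = sum_poly2 w (spec t)"
  by (simp add: sum_poly2_def map_poly_spec_sum map_poly_spec_smult degree_lift_poly coeff_lift_poly
      map_poly_spec_power_sum map_poly_pCons)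

lemma spec_thick_u1:
  "spec (thick_u1 (lift_poly w) x1 x2 x3 x4) = thick_u1 w (spec x1) (spec x2) (spec x3) (spec x4)"
  by (simp add: thick_u1_def spec_divided_diff map_poly_spec_sum_poly1)

lemma spec_thick_u2:
  "spec (thick_u2 (lift_poly w) x1 x2 x3 x4) = thick_u2 w (spec x1) (spec x2) (spec x3) (spec x4)"
  by (simp add: thick_u2_def spec_divided_diff map_poly_spec_sum_poly2)

lemma spec_chi_entry:
  "spec (chi_entry (lift_poly w) x1 x2 x3 x4) = chi_entry w (spec x1) (spec x2) (spec x3) (spec x4)"
  by (simp add: chi_entry_def spec_divided_diff2 map_poly_spec_sum_poly2 map_poly_spec_lift_poly)

text \<open>The smoothing and the thick edge have the same potential w(x1) + w(x2) - w(x3) - w(x4).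
  Comparing the two factorizations of it and inserting \<open>chi_entry\<close> gives the claim
  after multiplication by \<open>x1 - x4\<close>.\<close>

lemma chi_entry'_generic:
  fixes x1 x2 x3 x4 :: "'a::idom"
  assumes "x1 \<noteq> x4"
  shows "divided_diff w x1 x4 =
    thick_u1 w x1 x2 x3 x4 + x3 * thick_u2 w x1 x2 x3 x4 + chi_entry w x1 x2 x3 x4 * (x2 - x3)"
proof -
  let ?u1 = "thick_u1 w x1 x2 x3 x4" and ?u2 = "thick_u2 w x1 x2 x3 x4" and ?e = "chi_entry w x1 x2 x3 x4"
  have "(x1 - x4) * (?u1 + x3 * ?u2 + ?e * (x2 - x3)) =
      (x1 - x4) * (?u1 + x3 * ?u2) + (x2 - x3) * ((x1 - x4) * ?e)"
    by (simp add: algebra_simps)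
  also have "\<dots> = ((x1 + x2 - x3 - x4) * ?u1 + (x1 * x2 - x3 * x4) * ?u2) - (x2 - x3) * divided_diff w x2 x3"
    unfolding chi_entry by (simp add: algebra_simps)
  also have "\<dots> = (x1 - x4) * divided_diff w x1 x4"
    unfolding thick_potential divided_diff by simp
  finally show ?thesis using assms by simp
qed

text \<open>Equal arguments must be allowed: at a crossing with a loop, \<open>out1\<close> and
  \<open>in4\<close> can be the same mark. The argument \<open>x4\<close> is deformed to
  \<open>[:x4, 1:]\<close>, which differs from every constant.\<close>

lemma chi_entry':
  fixes x1 x2 x3 x4 :: "'a::idom"
  shows "divided_diff w x1 x4 =
    thick_u1 w x1 x2 x3 x4 + x3 * thick_u2 w x1 x2 x3 x4 + chi_entry w x1 x2 x3 x4 * (x2 - x3)"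
proof -
  have "[:x1:] \<noteq> [:x4, 1:]" by simp
  from arg_cong[OF chi_entry'_generic[OF this, of "lift_poly w" "[:x2:]" "[:x3:]"], of spec]
  show ?thesis
    by (simp only: spec_simps spec_divided_diff map_poly_spec_lift_poly
        spec_thick_u1 spec_thick_u2 spec_chi_entry)
qed

lemma divided_diff_pderiv: "divided_diff q a a = poly (pderiv q) a"
  by (induction q) (simp_all add: pderiv_pCons)

text \<open>The entries of null-homotopies of \<open>w'\<close> at an arc and at a thick edge.\<close>

lemma pderiv_arc: "poly (pderiv w) x = divided_diff w x y * 1 + (x - y) * divided_diff2 w x x y"
  unfolding divided_diff2 by (simp add: divided_diff_pderiv)

definition thick_htpy1 :: "'a::comm_ring_1 poly \<Rightarrow> 'a \<Rightarrow> 'a \<Rightarrow> 'a \<Rightarrow> 'a \<Rightarrow> 'a" where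
  "thick_htpy1 w x1 x2 x3 x4 = divided_diff2 w x2 x2 (x3 + x4 - x1) -
     x1 * x1 * divided_diff2 (sum_poly2 w (x3 + x4)) (x1 * x2) (x1 * (x3 + x4 - x1)) (x3 * x4)"

definition thick_htpy2 :: "'a::comm_ring_1 poly \<Rightarrow> 'a \<Rightarrow> 'a \<Rightarrow> 'a \<Rightarrow> 'a \<Rightarrow> 'a" where
  "thick_htpy2 w x1 x2 x3 x4 =
     x1 * divided_diff2 (sum_poly2 w (x3 + x4)) (x1 * x2) (x1 * (x3 + x4 - x1)) (x3 * x4)"

text \<open>With \<open>y = x3 + x4 - x1\<close> one has w[x2, y] = u1 + x1 Q[x1 x2, x1 y], the
  identity behind \<open>chi_entry\<close>. Passing from w'(x2) = w[x2, x2] to w[x2, y] costs a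
  multiple of x2 - y, which is the first linear entry b1; passing from x1 y to x3 x4 in Q costs a
  multiple of x1 y - x3 x4 = b2 - x1 b1. Collecting the multiples of b1 and b2 gives
  \<open>thick_htpy1\<close> and \<open>thick_htpy2\<close>.\<close>

lemma pderiv_thick:
  "poly (pderiv w) x2 =
    (thick_u1 w x1 x2 x3 x4 * 1 + (x1 + x2 - x3 - x4) * thick_htpy1 w x1 x2 x3 x4) +
    (thick_u2 w x1 x2 x3 x4 * x1 + (x1 * x2 - x3 * x4) * thick_htpy2 w x1 x2 x3 x4)"
proof -
  define y where "y = x3 + x4 - x1"
  define Q where "Q = sum_poly2 w (x3 + x4)"
  have w: "w = (\<Sum>k\<le>degree w. smult (coeff w k) (monom 1 k))"
    by (simp add: smult_monom poly_as_sum_of_monoms)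
  have dw: "divided_diff w x2 y = (\<Sum>k\<le>degree w. coeff w k * divided_diff (monom 1 k) x2 y)"
    by (subst w) (simp add: divided_diff_sum divided_diff_smult)
  have "thick_u1 w x1 x2 x3 x4 + x1 * divided_diff Q (x1 * x2) (x1 * y) =
      (\<Sum>k\<le>degree w. coeff w k *
        (divided_diff (power_sum k [:0, 1:] [:x1 * x2:]) (x1 + x2) (x1 + y) +
         x1 * divided_diff (power_sum k [:x1 + y:] [:0, 1:]) (x1 * x2) (x1 * y)))"
    by (simp add: thick_u1_def Q_def sum_poly1_def sum_poly2_def divided_diff_sum y_def
        divided_diff_smult sum_distrib_left sum.distrib algebra_simps)
  then have E: "divided_diff w x2 y = thick_u1 w x1 x2 x3 x4 + x1 * divided_diff Q (x1 * x2) (x1 * y)"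
    by (simp only: divided_diff_power_sum dw)
  define d where "d = divided_diff2 Q (x1 * x2) (x1 * y) (x3 * x4)"
  define e where "e = divided_diff2 w x2 x2 y"
  have 1: "(x1 * y - x3 * x4) * d = divided_diff Q (x1 * x2) (x1 * y) - thick_u2 w x1 x2 x3 x4"
    unfolding d_def divided_diff2 by (simp add: thick_u2_def Q_def)
  have 2: "(x2 - y) * e = poly (pderiv w) x2 - divided_diff w x2 y"
    unfolding e_def divided_diff2 by (simp add: divided_diff_pderiv)
  have "poly (pderiv w) x2 = (x2 - y) * e + thick_u1 w x1 x2 x3 x4 +
      x1 * ((x1 * y - x3 * x4) * d + thick_u2 w x1 x2 x3 x4)"
    unfolding 1 2 E by (simp add: algebra_simps)
  then show ?thesis
    by (simp add: thick_htpy1_def thick_htpy2_def flip: d_def e_def Q_def y_def)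
      (simp add: y_def algebra_simps)
qed

lemma thick_u_commute:
  "thick_u1 w x1 x2 x3 x4 = thick_u1 w x2 x1 x3 x4" "thick_u2 w x1 x2 x3 x4 = thick_u2 w x2 x1 x3 x4"
  by (simp_all add: thick_u1_def thick_u2_def add.commute mult.commute)

lemma pderiv_thick':
  "poly (pderiv w) x1 =
    (thick_u1 w x1 x2 x3 x4 * 1 + (x1 + x2 - x3 - x4) * thick_htpy1 w x2 x1 x3 x4) +
    (thick_u2 w x1 x2 x3 x4 * x2 + (x1 * x2 - x3 * x4) * thick_htpy2 w x2 x1 x3 x4)"
  using pderiv_thick[of w x1 x2 x3 x4]
  by (simp add: thick_u_commute[of w x1 x2] add.commute[of x1 x2] mult.commute[of x1 x2])

subsection \<open>The Khovanov--Rozansky maps commute with the differential at a crossing\<close>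

text \<open>The two factors of one crossing in isolation; the first factor gets a minus sign when
  the second one sits in its middle term, in accordance with the Koszul signs of
  \<open>mf_diff\<close>.\<close>

fun local_diff :: "'a::comm_ring_1 \<Rightarrow> 'a \<Rightarrow> 'a \<Rightarrow> 'a \<Rightarrow> (bool \<Rightarrow> bool \<Rightarrow> 'a) \<Rightarrow> bool \<Rightarrow> bool \<Rightarrow> 'a" where
  "local_diff a b a' b' t False False = b * t True False + b' * t False True"
| "local_diff a b a' b' t True False = a * t False False + b' * t True True"
| "local_diff a b a' b' t False True = a' * t False False - b * t True True"
| "local_diff a b a' b' t True True = a' * t True False - a * t False True"

context
  fixes w :: "'a::idom poly" and x1 x2 x3 x4 :: 'a
begin

private abbreviation "D0 \<equiv> local_diff (divided_diff w x1 x4) (x1 - x4) (divided_diff w x2 x3) (x2 - x3)"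
private abbreviation "D1 \<equiv> local_diff (thick_u1 w x1 x2 x3 x4) (x1 + x2 - x3 - x4)
  (thick_u2 w x1 x2 x3 x4) (x1 * x2 - x3 * x4)"

private lemma a2: "divided_diff w x2 x3 = thick_u1 w x1 x2 x3 x4 + x1 * thick_u2 w x1 x2 x3 x4 -
    (x1 - x4) * chi_entry w x1 x2 x3 x4"
  unfolding chi_entry by simp

text \<open>The two identities for \<open>chi_entry\<close> express both arc entries by
  \<open>u1\<close>, \<open>u2\<close> and \<open>chi_entry\<close>; in each coordinate a polynomial
  identity remains.\<close>

lemma chi0_local_diff: "D1 (chi0 w x1 x2 x3 x4 t) b b' = chi0 w x1 x2 x3 x4 (D0 t) b b'"
  unfolding chi_entry'[of w x1 x4 x2 x3] a2
  by (cases b; cases b') (simp_all add: algebra_simps)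

lemma chi1_local_diff: "D0 (chi1 w x1 x2 x3 x4 t) b b' = chi1 w x1 x2 x3 x4 (D1 t) b b'"
  unfolding chi_entry'[of w x1 x4 x2 x3] a2
  by (cases b; cases b') (simp_all add: algebra_simps)

end

section \<open>Degrees of polynomials\<close>

text \<open>Bounds are integers in the quantum normalization, where a variable has degree 2. For
  negative \<open>d\<close> only \<open>0\<close> is left, so bounds may be subtracted
  freely.\<close>

definition QDeg :: "nat set \<Rightarrow> int \<Rightarrow> mpoly set" where
  "QDeg V d = {f \<in> mpolys V. \<forall>m\<in>Poly_Mapping.keys f. 2 * int (monom_degree m) \<le> d}"

lemma monom_degree_superset:
  assumes "finite A" "Poly_Mapping.keys m \<subseteq> A"
  shows "monom_degree m = (\<Sum>i\<in>A. Poly_Mapping.lookup m i)"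
  unfolding monom_degree_def using assms
  by (intro sum.mono_neutral_left) (auto simp: in_keys_iff)

lemma monom_degree_add: "monom_degree (m + m') = monom_degree m + monom_degree m'"
proof -
  let ?A = "Poly_Mapping.keys m \<union> Poly_Mapping.keys m'"
  have "monom_degree (m + m') = (\<Sum>i\<in>?A. Poly_Mapping.lookup (m + m') i)"
    by (rule monom_degree_superset) (auto simp: keys_add_nat)
  then show ?thesis
    by (simp add: monom_degree_superset[of ?A] lookup_add sum.distrib)
qed

lemma monom_degree_single [simp]: "monom_degree (Poly_Mapping.single i k) = k"
  by (simp add: monom_degree_def)

lemma QDeg_0 [simp]: "0 \<in> QDeg V d"
  by (simp add: QDeg_def)

lemma QDeg_mpolys: "f \<in> QDeg V d \<Longrightarrow> f \<in> mpolys V"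
  by (simp add: QDeg_def)

lemma QDeg_mono: "f \<in> QDeg V d \<Longrightarrow> d \<le> d' \<Longrightarrow> f \<in> QDeg V d'"
  by (fastforce simp: QDeg_def)

lemma QDeg_add: "f \<in> QDeg V d \<Longrightarrow> g \<in> QDeg V d \<Longrightarrow> f + g \<in> QDeg V d"
  using keys_add[of f g] by (auto simp: QDeg_def mpolys_add)

lemma mpolys_uminus: "f \<in> mpolys V \<Longrightarrow> - f \<in> mpolys V"
  by (simp add: mpolys_def)

lemma QDeg_uminus: "f \<in> QDeg V d \<Longrightarrow> - f \<in> QDeg V d"
  by (simp add: QDeg_def mpolys_uminus)

lemma QDeg_diff: "f \<in> QDeg V d \<Longrightarrow> g \<in> QDeg V d \<Longrightarrow> f - g \<in> QDeg V d"
  using QDeg_add[of f V d "- g"] QDeg_uminus[of g V d] by simp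

lemma QDeg_sum: "(\<And>x. x \<in> A \<Longrightarrow> f x \<in> QDeg V d) \<Longrightarrow> sum f A \<in> QDeg V d"
  by (induction A rule: infinite_finite_induct) (auto intro: QDeg_add)

lemma QDeg_mult:
  assumes "f \<in> QDeg V d" "g \<in> QDeg V d'"
  shows "f * g \<in> QDeg V (d + d')"
proof -
  have "2 * int (monom_degree m) \<le> d + d'" if m: "m \<in> Poly_Mapping.keys (f * g)" for m
  proof -
    obtain a b where "m = a + b" "a \<in> Poly_Mapping.keys f" "b \<in> Poly_Mapping.keys g"
      using m keys_mult[of f g] by blast
    then show ?thesis using assms by (fastforce simp: QDeg_def monom_degree_add)
  qed
  then show ?thesis using assms by (simp add: QDeg_def mpolys_mult)
qed

lemma QDeg_Const: "0 \<le> d \<Longrightarrow> Const c \<in> QDeg V d"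
  by (simp add: QDeg_def) (simp add: Const_def monom_degree_def)

lemma QDeg_Var: "i \<in> V \<Longrightarrow> 2 \<le> d \<Longrightarrow> Var i \<in> QDeg V d"
  by (simp add: QDeg_def) (simp add: Var_def)

lemma Const_1: "Const 1 = 1"
  by (simp add: Const_def)

lemma QDeg_1: "0 \<le> d \<Longrightarrow> 1 \<in> QDeg V d"
  using QDeg_Const[of d 1 V] by (simp add: Const_1)

text \<open>Weighted degree for a polynomial whose own variable has weight \<open>e\<close>. Both
  \<open>e = 2\<close> (a mark or a sum of marks) and \<open>e = 4\<close> (a product of two marks)
  occur, for \<open>sum_poly1\<close> and \<open>sum_poly2\<close>.\<close>

definition PDeg :: "nat set \<Rightarrow> int \<Rightarrow> int \<Rightarrow> mpoly poly set" where
  "PDeg V e d = {q. \<forall>i. coeff q i \<in> QDeg V (d - e * int i)}"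

lemma PDeg_0 [simp]: "0 \<in> PDeg V e d"
  by (simp add: PDeg_def)

lemma PDeg_add: "p \<in> PDeg V e d \<Longrightarrow> q \<in> PDeg V e d \<Longrightarrow> p + q \<in> PDeg V e d"
  by (simp add: PDeg_def QDeg_add)

lemma PDeg_diff: "p \<in> PDeg V e d \<Longrightarrow> q \<in> PDeg V e d \<Longrightarrow> p - q \<in> PDeg V e d"
  by (simp add: PDeg_def QDeg_diff)

lemma PDeg_sum: "(\<And>x. x \<in> A \<Longrightarrow> f x \<in> PDeg V e d) \<Longrightarrow> sum f A \<in> PDeg V e d"
  by (induction A rule: infinite_finite_induct) (auto intro: PDeg_add)

lemma PDeg_mult:
  assumes "p \<in> PDeg V e d" "q \<in> PDeg V e d'"
  shows "p * q \<in> PDeg V e (d + d')"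
proof -
  have "coeff (p * q) i \<in> QDeg V (d + d' - e * int i)" for i
    unfolding coeff_mult
  proof (rule QDeg_sum)
    fix k assume "k \<in> {..i}"
    then obtain l where l: "i = k + l" using le_Suc_ex by auto
    then have "(d - e * int k) + (d' - e * int (i - k)) = d + d' - e * int i"
      by (simp add: algebra_simps)
    moreover have "coeff p k * coeff q (i - k) \<in> QDeg V ((d - e * int k) + (d' - e * int (i - k)))"
      using assms by (intro QDeg_mult) (simp_all add: PDeg_def)
    ultimately show "coeff p k * coeff q (i - k) \<in> QDeg V (d + d' - e * int i)" by (simp only:)
  qed
  then show ?thesis by (simp add: PDeg_def)
qed

lemma PDeg_smult:
  assumes "c \<in> QDeg V d" "q \<in> PDeg V e d'"
  shows "smult c q \<in> PDeg V e (d + d')"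
  unfolding PDeg_def
proof (intro CollectI allI)
  fix i
  have "c * coeff q i \<in> QDeg V (d + (d' - e * int i))"
    using assms by (intro QDeg_mult) (simp_all add: PDeg_def)
  then show "coeff (smult c q) i \<in> QDeg V (d + d' - e * int i)" by (simp add: algebra_simps)
qed

lemma PDeg_const: "c \<in> QDeg V d \<Longrightarrow> [:c:] \<in> PDeg V e d"
  by (auto simp: PDeg_def coeff_pCons split: nat.splits)

lemma PDeg_X: "0 \<le> d - e \<Longrightarrow> [:0, 1:] \<in> PDeg V e d"
  by (auto simp: PDeg_def coeff_pCons QDeg_1 split: nat.splits)

lemma PDeg_mono: "q \<in> PDeg V e d \<Longrightarrow> d \<le> d' \<Longrightarrow> q \<in> PDeg V e d'"
  by (auto simp: PDeg_def intro: QDeg_mono)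

lemma PDeg_pCons: "pCons c q \<in> PDeg V e d \<longleftrightarrow> c \<in> QDeg V d \<and> q \<in> PDeg V e (d - e)"
proof
  assume *: "pCons c q \<in> PDeg V e d"
  have "coeff q i \<in> QDeg V (d - e - e * int i)" for i
    using *[unfolded PDeg_def, simplified, rule_format, of "Suc i"] by (simp add: algebra_simps)
  then show "c \<in> QDeg V d \<and> q \<in> PDeg V e (d - e)"
    using *[unfolded PDeg_def, simplified, rule_format, of 0] by (simp add: PDeg_def)
next
  assume "c \<in> QDeg V d \<and> q \<in> PDeg V e (d - e)"
  then show "pCons c q \<in> PDeg V e d"
    by (auto simp: PDeg_def coeff_pCons algebra_simps split: nat.splits)
qed

lemma QDeg_poly: "q \<in> PDeg V e d \<Longrightarrow> a \<in> QDeg V e \<Longrightarrow> poly q a \<in> QDeg V d"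
proof (induction q arbitrary: d)
  case (pCons c q)
  then have "a * poly q a \<in> QDeg V (e + (d - e))" by (intro QDeg_mult) (simp_all add: PDeg_pCons)
  then show ?case using pCons.prems by (simp add: PDeg_pCons QDeg_add)
qed simp

lemma QDeg_divided_diff:
  "q \<in> PDeg V e d \<Longrightarrow> a \<in> QDeg V e \<Longrightarrow> b \<in> QDeg V e \<Longrightarrow> divided_diff q a b \<in> QDeg V (d - e)"
proof (induction q arbitrary: d)
  case (pCons c q)
  then have q: "q \<in> PDeg V e (d - e)" by (simp add: PDeg_pCons)
  have "a * divided_diff q a b \<in> QDeg V (e + (d - e - e))"
    by (rule QDeg_mult[OF pCons.prems(2) pCons.IH[OF q pCons.prems(2,3)]])
  then show ?case using QDeg_poly[OF q] pCons.prems by (simp add: QDeg_add)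
qed simp

lemma QDeg_divided_diff2:
  "q \<in> PDeg V e d \<Longrightarrow> a \<in> QDeg V e \<Longrightarrow> b \<in> QDeg V e \<Longrightarrow> c \<in> QDeg V e \<Longrightarrow>
    divided_diff2 q a b c \<in> QDeg V (d - 2 * e)"
proof (induction q arbitrary: d)
  case 0
  then show ?case by (simp add: divided_diff2_def)
next
  case (pCons c0 q)
  then have q: "q \<in> PDeg V e (d - e)" by (simp add: PDeg_pCons)
  have "b * divided_diff2 q a b c \<in> QDeg V (e + (d - e - 2 * e))"
    by (rule QDeg_mult[OF pCons.prems(3) pCons.IH[OF q pCons.prems(2-4)]])
  moreover have "divided_diff q c a \<in> QDeg V (d - e - e)"
    by (rule QDeg_divided_diff[OF q]) (use pCons.prems in auto)
  ultimately show ?case by (simp add: divided_diff2_pCons QDeg_add)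
qed

lemma PDeg_power_sum:
  "s \<in> PDeg V e 2 \<Longrightarrow> t \<in> PDeg V e 4 \<Longrightarrow> power_sum k s t \<in> PDeg V e (2 * int k)"
proof (induction k s t rule: power_sum.induct)
  case (1 s t)
  have "Const 2 = 2" by (simp add: Const_def)
  then have "2 \<in> QDeg V 0" using QDeg_Const[of 0 2 V] by simp
  from PDeg_const[OF this] show ?case by (simp add: numeral_poly)
next
  case (3 k s t)
  have "s * power_sum (Suc k) s t \<in> PDeg V e (2 + 2 * int (Suc k))"
    using 3 by (intro PDeg_mult) simp_all
  moreover have "t * power_sum k s t \<in> PDeg V e (4 + 2 * int k)"
    using 3 by (intro PDeg_mult) simp_all
  ultimately show ?case by (simp add: PDeg_diff algebra_simps)
qed simp

lemma PDeg_sum_power_sum: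
  assumes w: "w \<in> PDeg V 2 d" and "s \<in> PDeg V e 2" "t \<in> PDeg V e 4"
  shows "(\<Sum>k\<le>degree w. smult (coeff w k) (power_sum k s t)) \<in> PDeg V e d"
proof (rule PDeg_sum)
  fix k
  have "smult (coeff w k) (power_sum k s t) \<in> PDeg V e ((d - 2 * int k) + 2 * int k)"
    using w by (intro PDeg_smult PDeg_power_sum assms(2,3)) (simp add: PDeg_def)
  then show "smult (coeff w k) (power_sum k s t) \<in> PDeg V e d" by simp
qed

lemma PDeg_sum_poly1: "w \<in> PDeg V 2 d \<Longrightarrow> t \<in> QDeg V 4 \<Longrightarrow> sum_poly1 w t \<in> PDeg V 2 d"
  unfolding sum_poly1_def by (intro PDeg_sum_power_sum PDeg_const PDeg_X) simp_all

lemma PDeg_sum_poly2: "w \<in> PDeg V 2 d \<Longrightarrow> s \<in> QDeg V 2 \<Longrightarrow> sum_poly2 w s \<in> PDeg V 4 d"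
  unfolding sum_poly2_def by (intro PDeg_sum_power_sum PDeg_const PDeg_X) simp_all

lemma QDeg_mult_22: "f \<in> QDeg V 2 \<Longrightarrow> g \<in> QDeg V 2 \<Longrightarrow> f * g \<in> QDeg V 4"
  using QDeg_mult[of f V 2 g 2] by simp

context
  fixes w V d x1 x2 x3 x4
  assumes w: "w \<in> PDeg V 2 d"
    and x: "x1 \<in> QDeg V 2" "x2 \<in> QDeg V 2" "x3 \<in> QDeg V 2" "x4 \<in> QDeg V 2"
begin

lemma QDeg_thick_u1: "thick_u1 w x1 x2 x3 x4 \<in> QDeg V (d - 2)"
  unfolding thick_u1_def by (intro QDeg_divided_diff PDeg_sum_poly1 w QDeg_add QDeg_mult_22 x)

lemma QDeg_thick_u2: "thick_u2 w x1 x2 x3 x4 \<in> QDeg V (d - 4)"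
  unfolding thick_u2_def by (intro QDeg_divided_diff PDeg_sum_poly2 w QDeg_add QDeg_mult_22 x)

lemma QDeg_chi_entry: "chi_entry w x1 x2 x3 x4 \<in> QDeg V (d - 4)"
proof -
  have "x1 * (x1 - x3) * divided_diff2 (sum_poly2 w (x3 + x4)) (x1 * x2) (x3 * x4) (x1 * (x3 + x4 - x1))
      \<in> QDeg V (4 + (d - 2 * 4))"
    by (intro QDeg_mult[of _ V 4] QDeg_divided_diff2 PDeg_sum_poly2 w QDeg_add QDeg_diff QDeg_mult_22 x)
  moreover have "divided_diff2 w x2 x3 (x3 + x4 - x1) \<in> QDeg V (d - 2 * 2)"
    by (intro QDeg_divided_diff2 w QDeg_add QDeg_diff x)
  ultimately show ?thesis unfolding chi_entry_def by (intro QDeg_diff) simp_all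
qed

lemma QDeg_thick_htpy1: "thick_htpy1 w x1 x2 x3 x4 \<in> QDeg V (d - 4)"
proof -
  have "x1 * x1 * divided_diff2 (sum_poly2 w (x3 + x4)) (x1 * x2) (x1 * (x3 + x4 - x1)) (x3 * x4)
      \<in> QDeg V (4 + (d - 2 * 4))"
    by (intro QDeg_mult[of _ V 4] QDeg_divided_diff2 PDeg_sum_poly2 w QDeg_add QDeg_diff QDeg_mult_22 x)
  moreover have "divided_diff2 w x2 x2 (x3 + x4 - x1) \<in> QDeg V (d - 2 * 2)"
    by (intro QDeg_divided_diff2 w QDeg_add QDeg_diff x)
  ultimately show ?thesis unfolding thick_htpy1_def by (intro QDeg_diff) simp_all
qed

lemma QDeg_thick_htpy2: "thick_htpy2 w x1 x2 x3 x4 \<in> QDeg V (d - 6)"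
proof -
  have "x1 * divided_diff2 (sum_poly2 w (x3 + x4)) (x1 * x2) (x1 * (x3 + x4 - x1)) (x3 * x4)
      \<in> QDeg V (2 + (d - 2 * 4))"
    by (intro QDeg_mult[of _ V 2] QDeg_divided_diff2 PDeg_sum_poly2 w QDeg_add QDeg_diff QDeg_mult_22 x)
  then show ?thesis unfolding thick_htpy2_def by simp
qed

end

section \<open>The differentials of the cube of matrix factorizations\<close>

subsection \<open>Koszul operators\<close>

definition toggle :: "nat \<Rightarrow> nat set \<Rightarrow> nat set" where
  "toggle k S = (if k \<in> S then S - {k} else insert k S)"

definition ksign :: "nat \<Rightarrow> nat set \<Rightarrow> mpoly" where
  "ksign k S = (- 1) ^ card {l \<in> S. k < l}"

definition kos_term :: "(nat set \<Rightarrow> nat \<Rightarrow> mpoly) \<Rightarrow> (nat set \<Rightarrow> nat \<Rightarrow> mpoly) \<Rightarrow> cube_elem \<Rightarrow> nat set \<Rightarrow> nat set \<Rightarrow> nat \<Rightarrow> mpoly" where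
  "kos_term a b z v S k = ksign k S * (if k \<in> S then a v k else b v k) * z (v, toggle k S)"

text \<open>The entries are arbitrary and may depend on the vertex: the differentials of the matrix
  factorizations and their null-homotopies are both of this form, so one anticommutator formula
  serves for both.\<close>

definition kos :: "nat \<Rightarrow> (nat set \<Rightarrow> nat \<Rightarrow> mpoly) \<Rightarrow> (nat set \<Rightarrow> nat \<Rightarrow> mpoly) \<Rightarrow> cube_elem \<Rightarrow> cube_elem" where
  "kos N a b z = (\<lambda>(v, S). \<Sum>k<N. kos_term a b z v S k)"

lemma kos_apply: "kos N a b z (v, S) = (\<Sum>k<N. kos_term a b z v S k)"
  by (simp add: kos_def)

lemma mem_toggle: "l \<in> toggle k S \<longleftrightarrow> (if l = k then k \<notin> S else l \<in> S)"
  by (auto simp: toggle_def)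

lemma toggle_toggle [simp]: "toggle k (toggle k S) = S"
  by (auto simp: toggle_def)

lemma toggle_commute: "toggle k (toggle l S) = toggle l (toggle k S)"
  by (auto simp: mem_toggle split: if_splits)

lemma finite_toggle [simp]: "finite (toggle k S) \<longleftrightarrow> finite S"
  by (simp add: toggle_def)

lemma ksign_square: "ksign k S * ksign k S = 1"
  by (simp add: ksign_def flip: power_add mult_2)

lemma ksign_insert: "finite S \<Longrightarrow> k \<notin> S \<Longrightarrow> ksign l (insert k S) = (if l < k then - ksign l S else ksign l S)"
proof -
  assume S: "finite S" "k \<notin> S"
  have "{j \<in> insert k S. l < j} = (if l < k then insert k {j \<in> S. l < j} else {j \<in> S. l < j})"
    by auto
  then show ?thesis using S by (simp add: ksign_def)
qed

lemma ksign_toggle: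
  assumes "finite S"
  shows "ksign l (toggle k S) = (if l < k then - ksign l S else ksign l S)"
proof (cases "k \<in> S")
  case True
  then have "S = insert k (toggle k S)" "k \<notin> toggle k S" by (auto simp: toggle_def)
  then show ?thesis using ksign_insert[of "toggle k S" k l] assms by auto
next
  case False
  then show ?thesis using ksign_insert[of S k l] assms by (simp add: toggle_def)
qed

lemma ksign_anticommute:
  assumes "finite S" "k \<noteq> l"
  shows "ksign k S * ksign l (toggle k S) = - (ksign l S * ksign k (toggle l S))"
  using assms(2) by (simp add: ksign_toggle[OF assms(1)] linorder_neq_iff) (auto simp: mult.commute)

lemma sum_anticommuting:
  fixes f g :: "nat \<Rightarrow> nat \<Rightarrow> 'a::ab_group_add"
  assumes "finite A" "\<And>k l. k \<in> A \<Longrightarrow> l \<in> A \<Longrightarrow> k \<noteq> l \<Longrightarrow> f k l + g l k = 0"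
  shows "(\<Sum>k\<in>A. \<Sum>l\<in>A. f k l) + (\<Sum>k\<in>A. \<Sum>l\<in>A. g k l) = (\<Sum>k\<in>A. f k k + g k k)"
proof -
  have "(\<Sum>k\<in>A. \<Sum>l\<in>A. g k l) = (\<Sum>k\<in>A. \<Sum>l\<in>A. g l k)" by (rule sum.swap)
  then have "(\<Sum>k\<in>A. \<Sum>l\<in>A. f k l) + (\<Sum>k\<in>A. \<Sum>l\<in>A. g k l) = (\<Sum>k\<in>A. \<Sum>l\<in>A. f k l + g l k)"
    by (simp add: sum.distrib)
  also have "\<dots> = (\<Sum>k\<in>A. \<Sum>l\<in>A. if l = k then f k k + g k k else 0)"
    by (intro sum.cong refl) (use assms(2) in auto)
  also have "\<dots> = (\<Sum>k\<in>A. f k k + g k k)" using assms(1) by simp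
  finally show ?thesis .
qed

text \<open>The Koszul signs make the terms for different indices anticommute.\<close>

lemma kos_anticommutator:
  assumes S: "finite S"
  shows "kos N a b (kos N a' b' z) (v, S) + kos N a' b' (kos N a b z) (v, S) =
    (\<Sum>k<N. a v k * b' v k + b v k * a' v k) * z (v, S)"
proof -
  let ?c = "\<lambda>a b k S. if k \<in> S then a v k else b v k"
  have expand: "kos N a b (kos N a' b' z) (v, S) =
      (\<Sum>k<N. \<Sum>l<N. ksign k S * ?c a b k S * (ksign l (toggle k S) * ?c a' b' l (toggle k S) * z (v, toggle l (toggle k S))))"
    for a b a' b' :: "nat set \<Rightarrow> nat \<Rightarrow> mpoly"
    by (simp add: kos_apply kos_term_def sum_distrib_left)
  have "kos N a b (kos N a' b' z) (v, S) + kos N a' b' (kos N a b z) (v, S) =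
    (\<Sum>k<N. ksign k S * ?c a b k S * (ksign k (toggle k S) * ?c a' b' k (toggle k S) * z (v, toggle k (toggle k S))) +
       ksign k S * ?c a' b' k S * (ksign k (toggle k S) * ?c a b k (toggle k S) * z (v, toggle k (toggle k S))))"
    unfolding expand
  proof (rule sum_anticommuting)
    fix k l :: nat assume kl: "k \<noteq> l"
    let ?p = "?c a b k S * ?c a' b' l S * z (v, toggle k (toggle l S))"
    have "ksign k S * ?c a b k S * (ksign l (toggle k S) * ?c a' b' l (toggle k S) * z (v, toggle l (toggle k S))) =
        (ksign k S * ksign l (toggle k S)) * ?p"
      using kl by (simp only: toggle_commute[of l k] mem_toggle) simp
    moreover have "ksign l S * ?c a' b' l S * (ksign k (toggle l S) * ?c a b k (toggle l S) * z (v, toggle k (toggle l S))) =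
        (ksign l S * ksign k (toggle l S)) * ?p"
      using kl by (simp only: mem_toggle) simp
    ultimately show "ksign k S * ?c a b k S * (ksign l (toggle k S) * ?c a' b' l (toggle k S) * z (v, toggle l (toggle k S))) +
        ksign l S * ?c a' b' l S * (ksign k (toggle l S) * ?c a b k (toggle l S) * z (v, toggle k (toggle l S))) = 0"
      unfolding ksign_anticommute[OF S kl] by simp
  qed simp
  also have "\<dots> = (\<Sum>k<N. (a v k * b' v k + b v k * a' v k) * z (v, S))"
  proof (rule sum.cong)
    fix k
    have sq: "ksign k S * x * (ksign k (toggle k S) * y * u) = x * y * u" for x y u
    proof -
      have "ksign k S * x * (ksign k (toggle k S) * y * u) = (ksign k S * ksign k S) * (x * y * u)"
        by (simp add: ksign_toggle[OF S])
      then show ?thesis by (simp add: ksign_square)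
    qed
    show "ksign k S * ?c a b k S * (ksign k (toggle k S) * ?c a' b' k (toggle k S) * z (v, toggle k (toggle k S))) +
       ksign k S * ?c a' b' k S * (ksign k (toggle k S) * ?c a b k (toggle k S) * z (v, toggle k (toggle k S))) =
       (a v k * b' v k + b v k * a' v k) * z (v, S)"
      unfolding sq by (cases "k \<in> S") (simp_all add: mem_toggle algebra_simps)
  qed simp
  finally show ?thesis by (simp add: sum_distrib_right)
qed

lemma mpoly_double_cancel: "f + f = g + g \<Longrightarrow> f = g" for f g :: mpoly
proof (rule poly_mapping_eqI)
  fix k assume "f + f = g + g"
  then have "Poly_Mapping.lookup (f + f) k = Poly_Mapping.lookup (g + g) k" by (simp only:)
  then show "Poly_Mapping.lookup f k = Poly_Mapping.lookup g k" unfolding lookup_add by simp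
qed

text \<open>The square is half the anticommutator of the operator with itself, and \<open>2\<close>
  can be cancelled over the complex numbers.\<close>

lemma kos_kos:
  assumes "finite S"
  shows "kos N a b (kos N a b z) (v, S) = (\<Sum>k<N. a v k * b v k) * z (v, S)"
  by (rule mpoly_double_cancel, subst kos_anticommutator[OF assms])
    (simp add: mult.commute sum.distrib distrib_right flip: sum_distrib_left)

subsection \<open>The factors\<close>

definition piece :: "diagram \<Rightarrow> int \<Rightarrow> mpoly poly \<Rightarrow> nat set \<Rightarrow> nat \<Rightarrow> factor list" where
  "piece D n w v c = (if thick D v c then thick_factors n w (crossings D ! c)
                      else smoothing_factors n w (crossings D ! c))"

lemma factors_piece:
  "factors D n w v = concat (map (piece D n w v) [0..<length (crossings D)]) @
    map (\<lambda>(j, i). arc_factor n w j i) (arcs D)"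
  by (simp add: factors_def piece_def[abs_def])

lemma length_piece [simp]: "length (piece D n w v c) = 2"
  by (simp add: piece_def thick_factors_def smoothing_factors_def Let_def)

lemma length_concat_pairs: "(\<And>x. length (f x) = 2) \<Longrightarrow> length (concat (map f xs)) = 2 * length xs"
  by (induction xs) simp_all

lemma nth_concat_pairs:
  assumes "\<And>x. length (f x) = 2" "c < length xs" "b < 2"
  shows "concat (map f xs) ! (2 * c + b) = f (xs ! c) ! b"
  using assms(2)
proof (induction xs arbitrary: c)
  case (Cons x xs)
  then show ?case using assms(1)[of x] assms(3) by (cases c) (simp_all add: nth_append)
qed simp

lemma length_factors [simp]: "length (factors D n w v) = num_factors D"
  unfolding factors_piece num_factors_def by (simp add: length_concat_pairs del: length_concat)

lemma factors_nth_piece: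
  assumes "c < length (crossings D)" "b < 2"
  shows "factors D n w v ! (2 * c + b) = piece D n w v c ! b"
proof -
  have "factors D n w v ! (2 * c + b) = concat (map (piece D n w v) [0..<length (crossings D)]) ! (2 * c + b)"
    unfolding factors_piece using assms by (simp add: nth_append length_concat_pairs del: length_concat)
  then show ?thesis using nth_concat_pairs[of "piece D n w v" c "[0..<length (crossings D)]" b] assms by simp
qed

lemma factors_nth_arc:
  assumes "i < length (arcs D)"
  shows "factors D n w v ! (2 * length (crossings D) + i) = (\<lambda>(j, i). arc_factor n w j i) (arcs D ! i)"
  unfolding factors_piece using assms by (simp add: nth_append length_concat_pairs del: length_concat)

lemma factors_remove:
  assumes "k < num_factors D" "k \<noteq> 2 * c" "k \<noteq> 2 * c + 1"
  shows "factors D n w (v - {c}) ! k = factors D n w v ! k"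
proof (cases "k < 2 * length (crossings D)")
  case True
  define c' b where "c' = k div 2" and "b = k mod 2"
  have k: "k = 2 * c' + b" "c' < length (crossings D)" "b < 2" using True by (auto simp: c'_def b_def)
  then have "c' \<noteq> c" using assms(2,3) by (auto simp: less_2_cases_iff)
  then have "piece D n w (v - {c}) c' = piece D n w v c'" by (simp add: piece_def thick_def)
  then show ?thesis unfolding k(1) factors_nth_piece[OF k(2,3)] by simp
next
  case False
  define i where "i = k - 2 * length (crossings D)"
  have "k = 2 * length (crossings D) + i" "i < length (arcs D)"
    using False assms(1) by (auto simp: i_def num_factors_def)
  then show ?thesis by (simp add: factors_nth_arc)
qed

lemma sum_factors: "(\<Sum>k<num_factors D. f (factors D n w v ! k)) = sum_list (map f (factors D n w v))"
  for f :: "factor \<Rightarrow> 'a::comm_monoid_add"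
  by (simp add: sum_list_sum_nth atLeast0LessThan)

lemma sum_list_concat: "sum_list (concat xss) = sum_list (map sum_list xss)"
  by (induction xss) simp_all

definition fac_a :: "diagram \<Rightarrow> int \<Rightarrow> mpoly poly \<Rightarrow> nat set \<Rightarrow> nat \<Rightarrow> mpoly" where
  "fac_a D n w v k = fst (factors D n w v ! k)"
definition fac_b :: "diagram \<Rightarrow> int \<Rightarrow> mpoly poly \<Rightarrow> nat set \<Rightarrow> nat \<Rightarrow> mpoly" where
  "fac_b D n w v k = fst (snd (factors D n w v ! k))"
definition fac_shift :: "diagram \<Rightarrow> int \<Rightarrow> mpoly poly \<Rightarrow> nat set \<Rightarrow> nat \<Rightarrow> int" where
  "fac_shift D n w v k = snd (snd (factors D n w v ! k))"

lemma mf_diff_kos: "mf_diff D n w = kos (num_factors D) (fac_a D n w) (fac_b D n w)"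
proof (intro ext)
  fix z :: cube_elem and s :: "nat set \<times> nat set"
  obtain v S where s: "s = (v, S)" by fastforce
  show "mf_diff D n w z s = kos (num_factors D) (fac_a D n w) (fac_b D n w) z s"
    unfolding s mf_diff_def kos_apply prod.case
    by (rule sum.cong)
      (auto simp: kos_term_def ksign_def toggle_def fac_a_def fac_b_def case_prod_beta mult.assoc)
qed

text \<open>Each piece contributes w at its outgoing marks minus w at its incoming ones. In a closed
  diagram every mark is outgoing once and incoming once, and everything cancels.\<close>

lemma sum_potentials:
  assumes "link_diagram D"
  shows "(\<Sum>k<num_factors D. fac_a D n w v k * fac_b D n w v k) = 0"
proof -
  let ?f = "\<lambda>x :: factor. fst x * fst (snd x)"
  let ?W = "\<lambda>m. poly w (Var m)"
  let ?X = "crossings D"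
  have piece: "sum_list (map ?f (piece D n w v c)) =
      (\<lambda>X. ?W (out1 X) + ?W (out2 X) - ?W (in3 X) - ?W (in4 X)) (?X ! c)" for c
  proof (cases "thick D v c")
    case True
    then show ?thesis
      using thick_potential[of "Var (out1 (?X ! c))" "Var (out2 (?X ! c))" "Var (in3 (?X ! c))" "Var (in4 (?X ! c))" w]
      by (simp add: piece_def thick_factors_def Let_def mult.commute)
  next
    case False
    then show ?thesis
      using divided_diff[of "Var (out1 (?X ! c))" "Var (in4 (?X ! c))" w] divided_diff[of "Var (out2 (?X ! c))" "Var (in3 (?X ! c))" w]
      by (simp add: piece_def smoothing_factors_def arc_factor_def mult.commute)
  qed
  have arc: "?f ((\<lambda>(j, i). arc_factor n w j i) x) = ?W (snd x) - ?W (fst x)" for x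
    using divided_diff[of "Var (snd x)" "Var (fst x)" w] by (simp add: arc_factor_def case_prod_beta mult.commute)
  have "(\<Sum>k<num_factors D. fac_a D n w v k * fac_b D n w v k) = sum_list (map ?f (factors D n w v))"
    unfolding fac_a_def fac_b_def by (rule sum_factors)
  also have "\<dots> = sum_list (map (\<lambda>c. sum_list (map ?f (piece D n w v c))) [0..<length ?X]) +
      sum_list (map (\<lambda>x. ?f ((\<lambda>(j, i). arc_factor n w j i) x)) (arcs D))"
    unfolding factors_piece by (simp add: map_concat sum_list_concat comp_def)
  also have "\<dots> = sum_list (map (\<lambda>X. ?W (out1 X) + ?W (out2 X) - ?W (in3 X) - ?W (in4 X)) ?X) +
      sum_list (map (\<lambda>x. ?W (snd x) - ?W (fst x)) (arcs D))"
    unfolding piece arc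
    by (subst (3) map_nth[symmetric]) (simp add: comp_def del: map_nth)
  also have "\<dots> = sum_list (map ?W (out_marks D)) - sum_list (map ?W (in_marks D))"
    by (simp add: out_marks_def in_marks_def map_concat sum_list_concat comp_def sum_list_addf sum_list_subtractf)
  also have "\<dots> = 0"
    using assms by (simp add: link_diagram_def sum_list_distinct_conv_sum_set)
  finally show ?thesis .
qed

lemma mf_diff_mf_diff:
  assumes "link_diagram D" "\<And>v S. z (v, S) \<noteq> 0 \<Longrightarrow> finite S"
  shows "mf_diff D n w (mf_diff D n w z) = 0"
proof
  fix s :: "nat set \<times> nat set"
  obtain v S where s: "s = (v, S)" by fastforce
  show "mf_diff D n w (mf_diff D n w z) s = 0 s"
  proof (cases "finite S")
    case True
    then show ?thesis by (simp add: s mf_diff_kos kos_kos sum_potentials[OF assms(1)])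
  next
    \<comment> \<open>The Koszul signs behave well for finite sets only; at an infinite
      \<open>S\<close> all the coordinates involved vanish.\<close>
    case False
    then have "z (v, toggle l (toggle k S)) = 0" for k l
      using assms(2)[of v "toggle l (toggle k S)"] by auto
    then show ?thesis by (simp add: s mf_diff_kos kos_apply kos_term_def)
  qed
qed

subsection \<open>The Khovanov--Rozansky maps\<close>

definition chi_map :: "crossing \<Rightarrow> mpoly poly \<Rightarrow> (bool \<Rightarrow> bool \<Rightarrow> mpoly) \<Rightarrow> bool \<Rightarrow> bool \<Rightarrow> mpoly" where
  "chi_map X w = (if positive X then chi0 else chi1) w (Var (out1 X)) (Var (out2 X)) (Var (in3 X)) (Var (in4 X))"

definition chi_op :: "diagram \<Rightarrow> mpoly poly \<Rightarrow> nat \<Rightarrow> cube_elem \<Rightarrow> nat set \<Rightarrow> nat set \<Rightarrow> mpoly" where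
  "chi_op D w c z v S = chi_map (crossings D ! c) w (\<lambda>b b'. z (v - {c}, set_bits c S b b')) (2 * c \<in> S) (2 * c + 1 \<in> S)"

lemma cube_diff_chi_op:
  "cube_diff D w z (v, S) =
    (\<Sum>c | c \<in> v \<and> c < length (crossings D). (- 1) ^ card {c' \<in> v. c' < c} * chi_op D w c z v S)"
  by (simp add: cube_diff_def chi_op_def chi_map_def Let_def)

text \<open>The entries of \<open>chi_map\<close> vanish between basis elements of different parity.\<close>

lemma chi_map_cong:
  assumes "\<And>b b'. (b = b') = (f = f') \<Longrightarrow> t b b' = r * t' b b'"
  shows "chi_map X w t f f' = r * chi_map X w t' f f'"
  using assms[of False False] assms[of False True] assms[of True False] assms[of True True]
  by (cases f; cases f') (simp_all add: chi_map_def algebra_simps)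

lemma chi_map_scale: "chi_map X w (\<lambda>b b'. r * t b b') f f' = r * chi_map X w t f f'"
  by (rule chi_map_cong) simp

lemma chi_map_add: "chi_map X w (\<lambda>b b'. t b b' + t' b b') f f' = chi_map X w t f f' + chi_map X w t' f f'"
  by (cases f; cases f') (simp_all add: chi_map_def algebra_simps)

lemma chi_map_0: "chi_map X w (\<lambda>b b'. 0) f f' = 0"
  using chi_map_scale[of X w 0 "\<lambda>_ _. 0"] by simp

lemma chi_map_sum: "chi_map X w (\<lambda>b b'. \<Sum>k\<in>A. t k b b') f f' = (\<Sum>k\<in>A. chi_map X w (t k) f f')"
  by (induction A rule: infinite_finite_induct) (simp_all add: chi_map_0 chi_map_add)

lemma chi_map_commute:
  "chi_map X w (\<lambda>b b'. chi_map Y w' (\<lambda>d d'. t b b' d d') e e') f f' =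
    chi_map Y w' (\<lambda>d d'. chi_map X w (\<lambda>b b'. t b b' d d') f f') e e'"
  by (cases "positive X"; cases "positive Y"; cases e; cases e'; cases f; cases f')
    (simp_all add: chi_map_def algebra_simps)

lemma mem_set_bits:
  "k \<in> set_bits c S b b' \<longleftrightarrow> (if k = 2 * c then b else if k = 2 * c + 1 then b' else k \<in> S)"
  by (auto simp: set_bits_def)

lemma set_bits_set_bits [simp]: "set_bits c (set_bits c S b b') d d' = set_bits c S d d'"
  by (rule set_eqI) (simp add: mem_set_bits)

lemma set_bits_same: "set_bits c S (2 * c \<in> S) (2 * c + 1 \<in> S) = S"
  by (rule set_eqI) (simp add: mem_set_bits)

lemma set_bits_commute:
  "c \<noteq> c' \<Longrightarrow> set_bits c (set_bits c' S b b') d d' = set_bits c' (set_bits c S d d') b b'"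
  by (rule set_eqI) (auto simp: mem_set_bits) 

lemma set_bits_toggle:
  "k \<noteq> 2 * c \<Longrightarrow> k \<noteq> 2 * c + 1 \<Longrightarrow> set_bits c (toggle k S) b b' = toggle k (set_bits c S b b')"
  by (rule set_eqI) (auto simp: mem_set_bits mem_toggle)

lemma toggle_set_bits:
  "toggle (2 * c) S = set_bits c S (2 * c \<notin> S) (2 * c + 1 \<in> S)"
  "toggle (2 * c + 1) S = set_bits c S (2 * c \<in> S) (2 * c + 1 \<notin> S)"
  by (rule set_eqI; auto simp: mem_set_bits mem_toggle)+

lemma finite_set_bits [simp]: "finite (set_bits c S b b') \<longleftrightarrow> finite S"
proof
  assume "finite (set_bits c S b b')"
  moreover have "S \<subseteq> set_bits c S b b' \<union> {2 * c, 2 * c + 1}" by (auto simp: set_bits_def)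
  ultimately show "finite S" by (meson finite.emptyI finite.insertI finite_UnI finite_subset)
qed (simp add: set_bits_def)

lemma ksign_set_bits:
  assumes "finite S" "k \<noteq> 2 * c" "k \<noteq> 2 * c + 1"
  shows "ksign k (set_bits c S b b') =
    (if k < 2 * c then (if b = b' then 1 else - 1) else 1) * ksign k (S - {2 * c, 2 * c + 1})"
proof -
  let ?S = "S - {2 * c, 2 * c + 1}"
  have "set_bits c S b b' = (if b then insert (2 * c) else id) ((if b' then insert (2 * c + 1) else id) ?S)"
    by (auto simp: set_bits_def)
  moreover have "k < 2 * c + 1 \<longleftrightarrow> k < 2 * c" using assms by auto
  ultimately show ?thesis using assms(1)
    by (simp add: ksign_insert)
qed

lemma ksign_set_bits_same_parity:
  assumes "finite S" "k \<noteq> 2 * c" "k \<noteq> 2 * c + 1" "(b = b') = ((2 * c \<in> S) = (2 * c + 1 \<in> S))"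
  shows "ksign k (set_bits c S b b') = ksign k S"
  using ksign_set_bits[OF assms(1-3), of b b'] ksign_set_bits[OF assms(1-3), of "2 * c \<in> S" "2 * c + 1 \<in> S"]
    assms(4) by (simp add: set_bits_same del: One_nat_def)

lemma ksign_set_bits_last: "ksign (2 * c + 1) (set_bits c S b b') = ksign (2 * c + 1) S"
proof -
  have "{l \<in> set_bits c S b b'. 2 * c + 1 < l} = {l \<in> S. 2 * c + 1 < l}" by (auto simp: mem_set_bits)
  then show ?thesis by (simp add: ksign_def)
qed

lemma ksign_first:
  assumes "finite S"
  shows "ksign (2 * c) S = (if 2 * c + 1 \<in> S then - ksign (2 * c + 1) S else ksign (2 * c + 1) S)"
proof -
  have "{l \<in> S. 2 * c < l} = (if 2 * c + 1 \<in> S then insert (2 * c + 1) {l \<in> S. 2 * c + 1 < l} else {l \<in> S. 2 * c + 1 < l})"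
    by (auto simp: Suc_lessI) (metis Suc_lessI)+
  then show ?thesis using assms by (simp add: ksign_def)
qed

text \<open>Both terms share the sign caused by the factors beyond the pair; the extra sign of the
  first factor is built into \<open>local_diff\<close>.\<close>

lemma kos_term_pair:
  assumes "finite S"
  shows "kos_term a b z v S (2 * c) + kos_term a b z v S (2 * c + 1) =
    ksign (2 * c + 1) S * local_diff (a v (2 * c)) (b v (2 * c)) (a v (2 * c + 1)) (b v (2 * c + 1))
      (\<lambda>e e'. z (v, set_bits c S e e')) (2 * c \<in> S) (2 * c + 1 \<in> S)"
  unfolding kos_term_def toggle_set_bits ksign_first[OF assms]
  by (cases "2 * c \<in> S"; cases "2 * c + 1 \<in> S") (simp_all add: algebra_simps)

lemma local_diff_chi_map:
  assumes c: "c \<in> v" "c < length (crossings D)"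
  shows "local_diff (fac_a D n w v (2 * c)) (fac_b D n w v (2 * c)) (fac_a D n w v (2 * c + 1)) (fac_b D n w v (2 * c + 1))
      (chi_map (crossings D ! c) w t) e e' =
    chi_map (crossings D ! c) w
      (local_diff (fac_a D n w (v - {c}) (2 * c)) (fac_b D n w (v - {c}) (2 * c))
        (fac_a D n w (v - {c}) (2 * c + 1)) (fac_b D n w (v - {c}) (2 * c + 1)) t) e e'"
proof -
  have f: "factors D n w u ! (2 * c) = piece D n w u c ! 0" "factors D n w u ! (2 * c + 1) = piece D n w u c ! 1" for u
    using factors_nth_piece[OF c(2), of 0] factors_nth_piece[OF c(2), of 1] by simp_all
  show ?thesis
  proof (cases "positive (crossings D ! c)")
    case True
    then have "thick D v c" "\<not> thick D (v - {c}) c" using c by (auto simp: thick_def)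
    then show ?thesis unfolding fac_a_def fac_b_def f using True
      by (simp add: piece_def thick_factors_def smoothing_factors_def arc_factor_def Let_def chi_map_def chi0_local_diff)
  next
    case False
    then have "\<not> thick D v c" "thick D (v - {c}) c" using c by (auto simp: thick_def)
    then show ?thesis unfolding fac_a_def fac_b_def f using False
      by (simp add: piece_def thick_factors_def smoothing_factors_def arc_factor_def Let_def chi_map_def chi1_local_diff)
  qed
qed

text \<open>On the two factors of the crossing this is the local identity. All other factors have
  the same entries at both vertices, and their signs agree because \<chi> preserves the parity of
  the pair; hence the operators commute without a sign.\<close>

lemma mf_diff_chi_op:
  assumes c: "c \<in> v" "c < length (crossings D)" and S: "finite S"
  shows "mf_diff D n w (\<lambda>(v, S). chi_op D w c z v S) (v, S) = chi_op D w c (mf_diff D n w z) v S"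
proof -
  let ?N = "num_factors D" and ?a = "fac_a D n w" and ?b = "fac_b D n w" and ?X = "crossings D ! c"
  let ?z = "\<lambda>(v, S). chi_op D w c z v S"
  let ?R = "{..<?N} - {2 * c, 2 * c + 1}"
  have N: "2 * c < ?N" "2 * c + 1 < ?N" using c(2) by (auto simp: num_factors_def)
  have split: "kos ?N ?a ?b z (v, S) = kos_term ?a ?b z v S (2 * c) + kos_term ?a ?b z v S (2 * c + 1) +
      (\<Sum>k\<in>?R. kos_term ?a ?b z v S k)" for z v S
  proof -
    have "{..<?N} = insert (2 * c) (insert (2 * c + 1) ?R)" using N by auto
    then have "kos ?N ?a ?b z (v, S) = (\<Sum>k\<in>insert (2 * c) (insert (2 * c + 1) ?R). kos_term ?a ?b z v S k)"
      unfolding kos_apply by (rule arg_cong)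
    also have "\<dots> = kos_term ?a ?b z v S (2 * c) + (kos_term ?a ?b z v S (2 * c + 1) + (\<Sum>k\<in>?R. kos_term ?a ?b z v S k))"
      by (subst sum.insert, simp, simp, subst sum.insert) simp_all
    finally show ?thesis by (simp only: add.assoc)
  qed
  let ?L = "\<lambda>v. local_diff (?a v (2 * c)) (?b v (2 * c)) (?a v (2 * c + 1)) (?b v (2 * c + 1))"
  let ?t = "\<lambda>e e'. z (v - {c}, set_bits c S e e')"
  have pair: "kos_term ?a ?b ?z v S (2 * c) + kos_term ?a ?b ?z v S (2 * c + 1) =
      chi_map ?X w (\<lambda>e e'. kos_term ?a ?b z (v - {c}) (set_bits c S e e') (2 * c) +
        kos_term ?a ?b z (v - {c}) (set_bits c S e e') (2 * c + 1)) (2 * c \<in> S) (2 * c + 1 \<in> S)"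
  proof -
    have "kos_term ?a ?b ?z v S (2 * c) + kos_term ?a ?b ?z v S (2 * c + 1) =
        ksign (2 * c + 1) S * ?L v (chi_map ?X w ?t) (2 * c \<in> S) (2 * c + 1 \<in> S)"
      unfolding kos_term_pair[OF S] by (simp add: chi_op_def mem_set_bits)
    also have "\<dots> = ksign (2 * c + 1) S * chi_map ?X w (?L (v - {c}) ?t) (2 * c \<in> S) (2 * c + 1 \<in> S)"
      by (simp only: local_diff_chi_map[OF c])
    also have "\<dots> = chi_map ?X w (\<lambda>e e'. ksign (2 * c + 1) S * ?L (v - {c}) ?t e e') (2 * c \<in> S) (2 * c + 1 \<in> S)"
      by (rule chi_map_scale[symmetric])
    finally show ?thesis
      using S by (simp add: kos_term_pair ksign_set_bits_last mem_set_bits del: One_nat_def add_Suc_right)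
  qed
  have rest: "kos_term ?a ?b ?z v S k =
      chi_map ?X w (\<lambda>e e'. kos_term ?a ?b z (v - {c}) (set_bits c S e e') k) (2 * c \<in> S) (2 * c + 1 \<in> S)"
    if k: "k \<in> ?R" for k
  proof -
    have k': "k \<noteq> 2 * c" "k \<noteq> 2 * c + 1" "k < ?N" using k by auto
    have ab: "?a (v - {c}) k = ?a v k" "?b (v - {c}) k = ?b v k"
      using factors_remove[OF k'(3,1,2)] by (simp_all add: fac_a_def fac_b_def)
    let ?r = "ksign k S * (if k \<in> S then ?a v k else ?b v k)"
    have "chi_map ?X w (\<lambda>e e'. kos_term ?a ?b z (v - {c}) (set_bits c S e e') k) (2 * c \<in> S) (2 * c + 1 \<in> S) =
        ?r * chi_map ?X w (\<lambda>e e'. z (v - {c}, toggle k (set_bits c S e e'))) (2 * c \<in> S) (2 * c + 1 \<in> S)"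
      by (rule chi_map_cong)
        (use k' in \<open>simp add: kos_term_def ab mem_set_bits ksign_set_bits_same_parity[OF S k'(1,2)] del: One_nat_def\<close>)
    also have "\<dots> = kos_term ?a ?b ?z v S k"
      using k' by (simp add: kos_term_def chi_op_def set_bits_toggle mem_toggle)
    finally show ?thesis by (rule sym)
  qed
  have "kos ?N ?a ?b ?z (v, S) = chi_map ?X w (\<lambda>e e'. kos ?N ?a ?b z (v - {c}, set_bits c S e e')) (2 * c \<in> S) (2 * c + 1 \<in> S)"
    unfolding split chi_map_add chi_map_sum pair by (simp add: rest)
  then show ?thesis by (simp add: mf_diff_kos chi_op_def)
qed

lemma kos_sum: "kos N a b (\<lambda>s. \<Sum>x\<in>A. f x s) s = (\<Sum>x\<in>A. kos N a b (f x) s)"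
proof -
  obtain v S where s: "s = (v, S)" by fastforce
  show ?thesis unfolding s kos_apply kos_term_def by (subst sum.swap) (simp add: sum_distrib_left)
qed

lemma kos_scale: "(\<And>S. z (v, S) = r * z' (v, S)) \<Longrightarrow> kos N a b z (v, S) = r * kos N a b z' (v, S)"
  by (simp add: kos_apply kos_term_def sum_distrib_left algebra_simps)

lemma chi_op_sum: "chi_op D w c (\<lambda>s. \<Sum>x\<in>A. f x s) v S = (\<Sum>x\<in>A. chi_op D w c (f x) v S)"
  by (simp add: chi_op_def chi_map_sum)

lemma chi_op_scale: "(\<And>S. z (v - {c}, S) = r * z' (v - {c}, S)) \<Longrightarrow> chi_op D w c z v S = r * chi_op D w c z' v S"
  by (simp add: chi_op_def chi_map_scale)

lemma chi_op_eqI: "(\<And>S. z (v - {c}, S) = z' (v - {c}, S)) \<Longrightarrow> chi_op D w c z v S = chi_op D w c z' v S"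
  by (simp add: chi_op_def)

lemma kos_eqI: "(\<And>S. z (v, S) = z' (v, S)) \<Longrightarrow> kos N a b z (v, S) = kos N a b z' (v, S)"
  by (simp add: kos_apply kos_term_def)

lemma mf_diff_cube_diff:
  assumes "\<And>v S. z (v, S) \<noteq> 0 \<Longrightarrow> finite S"
  shows "mf_diff D n w (cube_diff D w z) = cube_diff D w (mf_diff D n w z)"
proof
  fix s :: "nat set \<times> nat set"
  obtain v S where s: "s = (v, S)" by fastforce
  show "mf_diff D n w (cube_diff D w z) s = cube_diff D w (mf_diff D n w z) s"
  proof (cases "finite S")
    case True
    let ?C = "{c. c \<in> v \<and> c < length (crossings D)}"
    let ?s = "\<lambda>c. (- 1 :: mpoly) ^ card {c' \<in> v. c' < c}"
    have "mf_diff D n w (cube_diff D w z) (v, S) =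
        mf_diff D n w (\<lambda>s. \<Sum>c\<in>?C. (\<lambda>(v', S). ?s c * chi_op D w c z v' S) s) (v, S)"
      unfolding mf_diff_kos by (rule kos_eqI) (simp add: cube_diff_chi_op)
    also have "\<dots> = (\<Sum>c\<in>?C. mf_diff D n w (\<lambda>(v', S). ?s c * chi_op D w c z v' S) (v, S))"
      unfolding mf_diff_kos by (rule kos_sum)
    also have "\<dots> = (\<Sum>c\<in>?C. ?s c * mf_diff D n w (\<lambda>(v', S). chi_op D w c z v' S) (v, S))"
      unfolding mf_diff_kos by (intro sum.cong refl kos_scale) simp
    also have "\<dots> = (\<Sum>c\<in>?C. ?s c * chi_op D w c (mf_diff D n w z) v S)"
      by (intro sum.cong refl arg_cong2[of _ _ _ _ "(*)"] mf_diff_chi_op True) auto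
    finally show ?thesis by (simp add: s cube_diff_chi_op)
  next
    case False
    have A: "cube_diff D w z (v, toggle k S) = 0" for k
    proof -
      have "z (v - {c}, set_bits c (toggle k S) b b') = 0" for c b b'
        using assms[of "v - {c}" "set_bits c (toggle k S) b b'"] False by auto
      then show ?thesis by (simp add: cube_diff_chi_op chi_op_def chi_map_0)
    qed
    have B: "mf_diff D n w z (v - {c}, set_bits c S b b') = 0" for c b b'
    proof -
      have "z (v - {c}, toggle k (set_bits c S b b')) = 0" for k
        using assms[of "v - {c}" "toggle k (set_bits c S b b')"] False by auto
      then show ?thesis by (simp add: mf_diff_kos kos_apply kos_term_def)
    qed
    have "mf_diff D n w (cube_diff D w z) (v, S) = 0"
      by (simp add: mf_diff_kos kos_apply kos_term_def A)
    moreover have "cube_diff D w (mf_diff D n w z) (v, S) = 0"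
      by (simp add: cube_diff_chi_op chi_op_def B chi_map_0)
    ultimately show ?thesis by (simp add: s)
  qed
qed

lemma chi_op_commute:
  assumes "c \<noteq> c'"
  shows "chi_op D w c (\<lambda>(v, S). chi_op D w c' z v S) v S = chi_op D w c' (\<lambda>(v, S). chi_op D w c z v S) v S"
proof -
  have bits: "2 * c' \<in> set_bits c S b b' \<longleftrightarrow> 2 * c' \<in> S" "2 * c' + 1 \<in> set_bits c S b b' \<longleftrightarrow> 2 * c' + 1 \<in> S"
    "2 * c \<in> set_bits c' S b b' \<longleftrightarrow> 2 * c \<in> S" "2 * c + 1 \<in> set_bits c' S b b' \<longleftrightarrow> 2 * c + 1 \<in> S" for b b'
    using assms by (auto simp: mem_set_bits)
  have "v - {c} - {c'} = v - {c'} - {c}" by auto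
  then show ?thesis
    unfolding chi_op_def prod.case bits set_bits_commute[OF assms]
    by (subst chi_map_commute) simp
qed

lemma card_less_remove:
  fixes v :: "nat set"
  assumes "c \<in> v"
  shows "card {x \<in> v. x < c'} = card {x \<in> v - {c}. x < c'} + (if c < c' then 1 else 0)"
proof -
  have "{x \<in> v. x < c'} = (if c < c' then insert c {x \<in> v - {c}. x < c'} else {x \<in> v - {c}. x < c'})"
    using assms by auto
  then show ?thesis by simp
qed

text \<open>The \<chi> maps at different crossings commute, while the cube signs for the two orders
  are opposite; no crossing is changed twice. The double sum is its own negative, which suffices
  because \<open>2\<close> can be cancelled.\<close>

lemma cube_diff_cube_diff: "cube_diff D w (cube_diff D w z) = 0"
proof
  fix s :: "nat set \<times> nat set"
  obtain v S where s: "s = (v, S)" by fastforce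
  let ?C = "{c. c \<in> v \<and> c < length (crossings D)}"
  let ?s = "\<lambda>v c. (- 1 :: mpoly) ^ card {c' \<in> v. c' < c}"
  let ?T = "\<lambda>c c'. chi_op D w c (\<lambda>(v, S). chi_op D w c' z v S) v S"
  let ?f = "\<lambda>c c'. if c' = c then 0 else ?s v c * ?s (v - {c}) c' * ?T c c'"
  have fin: "finite ?C" by simp
  have "chi_op D w c (cube_diff D w z) v S = (\<Sum>c'\<in>?C. if c' = c then 0 else ?s (v - {c}) c' * ?T c c')" if "c \<in> ?C" for c
  proof -
    have "chi_op D w c (cube_diff D w z) v S =
        chi_op D w c (\<lambda>s. \<Sum>c'\<in>?C - {c}. (\<lambda>(v', S). ?s (v - {c}) c' * chi_op D w c' z v' S) s) v S"
    proof (rule chi_op_eqI)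
      fix S
      have "{c'. c' \<in> v - {c} \<and> c' < length (crossings D)} = ?C - {c}" by auto
      then show "cube_diff D w z (v - {c}, S) =
          (\<Sum>c'\<in>?C - {c}. (\<lambda>(v', S). ?s (v - {c}) c' * chi_op D w c' z v' S) (v - {c}, S))"
        by (simp only: cube_diff_chi_op prod.case)
    qed
    also have "\<dots> = (\<Sum>c'\<in>?C - {c}. chi_op D w c (\<lambda>(v', S). ?s (v - {c}) c' * chi_op D w c' z v' S) v S)"
      by (rule chi_op_sum)
    also have "\<dots> = (\<Sum>c'\<in>?C - {c}. ?s (v - {c}) c' * ?T c c')"
      by (intro sum.cong refl chi_op_scale) simp
    also have "\<dots> = (\<Sum>c'\<in>?C. if c' = c then 0 else ?s (v - {c}) c' * ?T c c')"
      by (rule sum.mono_neutral_cong_left) (use fin in auto)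
    finally show ?thesis .
  qed
  then have "cube_diff D w (cube_diff D w z) (v, S) = (\<Sum>c\<in>?C. \<Sum>c'\<in>?C. ?f c c')"
    unfolding cube_diff_chi_op
    by (intro sum.cong refl) (simp add: sum_distrib_left if_distrib mult.assoc cong: if_cong)
  moreover have "(\<Sum>c\<in>?C. \<Sum>c'\<in>?C. ?f c c') + (\<Sum>c\<in>?C. \<Sum>c'\<in>?C. ?f c c') = (\<Sum>c\<in>?C. ?f c c + ?f c c)"
  proof (rule sum_anticommuting[OF fin])
    fix c c' assume c: "c \<in> ?C" "c' \<in> ?C" "c \<noteq> c'"
    have sgn: "?s v c * ?s (v - {c}) c' = - (?s v c' * ?s (v - {c'}) c)"
      using c card_less_remove[of c v c'] card_less_remove[of c' v c]
      by (cases "c < c'") (simp_all add: mult.commute)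
    have "?f c c' = (?s v c * ?s (v - {c}) c') * ?T c c'" "?f c' c = (?s v c' * ?s (v - {c'}) c) * ?T c' c"
      using c(3) by simp_all
    then show "?f c c' + ?f c' c = 0"
      unfolding sgn chi_op_commute[OF c(3)] by simp
  qed
  ultimately have "cube_diff D w (cube_diff D w z) (v, S) + cube_diff D w (cube_diff D w z) (v, S) = 0 + 0" by simp
  then show "cube_diff D w (cube_diff D w z) s = 0 s"
    unfolding s by (simp add: mpoly_double_cancel del: add_0)
qed

section \<open>Bounds on the cohomology\<close>

subsection \<open>Constants\<close>

lemma Const_0 [simp]: "Const 0 = 0"
  by (simp add: Const_def)

lemma Const_add: "Const (a + b) = Const a + Const b"
  by (simp add: Const_def single_add)

lemma Const_mult: "Const (a * b) = Const a * Const b"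
  by (simp add: Const_def mult_single)

lemma Const_of_nat: "Const (of_nat k) = of_nat k"
  by (simp add: Const_def)

lemma Const_eq_0_iff [simp]: "Const a = 0 \<longleftrightarrow> a = 0"
  by (metis Const_def lookup_single_eq lookup_zero Const_0)

lemma lookup_Const_mult: "Poly_Mapping.lookup (Const c * f) m = c * Poly_Mapping.lookup f m"
proof -
  have "Const c * f = (\<Sum>m\<in>Poly_Mapping.keys f. Poly_Mapping.single m (c * Poly_Mapping.lookup f m))"
    by (subst (1) poly_mapping_as_sum[of f]) (simp add: Const_def sum_distrib_left mult_single)
  then have "Poly_Mapping.lookup (Const c * f) m =
      (\<Sum>m'\<in>Poly_Mapping.keys f. if m' = m then c * Poly_Mapping.lookup f m' else 0)"
    by (simp add: lookup_sum lookup_single when_def)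
  then show ?thesis by (simp add: in_keys_iff)
qed

definition cscale :: "complex \<Rightarrow> cube_elem \<Rightarrow> cube_elem" where
  "cscale c z = (\<lambda>s. Const c * z s)"

lemma vector_space_cscale: "vector_space cscale"
  by unfold_locales
    (simp_all add: cscale_def fun_eq_iff Const_add Const_mult Const_1 algebra_simps)

lemma coeff_map_poly_Const: "coeff (map_poly Const q) i = Const (coeff q i)"
  by (simp add: coeff_map_poly)

lemma degree_map_poly_Const: "degree (map_poly Const q) = degree q"
  by (rule degree_map_poly) simp

lemma pderiv_map_poly_Const: "pderiv (map_poly Const q) = map_poly Const (pderiv q)"
  by (rule poly_eqI) (simp add: coeff_pderiv coeff_map_poly_Const Const_mult Const_of_nat Const_add Const_1)

lemma map_poly_Const_smult: "map_poly Const (smult c q) = smult (Const c) (map_poly Const q)"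
  by (rule poly_eqI) (simp add: coeff_map_poly_Const Const_mult)

lemma PDeg_map_poly_Const: "map_poly Const q \<in> PDeg V 2 (2 * int (degree q))"
  unfolding PDeg_def
proof (intro CollectI allI)
  fix i
  show "coeff (map_poly Const q) i \<in> QDeg V (2 * int (degree q) - 2 * int i)"
    by (cases "i \<le> degree q") (auto simp: coeff_map_poly_Const coeff_eq_0 intro: QDeg_Const)
qed

lemma degree_antiderivative: "degree (antiderivative p) \<le> degree p + 1"
  unfolding antiderivative_def
  by (intro degree_sum_le) (auto intro!: order.trans[OF degree_monom_le])

lemma Var_power: "Var i ^ k = Poly_Mapping.single (Poly_Mapping.single i k) 1"
  by (induction k) (simp_all add: Var_def mult_single single_add[symmetric])

subsection \<open>Polynomials modulo powers of variables\<close>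

text \<open>The sum of the ideal generated by \<open>x\<^sub>q ^ n\<close> for \<open>q \<in> Q\<close> and the space of
  polynomials of degree at most \<open>d\<close>.\<close>

definition IDeg :: "nat set \<Rightarrow> nat \<Rightarrow> nat set \<Rightarrow> int \<Rightarrow> mpoly set" where
  "IDeg V n Q d = {f \<in> mpolys V. \<forall>m\<in>Poly_Mapping.keys f.
     (\<exists>q\<in>Q. n \<le> Poly_Mapping.lookup m q) \<or> 2 * int (monom_degree m) \<le> d}"

lemma IDeg_empty: "IDeg V n {} d = QDeg V d"
  by (simp add: IDeg_def QDeg_def)

lemma IDeg_0 [simp]: "0 \<in> IDeg V n Q d"
  by (simp add: IDeg_def)

lemma IDeg_add: "f \<in> IDeg V n Q d \<Longrightarrow> g \<in> IDeg V n Q d \<Longrightarrow> f + g \<in> IDeg V n Q d"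
  using keys_add[of f g] by (fastforce simp: IDeg_def mpolys_add)

lemma IDeg_uminus: "f \<in> IDeg V n Q d \<Longrightarrow> - f \<in> IDeg V n Q d"
  by (simp add: IDeg_def mpolys_uminus)

lemma IDeg_diff: "f \<in> IDeg V n Q d \<Longrightarrow> g \<in> IDeg V n Q d \<Longrightarrow> f - g \<in> IDeg V n Q d"
  using IDeg_add[of f V n Q d "- g"] IDeg_uminus[of g V n Q d] by simp

lemma IDeg_sum: "(\<And>x. x \<in> A \<Longrightarrow> f x \<in> IDeg V n Q d) \<Longrightarrow> sum f A \<in> IDeg V n Q d"
  by (induction A rule: infinite_finite_induct) (auto intro: IDeg_add)

lemma IDeg_mono: "f \<in> IDeg V n Q d \<Longrightarrow> Q \<subseteq> Q' \<Longrightarrow> d \<le> d' \<Longrightarrow> f \<in> IDeg V n Q' d'"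
  by (fastforce simp: IDeg_def)

lemma IDeg_mult:
  assumes "r \<in> QDeg V d'" "f \<in> IDeg V n Q d"
  shows "r * f \<in> IDeg V n Q (d' + d)"
proof -
  have "(\<exists>q\<in>Q. n \<le> Poly_Mapping.lookup m q) \<or> 2 * int (monom_degree m) \<le> d' + d"
    if m: "m \<in> Poly_Mapping.keys (r * f)" for m
  proof -
    obtain a b where ab: "m = a + b" "a \<in> Poly_Mapping.keys r" "b \<in> Poly_Mapping.keys f"
      using m keys_mult[of r f] by blast
    have "2 * int (monom_degree a) \<le> d'" using assms(1) ab(2) by (simp add: QDeg_def)
    moreover have "(\<exists>q\<in>Q. n \<le> Poly_Mapping.lookup b q) \<or> 2 * int (monom_degree b) \<le> d"
      using assms(2) ab(3) by (simp add: IDeg_def)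
    ultimately show ?thesis unfolding ab(1) by (auto simp: monom_degree_add lookup_add intro: trans_le_add2)
  qed
  then show ?thesis using assms by (auto simp: IDeg_def QDeg_def mpolys_mult)
qed

lemma IDeg_single:
  assumes "Poly_Mapping.keys m \<subseteq> V" "(\<exists>q\<in>Q. n \<le> Poly_Mapping.lookup m q) \<or> 2 * int (monom_degree m) \<le> d"
  shows "Poly_Mapping.single m c \<in> IDeg V n Q d"
  using assms by (simp add: IDeg_def mpolys_def)

text \<open>Regularity of the sequence of powers x_q^n. The ideal is generated by monomials, and
  multiplication by a power of \<open>Var q\<close> with \<open>q \<notin> Q\<close> changes no
  exponent that decides membership, while it raises the degree by exactly \<open>n\<close>.\<close>

lemma IDeg_Var_power_cancel:
  assumes f: "f \<in> mpolys V" and q: "q \<notin> Q" and xf: "Var q ^ n * f \<in> IDeg V n Q (d + 2 * int n)"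
  shows "f \<in> IDeg V n Q d"
proof -
  let ?e = "Poly_Mapping.single q n"
  have "(\<exists>q\<in>Q. n \<le> Poly_Mapping.lookup m q) \<or> 2 * int (monom_degree m) \<le> d"
    if m: "m \<in> Poly_Mapping.keys f" for m
  proof -
    have "Var q ^ n * f = (\<Sum>m\<in>Poly_Mapping.keys f. Poly_Mapping.single (?e + m) (Poly_Mapping.lookup f m))"
      by (subst (1) poly_mapping_as_sum[of f]) (simp add: Var_power sum_distrib_left mult_single)
    then have "Poly_Mapping.lookup (Var q ^ n * f) (?e + m) =
        (\<Sum>m'\<in>Poly_Mapping.keys f. if m' = m then Poly_Mapping.lookup f m' else 0)"
      by (simp add: lookup_sum lookup_single when_def)
    also have "\<dots> = Poly_Mapping.lookup f m" using m by simp
    finally have "?e + m \<in> Poly_Mapping.keys (Var q ^ n * f)" using m by (simp add: in_keys_iff)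
    with xf have "(\<exists>q'\<in>Q. n \<le> Poly_Mapping.lookup (?e + m) q') \<or> 2 * int (monom_degree (?e + m)) \<le> d + 2 * int n"
      unfolding IDeg_def by blast
    then show ?thesis
    proof
      assume "\<exists>q'\<in>Q. n \<le> Poly_Mapping.lookup (?e + m) q'"
      then obtain q' where q': "q' \<in> Q" "n \<le> Poly_Mapping.lookup (?e + m) q'" by blast
      then have "Poly_Mapping.lookup (?e + m) q' = Poly_Mapping.lookup m q'"
        using q by (auto simp: lookup_add lookup_single when_def)
      with q' show ?thesis by auto
    qed (simp add: monom_degree_add)
  qed
  with f show ?thesis by (simp add: IDeg_def)
qed

text \<open>The monomials covered neither by \<open>Q\<close> nor by the degree bound are divisible
  by x_q^n, and \<open>t\<close> collects their quotients. The last clause ensures that applying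
  this to all coordinates of a cochain does not enlarge its support.\<close>

lemma IDeg_split:
  assumes f: "f \<in> IDeg V n (insert q Q) d" and f': "f \<in> QDeg V d'"
  shows "\<exists>t. t \<in> QDeg V (d' - 2 * int n) \<and> f - Var q ^ n * t \<in> IDeg V n Q d \<and> (f = 0 \<longrightarrow> t = 0)"
proof -
  let ?e = "Poly_Mapping.single q n" and ?c = "Poly_Mapping.lookup f"
  define B where "B = {m \<in> Poly_Mapping.keys f. \<not> ((\<exists>q\<in>Q. n \<le> Poly_Mapping.lookup m q) \<or> 2 * int (monom_degree m) \<le> d)}"
  define t where "t = (\<Sum>m\<in>B. Poly_Mapping.single (m - ?e) (?c m))"
  have B: "B \<subseteq> Poly_Mapping.keys f" "finite B" by (auto simp: B_def)
  have m: "?e + (m - ?e) = m" if "m \<in> B" for m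
  proof -
    have "m \<in> Poly_Mapping.keys f" using that B by blast
    then have "(\<exists>q'\<in>insert q Q. n \<le> Poly_Mapping.lookup m q') \<or> 2 * int (monom_degree m) \<le> d"
      using f unfolding IDeg_def by blast
    then have "n \<le> Poly_Mapping.lookup m q" using that by (auto simp: B_def)
    then show ?thesis
      by (intro poly_mapping_eqI) (auto simp: lookup_add lookup_minus lookup_single when_def)
  qed
  have "t \<in> QDeg V (d' - 2 * int n)"
    unfolding t_def IDeg_empty[of _ n, symmetric]
  proof (intro IDeg_sum IDeg_single disjI2)
    fix m assume mB: "m \<in> B"
    have k: "Poly_Mapping.keys m = Poly_Mapping.keys ?e \<union> Poly_Mapping.keys (m - ?e)"
      by (subst m[OF mB, symmetric]) (rule keys_add_nat)
    have mf: "Poly_Mapping.keys m \<subseteq> V" "2 * int (monom_degree m) \<le> d'"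
      using f' mB B(1) by (auto simp: QDeg_def mpolys_def)
    show "Poly_Mapping.keys (m - ?e) \<subseteq> V" using k mf(1) by blast
    have "monom_degree m = n + monom_degree (m - ?e)"
      using monom_degree_add[of ?e "m - ?e"] by (simp add: m[OF mB])
    then show "2 * int (monom_degree (m - ?e)) \<le> d' - 2 * int n" using mf(2) by simp
  qed
  moreover have "f - Var q ^ n * t \<in> IDeg V n Q d"
  proof -
    have "Var q ^ n * t = (\<Sum>m\<in>B. Poly_Mapping.single m (?c m))"
      unfolding t_def Var_power sum_distrib_left by (intro sum.cong refl) (simp add: mult_single m)
    then have "f - Var q ^ n * t = (\<Sum>m\<in>Poly_Mapping.keys f. Poly_Mapping.single m (?c m)) - (\<Sum>m\<in>B. Poly_Mapping.single m (?c m))"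
      using poly_mapping_as_sum[of f] by simp
    also have "\<dots> = (\<Sum>m\<in>Poly_Mapping.keys f - B. Poly_Mapping.single m (?c m))"
      by (rule sum_diff[symmetric]) (use B in auto)
    also have "\<dots> \<in> IDeg V n Q d"
      by (intro IDeg_sum IDeg_single) (use f in \<open>auto simp: B_def IDeg_def mpolys_def\<close>)
    finally show ?thesis .
  qed
  moreover have "f = 0 \<longrightarrow> t = 0" by (simp add: t_def B_def)
  ultimately show ?thesis by blast
qed

subsection \<open>The filtration\<close>

text \<open>The shifts of the factors depend on the degree of the potential but not on the potential
  itself, so \<open>0\<close> can take the place of \<open>w\<close>: all potentials of degree
  \<open>n\<close> share one filtration.\<close>

definition bdeg :: "diagram \<Rightarrow> nat \<Rightarrow> nat set \<Rightarrow> nat set \<Rightarrow> int" where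
  "bdeg D n v S = basis_degree D (int n) 0 v S"

lemma fac_shift_eq: "k < num_factors D \<Longrightarrow> fac_shift D n w v k = fac_shift D n w' v k"
proof (cases "k < 2 * length (crossings D)")
  case True
  define c b where "c = k div 2" and "b = k mod 2"
  have k: "k = 2 * c + b" "c < length (crossings D)" "b < 2" using True by (auto simp: c_def b_def)
  have "b = 0 \<or> b = 1" using k(3) by auto
  then show ?thesis unfolding fac_shift_def k(1) factors_nth_piece[OF k(2,3)]
    by (auto simp: piece_def thick_factors_def smoothing_factors_def arc_factor_def Let_def)
next
  case False
  assume "k < num_factors D"
  then obtain i where "k = 2 * length (crossings D) + i" "i < length (arcs D)"
    using False by (metis add_less_cancel_left le_Suc_ex not_less num_factors_def)
  then show ?thesis by (simp add: fac_shift_def factors_nth_arc arc_factor_def case_prod_beta)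
qed

lemma basis_degree_eq_bdeg: "S \<subseteq> {..<num_factors D} \<Longrightarrow> basis_degree D (int n) w v S = bdeg D n v S"
  unfolding bdeg_def basis_degree_def fac_shift_def[symmetric]
  by (intro arg_cong2[of _ _ _ _ "(+)"] sum.cong refl fac_shift_eq) auto

abbreviation cshift :: "diagram \<Rightarrow> nat \<Rightarrow> nat set \<Rightarrow> nat \<Rightarrow> int" where
  "cshift D n \<equiv> fac_shift D (int n) 0"

lemma bdeg_insert: "finite S \<Longrightarrow> k \<notin> S \<Longrightarrow> bdeg D n v (insert k S) = bdeg D n v S + cshift D n v k"
  by (simp add: bdeg_def basis_degree_def fac_shift_def)

lemma bdeg_toggle:
  assumes "finite S"
  shows "bdeg D n v (toggle k S) = (if k \<in> S then bdeg D n v S - cshift D n v k else bdeg D n v S + cshift D n v k)"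
proof (cases "k \<in> S")
  case True
  then have "insert k (toggle k S) = S" "k \<notin> toggle k S" by (auto simp: toggle_def)
  then show ?thesis using bdeg_insert[of "toggle k S" k D n v] assms True by simp
next
  case False
  then show ?thesis using bdeg_insert[of S k D n v] assms by (simp add: toggle_def)
qed

text \<open>The filtration step enlarged by the multiples of x_q^n for \<open>q \<in> Q\<close>.
  With \<open>Q = {}\<close> it is the filtration itself; otherwise membership says that the terms
  of too high degree lie in the ideal.\<close>

definition EFilt :: "diagram \<Rightarrow> nat \<Rightarrow> nat set \<Rightarrow> int \<Rightarrow> cube_elem set" where
  "EFilt D n Q j = {z. \<forall>v S. z (v, S) \<in> IDeg (marks D) n Q (j - bdeg D n v S)}"

definition Filt :: "diagram \<Rightarrow> nat \<Rightarrow> int \<Rightarrow> cube_elem set" where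
  "Filt D n j = {z. \<forall>v S. \<forall>m\<in>Poly_Mapping.keys (z (v, S)). 2 * int (monom_degree m) + bdeg D n v S \<le> j}"

lemma mf_spaceD:
  assumes "z \<in> mf_space D i"
  shows "z (v, S) \<in> mpolys (marks D)"
    "z (v, S) \<noteq> 0 \<Longrightarrow> v \<subseteq> {..<length (crossings D)}" "z (v, S) \<noteq> 0 \<Longrightarrow> S \<subseteq> {..<num_factors D}"
    "z (v, S) \<noteq> 0 \<Longrightarrow> cohom_degree D v = i" "z (v, S) \<noteq> 0 \<Longrightarrow> finite S"
proof -
  show "z (v, S) \<in> mpolys (marks D)"
    "z (v, S) \<noteq> 0 \<Longrightarrow> v \<subseteq> {..<length (crossings D)}" "z (v, S) \<noteq> 0 \<Longrightarrow> S \<subseteq> {..<num_factors D}"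
    "z (v, S) \<noteq> 0 \<Longrightarrow> cohom_degree D v = i"
    using assms by (auto simp: mf_space_def)
  then show "z (v, S) \<noteq> 0 \<Longrightarrow> finite S" using finite_subset by blast
qed

lemma mf_spaceI:
  assumes "\<And>v S. z (v, S) \<in> mpolys (marks D)"
    "\<And>v S. z (v, S) \<noteq> 0 \<Longrightarrow> v \<subseteq> {..<length (crossings D)} \<and> S \<subseteq> {..<num_factors D} \<and> cohom_degree D v = i"
  shows "z \<in> mf_space D i"
  using assms by (simp add: mf_space_def)

lemma Filt_EFilt: "z \<in> mf_space D i \<Longrightarrow> z \<in> Filt D n j \<longleftrightarrow> z \<in> EFilt D n {} j"
  using mf_spaceD(1)[of z D i]
  by (auto simp: Filt_def EFilt_def IDeg_def algebra_simps)

lemma Filt_mf_filt: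
  assumes "z \<in> mf_space D i"
  shows "z \<in> Filt D n j \<longleftrightarrow> z \<in> mf_filt D (int n) w j"
proof -
  have "basis_degree D (int n) w v S = bdeg D n v S" if "m \<in> Poly_Mapping.keys (z (v, S))" for m v S
  proof (rule basis_degree_eq_bdeg)
    have "z (v, S) \<noteq> 0" using that by auto
    then show "S \<subseteq> {..<num_factors D}" by (rule mf_spaceD(3)[OF assms])
  qed
  then show ?thesis by (auto simp: Filt_def mf_filt_def)
qed

lemma EFilt_diff: "z \<in> EFilt D n Q j \<Longrightarrow> z' \<in> EFilt D n Q j \<Longrightarrow> z - z' \<in> EFilt D n Q j"
  by (simp add: EFilt_def IDeg_diff)

lemma EFilt_add: "z \<in> EFilt D n Q j \<Longrightarrow> z' \<in> EFilt D n Q j \<Longrightarrow> z + z' \<in> EFilt D n Q j"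
  by (simp add: EFilt_def IDeg_add)

lemma EFilt_mono: "z \<in> EFilt D n Q j \<Longrightarrow> Q \<subseteq> Q' \<Longrightarrow> j \<le> j' \<Longrightarrow> z \<in> EFilt D n Q' j'"
  unfolding EFilt_def using IDeg_mono[of "z (v, S)" "marks D" n Q "j - bdeg D n v S" Q' "j' - bdeg D n v S" for v S] by simp

lemma EFilt_mult:
  assumes "r \<in> QDeg (marks D) d" "z \<in> EFilt D n Q j"
  shows "(\<lambda>s. r * z s) \<in> EFilt D n Q (j + d)"
  unfolding EFilt_def
proof (intro CollectI allI)
  fix v S
  have "r * z (v, S) \<in> IDeg (marks D) n Q (d + (j - bdeg D n v S))"
    using assms by (intro IDeg_mult) (simp_all add: EFilt_def)
  then show "r * z (v, S) \<in> IDeg (marks D) n Q (j + d - bdeg D n v S)" by (simp add: algebra_simps)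
qed

lemma mf_space_0 [simp]: "0 \<in> mf_space D i"
  by (rule mf_spaceI) simp_all

lemma EFilt_0 [simp]: "0 \<in> EFilt D n Q j"
  by (simp add: EFilt_def)

lemma mf_space_diff: "z \<in> mf_space D i \<Longrightarrow> z' \<in> mf_space D i \<Longrightarrow> z - z' \<in> mf_space D i"
proof (rule mf_spaceI)
  fix v S assume z: "z \<in> mf_space D i" "z' \<in> mf_space D i"
  show "(z - z') (v, S) \<in> mpolys (marks D)"
    using mpolys_add[OF mf_spaceD(1)[OF z(1)] mpolys_uminus[OF mf_spaceD(1)[OF z(2)]], of v S v S] by simp
  assume "(z - z') (v, S) \<noteq> 0"
  then have "z (v, S) \<noteq> 0 \<or> z' (v, S) \<noteq> 0" by auto
  then show "v \<subseteq> {..<length (crossings D)} \<and> S \<subseteq> {..<num_factors D} \<and> cohom_degree D v = i"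
    using mf_spaceD(2-4)[OF z(1)] mf_spaceD(2-4)[OF z(2)] by blast
qed

lemma mf_space_add: "z \<in> mf_space D i \<Longrightarrow> z' \<in> mf_space D i \<Longrightarrow> z + z' \<in> mf_space D i"
  using mf_space_diff[of z D i "0 - z'"] mf_space_diff[of 0 D i z'] by simp

lemma mf_space_mult:
  assumes "r \<in> mpolys (marks D)" "z \<in> mf_space D i"
  shows "(\<lambda>s. r * z s) \<in> mf_space D i"
proof (rule mf_spaceI)
  fix v S
  show "r * z (v, S) \<in> mpolys (marks D)" by (intro mpolys_mult assms(1) mf_spaceD(1)[OF assms(2)])
  assume "r * z (v, S) \<noteq> 0"
  then have "z (v, S) \<noteq> 0" by auto
  then show "v \<subseteq> {..<length (crossings D)} \<and> S \<subseteq> {..<num_factors D} \<and> cohom_degree D v = i"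
    using mf_spaceD(2-4)[OF assms(2)] by blast
qed

text \<open>The bounds under which \<open>kos\<close> raises the filtration by at most
  \<open>d\<close>: toggling a factor changes the basis degree by its shift, and the entries
  compensate for that.\<close>

definition koszul_degree :: "diagram \<Rightarrow> nat \<Rightarrow> int \<Rightarrow> (nat set \<Rightarrow> nat \<Rightarrow> mpoly) \<Rightarrow> (nat set \<Rightarrow> nat \<Rightarrow> mpoly) \<Rightarrow> bool" where
  "koszul_degree D n d a b \<longleftrightarrow> (\<forall>v. \<forall>k<num_factors D.
     a v k \<in> QDeg (marks D) (d - cshift D n v k) \<and> b v k \<in> QDeg (marks D) (d + cshift D n v k))"

lemma QDeg_ksign: "ksign k S \<in> QDeg V 0"
  unfolding ksign_def by (cases "even (card {l \<in> S. k < l})") (simp_all add: QDeg_1 QDeg_uminus)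

lemma kos_EFilt:
  assumes ab: "koszul_degree D n d a b" and z: "z \<in> EFilt D n Q j" "\<And>v S. z (v, S) \<noteq> 0 \<Longrightarrow> finite S"
  shows "kos (num_factors D) a b z \<in> EFilt D n Q (j + d)"
  unfolding EFilt_def
proof (intro CollectI allI)
  fix v S
  show "kos (num_factors D) a b z (v, S) \<in> IDeg (marks D) n Q (j + d - bdeg D n v S)"
    unfolding kos_apply
  proof (rule IDeg_sum)
    fix k assume "k \<in> {..<num_factors D}"
    then have k: "a v k \<in> QDeg (marks D) (d - cshift D n v k)" "b v k \<in> QDeg (marks D) (d + cshift D n v k)"
      using ab by (auto simp: koszul_degree_def)
    have zk: "z (v, toggle k S) \<in> IDeg (marks D) n Q (j - bdeg D n v (toggle k S))"
      using z(1) by (simp add: EFilt_def)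
    show "kos_term a b z v S k \<in> IDeg (marks D) n Q (j + d - bdeg D n v S)"
    proof (cases "finite S")
      case True
      let ?d = "if k \<in> S then d - cshift D n v k else d + cshift D n v k"
      have "ksign k S * (if k \<in> S then a v k else b v k) \<in> QDeg (marks D) (0 + ?d)"
        by (rule QDeg_mult[OF QDeg_ksign]) (use k in simp)
      from IDeg_mult[OF this zk] show ?thesis
        unfolding kos_term_def bdeg_toggle[OF True] by (simp add: algebra_simps split: if_splits)
    next
      case False
      then have "z (v, toggle k S) = 0" using z(2)[of v "toggle k S"] by auto
      then show ?thesis by (simp add: kos_term_def)
    qed
  qed
qed

lemma mpolys_sum: "(\<And>x. x \<in> A \<Longrightarrow> f x \<in> mpolys V) \<Longrightarrow> sum f A \<in> mpolys V"
  by (induction A rule: infinite_finite_induct) (auto intro: mpolys_add)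

lemma kos_mf_space:
  assumes ab: "koszul_degree D n d a b" and z: "z \<in> mf_space D i"
  shows "kos (num_factors D) a b z \<in> mf_space D i"
proof (rule mf_spaceI)
  fix v S
  show "kos (num_factors D) a b z (v, S) \<in> mpolys (marks D)"
    unfolding kos_apply kos_term_def
    using ab by (intro mpolys_sum mpolys_mult mf_spaceD(1)[OF z] QDeg_mpolys[OF QDeg_ksign])
      (auto simp: koszul_degree_def intro: QDeg_mpolys)
  assume "kos (num_factors D) a b z (v, S) \<noteq> 0"
  then obtain k where k: "k < num_factors D" "z (v, toggle k S) \<noteq> 0"
    unfolding kos_apply kos_term_def by (metis (no_types, lifting) lessThan_iff mult_zero_right sum.neutral)
  have "S \<subseteq> insert k (toggle k S)" by (auto simp: toggle_def)
  then show "v \<subseteq> {..<length (crossings D)} \<and> S \<subseteq> {..<num_factors D} \<and> cohom_degree D v = i"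
    using mf_spaceD(2-4)[OF z k(2)] k(1) by auto
qed

subsection \<open>Null-homotopies\<close>

text \<open>By the anticommutator formula, \<alpha> and \<beta> are the entries of a Koszul operator
  of degree \<open>d\<close> that contracts multiplication by \<open>r\<close>. As a statement about
  a list of factors it can be built up factor by factor.\<close>

definition null_htpy :: "nat set \<Rightarrow> int \<Rightarrow> factor list \<Rightarrow> mpoly \<Rightarrow> bool" where
  "null_htpy V d fs r \<longleftrightarrow> (\<exists>\<alpha> \<beta>.
     (\<forall>k<length fs. \<alpha> k \<in> QDeg V (d - snd (snd (fs ! k))) \<and> \<beta> k \<in> QDeg V (d + snd (snd (fs ! k)))) \<and>
     (\<Sum>k<length fs. fst (fs ! k) * \<beta> k + fst (snd (fs ! k)) * \<alpha> k) = r)"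

lemma null_htpy_Nil: "null_htpy V d [] 0"
  by (simp add: null_htpy_def)

lemma null_htpy_Cons:
  assumes "null_htpy V d fs r" "\<alpha> \<in> QDeg V (d - s)" "\<beta> \<in> QDeg V (d + s)"
  shows "null_htpy V d ((a, b, s) # fs) (a * \<beta> + b * \<alpha> + r)"
proof -
  obtain \<alpha>' \<beta>' where
    1: "\<forall>k<length fs. \<alpha>' k \<in> QDeg V (d - snd (snd (fs ! k))) \<and> \<beta>' k \<in> QDeg V (d + snd (snd (fs ! k)))"
    and 2: "(\<Sum>k<length fs. fst (fs ! k) * \<beta>' k + fst (snd (fs ! k)) * \<alpha>' k) = r"
    using assms(1) unfolding null_htpy_def by blast
  show ?thesis
    unfolding null_htpy_def
  proof (rule exI[of _ "case_nat \<alpha> \<alpha>'"], rule exI[of _ "case_nat \<beta> \<beta>'"], intro conjI allI impI)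
    fix k assume "k < length ((a, b, s) # fs)"
    then show "case_nat \<alpha> \<alpha>' k \<in> QDeg V (d - snd (snd (((a, b, s) # fs) ! k)))"
      "case_nat \<beta> \<beta>' k \<in> QDeg V (d + snd (snd (((a, b, s) # fs) ! k)))"
      using 1 assms(2,3) by (auto split: nat.split)
  next
    show "(\<Sum>k<length ((a, b, s) # fs). fst (((a, b, s) # fs) ! k) * case_nat \<beta> \<beta>' k +
        fst (snd (((a, b, s) # fs) ! k)) * case_nat \<alpha> \<alpha>' k) = a * \<beta> + b * \<alpha> + r"
      by (simp only: list.size(4) One_nat_def add_Suc_right add_0_right sum.lessThan_Suc_shift) (simp add: 2)
  qed
qed

lemma null_htpy_Cons_same: "null_htpy V d fs r \<Longrightarrow> null_htpy V d (f # fs) r"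
  using null_htpy_Cons[of V d fs r 0 "snd (snd f)" 0 "fst f" "fst (snd f)"] by simp

lemma null_htpy_zero: "null_htpy V d fs 0"
  by (induction fs) (simp_all add: null_htpy_Nil null_htpy_Cons_same)

lemma null_htpy_append: "null_htpy V d fs r \<Longrightarrow> null_htpy V d (gs @ fs) r"
  by (induction gs) (simp_all add: null_htpy_Cons_same)

text \<open>Here \<open>n\<close> is the degree of \<open>w\<close>, one more than that of the
  potential; this is why the factors carry the parameter \<open>n - 1\<close>.\<close>

lemma null_htpy_arc:
  assumes "2 \<le> n" "w \<in> PDeg V 2 (2 * n)" "i \<in> V" "j \<in> V"
  shows "null_htpy V (n - 2) (arc_factor (n - 1) w j i # fs) (poly (pderiv w) (Var i))"
proof -
  have "null_htpy V (n - 2) (arc_factor (n - 1) w j i # fs)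
      (divided_diff w (Var i) (Var j) * 1 + (Var i - Var j) * divided_diff2 w (Var i) (Var i) (Var j) + 0)"
    unfolding arc_factor_def
  proof (rule null_htpy_Cons[OF null_htpy_zero])
    show "divided_diff2 w (Var i) (Var i) (Var j) \<in> QDeg V (n - 2 - (1 - (n - 1)))"
      using QDeg_divided_diff2[OF assms(2), of "Var i" "Var i" "Var j"] assms QDeg_Var[of _ V 2]
      by (simp add: algebra_simps)
  qed (simp add: QDeg_1)
  then show ?thesis by (simp only: pderiv_arc[symmetric] add_0_right)
qed

lemma null_htpy_thick:
  assumes n: "2 \<le> n" and w: "w \<in> PDeg V 2 (2 * n)"
    and X: "out1 X \<in> V" "out2 X \<in> V" "in3 X \<in> V" "in4 X \<in> V" and i: "i \<in> {out1 X, out2 X}"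
  shows "null_htpy V (n - 2) (thick_factors (n - 1) w X @ fs) (poly (pderiv w) (Var i))"
proof -
  let ?x1 = "Var (out1 X)" and ?x2 = "Var (out2 X)" and ?x3 = "Var (in3 X)" and ?x4 = "Var (in4 X)"
  have V: "?x1 \<in> QDeg V 2" "?x2 \<in> QDeg V 2" "?x3 \<in> QDeg V 2" "?x4 \<in> QDeg V 2"
    using X by (auto intro: QDeg_Var)
  have "null_htpy V (n - 2) (thick_factors (n - 1) w X @ fs)
      (thick_u1 w ?x1 ?x2 ?x3 ?x4 * 1 + (?x1 + ?x2 - ?x3 - ?x4) * a +
        (thick_u2 w ?x1 ?x2 ?x3 ?x4 * x + (?x1 * ?x2 - ?x3 * ?x4) * b + 0))"
    if "a \<in> QDeg V (2 * n - 4)" "b \<in> QDeg V (2 * n - 6)" "x \<in> QDeg V 2" for a b x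
    unfolding thick_factors_def Let_def append_Cons append_Nil
    by (intro null_htpy_Cons null_htpy_zero) (use that in \<open>simp_all add: QDeg_1 algebra_simps\<close>)
  from this[OF QDeg_thick_htpy1[OF w V] QDeg_thick_htpy2[OF w V] V(1)]
    this[OF QDeg_thick_htpy1[OF w V(2,1,3,4)] QDeg_thick_htpy2[OF w V(2,1,3,4)] V(2)]
  show ?thesis using i
    by (auto simp only: add_0_right pderiv_thick[symmetric] pderiv_thick'[symmetric] insert_iff empty_iff)
qed

lemma null_htpy_piece:
  assumes n: "2 \<le> n" and w: "w \<in> PDeg V 2 (2 * n)" and X: "X = crossings D ! c"
    and V: "out1 X \<in> V" "out2 X \<in> V" "in3 X \<in> V" "in4 X \<in> V" and i: "i \<in> {out1 X, out2 X}"
  shows "null_htpy V (n - 2) (piece D (n - 1) w v c @ fs) (poly (pderiv w) (Var i))"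
proof (cases "thick D v c")
  case True
  then show ?thesis using null_htpy_thick[OF n w V i] by (simp add: piece_def X)
next
  case False
  have "null_htpy V (n - 2) (smoothing_factors (n - 1) w X @ fs) (poly (pderiv w) (Var i))"
  proof (cases "i = out1 X")
    case True
    show ?thesis
      unfolding smoothing_factors_def append_Cons append_Nil True by (rule null_htpy_arc[OF n w V(1,4)])
  next
    case False
    with i have "i = out2 X" by simp
    then show ?thesis
      unfolding smoothing_factors_def append_Cons append_Nil
      by (simp only:) (rule null_htpy_Cons_same[OF null_htpy_arc[OF n w V(2,3)]])
  qed
  with False show ?thesis by (simp add: piece_def X)
qed

lemma marks_cases:
  assumes "q \<in> marks D"
  obtains c where "c < length (crossings D)" "q \<in> {out1 (crossings D ! c), out2 (crossings D ! c)}"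
    | j where "(j, q) \<in> set (arcs D)"
proof -
  from assms consider X where "X \<in> set (crossings D)" "q \<in> {out1 X, out2 X}" | x where "x \<in> set (arcs D)" "q = snd x"
    unfolding marks_def out_marks_def by auto
  then show thesis
  proof cases
    case 1
    then obtain c where "c < length (crossings D)" "X = crossings D ! c" by (metis in_set_conv_nth)
    with 1 that(1) show ?thesis by blast
  next
    case 2
    with that(2)[of "fst x"] show ?thesis by simp
  qed
qed

lemma crossing_marks:
  assumes "link_diagram D" "c < length (crossings D)"
  shows "out1 (crossings D ! c) \<in> marks D" "out2 (crossings D ! c) \<in> marks D"
    "in3 (crossings D ! c) \<in> marks D" "in4 (crossings D ! c) \<in> marks D"
proof -
  have "crossings D ! c \<in> set (crossings D)" using assms(2) by simp
  then show "out1 (crossings D ! c) \<in> marks D" "out2 (crossings D ! c) \<in> marks D"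
    unfolding marks_def out_marks_def by auto
  have "marks D = set (in_marks D)" using assms(1) by (simp add: marks_def link_diagram_def)
  with \<open>crossings D ! c \<in> set (crossings D)\<close>
  show "in3 (crossings D ! c) \<in> marks D" "in4 (crossings D ! c) \<in> marks D"
    unfolding in_marks_def by auto
qed

lemma arc_marks:
  assumes "link_diagram D" "(j, i) \<in> set (arcs D)"
  shows "i \<in> marks D" "j \<in> marks D"
proof -
  show "i \<in> marks D" using assms(2) unfolding marks_def out_marks_def by force
  have "marks D = set (in_marks D)" using assms(1) by (simp add: marks_def link_diagram_def)
  then show "j \<in> marks D" using assms(2) unfolding in_marks_def by force
qed

lemma concat_split: "c < length xs \<Longrightarrow> \<exists>ys zs. concat (map f xs) = ys @ f (xs ! c) @ zs"
  by (metis concat.simps(2) concat_append id_take_nth_drop list.simps(9) map_append)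

text \<open>Every mark is an outgoing mark of some piece. The homotopy lives on the factors of that
  piece, with zero entries elsewhere.\<close>

lemma null_htpy_factors:
  assumes D: "link_diagram D" and n: "2 \<le> n" and w: "w \<in> PDeg (marks D) 2 (2 * n)" and q: "q \<in> marks D"
  shows "null_htpy (marks D) (n - 2) (factors D (n - 1) w v) (poly (pderiv w) (Var q))"
  using q
proof (cases rule: marks_cases)
  case (1 c)
  then obtain ys zs where "concat (map (piece D (n - 1) w v) [0..<length (crossings D)]) = ys @ piece D (n - 1) w v c @ zs"
    using concat_split[of c "[0..<length (crossings D)]" "piece D (n - 1) w v"] by auto
  then show ?thesis
    unfolding factors_piece
    using null_htpy_append[OF null_htpy_piece[OF n w refl crossing_marks[OF D 1(1)] 1(2)]] by simp
next
  case (2 j)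
  then obtain ys zs where "arcs D = ys @ (j, q) # zs" by (meson split_list)
  then have "factors D (n - 1) w v = (concat (map (piece D (n - 1) w v) [0..<length (crossings D)]) @
      map (\<lambda>(j, i). arc_factor (n - 1) w j i) ys) @ arc_factor (n - 1) w j q # map (\<lambda>(j, i). arc_factor (n - 1) w j i) zs"
    by (simp add: factors_piece)
  then show ?thesis
    by (simp only:) (rule null_htpy_append[OF null_htpy_arc[OF n w arc_marks[OF D 2]]])
qed

lemma finite_marks [simp]: "finite (marks D)"
  by (simp add: marks_def)

subsection \<open>Reduction of degrees\<close>

locale link_potential =
  fixes D :: diagram and n :: nat and p :: "complex poly"
  assumes D: "link_diagram D" and n: "1 \<le> n" and p: "p \<in> potentials n"
begin

definition "w = map_poly Const (antiderivative p)"

abbreviation "V \<equiv> marks D"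
abbreviation "N \<equiv> num_factors D"
abbreviation "d \<equiv> mf_diff D (int n) w"
abbreviation "a \<equiv> fac_a D (int n) w"
abbreviation "b \<equiv> fac_b D (int n) w"

lemma degree_p: "degree p = n" and coeff_p: "coeff p n = 1"
  using p by (auto simp: potentials_def)

lemma w_PDeg: "w \<in> PDeg V 2 (2 * (int n + 1))"
  unfolding w_def
  by (rule PDeg_mono[OF PDeg_map_poly_Const]) (use degree_antiderivative[of p] in \<open>simp add: degree_p\<close>)

lemma pderiv_w: "poly (pderiv w) x = Const (of_nat (n + 1)) * poly (map_poly Const p) x"
  by (simp add: w_def pderiv_map_poly_Const pderiv_antiderivative map_poly_Const_smult degree_p)

lemma QDeg_fac:
  assumes "k < N"
  shows "a v k \<in> QDeg V (int n + 1 - cshift D n v k) \<and> b v k \<in> QDeg V (int n + 1 + cshift D n v k)"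
proof -
  let ?P = "\<lambda>f :: factor. fst f \<in> QDeg V (int n + 1 - snd (snd f)) \<and> fst (snd f) \<in> QDeg V (int n + 1 + snd (snd f))"
  have arc: "?P (arc_factor (int n) w j i)" if "i \<in> V" "j \<in> V" for i j
    using QDeg_divided_diff[OF w_PDeg, of "Var i" "Var j"] that QDeg_Var[of _ V 2]
    by (simp add: arc_factor_def QDeg_diff algebra_simps)
  have "?P f" if f: "f \<in> set (factors D (int n) w v)" for f
  proof -
    from f consider c where "c < length (crossings D)" "f \<in> set (piece D (int n) w v c)" | x where "x \<in> set (arcs D)" "f = arc_factor (int n) w (fst x) (snd x)"
      unfolding factors_piece by auto
    then show ?thesis
    proof cases
      case 1
      note V = crossing_marks[OF D 1(1)]
      let ?X = "crossings D ! c"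
      have x: "Var (out1 ?X) \<in> QDeg V 2" "Var (out2 ?X) \<in> QDeg V 2" "Var (in3 ?X) \<in> QDeg V 2" "Var (in4 ?X) \<in> QDeg V 2"
        using V by (auto intro: QDeg_Var)
      show ?thesis
      proof (cases "thick D v c")
        case True
        have "Var (out1 ?X) + Var (out2 ?X) - Var (in3 ?X) - Var (in4 ?X) \<in> QDeg V 2"
          "Var (out1 ?X) * Var (out2 ?X) - Var (in3 ?X) * Var (in4 ?X) \<in> QDeg V 4"
          using x by (auto intro!: QDeg_add QDeg_diff QDeg_mult_22)
        with True 1(2) QDeg_thick_u1[OF w_PDeg x] QDeg_thick_u2[OF w_PDeg x] show ?thesis
          by (auto simp: piece_def thick_factors_def Let_def algebra_simps)
      next
        case False
        with 1(2) arc V show ?thesis by (auto simp: piece_def smoothing_factors_def)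
      qed
    next
      case 2
      then show ?thesis using arc arc_marks[OF D, of "fst x" "snd x"] by simp
    qed
  qed
  then have "?P (factors D (int n) w v ! k)" using assms by simp
  then show ?thesis using fac_shift_eq[OF assms, of "int n" w v 0] by (simp add: fac_a_def fac_b_def fac_shift_def)
qed

lemma koszul_degree_d: "koszul_degree D n (int n + 1) a b"
  unfolding koszul_degree_def using QDeg_fac by blast

lemma d_mf_space: "z \<in> mf_space D i \<Longrightarrow> d z \<in> mf_space D i"
  unfolding mf_diff_kos by (rule kos_mf_space[OF koszul_degree_d])

lemma d_EFilt: "z \<in> mf_space D i \<Longrightarrow> z \<in> EFilt D n Q j \<Longrightarrow> d z \<in> EFilt D n Q (j + (int n + 1))"
  unfolding mf_diff_kos by (rule kos_EFilt[OF koszul_degree_d _ mf_spaceD(5)])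

lemma d_d: "z \<in> mf_space D i \<Longrightarrow> d (d z) = 0"
  by (rule mf_diff_mf_diff[OF D mf_spaceD(5)])

text \<open>As w' is \<open>n + 1\<close> times the potential, the homotopies for w' are divided by
  \<open>n + 1\<close>. The degree \<open>n - 1\<close> of \<open>h\<close> and the degree
  \<open>n + 1\<close> of \<open>d\<close> add up to \<open>2 * n\<close>, the degree of the leading
  term x_q^n.\<close>

lemma ex_null_homotopy:
  assumes q: "q \<in> V"
  shows "\<exists>h. (\<forall>i z. z \<in> mf_space D i \<longrightarrow> h z \<in> mf_space D i \<and>
      (\<lambda>s. d (h z) s + h (d z) s) = (\<lambda>s. poly (map_poly Const p) (Var q) * z s)) \<and>
    (\<forall>i Q j z. z \<in> mf_space D i \<longrightarrow> z \<in> EFilt D n Q j \<longrightarrow> h z \<in> EFilt D n Q (j + (int n - 1)))"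
proof -
  let ?r = "Const (1 / of_nat (n + 1))" and ?P = "poly (map_poly Const p) (Var q)"
  have "\<exists>\<alpha> \<beta>. (\<forall>k<N. \<alpha> k \<in> QDeg V (int n - 1 - cshift D n v k) \<and> \<beta> k \<in> QDeg V (int n - 1 + cshift D n v k)) \<and>
     (\<Sum>k<N. a v k * \<beta> k + b v k * \<alpha> k) = poly (pderiv w) (Var q)" for v
  proof -
    have "null_htpy V (int n - 1) (factors D (int n) w v) (poly (pderiv w) (Var q))"
      using null_htpy_factors[OF D _ w_PDeg q, of v] n by simp
    then obtain \<alpha> \<beta> where
      1: "\<forall>k<N. \<alpha> k \<in> QDeg V (int n - 1 - fac_shift D (int n) w v k) \<and> \<beta> k \<in> QDeg V (int n - 1 + fac_shift D (int n) w v k)"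
      and 2: "(\<Sum>k<N. a v k * \<beta> k + b v k * \<alpha> k) = poly (pderiv w) (Var q)"
      unfolding null_htpy_def fac_a_def fac_b_def fac_shift_def length_factors by blast
    have "\<forall>k<N. \<alpha> k \<in> QDeg V (int n - 1 - cshift D n v k) \<and> \<beta> k \<in> QDeg V (int n - 1 + cshift D n v k)"
      using 1 fac_shift_eq[of _ D "int n" w v 0] by simp
    with 2 show ?thesis by blast
  qed
  moreover define R where "R v \<alpha> \<beta> \<longleftrightarrow>
     (\<forall>k<N. \<alpha> k \<in> QDeg V (int n - 1 - cshift D n v k) \<and> \<beta> k \<in> QDeg V (int n - 1 + cshift D n v k)) \<and>
     (\<Sum>k<N. a v k * \<beta> k + b v k * \<alpha> k) = poly (pderiv w) (Var q)" for v \<alpha> \<beta>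
  ultimately have "\<exists>\<alpha> \<beta>. R v \<alpha> \<beta>" for v by simp
  then obtain \<alpha> \<beta> where "\<And>v. R v (\<alpha> v) (\<beta> v)" by metis
  then have
    deg: "\<And>v k. k < N \<Longrightarrow> \<alpha> v k \<in> QDeg V (int n - 1 - cshift D n v k) \<and> \<beta> v k \<in> QDeg V (int n - 1 + cshift D n v k)"
    and sum: "\<And>v. (\<Sum>k<N. a v k * \<beta> v k + b v k * \<alpha> v k) = poly (pderiv w) (Var q)"
    unfolding R_def by simp_all
  define \<alpha>' where "\<alpha>' v k = ?r * \<alpha> v k" for v k
  define \<beta>' where "\<beta>' v k = ?r * \<beta> v k" for v k
  have c0: "?r * f \<in> QDeg V e" if "f \<in> QDeg V e" for f e
    using QDeg_mult[OF QDeg_Const[of 0 "1 / of_nat (n + 1)" V] that] by simp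
  have deg': "koszul_degree D n (int n - 1) \<alpha>' \<beta>'"
    unfolding koszul_degree_def \<alpha>'_def \<beta>'_def using deg c0 by blast
  have sum': "(\<Sum>k<N. a v k * \<beta>' v k + b v k * \<alpha>' v k) = ?P" for v
  proof -
    have "(\<Sum>k<N. a v k * \<beta>' v k + b v k * \<alpha>' v k) = ?r * poly (pderiv w) (Var q)"
      unfolding sum[of v, symmetric] \<alpha>'_def \<beta>'_def by (simp add: sum_distrib_left algebra_simps)
    also have "\<dots> = Const (1 / of_nat (n + 1) * of_nat (n + 1)) * ?P"
      unfolding pderiv_w Const_mult by (simp only: mult.assoc)
    also have "1 / of_nat (n + 1) * of_nat (n + 1) = (1 :: complex)"
      by (simp del: of_nat_Suc of_nat_add)
    finally show ?thesis by (simp add: Const_1)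
  qed
  show ?thesis
  proof (intro exI[of _ "kos N \<alpha>' \<beta>'"] conjI allI impI)
    fix i z assume z: "z \<in> mf_space D i"
    show "kos N \<alpha>' \<beta>' z \<in> mf_space D i" by (rule kos_mf_space[OF deg' z])
    show "(\<lambda>s. d (kos N \<alpha>' \<beta>' z) s + kos N \<alpha>' \<beta>' (d z) s) = (\<lambda>s. ?P * z s)"
    proof
      fix s :: "nat set \<times> nat set"
      obtain v S where s: "s = (v, S)" by fastforce
      show "d (kos N \<alpha>' \<beta>' z) s + kos N \<alpha>' \<beta>' (d z) s = ?P * z s"
      proof (cases "finite S")
        case True
        then show ?thesis unfolding s mf_diff_kos by (simp add: kos_anticommutator sum')
      next
        case False
        have "u (v, S) = 0" if "u \<in> mf_space D i" for u
          using mf_spaceD(5)[OF that, of v S] False by auto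
        from this[OF d_mf_space[OF kos_mf_space[OF deg' z]]] this[OF kos_mf_space[OF deg' d_mf_space[OF z]]] this[OF z]
        show ?thesis by (simp add: s)
      qed
    qed
  next
    fix i Q j z assume z: "z \<in> mf_space D i" "z \<in> EFilt D n Q j"
    show "kos N \<alpha>' \<beta>' z \<in> EFilt D n Q (j + (int n - 1))"
      by (rule kos_EFilt[OF deg' z(2) mf_spaceD(5)[OF z(1)]])
  qed
qed

lemma P_lower: "q \<in> V \<Longrightarrow> Var q ^ n - poly (map_poly Const p) (Var q) \<in> QDeg V (2 * int n - 2)"
proof -
  assume q: "q \<in> V"
  have pow: "Var q ^ k \<in> QDeg V (2 * int k)" for k
    using q by (simp add: Var_power QDeg_def mpolys_def)
  have "poly (map_poly Const p) (Var q) = (\<Sum>i\<le>n. Const (coeff p i) * Var q ^ i)"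
    unfolding poly_altdef by (simp add: degree_map_poly_Const degree_p coeff_map_poly_Const)
  also have "\<dots> = (\<Sum>i<n. Const (coeff p i) * Var q ^ i) + Var q ^ n"
    by (simp add: coeff_p Const_1 flip: lessThan_Suc_atMost)
  finally have eq: "Var q ^ n - poly (map_poly Const p) (Var q) = - (\<Sum>i<n. Const (coeff p i) * Var q ^ i)"
    by simp
  have "Const (coeff p i) * Var q ^ i \<in> QDeg V (2 * int n - 2)" if "i < n" for i
    using QDeg_mult[OF QDeg_Const[of 0 "coeff p i" V] pow[of i]] that by (auto intro: QDeg_mono)
  then show ?thesis unfolding eq by (intro QDeg_uminus QDeg_sum) auto
qed

text \<open>The set \<open>Q\<close> decreases from all marks to the empty set. In the step, the part of \<open>z\<close> divisible
  by \<open>x\<^sub>q ^ n\<close> is, up to terms of lower degree, in the image of a null-homotopic map.\<close>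

lemma reduction_aux:
  assumes "finite A" "A \<subseteq> V"
    and "z \<in> mf_space D i" "z \<in> EFilt D n {} j" "d z \<in> EFilt D n (V - A) (j + int n)" "z \<in> EFilt D n V (j - 1)"
  shows "\<exists>u\<in>mf_space D i. u \<in> EFilt D n {} (j - (int n + 1)) \<and> z - d u \<in> EFilt D n (V - A) (j - 1)"
  using assms
proof (induction A arbitrary: z rule: finite_induct)
  case empty
  have "d 0 = 0" unfolding mf_diff_kos by (simp add: fun_eq_iff kos_def kos_term_def case_prod_beta)
  then have "z - d 0 = z" by simp
  then show ?case
    using empty.prems(5) by (intro bexI[of _ 0] conjI EFilt_0 mf_space_0) (simp only: Diff_empty)
next
  case (insert q A)
  let ?Q = "V - insert q A"
  have q: "q \<in> V" "q \<notin> ?Q" and ins: "V - A = insert q ?Q" using insert by auto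
  have "d z \<in> EFilt D n (V - A) (j + int n)"
    using insert.prems(4) by (rule EFilt_mono) auto
  then obtain u where u: "u \<in> mf_space D i" "u \<in> EFilt D n {} (j - (int n + 1))" "z - d u \<in> EFilt D n (insert q ?Q) (j - 1)"
    using insert.IH[of z] insert.prems unfolding ins by blast
  define z1 where "z1 = z - d u"
  have du: "d u \<in> EFilt D n {} j" using d_EFilt[OF u(1,2)] by simp
  have z1: "z1 \<in> mf_space D i" "z1 \<in> EFilt D n (insert q ?Q) (j - 1)" "z1 \<in> EFilt D n {} j"
    unfolding z1_def using u insert.prems(2,3) du by (auto intro: mf_space_diff d_mf_space EFilt_diff)
  have dlin: "d (x - y) = d x - d y" for x y
    unfolding mf_diff_kos by (simp add: fun_eq_iff kos_def kos_term_def case_prod_beta algebra_simps sum_subtractf)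
  have dz1: "d z1 = d z" unfolding z1_def dlin by (simp add: d_d[OF u(1)])
  \<comment> \<open>In each coordinate z1 = x_q^n t + y, where y already has the desired
    form.\<close>
  have "\<exists>t. t \<in> QDeg V (j - bdeg D n (fst s) (snd s) - 2 * int n) \<and>
      z1 s - Var q ^ n * t \<in> IDeg V n ?Q (j - 1 - bdeg D n (fst s) (snd s)) \<and> (z1 s = 0 \<longrightarrow> t = 0)" for s
    by (rule IDeg_split) (use z1(2,3) in \<open>cases s; simp add: EFilt_def flip: IDeg_empty[of _ n]\<close>)+
  then obtain t where t: "\<And>s. t s \<in> QDeg V (j - bdeg D n (fst s) (snd s) - 2 * int n)"
    "\<And>s. z1 s - Var q ^ n * t s \<in> IDeg V n ?Q (j - 1 - bdeg D n (fst s) (snd s))"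
    "\<And>s. z1 s = 0 \<Longrightarrow> t s = 0" by metis
  have tC: "t \<in> mf_space D i"
  proof (rule mf_spaceI)
    show "t (v, S) \<in> mpolys V" for v S using QDeg_mpolys[OF t(1)] .
    fix v S assume "t (v, S) \<noteq> 0"
    then have "z1 (v, S) \<noteq> 0" using t(3) by blast
    then show "v \<subseteq> {..<length (crossings D)} \<and> S \<subseteq> {..<N} \<and> cohom_degree D v = i"
      using mf_spaceD(2-4)[OF z1(1)] by blast
  qed
  have tE: "t \<in> EFilt D n {} (j - 2 * int n)"
    unfolding EFilt_def IDeg_empty using t(1) by (auto simp: algebra_simps)
  define y where "y = (\<lambda>s. z1 s - Var q ^ n * t s)"
  have yE: "y \<in> EFilt D n ?Q (j - 1)" unfolding EFilt_def y_def using t(2) by auto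
  have xV: "Var q ^ n \<in> mpolys V" using q by (simp add: Var_power mpolys_def)
  have yC: "y \<in> mf_space D i"
    using mf_space_diff[OF z1(1) mf_space_mult[OF xV tC]] by (simp add: y_def fun_diff_def)
  have "d y = (\<lambda>s. d z1 s - Var q ^ n * d t s)"
    unfolding mf_diff_kos y_def
    by (simp add: fun_eq_iff kos_def kos_term_def case_prod_beta algebra_simps sum_subtractf sum_distrib_left)
  then have xdt: "(\<lambda>s. Var q ^ n * d t s) = d z - d y" by (simp add: dz1 fun_eq_iff)
  have "d y \<in> EFilt D n ?Q (j + int n)" using d_EFilt[OF yC yE] by simp
  then have "(\<lambda>s. Var q ^ n * d t s) \<in> EFilt D n ?Q (j + int n)"
    unfolding xdt using insert.prems(4) by (intro EFilt_diff)
  \<comment> \<open>Cancelling x_q^n, which is no zero divisor modulo the remaining powers, shows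
    that \<open>t\<close> is a cocycle to leading order modulo these powers.\<close>
  then have dt: "d t \<in> EFilt D n ?Q (j + int n - 2 * int n)"
    unfolding EFilt_def
    using IDeg_Var_power_cancel[OF mf_spaceD(1)[OF d_mf_space[OF tC]] q(2)] by (simp add: algebra_simps)
  from ex_null_homotopy[OF q(1)] obtain h where
    h12: "\<forall>i z. z \<in> mf_space D i \<longrightarrow> h z \<in> mf_space D i \<and>
      (\<lambda>s. d (h z) s + h (d z) s) = (\<lambda>s. poly (map_poly Const p) (Var q) * z s)"
    and h3: "\<forall>i Q j z. z \<in> mf_space D i \<longrightarrow> z \<in> EFilt D n Q j \<longrightarrow> h z \<in> EFilt D n Q (j + (int n - 1))"
    by (elim exE conjE)
  have h1: "h z \<in> mf_space D i"
    and h2: "(\<lambda>s. d (h z) s + h (d z) s) = (\<lambda>s. poly (map_poly Const p) (Var q) * z s)"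
    if "z \<in> mf_space D i" for z i
    using h12[rule_format, OF that] by (rule conjunct1, rule conjunct2)
  note h = h1 h2 h3[rule_format]
  \<comment> \<open>Up to lower terms x_q^n t equals p(x_q) t = d (h t) + h (d t). The first summand
    is a coboundary, and the second is one degree lower than expected, by the bound just obtained
    for \<open>d t\<close>.\<close>
  let ?u = "u + h t"
  have "z - d ?u = y + (\<lambda>s. (Var q ^ n - poly (map_poly Const p) (Var q)) * t s) + h (d t)"
  proof
    fix s
    have "d ?u s = d u s + d (h t) s"
      unfolding mf_diff_kos by (simp add: kos_def kos_term_def case_prod_beta algebra_simps sum.distrib)
    moreover have "d (h t) s + h (d t) s = poly (map_poly Const p) (Var q) * t s"
      using fun_cong[OF h(2)[OF tC]] by blast
    ultimately show "(z - d ?u) s = (y + (\<lambda>s. (Var q ^ n - poly (map_poly Const p) (Var q)) * t s) + h (d t)) s"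
      by (simp add: y_def z1_def algebra_simps)
  qed
  moreover have "(\<lambda>s. (Var q ^ n - poly (map_poly Const p) (Var q)) * t s) \<in> EFilt D n ?Q (j - 1)"
    using EFilt_mult[OF P_lower[OF q(1)] tE] by (rule EFilt_mono) auto
  moreover have "h (d t) \<in> EFilt D n ?Q (j - 1)"
    using h(3)[OF d_mf_space[OF tC] dt] by simp
  ultimately have "z - d ?u \<in> EFilt D n ?Q (j - 1)" using yE by (simp add: EFilt_add)
  moreover have "?u \<in> mf_space D i" using u(1) h(1)[OF tC] by (rule mf_space_add)
  moreover have "h t \<in> EFilt D n {} (j - (int n + 1))"
    using h(3)[OF tC tE] by (rule EFilt_mono) auto
  then have "?u \<in> EFilt D n {} (j - (int n + 1))" using u(2) by (intro EFilt_add)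
  ultimately show ?case by blast
qed

end

subsection \<open>The instance of the abstract theory\<close>

definition bmax :: "diagram \<Rightarrow> nat \<Rightarrow> int" where
  "bmax D n = (\<Sum>(v, S)\<in>Pow {..<length (crossings D)} \<times> Pow {..<num_factors D}. \<bar>bdeg D n v S\<bar>)"

lemma bmax:
  assumes "v \<subseteq> {..<length (crossings D)}" "S \<subseteq> {..<num_factors D}"
  shows "\<bar>bdeg D n v S\<bar> \<le> bmax D n"
proof -
  have "(\<lambda>(v, S). \<bar>bdeg D n v S\<bar>) (v, S) \<le> bmax D n"
    unfolding bmax_def by (rule member_le_sum) (use assms in auto)
  then show ?thesis by simp
qed

lemma bmax_nonneg: "0 \<le> bmax D n"
  unfolding bmax_def by (rule sum_nonneg) auto

definition jmin :: "diagram \<Rightarrow> nat \<Rightarrow> int" where "jmin D n = - bmax D n - 1"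
text \<open>Chosen so that a monomial of total degree above \<open>jmax\<close> has some exponent at
  least \<open>n\<close>: if no exponent exceeds \<open>n\<close>, its quantum degree is at most
  twice \<open>card (marks D) * n\<close>, to which the basis degree adds at most
  \<open>bmax\<close>.\<close>

definition jmax :: "diagram \<Rightarrow> nat \<Rightarrow> int" where "jmax D n = 2 * (int (card (marks D)) * int n) + bmax D n"
text \<open>The entries of the \<chi> maps have degree at most \<open>2 * n + 2\<close>, and the
  basis degrees of source and target differ by at most \<open>2 * bmax D n\<close>.\<close>

definition chi_shift :: "diagram \<Rightarrow> nat \<Rightarrow> int" where "chi_shift D n = 2 * bmax D n + 2 * int n + 2"
definition jtop :: "diagram \<Rightarrow> nat \<Rightarrow> int" where "jtop D n = jmax D n + chi_shift D n"

lemma jmin_jmax_jtop: "jmin D n \<le> jmax D n" "jmax D n \<le> jtop D n"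
proof -
  have "0 \<le> int (card (marks D)) * int n" by simp
  then show "jmin D n \<le> jmax D n" "jmax D n \<le> jtop D n"
    using bmax_nonneg[of D n] unfolding jmin_def jmax_def jtop_def chi_shift_def by linarith+
qed

lemma cohom_degree_bounds:
  assumes "v \<subseteq> {..<length (crossings D)}"
  shows "- int (length (crossings D)) \<le> cohom_degree D v" "cohom_degree D v \<le> int (length (crossings D))"
proof -
  have "card v \<le> length (crossings D)" using card_mono[OF _ assms] by simp
  moreover have "card {c. c < length (crossings D) \<and> \<not> positive (crossings D ! c)} \<le> length (crossings D)"
    using card_mono[of "{..<length (crossings D)}" "{c. c < length (crossings D) \<and> \<not> positive (crossings D ! c)}"] by auto
  ultimately show "- int (length (crossings D)) \<le> cohom_degree D v" "cohom_degree D v \<le> int (length (crossings D))"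
    unfolding cohom_degree_def by linarith+
qed

lemma mf_space_trivial:
  assumes "i < - int (length (crossings D)) \<or> int (length (crossings D)) < i"
  shows "mf_space D i = {0}"
proof -
  have "z = 0" if z: "z \<in> mf_space D i" for z
  proof
    fix s :: "nat set \<times> nat set"
    obtain v S where s: "s = (v, S)" by fastforce
    have "z (v, S) = 0"
    proof (rule ccontr)
      assume nz: "z (v, S) \<noteq> 0"
      show False
        using cohom_degree_bounds[OF mf_spaceD(2)[OF z nz]] mf_spaceD(4)[OF z nz] assms by auto
    qed
    then show "z s = 0 s" by (simp add: s)
  qed
  then show ?thesis by auto
qed

lemma Filt_jmin:
  assumes z: "z \<in> mf_space D i" "z \<in> Filt D n (jmin D n)"
  shows "z = 0"
proof
  fix s :: "nat set \<times> nat set"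
  obtain v S where s: "s = (v, S)" by fastforce
  have "Poly_Mapping.keys (z (v, S)) = {}"
  proof (rule ccontr)
    assume "Poly_Mapping.keys (z (v, S)) \<noteq> {}"
    then obtain m where m: "m \<in> Poly_Mapping.keys (z (v, S))" by blast
    then have "z (v, S) \<noteq> 0" by auto
    then have "\<bar>bdeg D n v S\<bar> \<le> bmax D n" using mf_spaceD(2,3)[OF z(1)] by (intro bmax)
    moreover have "2 * int (monom_degree m) + bdeg D n v S \<le> jmin D n" using z(2) m by (auto simp: Filt_def)
    ultimately show False by (simp add: jmin_def)
  qed
  then show "z s = 0 s" by (simp add: s)
qed

lemma ex_Filt:
  assumes z: "z \<in> mf_space D i"
  shows "\<exists>j. z \<in> Filt D n j"
proof -
  let ?A = "Pow {..<length (crossings D)} \<times> Pow {..<num_factors D}"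
  let ?M = "(\<Union>s\<in>?A. Poly_Mapping.keys (z s))"
  let ?j = "(\<Sum>m\<in>?M. 2 * int (monom_degree m)) + bmax D n"
  have "2 * int (monom_degree m) + bdeg D n v S \<le> ?j" if m: "m \<in> Poly_Mapping.keys (z (v, S))" for m v S
  proof -
    have "z (v, S) \<noteq> 0" using m by auto
    then have vS: "(v, S) \<in> ?A" using mf_spaceD(2,3)[OF z] by auto
    have "2 * int (monom_degree m) \<le> (\<Sum>m\<in>?M. 2 * int (monom_degree m))"
      by (rule member_le_sum) (use vS m in auto)
    moreover have "bdeg D n v S \<le> bmax D n" using bmax[of v D S n] vS by auto
    ultimately show ?thesis by simp
  qed
  then show ?thesis unfolding Filt_def by blast
qed

lemma Filt_mono: "j \<le> j' \<Longrightarrow> Filt D n j \<subseteq> Filt D n j'"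
  by (fastforce simp: Filt_def)

section \<open>The vector space of cube elements and its monomial coordinates\<close>

global_interpretation cube: vector_space cscale by (rule vector_space_cscale)

lemma subspace_mf_space: "cube.subspace (mf_space D i)"
  by (rule cube.subspaceI)
    (auto simp: cscale_def intro: mf_space_add mf_space_mult)

lemma keys_Const_mult: "Poly_Mapping.keys (Const c * f) \<subseteq> Poly_Mapping.keys f"
  by (auto simp: in_keys_iff lookup_Const_mult)

lemma subspace_Filt: "cube.subspace (Filt D n j)"
proof (rule cube.subspaceI)
  show "x + y \<in> Filt D n j" if "x \<in> Filt D n j" "y \<in> Filt D n j" for x y
    using that keys_add by (fastforce simp: Filt_def)
  show "cscale c x \<in> Filt D n j" if "x \<in> Filt D n j" for c x
    using that keys_Const_mult by (fastforce simp: Filt_def cscale_def)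
qed (simp add: Filt_def)

lemma linear_mf_diff: "Vector_Spaces.linear cscale cscale (mf_diff D k w)"
  by unfold_locales
    (simp_all add: mf_diff_kos kos_def kos_term_def cscale_def fun_eq_iff case_prod_beta algebra_simps
      sum.distrib sum_distrib_left)

lemma linear_cube_diff: "Vector_Spaces.linear cscale cscale (cube_diff D w)"
proof unfold_locales
  show "cube_diff D w (x + y) = cube_diff D w x + cube_diff D w y" for x y
    by (simp add: fun_eq_iff cube_diff_chi_op chi_op_def chi_map_add algebra_simps sum.distrib)
  show "cube_diff D w (cscale c x) = cscale c (cube_diff D w x)" for c x
    by (simp add: fun_eq_iff cube_diff_chi_op chi_op_def cscale_def chi_map_scale algebra_simps sum_distrib_left)
qed

definition unit_elem :: "(nat set \<times> nat set) \<times> (nat \<Rightarrow>\<^sub>0 nat) \<Rightarrow> cube_elem" where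
  "unit_elem l = (\<lambda>s. if s = fst l then Poly_Mapping.single (snd l) 1 else 0)"

definition coords :: "diagram \<Rightarrow> nat \<Rightarrow> int \<Rightarrow> int \<Rightarrow> ((nat set \<times> nat set) \<times> (nat \<Rightarrow>\<^sub>0 nat)) set" where
  "coords D n i j = {((v, S), m) | v S m. v \<subseteq> {..<length (crossings D)} \<and> S \<subseteq> {..<num_factors D} \<and>
     cohom_degree D v = i \<and> Poly_Mapping.keys m \<subseteq> marks D \<and> 2 * int (monom_degree m) + bdeg D n v S \<le> j}"

definition cf :: "cube_elem \<Rightarrow> (nat set \<times> nat set) \<times> (nat \<Rightarrow>\<^sub>0 nat) \<Rightarrow> complex" where
  "cf z l = Poly_Mapping.lookup (z (fst l)) (snd l)"

lemma cf_simps: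
  "cf (x + y) l = cf x l + cf y l" "cf (x - y) l = cf x l - cf y l" "cf (cscale c x) l = c * cf x l" "cf 0 l = 0"
  by (simp_all add: cf_def lookup_add lookup_minus cscale_def lookup_Const_mult)

lemma cf_sum: "cf (sum f A) l = (\<Sum>x\<in>A. cf (f x) l)"
  by (induction A rule: infinite_finite_induct) 
    (simp_all only: sum.infinite sum.empty sum.insert cf_simps simp_thms not_False_eq_True)

lemma cf_eqI: "(\<And>l. cf x l = cf y l) \<Longrightarrow> x = y"
  by (rule ext, rule poly_mapping_eqI) (metis cf_def fst_conv snd_conv)

lemma cf_unit_elem: "cf (unit_elem l) l' = (if l' = l then 1 else 0)"
  by (auto simp: cf_def unit_elem_def lookup_single when_def prod_eq_iff)

text \<open>Both conditions only concern supports, so a filtration step in a given degree is the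
  coordinate subspace on \<open>coords\<close>, a finite set that is the same for all
  potentials.\<close>

lemma mf_space_Filt_iff:
  "z \<in> mf_space D i \<and> z \<in> Filt D n j \<longleftrightarrow> (\<forall>l. cf z l \<noteq> 0 \<longrightarrow> l \<in> coords D n i j)"
proof
  assume z: "z \<in> mf_space D i \<and> z \<in> Filt D n j"
  show "\<forall>l. cf z l \<noteq> 0 \<longrightarrow> l \<in> coords D n i j"
  proof (intro allI impI)
    fix l assume l: "cf z l \<noteq> 0"
    obtain v S m where lv: "l = ((v, S), m)" by (metis prod.exhaust)
    have m: "m \<in> Poly_Mapping.keys (z (v, S))" using l by (simp add: cf_def lv in_keys_iff)
    then have "z (v, S) \<noteq> 0" by auto
    then show "l \<in> coords D n i j"
      using z m mf_spaceD[of z D i v S] by (auto simp: coords_def lv mpolys_def Filt_def)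
  qed
next
  assume l: "\<forall>l. cf z l \<noteq> 0 \<longrightarrow> l \<in> coords D n i j"
  have k: "((v, S), m) \<in> coords D n i j" if "m \<in> Poly_Mapping.keys (z (v, S))" for v S m
    using that l by (auto simp: cf_def in_keys_iff)
  have "z \<in> mf_space D i"
  proof (rule mf_spaceI)
    show "z (v, S) \<in> mpolys (marks D)" for v S using k by (auto simp: mpolys_def coords_def)
    fix v S assume "z (v, S) \<noteq> 0"
    then obtain m where "m \<in> Poly_Mapping.keys (z (v, S))"
      by (metis ex_in_conv keys_zero lookup_not_eq_zero_eq_in_keys poly_mapping_eqI lookup_zero)
    from k[OF this] show "v \<subseteq> {..<length (crossings D)} \<and> S \<subseteq> {..<num_factors D} \<and> cohom_degree D v = i"
      by (auto simp: coords_def)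
  qed
  moreover have "z \<in> Filt D n j" using k by (auto simp: Filt_def coords_def)
  ultimately show "z \<in> mf_space D i \<and> z \<in> Filt D n j" by blast
qed

lemma finite_monomials:
  assumes "finite V"
  shows "finite {m :: nat \<Rightarrow>\<^sub>0 nat. Poly_Mapping.keys m \<subseteq> V \<and> monom_degree m \<le> d}"
proof -
  let ?A = "{m :: nat \<Rightarrow>\<^sub>0 nat. Poly_Mapping.keys m \<subseteq> V \<and> monom_degree m \<le> d}"
  let ?f = "\<lambda>m :: nat \<Rightarrow>\<^sub>0 nat. restrict (Poly_Mapping.lookup m) V"
  have "?f ` ?A \<subseteq> V \<rightarrow>\<^sub>E {..d}"
  proof (rule image_subsetI)
    fix m :: "nat \<Rightarrow>\<^sub>0 nat" assume m: "m \<in> ?A"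
    have "Poly_Mapping.lookup m i \<le> d" if "i \<in> V" for i
    proof -
      have "Poly_Mapping.lookup m i \<le> (\<Sum>i\<in>V. Poly_Mapping.lookup m i)"
        by (rule member_le_sum[OF that]) (use assms in auto)
      then show ?thesis using m monom_degree_superset[OF assms, of m] by simp
    qed
    then show "?f m \<in> V \<rightarrow>\<^sub>E {..d}" by auto
  qed
  moreover have "finite (V \<rightarrow>\<^sub>E {..d})" using assms by (intro finite_PiE) auto
  ultimately have "finite (?f ` ?A)" by (rule finite_subset)
  moreover have "inj_on ?f ?A"
  proof (rule inj_onI)
    fix m m' assume m: "m \<in> ?A" "m' \<in> ?A" "?f m = ?f m'"
    show "m = m'"
    proof (rule poly_mapping_eqI)
      fix i
      show "Poly_Mapping.lookup m i = Poly_Mapping.lookup m' i"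
      proof (cases "i \<in> V")
        case True
        then show ?thesis using fun_cong[OF m(3), of i] by simp
      next
        case False
        then have "i \<notin> Poly_Mapping.keys m" "i \<notin> Poly_Mapping.keys m'" using m by auto
        then show ?thesis by (simp add: in_keys_iff)
      qed
    qed
  qed
  ultimately show ?thesis by (rule finite_imageD)
qed

lemma finite_coords: "finite (coords D n i j)"
proof (rule finite_subset)
  let ?M = "{m :: nat \<Rightarrow>\<^sub>0 nat. Poly_Mapping.keys m \<subseteq> marks D \<and> monom_degree m \<le> nat (j + bmax D n)}"
  show "coords D n i j \<subseteq> (Pow {..<length (crossings D)} \<times> Pow {..<num_factors D}) \<times> ?M"
  proof
    fix l assume "l \<in> coords D n i j"
    then obtain v S m where l: "l = ((v, S), m)" "v \<subseteq> {..<length (crossings D)}" "S \<subseteq> {..<num_factors D}"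
      "Poly_Mapping.keys m \<subseteq> marks D" "2 * int (monom_degree m) + bdeg D n v S \<le> j"
      unfolding coords_def by blast
    have "monom_degree m \<le> nat (j + bmax D n)" using l(5) bmax[OF l(2,3), of n] by linarith
    with l show "l \<in> (Pow {..<length (crossings D)} \<times> Pow {..<num_factors D}) \<times> ?M" by auto
  qed
  show "finite ((Pow {..<length (crossings D)} \<times> Pow {..<num_factors D}) \<times> ?M)"
    by (intro finite_cartesian_product finite_monomials) simp_all
qed

lemma unit_elem_expansion:
  assumes "finite A" "\<And>l. cf z l \<noteq> 0 \<Longrightarrow> l \<in> A"
  shows "z = (\<Sum>l\<in>A. cscale (cf z l) (unit_elem l))"
proof (rule cf_eqI)
  fix l'
  have "cf (\<Sum>l\<in>A. cscale (cf z l) (unit_elem l)) l' = (\<Sum>l\<in>A. if l' = l then cf z l else 0)"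
    unfolding cf_sum by (rule sum.cong) (simp_all add: cf_simps cf_unit_elem)
  also have "\<dots> = cf z l'" using assms(1) assms(2)[of l'] by (cases "cf z l' = 0") simp_all
  finally show "cf z l' = cf (\<Sum>l\<in>A. cscale (cf z l) (unit_elem l)) l'" by (rule sym)
qed

lemma mf_space_Filt_span: "mf_space D i \<inter> Filt D n j \<subseteq> cube.span (unit_elem ` coords D n i j)"
proof
  fix z assume "z \<in> mf_space D i \<inter> Filt D n j"
  then have "\<And>l. cf z l \<noteq> 0 \<Longrightarrow> l \<in> coords D n i j" using mf_space_Filt_iff[of z D i n j] by blast
  from unit_elem_expansion[OF finite_coords this]
  show "z \<in> cube.span (unit_elem ` coords D n i j)"
    by (metis (no_types, lifting) cube.span_base cube.span_scale cube.span_sum imageI)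
qed

section \<open>Degree reduction and the levels for link diagrams\<close>

context link_potential
begin

abbreviation "X \<equiv> cube_diff D w"

text \<open>Above \<open>jmax\<close> each monomial of top degree contains some x_q^n, so the
  leading part of \<open>z\<close> lies in the ideal of all these powers. Applying
  \<open>reduction_aux\<close> to all marks leaves the empty set of powers, that is, a drop in the
  filtration.\<close>

lemma reduction:
  assumes z: "z \<in> mf_space D i" "z \<in> Filt D n j" and dz: "d z \<in> Filt D n (j + int n)" and j: "jmax D n < j"
  shows "\<exists>u\<in>mf_space D i. z - d u \<in> Filt D n (j - 1)"
proof -
  have zE: "z \<in> EFilt D n {} j" using z Filt_EFilt by blast
  have "d z \<in> EFilt D n {} (j + int n)" using dz Filt_EFilt[OF d_mf_space[OF z(1)]] by blast
  moreover have "z \<in> EFilt D n V (j - 1)"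
    unfolding EFilt_def IDeg_def
  proof (intro CollectI allI conjI ballI)
    fix v S
    show "z (v, S) \<in> mpolys V" by (rule mf_spaceD(1)[OF z(1)])
    fix m assume m: "m \<in> Poly_Mapping.keys (z (v, S))"
    then have nz: "z (v, S) \<noteq> 0" by auto
    show "(\<exists>q\<in>V. n \<le> Poly_Mapping.lookup m q) \<or> 2 * int (monom_degree m) \<le> j - 1 - bdeg D n v S"
    proof (rule disjCI)
      assume ge: "\<not> 2 * int (monom_degree m) \<le> j - 1 - bdeg D n v S"
      show "\<exists>q\<in>V. n \<le> Poly_Mapping.lookup m q"
      proof (rule ccontr)
        assume "\<not> (\<exists>q\<in>V. n \<le> Poly_Mapping.lookup m q)"
        then have "\<And>q. q \<in> V \<Longrightarrow> Poly_Mapping.lookup m q \<le> n" by (meson le_cases)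
        then have "(\<Sum>q\<in>V. Poly_Mapping.lookup m q) \<le> card V * n"
          using sum_bounded_above[of V "Poly_Mapping.lookup m" n] by simp
        moreover have "Poly_Mapping.keys m \<subseteq> V"
          using mf_spaceD(1)[OF z(1), of v S] m by (auto simp: mpolys_def)
        ultimately have "monom_degree m \<le> card V * n"
          using monom_degree_superset[OF finite_marks, of m D] by simp
        then have "int (monom_degree m) \<le> int (card V) * int n" by (metis of_nat_mono of_nat_mult)
        moreover have "bdeg D n v S \<le> bmax D n"
          using bmax[OF mf_spaceD(2,3)[OF z(1) nz], of n] by simp
        ultimately show False using ge j by (simp add: jmax_def)
      qed
    qed
  qed
  ultimately obtain u where u: "u \<in> mf_space D i" "z - d u \<in> EFilt D n (V - V) (j - 1)"
    using reduction_aux[of V z i j, OF _ _ z(1) zE] by auto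
  then have "z - d u \<in> Filt D n (j - 1)"
    using Filt_EFilt[OF mf_space_diff[OF z(1) d_mf_space[OF u(1)]]] by simp
  with u(1) show ?thesis by blast
qed

text \<open>The hypothesis on \<open>d z\<close> covers two uses: cocycles, and cochains whose
  coboundary lies low enough. Every cochain lies in some filtration step, and the descent starts
  there.\<close>

lemma reduction_to:
  assumes l: "jmax D n \<le> l" and "z \<in> mf_space D i" and "d z \<in> Filt D n (l + 1 + int n)"
  shows "\<exists>u\<in>mf_space D i. z - d u \<in> Filt D n l"
proof -
  interpret d: Vector_Spaces.linear cscale cscale d by (rule linear_mf_diff)
  have step: "z \<in> Filt D n (l + int k) \<Longrightarrow> z \<in> mf_space D i \<Longrightarrow> d z \<in> Filt D n (l + 1 + int n) \<Longrightarrow>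
      \<exists>u\<in>mf_space D i. z - d u \<in> Filt D n l" for k z
  proof (induction k arbitrary: z)
    case 0
    have "z - d 0 \<in> Filt D n l" unfolding d.zero diff_zero using 0(1) by simp
    then show ?case by (rule bexI[OF _ mf_space_0])
  next
    case (Suc k)
    let ?j = "l + int (Suc k)"
    have "d z \<in> Filt D n (?j + int n)"
      using Suc.prems(3) Filt_mono[of "l + 1 + int n" "?j + int n" D n] by auto
    then obtain u where u: "u \<in> mf_space D i" "z - d u \<in> Filt D n (?j - 1)"
      using reduction[of z i ?j] Suc.prems l by auto
    have du: "d (z - d u) = d z" by (simp only: d.diff d_d[OF u(1)] diff_zero)
    have "z - d u \<in> mf_space D i" by (rule mf_space_diff[OF Suc.prems(2) d_mf_space[OF u(1)]])
    moreover have "z - d u \<in> Filt D n (l + int k)" using u(2) by simp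
    ultimately obtain u' where u': "u' \<in> mf_space D i" "z - d u - d u' \<in> Filt D n l"
      using Suc.IH[of "z - d u"] Suc.prems(3) unfolding du by blast
    then have "z - d (u + u') \<in> Filt D n l" by (simp add: d.add diff_diff_eq)
    then show ?case using mf_space_add[OF u(1) u'(1)] by blast
  qed
  obtain j where "z \<in> Filt D n j" using ex_Filt[OF assms(2)] by blast
  then have "z \<in> Filt D n (l + int (nat (j - l)))" using Filt_mono[of j "l + int (nat (j - l))" D n] by auto
  from step[OF this assms(2,3)] show ?thesis .
qed

lemma QDeg_chi_map:
  assumes c: "c < length (crossings D)" and t: "\<And>b b'. t b b' \<in> QDeg V e"
  shows "chi_map (crossings D ! c) w t f f' \<in> QDeg V (e + (2 * int n + 2))"
proof -
  let ?X = "crossings D ! c"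
  let ?e = "e + (2 * int n + 2)"
  note V = crossing_marks[OF D c]
  have x: "Var (out1 ?X) \<in> QDeg V 2" "Var (out2 ?X) \<in> QDeg V 2" "Var (in3 ?X) \<in> QDeg V 2" "Var (in4 ?X) \<in> QDeg V 2"
    using V by (auto intro: QDeg_Var)
  have mult: "r * t b b' \<in> QDeg V ?e" if "r \<in> QDeg V (2 * int n + 2)" for r b b'
    using QDeg_mult[OF that t[of b b']] by (simp add: add.commute)
  have x': "Var (out1 ?X) \<in> QDeg V (2 * int n + 2)" "Var (in3 ?X) \<in> QDeg V (2 * int n + 2)"
    "Var (out1 ?X) - Var (in3 ?X) \<in> QDeg V (2 * int n + 2)"
    using x QDeg_diff[OF x(1,3)] by (auto intro: QDeg_mono)
  have ce: "chi_entry w (Var (out1 ?X)) (Var (out2 ?X)) (Var (in3 ?X)) (Var (in4 ?X)) \<in> QDeg V (2 * int n + 2)"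
    using QDeg_chi_entry[OF w_PDeg x] by (rule QDeg_mono) simp
  have t': "t b b' \<in> QDeg V ?e" for b b' using t[of b b'] by (rule QDeg_mono) simp
  show ?thesis
    unfolding chi_map_def
    by (cases "positive ?X"; cases f; cases f')
      (auto intro!: QDeg_add QDeg_diff QDeg_uminus mult x' ce t' QDeg_uminus[OF ce])
qed

lemma X_mf_space: 
  assumes z: "z \<in> mf_space D i"
  shows "X z \<in> mf_space D (i + 1)"
proof (rule mf_spaceI)
  fix v S
  obtain j where "z \<in> Filt D n j" using ex_Filt[OF z] by blast
  have nz: "v \<subseteq> {..<length (crossings D)} \<and> S \<subseteq> {..<N} \<and> cohom_degree D v = i + 1" if "X z (v, S) \<noteq> 0"
  proof -
    from that obtain c where c: "c \<in> v" "c < length (crossings D)" "chi_op D w c z v S \<noteq> 0"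
      unfolding cube_diff_chi_op by (metis (mono_tags, lifting) mem_Collect_eq mult_zero_right sum.neutral)
    have "\<exists>b b'. z (v - {c}, set_bits c S b b') \<noteq> 0"
    proof (rule ccontr)
      assume "\<not> (\<exists>b b'. z (v - {c}, set_bits c S b b') \<noteq> 0)"
      then have "chi_op D w c z v S = 0" by (simp add: chi_op_def chi_map_0)
      with c(3) show False by simp
    qed
    then obtain b b' where b: "z (v - {c}, set_bits c S b b') \<noteq> 0" by blast
    note * = mf_spaceD(2-4)[OF z b]
    have "finite (v - {c})" using *(1) by (rule finite_subset) simp
    then have "finite v" by simp
    then have "card v = Suc (card (v - {c}))" using card_Suc_Diff1[OF _ c(1)] by simp
    then have "cohom_degree D v = i + 1" using *(3) by (simp add: cohom_degree_def)
    moreover have "S \<subseteq> set_bits c S b b' \<union> {2 * c, 2 * c + 1}" by (auto simp: set_bits_def)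
    then have "S \<subseteq> {..<N}" using *(2) c(2) by (auto simp: num_factors_def)
    moreover have "v \<subseteq> {..<length (crossings D)}" using *(1) c(2) by auto
    ultimately show ?thesis by blast
  qed
  then show "X z (v, S) \<noteq> 0 \<Longrightarrow> v \<subseteq> {..<length (crossings D)} \<and> S \<subseteq> {..<N} \<and> cohom_degree D v = i + 1" .
  have "chi_op D w c z v S \<in> mpolys V" if c: "c < length (crossings D)" for c
  proof -
    have "z (v - {c}, set_bits c S b b') \<in> QDeg V (j + bmax D n)" for b b'
    proof (cases "z (v - {c}, set_bits c S b b') = 0")
      case False
      have "\<bar>bdeg D n (v - {c}) (set_bits c S b b')\<bar> \<le> bmax D n"
        using mf_spaceD(2,3)[OF z False] by (intro bmax)
      moreover have "z (v - {c}, set_bits c S b b') \<in> QDeg V (j - bdeg D n (v - {c}) (set_bits c S b b'))"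
        using \<open>z \<in> Filt D n j\<close> unfolding Filt_EFilt[OF z] EFilt_def IDeg_empty by blast
      ultimately show ?thesis by (auto elim: QDeg_mono)
    qed simp
    from QDeg_chi_map[OF c this] show ?thesis unfolding chi_op_def by (rule QDeg_mpolys)
  qed
  moreover have "(- 1) ^ k \<in> mpolys V" for k :: nat
    by (cases "even k") (use QDeg_mpolys[OF QDeg_1[of 0 V]] in \<open>simp_all add: mpolys_uminus\<close>)
  ultimately show "X z (v, S) \<in> mpolys V"
    unfolding cube_diff_chi_op by (intro mpolys_sum mpolys_mult) auto
qed

lemma X_Filt:
  assumes z: "z \<in> mf_space D i" "z \<in> Filt D n j"
  shows "X z \<in> Filt D n (j + chi_shift D n)"
  unfolding Filt_EFilt[OF X_mf_space[OF z(1)]] EFilt_def IDeg_empty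
proof (intro CollectI allI)
  fix v S
  show "X z (v, S) \<in> QDeg V (j + chi_shift D n - bdeg D n v S)"
  proof (cases "X z (v, S) = 0")
    case False
    then have "\<bar>bdeg D n v S\<bar> \<le> bmax D n"
      using mf_spaceD(2,3)[OF X_mf_space[OF z(1)], of v S] by (intro bmax)
    moreover have "X z (v, S) \<in> QDeg V (0 + (j + bmax D n + (2 * int n + 2)))"
      unfolding cube_diff_chi_op
    proof (intro QDeg_sum QDeg_mult)
      fix c assume c: "c \<in> {c \<in> v. c < length (crossings D)}"
      show "(- 1) ^ card {c' \<in> v. c' < c} \<in> QDeg V 0"
        by (cases "even (card {c' \<in> v. c' < c})") (simp_all add: QDeg_1 QDeg_uminus)
      have "z (v - {c}, set_bits c S b b') \<in> QDeg V (j + bmax D n)" for b b'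
      proof (cases "z (v - {c}, set_bits c S b b') = 0")
        case False
        have "\<bar>bdeg D n (v - {c}) (set_bits c S b b')\<bar> \<le> bmax D n"
          using mf_spaceD(2,3)[OF z(1) False] by (intro bmax)
        moreover have "z (v - {c}, set_bits c S b b') \<in> QDeg V (j - bdeg D n (v - {c}) (set_bits c S b b'))"
          using z(2) unfolding Filt_EFilt[OF z(1)] EFilt_def IDeg_empty by blast
        ultimately show ?thesis by (auto elim: QDeg_mono)
      qed simp
      then show "chi_op D w c z v S \<in> QDeg V (j + bmax D n + (2 * int n + 2))"
        unfolding chi_op_def using c by (intro QDeg_chi_map) auto
    qed
    ultimately show ?thesis by (auto elim!: QDeg_mono simp: chi_shift_def)
  qed simp
qed

lemma double_complex: "double_complex cscale (mf_space D) (Filt D n) d X"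
proof -
  interpret X: Vector_Spaces.linear cscale cscale X by (rule linear_cube_diff)
  show ?thesis
  proof unfold_locales
    fix i x assume x: "x \<in> mf_space D i"
    show "d x \<in> mf_space D i" "d (d x) = 0" "X x \<in> mf_space D (i + 1)"
      using x by (rule d_mf_space, rule d_d, rule X_mf_space)
    show "d (X x) = X (d x)" by (rule mf_diff_cube_diff[OF mf_spaceD(5)[OF x]])
    show "X (X x) = 0" by (rule cube_diff_cube_diff)
  qed (use subspace_mf_space subspace_Filt linear_mf_diff linear_cube_diff in
      \<open>auto simp: Vector_Spaces.linear_iff\<close>)
qed

abbreviation "len \<equiv> int (length (crossings D))"

text \<open>\<open>jtop\<close> serves both as \<open>L\<close> and as \<open>K\<close>: a cochain
  with coboundary in step \<open>jtop\<close> can itself be reduced to step \<open>jtop\<close>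
  without changing its coboundary.\<close>

lemma filtered_double_complex:
  "filtered_double_complex cscale (mf_space D) (Filt D n) d X (jmin D n) (jmax D n) (jtop D n) (jtop D n) (- len) (len + 1)"
proof -
  interpret double_complex cscale "mf_space D" "Filt D n" d X by (rule double_complex)
  show ?thesis
  proof unfold_locales
    fix i x assume "x \<in> Z i"
    then have "x \<in> mf_space D i" "d x \<in> Filt D n (jmax D n + 1 + int n)"
      using cube.subspace_0[OF subspace_Filt] by (auto simp: Z_def)
    then show "\<exists>u\<in>mf_space D i. x - d u \<in> Filt D n (jmax D n)"
      by (intro reduction_to) auto
  next
    fix i y assume y: "y \<in> mf_space D i" "d y \<in> Filt D n (jtop D n)"
    have "d y \<in> Filt D n (jtop D n + 1 + int n)"
      using y(2) Filt_mono[of "jtop D n" "jtop D n + 1 + int n" D n] by auto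
    then obtain u where u: "u \<in> mf_space D i" "y - d u \<in> Filt D n (jtop D n)"
      using reduction_to[OF jmin_jmax_jtop(2) y(1)] by blast
    have "d (y - d u) = d y" by (simp only: D.diff D_D[OF u(1)] diff_zero)
    then show "\<exists>y'\<in>mf_space D i \<inter> Filt D n (jtop D n). d y' = d y"
      using u mf_space_diff[OF y(1) d_mf_space[OF u(1)]] by blast
  next
    fix i x assume "x \<in> mf_space D i" "x \<in> Filt D n (jmax D n)"
    then show "X x \<in> Filt D n (jtop D n)" unfolding jtop_def by (rule X_Filt)
  next
    show "\<exists>A. finite A \<and> mf_space D i \<inter> Filt D n j \<subseteq> cube.span A" for i j
      using mf_space_Filt_span[of D i n j] finite_coords[of D n i j] by blast
  next
    show "len + 1 \<le> i \<Longrightarrow> mf_space D i = {0}" for i by (rule mf_space_trivial) auto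
    show "i < - len \<Longrightarrow> mf_space D i = {0}" for i by (rule mf_space_trivial) auto
  qed (use Filt_mono Filt_jmin jmin_jmax_jtop in auto)
qed

lemma KR_complex_eq: "KR_complex D p = coset_complex cscale (mf_space D) (Filt D n) d X"
proof -
  have "z \<in> mf_space D i \<Longrightarrow> z \<in> Filt D n j \<longleftrightarrow> z \<in> mf_filt D (int n) w j" for z i j by (rule Filt_mf_filt)
  then show ?thesis
    unfolding KR_complex_def coset_complex_def Let_def degree_p w_def[symmetric]
    by (auto simp: cscale_def[abs_def] fun_eq_iff conj_assoc)
qed

end

section \<open>Dependence on the potential\<close>

lemma polyfun_cong: "(\<And>p. p \<in> potentials n \<Longrightarrow> f p = g p) \<Longrightarrow> polyfun n f \<longleftrightarrow> polyfun n g"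
  by (simp add: polyfun_def)

text \<open>A polynomial-valued family with finitely many fixed polynomials and coefficients that
  are polynomial in the potential. Thus each coefficient of a monomial depends polynomially on the
  potential.\<close>

definition polyfam :: "nat \<Rightarrow> (complex poly \<Rightarrow> mpoly) \<Rightarrow> bool" where
  "polyfam n f \<longleftrightarrow> (\<exists>cs. (\<forall>(c, g)\<in>set cs. polyfun n c) \<and>
     (\<forall>p\<in>potentials n. f p = (\<Sum>(c, g)\<leftarrow>cs. Const (c p) * g)))"

lemma polyfam_coeff: "polyfun n c \<Longrightarrow> polyfam n (\<lambda>p. Const (c p) * g)"
  unfolding polyfam_def by (rule exI[of _ "[(c, g)]"]) simp

lemma polyfam_const: "polyfam n (\<lambda>p. g)"
  using polyfam_coeff[of n "\<lambda>p. 1" g] by (simp add: Const_1)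

lemma polyfam_add:
  assumes "polyfam n f" "polyfam n g"
  shows "polyfam n (\<lambda>p. f p + g p)"
proof -
  obtain cs where cs: "\<forall>(c, g)\<in>set cs. polyfun n c" "\<forall>p\<in>potentials n. f p = (\<Sum>(c, g)\<leftarrow>cs. Const (c p) * g)"
    using assms(1) unfolding polyfam_def by blast
  obtain ds where ds: "\<forall>(c, g)\<in>set ds. polyfun n c" "\<forall>p\<in>potentials n. g p = (\<Sum>(c, g)\<leftarrow>ds. Const (c p) * g)"
    using assms(2) unfolding polyfam_def by blast
  show ?thesis unfolding polyfam_def
    by (rule exI[of _ "cs @ ds"]) (use cs ds in auto)
qed

lemma polyfam_mult_left:
  assumes "polyfam n f"
  shows "polyfam n (\<lambda>p. r * f p)"
proof -
  obtain cs where cs: "\<forall>(c, g)\<in>set cs. polyfun n c" "\<forall>p\<in>potentials n. f p = (\<Sum>(c, g)\<leftarrow>cs. Const (c p) * g)"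
    using assms unfolding polyfam_def by blast
  have "r * (\<Sum>(c, g)\<leftarrow>cs. Const (c p) * g) = (\<Sum>(c, g)\<leftarrow>map (\<lambda>(c, g). (c, r * g)) cs. Const (c p) * g)" for p
    by (induction cs) (auto simp: algebra_simps)
  then show ?thesis unfolding polyfam_def
    by (intro exI[of _ "map (\<lambda>(c, g). (c, r * g)) cs"]) (use cs in auto)
qed

lemma polyfam_mult_right: "polyfam n f \<Longrightarrow> polyfam n (\<lambda>p. f p * r)"
  using polyfam_mult_left[of n f r] by (simp add: mult.commute)

lemma polyfam_uminus: "polyfam n f \<Longrightarrow> polyfam n (\<lambda>p. - f p)"
  using polyfam_mult_left[of n f "- 1"] by simp

lemma polyfam_diff: "polyfam n f \<Longrightarrow> polyfam n g \<Longrightarrow> polyfam n (\<lambda>p. f p - g p)"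
  using polyfam_add[of n f "\<lambda>p. - g p"] polyfam_uminus[of n g] by simp

lemma polyfam_sum: "(\<And>x. x \<in> A \<Longrightarrow> polyfam n (f x)) \<Longrightarrow> polyfam n (\<lambda>p. \<Sum>x\<in>A. f x p)"
  by (induction A rule: infinite_finite_induct) (auto intro: polyfam_add polyfam_const)

lemma polyfam_cong: "(\<And>p. p \<in> potentials n \<Longrightarrow> f p = g p) \<Longrightarrow> polyfam n f \<longleftrightarrow> polyfam n g"
  by (simp add: polyfam_def)

lemma polyfun_lookup:
  assumes "polyfam n f"
  shows "polyfun n (\<lambda>p. Poly_Mapping.lookup (f p) m)"
proof -
  obtain cs where cs: "\<forall>(c, g)\<in>set cs. polyfun n c" "\<forall>p\<in>potentials n. f p = (\<Sum>(c, g)\<leftarrow>cs. Const (c p) * g)"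
    using assms unfolding polyfam_def by blast
  have "polyfun n (\<lambda>p. Poly_Mapping.lookup (\<Sum>(c, g)\<leftarrow>cs. Const (c p) * g) m)"
    using cs(1)
  proof (induction cs)
    case (Cons x cs)
    obtain c g where x: "x = (c, g)" by fastforce
    have "polyfun n (\<lambda>p. c p * Poly_Mapping.lookup g m + Poly_Mapping.lookup (\<Sum>(c, g)\<leftarrow>cs. Const (c p) * g) m)"
      using Cons x by (intro polyfun_add polyfun_mult polyfun_const) auto
    then show ?case by (simp add: x lookup_add lookup_Const_mult)
  qed (simp add: polyfun_const)
  then show ?thesis using cs(2) by (subst polyfun_cong) auto
qed

section \<open>The differentials as families over the space of potentials\<close>

definition wpoly :: "complex poly \<Rightarrow> mpoly poly" where
  "wpoly p = map_poly Const (antiderivative p)"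

lemma coeff_antiderivative:
  "coeff (antiderivative p) k = (if k = 0 then 0 else of_nat (degree p + 1) * coeff p (k - 1) / of_nat k)"
proof (cases k)
  case 0
  then show ?thesis by (simp add: antiderivative_def coeff_sum)
next
  case (Suc m)
  have "coeff (antiderivative p) k =
      (\<Sum>j\<le>degree p. if j = m then of_nat (degree p + 1) * coeff p j / of_nat (j + 1) else 0)"
    unfolding antiderivative_def coeff_sum Suc by (rule sum.cong) simp_all
  then show ?thesis by (simp add: Suc coeff_eq_0)
qed

text \<open>All entries built from \<open>w\<close> depend linearly on \<open>w\<close>, and the
  coefficients of \<open>w\<close> are fixed multiples of those of the potential. So expanding
  \<open>w\<close> in monomials exhibits the family.\<close>

lemma polyfam_linear:
  assumes add: "\<And>x y. L (x + y) = L x + L y" and smult: "\<And>c x. L (smult c x) = c * L x"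
  shows "polyfam n (\<lambda>p. L (wpoly p))"
proof -
  let ?c = "\<lambda>k p. coeff (antiderivative p) k"
  have L0: "L 0 = 0" using smult[of 0 0] by simp
  have Lsum: "L (sum f A) = (\<Sum>x\<in>A. L (f x))" for f and A :: "nat set"
    by (induction A rule: infinite_finite_induct) (simp_all add: L0 add)
  have "L (wpoly p) = (\<Sum>k\<le>n + 1. Const (?c k p) * L (monom 1 k))" if p: "p \<in> potentials n" for p
  proof -
    have "degree (wpoly p) \<le> n + 1"
      using degree_antiderivative[of p] p by (simp add: wpoly_def degree_map_poly_Const potentials_def)
    then have "wpoly p = (\<Sum>k\<le>n + 1. monom (coeff (wpoly p) k) k)" by (rule poly_as_sum_of_monoms'[symmetric])
    also have "\<dots> = (\<Sum>k\<le>n + 1. smult (Const (?c k p)) (monom 1 k))"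
      by (simp add: wpoly_def coeff_map_poly_Const smult_monom)
    finally show ?thesis by (simp only: Lsum smult)
  qed
  moreover have "polyfam n (\<lambda>p. \<Sum>k\<le>n + 1. Const (?c k p) * L (monom 1 k))"
  proof (intro polyfam_sum polyfam_coeff)
    fix k assume k: "k \<in> {..n + 1}"
    show "polyfun n (?c k)"
    proof (cases "k = 0")
      case False
      have "polyfun n (\<lambda>p. (of_nat (n + 1) / of_nat k) * coeff p (k - 1))"
        using k by (intro polyfun_mult polyfun_const polyfun_coeff) auto
      then show ?thesis using False
        by (subst polyfun_cong[of _ _ "\<lambda>p. (of_nat (n + 1) / of_nat k) * coeff p (k - 1)"])
          (auto simp: coeff_antiderivative potentials_def)
    qed (simp add: coeff_antiderivative)
  qed
  ultimately show ?thesis by (subst polyfam_cong) auto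
qed

lemma sum_poly_extend:
  "degree w \<le> M \<Longrightarrow> (\<Sum>k\<le>degree w. smult (coeff w k) (g k)) = (\<Sum>k\<le>M. smult (coeff w k) (g k))"
  by (rule sum.mono_neutral_left) (auto simp: coeff_eq_0)

text \<open>The degree of a sum can drop, so the three upper limits are first raised to a common
  bound.\<close>

lemma sum_poly_additive:
  "(\<Sum>k\<le>degree (v + w). smult (coeff (v + w) k) (g k)) =
    (\<Sum>k\<le>degree v. smult (coeff v k) (g k)) + (\<Sum>k\<le>degree w. smult (coeff w k) (g k))"
proof -
  let ?M = "max (degree v) (degree w)"
  have "degree (v + w) \<le> ?M" by (rule degree_add_le) auto
  then show ?thesis
    by (subst (1 2 3) sum_poly_extend[of _ ?M]) (auto simp: smult_add_left sum.distrib)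
qed

lemma smult_sum_right: "smult c (sum f A) = (\<Sum>x\<in>A. smult c (f x))"
  by (induction A rule: infinite_finite_induct) (simp_all add: smult_add_right)

lemma sum_poly_smult:
  "(\<Sum>k\<le>degree (smult c w). smult (coeff (smult c w) k) (g k)) =
    smult c (\<Sum>k\<le>degree w. smult (coeff w k) (g k))" for c :: "'a::comm_ring_1"
  by (subst sum_poly_extend[of "smult c w" "degree w"]) (auto simp: degree_smult_le smult_sum_right)

lemma sum_poly1_linear:
  "sum_poly1 (v + w) t = sum_poly1 v t + sum_poly1 w t" "sum_poly1 (smult c w) t = smult c (sum_poly1 w t)"
  unfolding sum_poly1_def by (rule sum_poly_additive, rule sum_poly_smult)

lemma sum_poly2_linear:
  "sum_poly2 (v + w) t = sum_poly2 v t + sum_poly2 w t" "sum_poly2 (smult c w) t = smult c (sum_poly2 w t)"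
  unfolding sum_poly2_def by (rule sum_poly_additive, rule sum_poly_smult)

lemma divided_diff2_linear:
  "divided_diff2 (v + w) a b c = divided_diff2 v a b c + divided_diff2 w a b c"
  "divided_diff2 (smult r w) a b c = r * divided_diff2 w a b c"
proof -
  show "divided_diff2 (v + w) a b c = divided_diff2 v a b c + divided_diff2 w a b c"
  proof (induction v arbitrary: w)
    case 0
    then show ?case by (simp add: divided_diff2_def)
  next
    case (pCons x v)
    then show ?case by (cases w) (simp add: divided_diff2_pCons divided_diff_add algebra_simps)
  qed
  show "divided_diff2 (smult r w) a b c = r * divided_diff2 w a b c"
    by (induction w) (simp_all add: divided_diff2_def[of 0] divided_diff2_pCons divided_diff_smult algebra_simps)
qed

lemma polyfam_divided_diff: "polyfam n (\<lambda>p. divided_diff (wpoly p) x y)"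
  by (rule polyfam_linear) (simp_all add: divided_diff_add divided_diff_smult)

lemma polyfam_thick_u1: "polyfam n (\<lambda>p. thick_u1 (wpoly p) x1 x2 x3 x4)"
  by (rule polyfam_linear)
    (simp_all add: thick_u1_def sum_poly1_linear divided_diff_add divided_diff_smult)

lemma polyfam_thick_u2: "polyfam n (\<lambda>p. thick_u2 (wpoly p) x1 x2 x3 x4)"
  by (rule polyfam_linear)
    (simp_all add: thick_u2_def sum_poly2_linear divided_diff_add divided_diff_smult)

lemma polyfam_chi_entry: "polyfam n (\<lambda>p. chi_entry (wpoly p) x1 x2 x3 x4)"
  by (rule polyfam_linear)
    (simp_all add: chi_entry_def sum_poly2_linear divided_diff2_linear algebra_simps)

lemma polyfam_fac:
  assumes "k < num_factors D"
  shows "polyfam n (\<lambda>p. fac_a D r (wpoly p) v k) \<and> polyfam n (\<lambda>p. fac_b D r (wpoly p) v k)"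
proof (cases "k < 2 * length (crossings D)")
  case True
  define c b where "c = k div 2" and "b = k mod 2"
  have k: "k = 2 * c + b" "c < length (crossings D)" "b < 2" using True by (auto simp: c_def b_def)
  have "b = 0 \<or> b = 1" using k(3) by auto
  then show ?thesis unfolding fac_a_def fac_b_def k(1) factors_nth_piece[OF k(2,3)]
    by (cases "thick D v c") (auto simp: piece_def thick_factors_def smoothing_factors_def arc_factor_def Let_def
        polyfam_divided_diff polyfam_thick_u1 polyfam_thick_u2 polyfam_const)
next
  case False
  then obtain i where "k = 2 * length (crossings D) + i" "i < length (arcs D)"
    using assms by (metis add_less_cancel_left le_Suc_ex not_less num_factors_def)
  then show ?thesis
    by (simp add: fac_a_def fac_b_def factors_nth_arc arc_factor_def case_prod_beta polyfam_divided_diff polyfam_const)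
qed

lemma polyfam_mf_diff: "polyfam n (\<lambda>p. mf_diff D r (wpoly p) z s)"
proof -
  obtain v S where s: "s = (v, S)" by fastforce
  have "polyfam n (\<lambda>p. kos_term (fac_a D r (wpoly p)) (fac_b D r (wpoly p)) z v S k)" if "k < num_factors D" for k
    unfolding kos_term_def using polyfam_fac[OF that, of n r v]
    by (cases "k \<in> S") (auto intro!: polyfam_mult_right polyfam_mult_left)
  then show ?thesis unfolding s mf_diff_kos kos_apply by (intro polyfam_sum) simp
qed

lemma polyfam_chi_map: "polyfam n (\<lambda>p. chi_map X (wpoly p) t f f')"
  by (cases "positive X"; cases f; cases f')
    (auto simp: chi_map_def intro!: polyfam_add polyfam_diff polyfam_mult_right polyfam_uminus polyfam_chi_entry polyfam_const)

lemma polyfam_cube_diff: "polyfam n (\<lambda>p. cube_diff D (wpoly p) z s)"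
proof -
  obtain v S where s: "s = (v, S)" by fastforce
  show ?thesis unfolding s cube_diff_chi_op chi_op_def
    by (intro polyfam_sum polyfam_mult_left polyfam_chi_map)
qed

lemma polyfun_cf_mf_diff: "polyfun n (\<lambda>p. cf (mf_diff D r (wpoly p) z) l)"
  unfolding cf_def by (rule polyfun_lookup[OF polyfam_mf_diff])

lemma polyfun_cf_cube_diff: "polyfun n (\<lambda>p. cf (cube_diff D (wpoly p) z) l)"
  unfolding cf_def by (rule polyfun_lookup[OF polyfam_cube_diff])

subsection \<open>The invariants are constructible\<close>

type_synonym label = "(nat set \<times> nat set) \<times> (nat \<Rightarrow>\<^sub>0 nat)"

text \<open>Coordinate \<open>l\<close> of \<open>d x\<close> as a linear form. The unknowns
  \<open>Inl u\<close> are the coordinates of the cocycle \<open>x\<close>, the unknowns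
  \<open>Inr u\<close> those of the witness \<open>y\<close>, which does not occur in this
  equation.\<close>

definition sys_equations1 :: "diagram \<Rightarrow> nat \<Rightarrow> label \<Rightarrow> complex poly \<Rightarrow> label + label \<Rightarrow> complex" where
  "sys_equations1 D n l p = case_sum (\<lambda>u. cf (mf_diff D (int n) (wpoly p) (unit_elem u)) l) (\<lambda>u. 0)"

definition sys_equations2 :: "diagram \<Rightarrow> nat \<Rightarrow> label \<Rightarrow> complex poly \<Rightarrow> label + label \<Rightarrow> complex" where
  "sys_equations2 D n l p = case_sum (\<lambda>u. cf (cube_diff D (wpoly p) (unit_elem u)) l)
     (\<lambda>u. - cf (mf_diff D (int n) (wpoly p) (unit_elem u)) l)"

text \<open>\<open>X x\<close> and \<open>d y\<close> always lie in this step: \<open>X\<close>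
  raises the filtration by at most \<open>chi_shift\<close> and \<open>d\<close> by at most
  \<open>n + 1\<close>. Hence finitely many equations control \<open>X x - d y\<close>.\<close>

definition sys_top :: "diagram \<Rightarrow> nat \<Rightarrow> int \<Rightarrow> int" where
  "sys_top D n j = max (j + chi_shift D n) (jtop D n + int n + 1)"

text \<open>The second family requires the coordinates of \<open>X x - d y\<close> outside step
  \<open>k\<close> to vanish. Any listing of the finite set will do, hence \<open>SOME\<close>; the
  list consists of functions of the potential, so it is chosen once for all potentials.\<close>

definition sys_equations :: "diagram \<Rightarrow> nat \<Rightarrow> int \<Rightarrow> int \<Rightarrow> int \<Rightarrow> (complex poly \<Rightarrow> label + label \<Rightarrow> complex) list" where
  "sys_equations D n i j k =
    (SOME es. set es = sys_equations1 D n ` coords D n i (j + int n + 1) \<union>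
      sys_equations2 D n ` (coords D n (i + 1) (sys_top D n j) - coords D n (i + 1) k))"

lemma set_sys_equations:
  "set (sys_equations D n i j k) = sys_equations1 D n ` coords D n i (j + int n + 1) \<union>
      sys_equations2 D n ` (coords D n (i + 1) (sys_top D n j) - coords D n (i + 1) k)"
proof -
  have "\<exists>es. set es = sys_equations1 D n ` coords D n i (j + int n + 1) \<union>
      sys_equations2 D n ` (coords D n (i + 1) (sys_top D n j) - coords D n (i + 1) k)"
    by (rule finite_list) (simp add: finite_coords)
  then show ?thesis unfolding sys_equations_def by (rule someI_ex)
qed

definition sys_unknowns :: "diagram \<Rightarrow> nat \<Rightarrow> int \<Rightarrow> int \<Rightarrow> (label + label) set" where
  "sys_unknowns D n i j = Inl ` coords D n i j \<union> Inr ` coords D n (i + 1) (jtop D n)"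

lemma finite_sys_unknowns: "finite (sys_unknowns D n i j)"
  by (simp add: sys_unknowns_def finite_coords)

lemma polyfun_sys_equations:
  assumes "e \<in> set (sys_equations D n i j k)"
  shows "polyfun n (\<lambda>p. e p u)"
proof -
  have "polyfun n (\<lambda>p. sys_equations1 D n l p u)" for l
    by (cases u) (simp_all add: sys_equations1_def polyfun_cf_mf_diff)
  moreover have "polyfun n (\<lambda>p. sys_equations2 D n l p u)" for l
    by (cases u) (simp_all add: sys_equations2_def polyfun_cf_mf_diff polyfun_cf_cube_diff polyfun_minus)
  ultimately show ?thesis using assms unfolding set_sys_equations by auto
qed

lemma sum_sys_unknowns:
  "(\<Sum>u\<in>sys_unknowns D n i j. f u) = (\<Sum>u\<in>coords D n i j. f (Inl u)) + (\<Sum>u\<in>coords D n (i + 1) (jtop D n). f (Inr u))"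
  unfolding sys_unknowns_def
  by (subst sum.union_disjoint) (auto simp: finite_coords sum.reindex)

context link_potential
begin

interpretation fdc: filtered_double_complex cscale "mf_space D" "Filt D n" d X "jmin D n" "jmax D n" "jtop D n" "jtop D n" "- len" "len + 1"
  by (rule filtered_double_complex)

definition pair_cf :: "cube_elem \<times> cube_elem \<Rightarrow> label + label \<Rightarrow> complex" where
  "pair_cf z = case_sum (cf (fst z)) (cf (snd z))"

lemma w_wpoly: "w = wpoly p"
  by (simp add: w_def wpoly_def)

lemma cf_linear_expansion:
  assumes L: "Vector_Spaces.linear cscale cscale L" and A: "finite A" "\<And>l. cf z l \<noteq> 0 \<Longrightarrow> l \<in> A"
  shows "cf (L z) l = (\<Sum>u\<in>A. cf (L (unit_elem u)) l * cf z u)"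
proof -
  interpret L: Vector_Spaces.linear cscale cscale L by (rule L)
  have "cf (L z) l = cf (L (\<Sum>u\<in>A. cscale (cf z u) (unit_elem u))) l"
    using unit_elem_expansion[OF A] by simp
  also have "\<dots> = (\<Sum>u\<in>A. cf (cscale (cf z u) (L (unit_elem u))) l)"
    by (simp only: L.sum L.scale cf_sum)
  finally show ?thesis by (simp only: cf_simps mult.commute)
qed

text \<open>The defining conditions of \<open>Sys\<close> become equations between coordinates;
  those outside the listed range hold automatically, by the degree bounds for \<open>d\<close> and
  \<open>X\<close>.\<close>

lemma pair_cf_Sys:
  "pair_cf ` fdc.Sys i j k = solutions (sys_unknowns D n i j) (map (\<lambda>e. e p) (sys_equations D n i j k))"
proof -
  let ?I1 = "coords D n i j" and ?I2 = "coords D n (i + 1) (jtop D n)"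
  have eqs: "(\<Sum>u\<in>sys_unknowns D n i j. sys_equations1 D n l p u * pair_cf (x, y) u) = cf (d x) l"
    "(\<Sum>u\<in>sys_unknowns D n i j. sys_equations2 D n l p u * pair_cf (x, y) u) = cf (X x - d y) l"
    if x: "\<And>l. cf x l \<noteq> 0 \<Longrightarrow> l \<in> ?I1" and y: "\<And>l. cf y l \<noteq> 0 \<Longrightarrow> l \<in> ?I2" for x y l
  proof -
    have "cf (d x) l = (\<Sum>u\<in>?I1. cf (d (unit_elem u)) l * cf x u)"
      by (rule cf_linear_expansion[OF linear_mf_diff finite_coords]) (rule x)
    moreover have "cf (X x) l = (\<Sum>u\<in>?I1. cf (X (unit_elem u)) l * cf x u)"
      by (rule cf_linear_expansion[OF linear_cube_diff finite_coords]) (rule x)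
    moreover have "cf (d y) l = (\<Sum>u\<in>?I2. cf (d (unit_elem u)) l * cf y u)"
      by (rule cf_linear_expansion[OF linear_mf_diff finite_coords]) (rule y)
    ultimately show "(\<Sum>u\<in>sys_unknowns D n i j. sys_equations1 D n l p u * pair_cf (x, y) u) = cf (d x) l"
      "(\<Sum>u\<in>sys_unknowns D n i j. sys_equations2 D n l p u * pair_cf (x, y) u) = cf (X x - d y) l"
      unfolding sum_sys_unknowns cf_simps
      by (simp_all add: sys_equations1_def sys_equations2_def pair_cf_def w_wpoly sum_negf)
  qed
  show ?thesis
  proof (intro set_eqI iffI)
    fix c assume "c \<in> pair_cf ` fdc.Sys i j k"
    then obtain x y where c: "c = pair_cf (x, y)" and xy: "x \<in> mf_space D i" "x \<in> Filt D n j"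
      "y \<in> mf_space D (i + 1)" "y \<in> Filt D n (jtop D n)" "d x = 0" "X x - d y \<in> Filt D n k"
      by (auto simp: fdc.Sys_def)
    have x: "\<And>l. cf x l \<noteq> 0 \<Longrightarrow> l \<in> ?I1" using mf_space_Filt_iff[of x D i n j] xy by blast
    have y: "\<And>l. cf y l \<noteq> 0 \<Longrightarrow> l \<in> ?I2" using mf_space_Filt_iff[of y D "i + 1" n "jtop D n"] xy by blast
    have "X x - d y \<in> mf_space D (i + 1)" by (intro mf_space_diff X_mf_space d_mf_space xy)
    then have xd: "\<And>l. cf (X x - d y) l \<noteq> 0 \<Longrightarrow> l \<in> coords D n (i + 1) k"
      using mf_space_Filt_iff[of "X x - d y" D "i + 1" n k] xy(6) by blast
    have "(\<Sum>u\<in>sys_unknowns D n i j. e p u * c u) = 0" if e: "e \<in> set (sys_equations D n i j k)" for e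
    proof -
      from e consider l where "e = sys_equations1 D n l" | l where "e = sys_equations2 D n l" "l \<notin> coords D n (i + 1) k"
        unfolding set_sys_equations by blast
      then show ?thesis
      proof cases
        case 1
        then show ?thesis by (simp add: c eqs(1)[OF x y] xy(5) cf_simps)
      next
        case (2 l)
        then have "cf (X x - d y) l = 0" using xd by blast
        then show ?thesis by (simp add: c 2(1) eqs(2)[OF x y])
      qed
    qed
    moreover have "c u = 0" if "u \<notin> sys_unknowns D n i j" for u
      using that x y by (cases u) (auto simp: c pair_cf_def sys_unknowns_def)
    ultimately show "c \<in> solutions (sys_unknowns D n i j) (map (\<lambda>e. e p) (sys_equations D n i j k))"
      by (simp add: solutions_def)
  next
    fix c assume c: "c \<in> solutions (sys_unknowns D n i j) (map (\<lambda>e. e p) (sys_equations D n i j k))"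
    define x where "x = (\<Sum>u\<in>?I1. cscale (c (Inl u)) (unit_elem u))"
    define y where "y = (\<Sum>u\<in>?I2. cscale (c (Inr u)) (unit_elem u))"
    have c0: "c (Inl u) = 0" if "u \<notin> ?I1" for u
      using c that by (auto simp: solutions_def sys_unknowns_def)
    have c1: "c (Inr u) = 0" if "u \<notin> ?I2" for u
      using c that by (auto simp: solutions_def sys_unknowns_def)
    have delta: "cf (\<Sum>u\<in>A. cscale (f u) (unit_elem u)) l = (if l \<in> A then f l else 0)" if "finite A" for A f l
    proof -
      have "cf (\<Sum>u\<in>A. cscale (f u) (unit_elem u)) l = (\<Sum>u\<in>A. if l = u then f u else 0)"
        unfolding cf_sum by (rule sum.cong) (simp_all add: cf_simps cf_unit_elem)
      then show ?thesis using that by simp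
    qed
    have cfx: "cf x u = c (Inl u)" for u using delta[OF finite_coords] c0 by (simp add: x_def)
    have cfy: "cf y u = c (Inr u)" for u using delta[OF finite_coords] c1 by (simp add: y_def)
    have cxy: "c = pair_cf (x, y)"
      by (rule ext) (simp add: pair_cf_def cfx cfy split: sum.split)
    have x: "\<And>l. cf x l \<noteq> 0 \<Longrightarrow> l \<in> ?I1" using c0 cfx by metis
    have y: "\<And>l. cf y l \<noteq> 0 \<Longrightarrow> l \<in> ?I2" using c1 cfy by metis
    have xC: "x \<in> mf_space D i" "x \<in> Filt D n j" using mf_space_Filt_iff[of x D i n j] x by blast+
    have yC: "y \<in> mf_space D (i + 1)" "y \<in> Filt D n (jtop D n)"
      using mf_space_Filt_iff[of y D "i + 1" n "jtop D n"] y by blast+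
    have sol: "(\<Sum>u\<in>sys_unknowns D n i j. e p u * pair_cf (x, y) u) = 0" if "e \<in> set (sys_equations D n i j k)" for e
      using c that unfolding cxy by (simp add: solutions_def)
    have d_Filt: "d u \<in> Filt D n (j' + int n + 1)" if "u \<in> mf_space D i'" "u \<in> Filt D n j'" for u i' j'
      using d_EFilt[OF that(1), of "{}" j'] that Filt_EFilt[OF that(1)] Filt_EFilt[OF d_mf_space[OF that(1)]]
      by (simp add: add.assoc)
    \<comment> \<open>Coordinates up to step \<open>j + n + 1\<close> vanish by the equations, the
      others because \<open>d\<close> raises the filtration by at most \<open>n + 1\<close>.\<close>
    have "cf (d x) l = 0" for l
    proof (rule ccontr)
      assume nz: "cf (d x) l \<noteq> 0"
      then have "l \<in> coords D n i (j + int n + 1)"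
        using mf_space_Filt_iff[of "d x" D i n "j + int n + 1"] d_mf_space[OF xC(1)] d_Filt[OF xC] by blast
      then have "cf (d x) l = 0"
        using sol[of "sys_equations1 D n l"] by (simp add: set_sys_equations eqs(1)[OF x y])
      with nz show False by contradiction
    qed
    then have dx: "d x = 0" by (intro cf_eqI) (simp only: cf_simps)
    have XdC: "X x - d y \<in> mf_space D (i + 1)" by (intro mf_space_diff X_mf_space d_mf_space xC yC)
    have "X x \<in> Filt D n (sys_top D n j)"
      using X_Filt[OF xC] Filt_mono[of "j + chi_shift D n" "sys_top D n j" D n] by (auto simp: sys_top_def)
    moreover have "d y \<in> Filt D n (sys_top D n j)"
      using d_Filt[OF yC] Filt_mono[of "jtop D n + int n + 1" "sys_top D n j" D n] by (auto simp: sys_top_def)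
    ultimately have "X x - d y \<in> Filt D n (sys_top D n j)"
      by (rule cube.subspace_diff[OF subspace_Filt])
    then have top: "\<And>l. cf (X x - d y) l \<noteq> 0 \<Longrightarrow> l \<in> coords D n (i + 1) (sys_top D n j)"
      using mf_space_Filt_iff[of "X x - d y" D "i + 1" n "sys_top D n j"] XdC by blast
    have "l \<in> coords D n (i + 1) k" if nz: "cf (X x - d y) l \<noteq> 0" for l
    proof (rule ccontr)
      assume "l \<notin> coords D n (i + 1) k"
      then have "cf (X x - d y) l = 0"
        using sol[of "sys_equations2 D n l"] top[OF nz] by (simp add: set_sys_equations eqs(2)[OF x y])
      with nz show False by contradiction
    qed
    then have "X x - d y \<in> Filt D n k"
      using mf_space_Filt_iff[of "X x - d y" D "i + 1" n k] by blast
    with xC yC dx have "(x, y) \<in> fdc.Sys i j k" by (simp add: fdc.Sys_def)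
    then show "c \<in> pair_cf ` fdc.Sys i j k" unfolding cxy by (rule imageI)
  qed
qed

lemma sdim_nullity:
  "fdc.sdim i j k = nullity (sys_unknowns D n i j) (map (\<lambda>e. e p) (sys_equations D n i j k))"
proof -
  interpret pr: vector_space_pair "pair_scale cscale" fun_scale ..
  have lin: "Vector_Spaces.linear (pair_scale cscale) fun_scale pair_cf"
    by unfold_locales (auto simp: pair_cf_def pair_scale_def fun_scale_def fun_eq_iff cf_simps split: sum.split)
  have "inj_on pair_cf (fdc.Sys i j k)"
  proof (rule inj_onI)
    fix z z' assume eq: "pair_cf z = pair_cf z'"
    have "cf (fst z) l = cf (fst z') l" "cf (snd z) l = cf (snd z') l" for l
      using fun_cong[OF eq, of "Inl l"] fun_cong[OF eq, of "Inr l"] by (simp_all add: pair_cf_def)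
    then show "z = z'" by (intro prod_eqI cf_eqI)
  qed
  from pr.dim_image_inj[OF lin fdc.subspace_Sys this] show ?thesis
    unfolding pair_cf_Sys fdc.sdim_def nullity_def by simp
qed

end

text \<open>Restricted to the finite box of degrees and levels that enter the classification, so
  that only finitely many nullities are recorded.\<close>

definition invariants :: "diagram \<Rightarrow> nat \<Rightarrow> complex poly \<Rightarrow> int \<times> int \<times> int \<Rightarrow> nat" where
  "invariants D n p = restrict (\<lambda>(i, j, k). nullity (sys_unknowns D n i j) (map (\<lambda>e. e p) (sys_equations D n i j k)))
     ({- int (length (crossings D)) - 1..int (length (crossings D)) + 1} \<times> {jmin D n..jmax D n} \<times> {jmin D n..jmax D n})"

lemma constructible_invariants: "constructible n (invariants D n)"
  unfolding invariants_def[abs_def]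
proof (rule constructible_restrict)
  fix t :: "int \<times> int \<times> int"
  obtain i j k where t: "t = (i, j, k)" by (metis prod.exhaust)
  show "constructible n (\<lambda>p. (\<lambda>(i, j, k). nullity (sys_unknowns D n i j) (map (\<lambda>e. e p) (sys_equations D n i j k))) t)"
    unfolding t prod.case 
    by (rule constructible_nullity[OF finite_sys_unknowns]) (rule polyfun_sys_equations)
qed simp

section \<open>The equivalence relation and the structure of its classes\<close>

lemma equivalent_of_invariants:
  assumes D: "link_diagram D" and n: "1 \<le> n" and p: "p \<in> potentials n" and q: "q \<in> potentials n"
    and eq: "invariants D n p = invariants D n q"
  shows "filtered_homotopy_equivalent (KR_complex D p) (KR_complex D q)"
proof -
  interpret p: link_potential D n p by unfold_locales (fact D n p)+
  interpret q: link_potential D n q by unfold_locales (fact D n q)+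
  show ?thesis
    unfolding p.KR_complex_eq q.KR_complex_eq
  proof (rule filtered_homotopy_equivalent_of_sdim[OF p.filtered_double_complex q.filtered_double_complex],
      unfold p.sdim_nullity q.sdim_nullity)
    fix i j k :: int
    assume "i \<in> {- int (length (crossings D)) - 1..int (length (crossings D)) + 1}" "j \<in> {jmin D n..jmax D n}" "k \<in> {jmin D n..jmax D n}"
    then show "nullity (sys_unknowns D n i j) (map (\<lambda>e. e p) (sys_equations D n i j k)) =
        nullity (sys_unknowns D n i j) (map (\<lambda>e. e q) (sys_equations D n i j k))"
      using fun_cong[OF eq, of "(i, j, k)"] by (simp add: invariants_def)
  qed
qed

lemma equiv_KR_equivalence:
  assumes D: "link_diagram D" and n: "1 \<le> n"
  shows "equiv (potentials n) (KR_equivalence D n)"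
proof -
  have additive: "additive_complex (KR_complex D p)" if "p \<in> potentials n" for p
  proof -
    interpret link_potential D n p by unfold_locales (fact D n that)+
    show ?thesis unfolding KR_complex_eq by (rule double_complex.additive_complex_H[OF double_complex])
  qed
  \<comment> \<open>A potential has the same invariants as itself, so reflexivity is an instance of
    the classification.\<close>
  have "refl_on (potentials n) (KR_equivalence D n)"
    unfolding refl_on_def KR_equivalence_def using equivalent_of_invariants[OF D n] by auto
  moreover have "sym (KR_equivalence D n)"
    unfolding sym_def KR_equivalence_def using filtered_homotopy_equivalent_sym by auto
  moreover have "trans (KR_equivalence D n)"
    unfolding trans_def KR_equivalence_def
    using filtered_homotopy_equivalent_trans[OF additive additive additive] by auto
  moreover have "KR_equivalence D n \<subseteq> potentials n \<times> potentials n"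
    by (auto simp: KR_equivalence_def)
  ultimately show ?thesis by (simp add: equiv_def)
qed

lemma potentials_nonempty: "potentials n \<noteq> {}"
proof -
  have "monom 1 n \<in> potentials n" by (simp add: potentials_def degree_monom_eq)
  then show ?thesis by blast
qed

theorem theorem3p7:
  fixes D :: diagram and n :: nat
  assumes "link_diagram D" and "n \<ge> 1"
  shows "finite (potentials n // KR_equivalence D n) \<and>
    (\<exists>G \<in> potentials n // KR_equivalence D n.
      \<forall>K \<in> potentials n // KR_equivalence D n. K \<noteq> G \<longrightarrow>
        (\<exists>P. finite P \<and>
             (\<forall>(U, Z) \<in> P. zariski_open n U \<and> zariski_closed n Z \<and> Z \<noteq> potentials n) \<and>
             K = (\<Union>(U, Z) \<in> P. U \<inter> Z)))"
proof -
  let ?R = "KR_equivalence D n" and ?Q = "potentials n // KR_equivalence D n"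
  have equiv: "equiv (potentials n) ?R" by (rule equiv_KR_equivalence[OF assms])
  obtain \<P> where P: "finite \<P>" "\<And>A. A \<in> \<P> \<Longrightarrow> zariski_locally_closed n A" "potentials n = \<Union>\<P>"
    and inv: "\<And>A p q. A \<in> \<P> \<Longrightarrow> p \<in> A \<Longrightarrow> q \<in> A \<Longrightarrow> invariants D n p = invariants D n q"
    by (rule constructibleE[OF constructible_invariants[of n D]], rule that)
  have related: "(p, q) \<in> ?R" if "A \<in> \<P>" "p \<in> A" "q \<in> A" for A p q
  proof -
    have pq: "p \<in> potentials n" "q \<in> potentials n" unfolding P(3) using that by blast+
    show ?thesis
      using pq equivalent_of_invariants[OF assms pq inv[OF that]] by (simp add: KR_equivalence_def)
  qed
  have piece: "A \<subseteq> K" if K: "K \<in> ?Q" and A: "A \<in> \<P>" "A \<inter> K \<noteq> {}" for A K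
  proof
    fix q assume q: "q \<in> A"
    from A(2) obtain p where p: "p \<in> A" "p \<in> K" by blast
    from quotientE[OF K] obtain x where x: "K = ?R `` {x}" by blast
    have "(x, p) \<in> ?R" using p(2) x by simp
    moreover have "(p, q) \<in> ?R" by (rule related[OF A(1) p(1) q])
    ultimately have "(x, q) \<in> ?R" using equiv by (meson equivE transD)
    then show "q \<in> K" using x by simp
  qed
  have union: "K = \<Union>{A \<in> \<P>. A \<inter> K \<noteq> {}}" if K: "K \<in> ?Q" for K
  proof
    have "K \<subseteq> potentials n" using K Union_quotient[OF equiv] by blast
    then show "K \<subseteq> \<Union>{A \<in> \<P>. A \<inter> K \<noteq> {}}" unfolding P(3) by blast
    show "\<Union>{A \<in> \<P>. A \<inter> K \<noteq> {}} \<subseteq> K" using piece[OF K] by blast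
  qed
  \<comment> \<open>A class is the union of the pieces it meets, so there are at most as many
    classes as sets of pieces.\<close>
  have "?Q \<subseteq> Union ` Pow \<P>"
  proof
    fix K assume "K \<in> ?Q"
    from union[OF this] show "K \<in> Union ` Pow \<P>" by blast
  qed
  then have fin: "finite ?Q" by (rule finite_subset) (simp add: P(1))
  \<comment> \<open>The right alternative to openness: if a piece is not thin, then in any
    presentation of it as \<open>U \<inter> Z\<close> the closed set is the whole space, and the
    piece equals \<open>U\<close>.\<close>
  define thin where "thin A \<longleftrightarrow> (\<exists>U Z. zariski_open n U \<and> zariski_closed n Z \<and> Z \<noteq> potentials n \<and> A = U \<inter> Z)" for A
  have open_piece: "zariski_open n A" if A: "A \<in> \<P>" "\<not> thin A" for A
  proof -
    from P(2)[OF A(1)] obtain U Z where UZ: "zariski_open n U" "zariski_closed n Z" "A = U \<inter> Z"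
      unfolding zariski_locally_closed_def by (elim exE conjE)
    then have "Z = potentials n" using A(2) unfolding thin_def by blast
    moreover have "U \<subseteq> potentials n" using UZ(1) by (simp add: zariski_open_def)
    ultimately have "A = U" using UZ(3) by blast
    with UZ(1) show ?thesis by simp
  qed
  have "\<exists>G\<in>?Q. \<forall>A\<in>\<P>. A \<noteq> {} \<longrightarrow> \<not> thin A \<longrightarrow> A \<subseteq> G"
  proof (cases "\<exists>A\<in>\<P>. A \<noteq> {} \<and> \<not> thin A")
    case True
    then obtain A x where A: "A \<in> \<P>" "\<not> thin A" "x \<in> A" by blast
    then have x: "x \<in> potentials n" unfolding P(3) by blast
    then have G: "?R `` {x} \<in> ?Q" by (rule quotientI)
    have xG: "x \<in> ?R `` {x}" using equiv x by (rule equiv_class_self)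
    then have AG: "A \<subseteq> ?R `` {x}" using piece[OF G A(1)] A(3) by blast
    have "B \<subseteq> ?R `` {x}" if B: "B \<in> \<P>" "B \<noteq> {}" "\<not> thin B" for B
    proof -
      \<comment> \<open>Two nonempty open pieces meet, and each piece lies inside one class; so all
        of them lie in the class of \<open>x\<close>.\<close>
      have "A \<noteq> {}" using A(3) by blast
      then have "A \<inter> B \<noteq> {}"
        by (rule zariski_open_meet[OF open_piece[OF A(1,2)] _ open_piece[OF B(1,3)] B(2)])
      then show ?thesis using piece[OF G B(1)] AG by blast
    qed
    with G show ?thesis by blast
  next
    \<comment> \<open>If all nonempty pieces are thin, the condition on \<open>G\<close> is vacuous
      and any class can be chosen.\<close>
    case False
    obtain x where "x \<in> potentials n" using potentials_nonempty by blast
    then have "?R `` {x} \<in> ?Q" by (rule quotientI)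
    with False show ?thesis by blast
  qed
  then obtain G where G: "G \<in> ?Q" "\<And>A. A \<in> \<P> \<Longrightarrow> A \<noteq> {} \<Longrightarrow> \<not> thin A \<Longrightarrow> A \<subseteq> G" by blast
  have "\<exists>P. finite P \<and> (\<forall>(U, Z) \<in> P. zariski_open n U \<and> zariski_closed n Z \<and> Z \<noteq> potentials n) \<and>
      K = (\<Union>(U, Z) \<in> P. U \<inter> Z)" if K: "K \<in> ?Q" "K \<noteq> G" for K
  proof -
    let ?A = "{A \<in> \<P>. A \<inter> K \<noteq> {}}"
    have disj: "K \<inter> G = {}" using quotient_disj[OF equiv K(1) G(1)] K(2) by blast
    \<comment> \<open>A piece that meets \<open>K\<close> lies outside \<open>G\<close> at some
      point, so it is not one of the open pieces collected in \<open>G\<close>.\<close>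
    have thin: "thin A" if "A \<in> ?A" for A using that G(2)[of A] disj by blast
    define f where "f A = (SOME UZ. zariski_open n (fst UZ) \<and> zariski_closed n (snd UZ) \<and>
      snd UZ \<noteq> potentials n \<and> A = fst UZ \<inter> snd UZ)" for A
    have f: "zariski_open n (fst (f A)) \<and> zariski_closed n (snd (f A)) \<and>
      snd (f A) \<noteq> potentials n \<and> A = fst (f A) \<inter> snd (f A)" if "A \<in> ?A" for A
    proof -
      from thin[OF that] obtain U Z where "zariski_open n U \<and> zariski_closed n Z \<and> Z \<noteq> potentials n \<and> A = U \<inter> Z"
        unfolding thin_def by (elim exE)
      then have "\<exists>UZ. zariski_open n (fst UZ) \<and> zariski_closed n (snd UZ) \<and>
          snd UZ \<noteq> potentials n \<and> A = fst UZ \<inter> snd UZ"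
        by (intro exI[of _ "(U, Z)"]) simp
      then show ?thesis unfolding f_def by (rule someI_ex)
    qed
    show ?thesis
    proof (intro exI[of _ "f ` ?A"] conjI)
      show "finite (f ` ?A)" using P(1) by simp
      show "\<forall>(U, Z)\<in>f ` ?A. zariski_open n U \<and> zariski_closed n Z \<and> Z \<noteq> potentials n"
        unfolding case_prod_beta using f by blast
      have "(\<Union>(U, Z)\<in>f ` ?A. U \<inter> Z) = (\<Union>A\<in>?A. fst (f A) \<inter> snd (f A))"
        by (simp add: case_prod_beta)
      also have "\<dots> = \<Union>?A"
      proof -
        have "(\<Union>A\<in>?A. fst (f A) \<inter> snd (f A)) = (\<Union>A\<in>?A. A)"
          by (rule SUP_cong[OF refl]) (use f in blast)
        then show ?thesis by simp
      qed
      also have "\<dots> = K" by (rule union[OF K(1), symmetric])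
      finally show "K = (\<Union>(U, Z)\<in>f ` ?A. U \<inter> Z)" by (rule sym)
    qed
  qed
  with fin G(1) show ?thesis by blast
qed

end
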